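(* Let $s\in(0,1)$, let $\Omega=B_1(0)$ be the unit ball in $\mathbb{R}^n$ for some $n\in\mathbb{N}$ ($n\ge1$) and let $W:=B_3(0)\setminus\overline{B_2(0)}$. Let $\lambda_1$ denote the first Dirichlet eigenvalue of $(-\Delta)^s$ on $\Omega$. Then there exist $N_0\in\mathbb{N}$, $\mu>0$ and $\bar C\ge1$ such that for all $N\ge N_0$ there is a partitioning $D_1,\dots,D_N$ of $\Omega$ into Lipschitz sets with the following property. Let $C_1>0$ be any constant such that for all $$q_1,q_2\in\operatorname{span}\{\chi_{D_1},\dots,\chi_{D_N}\}\quad\text{with}\quad\|q_1\|_{L^\infty(\Omega)},\|q_2\|_{L^\infty(\Omega)}\le\frac{\lambda_1}{2}$$ there exist data $\tilde f^{(k)}=(\tilde f_1^{(k)},\dots,\tilde f_N^{(k)})$, $\tilde f^{(k)}_j\in\widetilde H^s(W)$, $\|\tilde f_j^{(k)}\|_{\widetilde H^s(W)}=1$ ($j\in\{1,\dots,N\}$, $k\in\{1,2\}$) with $$\|q_1-q_2\|_{L^\infty(\Omega)}\le C_1\inf\Big\{\|(\Lambda_{q_1}-\Lambda_{q_2})\tilde f^{(1)}\|_{H^{-s}(W)},\ \|(\Lambda_{q_1}-\Lambda_{q_2})\tilde f^{(2)}\|_{H^{-s}(W)}\Big\}.$$ Then necessarily $$C_1\ge\exp(\bar CN^\mu).$$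
   Context: All functions are real valued. $(-\Delta)^s$ is the Fourier multiplier with symbol $|\xi|^{2s}$; $B_r(0)$ is the open ball of radius $r$; $\chi_D$ is the characteristic function of $D$. A partitioning is a covering of $\Omega$ by sets that are disjoint up to null sets. $\widetilde H^s(V)$ is the closure of $C_c^\infty(V)$ in $H^s(\mathbb{R}^n)$, with the $H^s(\mathbb{R}^n)$ norm; $H^{-s}(V)$ is identified with the dual of $\widetilde H^s(V)$. $\lambda_1=\min\{\|(-\Delta)^{s/2}u\|_{L^2(\mathbb{R}^n)}^2:u\in\widetilde H^s(\Omega),\ \|u\|_{L^2(\Omega)}=1\}$. For $q\in L^\infty(\Omega)$ put $B_q(u,v):=((-\Delta)^{s/2}u,(-\Delta)^{s/2}v)_{L^2(\mathbb{R}^n)}+(qu,v)_{L^2(\Omega)}$. If $\|q\|_{L^\infty(\Omega)}\le\lambda_1/2$, then for each $f\in\widetilde H^s(W)$ there is a unique $u_f\in H^s(\mathbb{R}^n)$ with $u_f-f\in\widetilde H^s(\Omega)$ and $B_q(u_f,w)=0$ for all $w\in\widetilde H^s(\Omega)$ (the solution of $((-\Delta)^s+q)u=0$ in $\Omega$, $u=f$ in $\mathbb{R}^n\setminus\overline\Omega$). The Dirichlet-to-Neumann map $\Lambda_q:\widetilde H^s(W)\to H^{-s}(W)$ is $(\Lambda_qf,g):=B_q(u_f,g)$, $g\in\widetilde H^s(W)$. $(\Lambda_{q_1}-\Lambda_{q_2})\tilde f^{(k)}$ is the $N$-tuple with components $(\Lambda_{q_1}-\Lambda_{q_2})\tilde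 f_j^{(k)}$, and the norm of a tuple of elements of $H^{-s}(W)$ is the maximum of the norms of its components. *)

theory Defs
  imports "HOL-Probability.Essential_Supremum"
begin

text \<open>
  Elements of the spaces below are Borel functions rather than classes modulo null sets;
  every notion depends only on the almost-everywhere class of its arguments.
\<close>

subsection \<open>Lebesgue spaces\<close>

definition L2 :: "('a::euclidean_space \<Rightarrow> 'b::real_normed_vector) set" where
  "L2 = {f. f \<in> borel_measurable lborel \<and> integrable lborel (\<lambda>x. (norm (f x))\<^sup>2)}"

definition L2_norm :: "'a::euclidean_space set \<Rightarrow> ('a \<Rightarrow> 'b::real_normed_vector) \<Rightarrow> real" where
  "L2_norm S f = sqrt (LINT x:S|lborel. (norm (f x))\<^sup>2)"

definition L2_inner :: "'a::euclidean_space set \<Rightarrow> ('a \<Rightarrow> real) \<Rightarrow> ('a \<Rightarrow> real) \<Rightarrow> real" where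
  "L2_inner S u v = (LINT x:S|lborel. u x * v x)"

definition Linf_norm :: "'a::euclidean_space set \<Rightarrow> ('a \<Rightarrow> real) \<Rightarrow> ereal" where
  "Linf_norm S q = esssup (restrict_space lborel S) (\<lambda>x. ereal \<bar>q x\<bar>)"

subsection \<open>Fourier transform and fractional Laplacian\<close>

definition fourier_L1 :: "('a::euclidean_space \<Rightarrow> real) \<Rightarrow> 'a \<Rightarrow> complex" where
  "fourier_L1 u \<xi> = of_real ((2 * pi) powr (- real DIM('a) / 2)) *
     (LINT x|lborel. cis (- (x \<bullet> \<xi>)) * of_real (u x))"

text \<open>
  For \<open>u\<close> in \<open>L2\<close> the following is Plancherel's limit in the mean of the transforms of the
  truncations of \<open>u\<close> to balls; it is determined up to a null set.
\<close>

definition fourier :: "('a::euclidean_space \<Rightarrow> real) \<Rightarrow> 'a \<Rightarrow> complex" where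
  "fourier u = (SOME g. g \<in> L2 \<and>
     ((\<lambda>R. \<integral>\<^sup>+ \<xi>. ennreal ((cmod (fourier_L1 (\<lambda>x. indicator (ball 0 R) x * u x) \<xi> - g \<xi>))\<^sup>2) \<partial>lborel)
       \<longlongrightarrow> 0) at_top)"

definition frac_laplace :: "real \<Rightarrow> ('a::euclidean_space \<Rightarrow> real) \<Rightarrow> 'a \<Rightarrow> real" where
  "frac_laplace s u = (SOME w. w \<in> L2 \<and>
     (AE \<xi> in lborel. fourier w \<xi> = of_real (norm \<xi> powr (2 * s)) * fourier u \<xi>))"

subsection \<open>Sobolev spaces\<close>

definition bessel_weight :: "real \<Rightarrow> ('a::euclidean_space \<Rightarrow> real) \<Rightarrow> 'a \<Rightarrow> complex" where
  "bessel_weight s u \<xi> = of_real ((1 + (norm \<xi>)\<^sup>2) powr (s / 2)) * fourier u \<xi>"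

definition Hs :: "real \<Rightarrow> ('a::euclidean_space \<Rightarrow> real) set" where
  "Hs s = {u \<in> L2. bessel_weight s u \<in> L2}"

definition Hs_norm :: "real \<Rightarrow> ('a::euclidean_space \<Rightarrow> real) \<Rightarrow> real" where
  "Hs_norm s u = L2_norm UNIV (bessel_weight s u)"

primrec C_k :: "nat \<Rightarrow> ('a::euclidean_space \<Rightarrow> real) \<Rightarrow> bool" where
  "C_k 0 f \<longleftrightarrow> continuous_on UNIV f"
| "C_k (Suc k) f \<longleftrightarrow> (\<forall>x. f differentiable (at x)) \<and>
     (\<forall>e\<in>Basis. C_k k (\<lambda>x. frechet_derivative f (at x) e))"

definition test_functions :: "'a::euclidean_space set \<Rightarrow> ('a \<Rightarrow> real) set" where
  "test_functions V = {\<phi>. (\<forall>k. C_k k \<phi>) \<and>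
     compact (closure {x. \<phi> x \<noteq> 0}) \<and> closure {x. \<phi> x \<noteq> 0} \<subseteq> V}"

definition Htilde :: "real \<Rightarrow> 'a::euclidean_space set \<Rightarrow> ('a \<Rightarrow> real) set" where
  "Htilde s V = {u \<in> Hs s. \<forall>\<epsilon>>0. \<exists>\<phi>\<in>test_functions V. Hs_norm s (\<lambda>x. u x - \<phi> x) < \<epsilon>}"

text \<open>The norm of \<open>T\<close> in the dual of \<open>Htilde s V\<close>, that is, in \<open>H\<^sup>-\<^sup>s(V)\<close>.\<close>

definition dual_norm :: "real \<Rightarrow> 'a::euclidean_space set \<Rightarrow> (('a \<Rightarrow> real) \<Rightarrow> real) \<Rightarrow> real" where
  "dual_norm s V T = (SUP g\<in>{g \<in> Htilde s V. Hs_norm s g \<le> 1}. \<bar>T g\<bar>)"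

subsection \<open>The Dirichlet-to-Neumann map\<close>

definition first_eigenvalue :: "real \<Rightarrow> 'a::euclidean_space set \<Rightarrow> real" where
  "first_eigenvalue s \<Omega> =
     Inf {(L2_norm UNIV (frac_laplace (s / 2) u))\<^sup>2 | u. u \<in> Htilde s \<Omega> \<and> L2_norm \<Omega> u = 1}"

definition bilinear_form ::
  "real \<Rightarrow> 'a::euclidean_space set \<Rightarrow> ('a \<Rightarrow> real) \<Rightarrow> ('a \<Rightarrow> real) \<Rightarrow> ('a \<Rightarrow> real) \<Rightarrow> real" where
  "bilinear_form s \<Omega> q u v =
     L2_inner UNIV (frac_laplace (s / 2) u) (frac_laplace (s / 2) v) +
     L2_inner \<Omega> (\<lambda>x. q x * u x) v"

definition solution ::
  "real \<Rightarrow> 'a::euclidean_space set \<Rightarrow> ('a \<Rightarrow> real) \<Rightarrow> ('a \<Rightarrow> real) \<Rightarrow> 'a \<Rightarrow> real" where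
  "solution s \<Omega> q f = (SOME u. u \<in> Hs s \<and> (\<lambda>x. u x - f x) \<in> Htilde s \<Omega> \<and>
     (\<forall>w\<in>Htilde s \<Omega>. bilinear_form s \<Omega> q u w = 0))"

definition DN_map ::
  "real \<Rightarrow> 'a::euclidean_space set \<Rightarrow> ('a \<Rightarrow> real) \<Rightarrow> ('a \<Rightarrow> real) \<Rightarrow> ('a \<Rightarrow> real) \<Rightarrow> real" where
  "DN_map s \<Omega> q f = (\<lambda>g. bilinear_form s \<Omega> q (solution s \<Omega> q f) g)"

text \<open>The norm of the tuple with components \<open>(\<Lambda>\<^bsub>q1\<^esub> - \<Lambda>\<^bsub>q2\<^esub>) (f j)\<close> for \<open>1 \<le> j \<le> N\<close>.\<close>

definition DN_diff_norm ::
  "real \<Rightarrow> 'a::euclidean_space set \<Rightarrow> 'a set \<Rightarrow> nat \<Rightarrow> ('a \<Rightarrow> real) \<Rightarrow> ('a \<Rightarrow> real) \<Rightarrow>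
     (nat \<Rightarrow> 'a \<Rightarrow> real) \<Rightarrow> real" where
  "DN_diff_norm s \<Omega> W N q1 q2 f =
     Max ((\<lambda>j. dual_norm s W (\<lambda>g. DN_map s \<Omega> q1 (f j) g - DN_map s \<Omega> q2 (f j) g)) ` {1..N})"

subsection \<open>Lipschitz partitionings\<close>

text \<open>
  Near each boundary point the set lies on one side of a Lipschitz graph over a hyperplane with
  unit normal \<open>e\<close>. Which points of the graph belong to the set is left open: the sets of an
  exact covering of a connected domain by several sets with null overlaps cannot all be open.
\<close>

definition lipschitz_set :: "'a::euclidean_space set \<Rightarrow> bool" where
  "lipschitz_set D \<longleftrightarrow> D \<noteq> {} \<and>
     (\<forall>p\<in>frontier D. \<exists>e r L \<phi>. norm e = 1 \<and> r > 0 \<and> L-lipschitz_on {y. y \<bullet> e = 0} \<phi> \<and>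
       (\<forall>x\<in>ball p r.
          (x \<bullet> e > \<phi> (x - (x \<bullet> e) *\<^sub>R e) \<longrightarrow> x \<in> D) \<and>
          (x \<bullet> e < \<phi> (x - (x \<bullet> e) *\<^sub>R e) \<longrightarrow> x \<notin> D)))"

text \<open>
  Borel measurability is listed separately because an arbitrary subset of the null set
  \<open>frontier D\<close> may belong to a Lipschitz set \<open>D\<close>.
\<close>

definition lipschitz_partitioning :: "'a::euclidean_space set \<Rightarrow> nat \<Rightarrow> (nat \<Rightarrow> 'a set) \<Rightarrow> bool" where
  "lipschitz_partitioning \<Omega> N D \<longleftrightarrow>
     (\<forall>j\<in>{1..N}. lipschitz_set (D j) \<and> D j \<in> sets borel) \<and>
     (\<Union>j\<in>{1..N}. D j) = \<Omega> \<and>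
     (\<forall>i\<in>{1..N}. \<forall>j\<in>{1..N}. i \<noteq> j \<longrightarrow> D i \<inter> D j \<in> null_sets lborel)"

definition span_indicators :: "nat \<Rightarrow> (nat \<Rightarrow> 'a set) \<Rightarrow> ('a \<Rightarrow> real) set" where
  "span_indicators N D = {q. \<exists>c. q = (\<lambda>x. \<Sum>j=1..N. c j * indicator (D j) x)}"

end

theory Submission
  imports Defs "HOL-Probability.Characteristic_Functions" "HOL-Real_Asymp.Real_Asymp"
begin

text \<open>
  The map from potentials to Dirichlet-to-Neumann maps compresses exponentially. Since \<open>W\<close> and the
  unit ball have positive distance, the form of the fractional Laplacian between functions supported
  in these two sets is given by the kernel \<open>\<bar>x - y\<bar> powr (- n - 2 * s)\<close>. Writing it as a
  superposition of Gaussians \<open>exp (- t * \<bar>x - y\<bar>\<^sup>2)\<close>, whose Taylor terms are polynomials in finitely many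
  functions of \<open>x\<close> and of \<open>y\<close>, approximates the form up to an error \<open>(16/17)^m\<close> by one of rank
  \<open>m^d\<close>, where \<open>d\<close> depends on the dimension only. Consequently
  \<open>\<Lambda>\<^sub>q\<close> is determined, up to such an error, by an \<open>m^d \<times> m^d\<close> matrix of moments of solutions of the
  Dirichlet problem in the ball, and these matrices can be covered by \<open>2^O(m^(2d+1))\<close> sets on which
  \<open>\<Lambda>\<^sub>q\<close> varies by \<open>O((16/17)^m)\<close>. On a partition into \<open>N\<close> slabs there are \<open>2^N\<close> potentials with values
  in \<open>{0, \<lambda>\<^sub>1/2}\<close>, which are pairwise at distance \<open>\<lambda>\<^sub>1/2\<close>. Choosing \<open>m\<close> as a small power of \<open>N\<close>, the pigeonhole
  principle yields two of them whose maps are exponentially close.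
\<close>

text \<open>Two things shape the proof. \<open>fourier\<close>, \<open>frac_laplace\<close> and
  \<open>solution\<close> are choices, so Plancherel's theorem, surjectivity onto Hermitian
  functions and solvability of the Dirichlet problem must precede any statement about the maps. And
  the data may depend on both potentials, so the pair of potentials is fixed before any data and the
  bound is uniform over unit data. Moments suffice because, once the form of the data f is close to
  a combination of right factors, the solution for f is close to minus the same combination of
  solutions \<open>V \<beta>\<close> with right factor \<beta> as source; pairing with g then sees
  only the numbers \<open>ip (right_factor \<gamma>) (V \<beta>)\<close>. The coefficients may grow
  like R^m, so these numbers have to agree up to (16/17)^m / (m^(2d) R^(2m)). That costs O(m) bits
  per entry, which is affordable since the rank is polynomial in m. The ratio 16/17 is 8 over 17/2:
  squared distances lie in [1, 16], hence within 8 of the expansion point 9, and 17/2 is still below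
  the exponent 9 of the Gaussian at that point.\<close>

lemma quadratic_nonneg_imp_discriminant:
  fixes a b c :: real
  assumes "\<And>t. 0 \<le> a + 2 * b * t + c * t\<^sup>2" and "0 \<le> c"
  shows "b\<^sup>2 \<le> a * c"
proof (cases "c = 0")
  case True
  have "b = 0"
  proof (rule ccontr)
    assume "b \<noteq> 0"
    \<comment> \<open>This \<open>t\<close> gives the affine function the value -1.\<close>
    then show False
      using assms(1)[of "- (a + 1) / (2 * b)"] True by (simp add: field_simps)
  qed
  with True show ?thesis by simp
next
  case False
  with assms(2) have "c > 0" by simp
  have "0 \<le> a + 2 * b * (- b / c) + c * (- b / c)\<^sup>2" by (rule assms(1))
  also have "\<dots> = (a * c - b\<^sup>2) / c"
    using \<open>c > 0\<close> by (simp add: field_simps power2_eq_square)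
  finally show ?thesis using \<open>c > 0\<close> by (simp add: zero_le_divide_iff)
qed

section \<open>The Hilbert space of square integrable functions\<close>

text \<open>For complex values the integrand is the real part of the Hermitian product. Transforms
  of real functions thus live in a real Hilbert space, and Cauchy-Schwarz and completeness are
  proved once for all ranges.\<close>

definition ip :: "('a::euclidean_space \<Rightarrow> 'b::euclidean_space) \<Rightarrow> ('a \<Rightarrow> 'b) \<Rightarrow> real" where
  "ip f g = (LINT x|lborel. f x \<bullet> g x)"

lemma L2_measurable [measurable_dest]: "f \<in> L2 \<Longrightarrow> f \<in> borel_measurable borel"
  by (simp add: L2_def)

lemma L2_integrable: "f \<in> L2 \<Longrightarrow> integrable lborel (\<lambda>x. (norm (f x))\<^sup>2)"
  by (simp add: L2_def)

lemma L2_I: "f \<in> borel_measurable borel \<Longrightarrow> integrable lborel (\<lambda>x. (norm (f x))\<^sup>2) \<Longrightarrow> f \<in> L2"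
  by (simp add: L2_def)

lemma L2_bound:
  fixes f :: "'a::euclidean_space \<Rightarrow> 'b::euclidean_space" and g :: "'a \<Rightarrow> 'c::euclidean_space"
  assumes "f \<in> borel_measurable borel" and "g \<in> L2"
    and "AE x in lborel. norm (f x) \<le> norm (g x)"
  shows "f \<in> L2"
proof (rule L2_I)
  show "integrable lborel (\<lambda>x. (norm (f x))\<^sup>2)"
  proof (rule Bochner_Integration.integrable_bound[OF L2_integrable[OF assms(2)]])
    show "AE x in lborel. norm ((norm (f x))\<^sup>2) \<le> norm ((norm (g x))\<^sup>2)"
      using assms(3) by eventually_elim (simp add: power_mono)
  qed (use assms(1) in measurable)
qed fact

lemma L2_inner_integrable:
  fixes f g :: "'a::euclidean_space \<Rightarrow> 'b::euclidean_space"
  assumes "f \<in> L2" "g \<in> L2"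
  shows "integrable lborel (\<lambda>x. f x \<bullet> g x)"
proof (rule Bochner_Integration.integrable_bound)
  show "integrable lborel (\<lambda>x. (norm (f x))\<^sup>2 + (norm (g x))\<^sup>2)"
    using assms by (intro Bochner_Integration.integrable_add L2_integrable)
  show "AE x in lborel. norm (f x \<bullet> g x) \<le> norm ((norm (f x))\<^sup>2 + (norm (g x))\<^sup>2)"
  proof (rule AE_I2)
    fix x
    have "\<bar>f x \<bullet> g x\<bar> \<le> norm (f x) * norm (g x)" by (rule Cauchy_Schwarz_ineq2)
    also have "\<dots> \<le> (norm (f x))\<^sup>2 + (norm (g x))\<^sup>2"
      using sum_squares_bound[of "norm (f x)" "norm (g x)"] mult_nonneg_nonneg[OF norm_ge_zero[of "f x"] norm_ge_zero[of "g x"]] by linarith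
    finally show "norm (f x \<bullet> g x) \<le> norm ((norm (f x))\<^sup>2 + (norm (g x))\<^sup>2)" by simp
  qed
qed (use assms[THEN L2_measurable] in measurable)

lemma L2_scale:
  fixes f :: "'a::euclidean_space \<Rightarrow> 'b::euclidean_space"
  assumes "f \<in> L2" shows "(\<lambda>x. c *\<^sub>R f x) \<in> L2"
  using assms L2_measurable[OF assms] L2_integrable[OF assms] by (intro L2_I) (auto simp: power_mult_distrib)

lemma L2_add:
  fixes f g :: "'a::euclidean_space \<Rightarrow> 'b::euclidean_space"
  assumes "f \<in> L2" "g \<in> L2" shows "(\<lambda>x. f x + g x) \<in> L2"
proof (rule L2_I)
  show "integrable lborel (\<lambda>x. (norm (f x + g x))\<^sup>2)"
    unfolding power2_norm_eq_inner inner_add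
    using assms by (intro Bochner_Integration.integrable_add L2_inner_integrable)
qed (use assms[THEN L2_measurable] in measurable)

lemma L2_zero: "(\<lambda>x. 0) \<in> L2"
  by (intro L2_I) auto

lemma L2_diff:
  fixes f g :: "'a::euclidean_space \<Rightarrow> 'b::euclidean_space"
  assumes "f \<in> L2" "g \<in> L2" shows "(\<lambda>x. f x - g x) \<in> L2"
  using L2_add[OF assms(1) L2_scale[OF assms(2), of "-1"]] by simp

lemma L2_mult:
  fixes f :: "'a::euclidean_space \<Rightarrow> real"
  shows "f \<in> L2 \<Longrightarrow> (\<lambda>x. c * f x) \<in> L2"
  using L2_scale[of f c] by simp

lemma ip_commute: "ip f g = ip g f"
  by (simp add: ip_def inner_commute)

lemma ip_add_left:
  assumes "f \<in> L2" "g \<in> L2" "h \<in> L2"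
  shows "ip (\<lambda>x. f x + g x) h = ip f h + ip g h"
  using assms by (simp add: ip_def inner_add_left L2_inner_integrable)

lemma ip_diff_left:
  assumes "f \<in> L2" "g \<in> L2" "h \<in> L2"
  shows "ip (\<lambda>x. f x - g x) h = ip f h - ip g h"
  using assms by (simp add: ip_def inner_diff_left L2_inner_integrable)

lemma ip_scale_left: "ip (\<lambda>x. c *\<^sub>R f x) h = c * ip f h"
  by (simp add: ip_def)

lemma ip_add_right:
  assumes "f \<in> L2" "g \<in> L2" "h \<in> L2"
  shows "ip h (\<lambda>x. f x + g x) = ip h f + ip h g"
  using ip_add_left[OF assms] by (simp add: ip_commute)

lemma ip_diff_right:
  assumes "f \<in> L2" "g \<in> L2" "h \<in> L2"
  shows "ip h (\<lambda>x. f x - g x) = ip h f - ip h g"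
  using ip_diff_left[OF assms] by (simp add: ip_commute)

lemma ip_scale_right: "ip h (\<lambda>x. c *\<^sub>R f x) = c * ip h f"
  by (simp add: ip_def)

lemma ip_self: "ip f f = (LINT x|lborel. (norm (f x))\<^sup>2)"
  by (simp add: ip_def power2_norm_eq_inner)

lemma ip_self_nonneg [simp]: "0 \<le> ip f f"
  by (simp add: ip_self)

lemma L2_norm_UNIV:
  fixes f :: "'a::euclidean_space \<Rightarrow> 'b::euclidean_space"
  shows "L2_norm UNIV f = sqrt (ip f f)"
  by (simp add: L2_norm_def ip_self set_lebesgue_integral_def)

lemma L2_norm_nonneg [simp]: "0 \<le> L2_norm S f"
  by (simp add: L2_norm_def set_lebesgue_integral_def)

lemma L2_norm_sq:
  fixes f :: "'a::euclidean_space \<Rightarrow> 'b::euclidean_space"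
  shows "(L2_norm UNIV f)\<^sup>2 = ip f f"
  by (simp add: L2_norm_UNIV)

lemma ip_Cauchy_Schwarz:
  fixes f g :: "'a::euclidean_space \<Rightarrow> 'b::euclidean_space"
  assumes "f \<in> L2" "g \<in> L2"
  shows "\<bar>ip f g\<bar> \<le> L2_norm UNIV f * L2_norm UNIV g"
proof -
  have "(ip f g)\<^sup>2 \<le> ip f f * ip g g"
  proof (rule quadratic_nonneg_imp_discriminant)
    fix t
    have "0 \<le> ip (\<lambda>x. f x + t *\<^sub>R g x) (\<lambda>x. f x + t *\<^sub>R g x)" by simp
    also have "\<dots> = ip f f + 2 * ip f g * t + ip g g * t\<^sup>2"
      using assms L2_scale[OF assms(2), of t]
      by (simp add: ip_add_left ip_add_right L2_add ip_scale_left ip_scale_right ip_commute[of g f]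
          algebra_simps power2_eq_square)
    finally show "0 \<le> ip f f + 2 * ip f g * t + ip g g * t\<^sup>2" .
  qed simp
  then have "\<bar>ip f g\<bar> \<le> sqrt (ip f f * ip g g)"
    using real_le_rsqrt real_sqrt_abs real_sqrt_le_mono by metis
  then show ?thesis by (simp add: L2_norm_UNIV real_sqrt_mult)
qed

lemma L2_norm_triangle:
  fixes f g :: "'a::euclidean_space \<Rightarrow> 'b::euclidean_space"
  assumes "f \<in> L2" "g \<in> L2"
  shows "L2_norm UNIV (\<lambda>x. f x + g x) \<le> L2_norm UNIV f + L2_norm UNIV g"
proof (rule power2_le_imp_le)
  have "(L2_norm UNIV (\<lambda>x. f x + g x))\<^sup>2 = ip f f + 2 * ip f g + ip g g"
    using assms by (simp add: L2_norm_sq ip_add_left ip_add_right L2_add ip_commute[of g f])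
  also have "\<dots> \<le> (L2_norm UNIV f + L2_norm UNIV g)\<^sup>2"
    using ip_Cauchy_Schwarz[OF assms] by (simp add: power2_sum L2_norm_sq)
  finally show "(L2_norm UNIV (\<lambda>x. f x + g x))\<^sup>2 \<le> (L2_norm UNIV f + L2_norm UNIV g)\<^sup>2" .
qed simp

lemma L2_norm_scale:
  fixes f :: "'a::euclidean_space \<Rightarrow> 'b::euclidean_space"
  shows "L2_norm UNIV (\<lambda>x. c *\<^sub>R f x) = \<bar>c\<bar> * L2_norm UNIV f"
  by (simp add: L2_norm_UNIV ip_scale_left ip_scale_right real_sqrt_mult mult.assoc[symmetric])

lemma L2_norm_minus_commute:
  fixes f g :: "'a::euclidean_space \<Rightarrow> 'b::euclidean_space"
  shows "L2_norm UNIV (\<lambda>x. f x - g x) = L2_norm UNIV (\<lambda>x. g x - f x)"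
  by (simp add: L2_norm_def norm_minus_commute)

lemma L2_norm_triangle_diff:
  fixes f g h :: "'a::euclidean_space \<Rightarrow> 'b::euclidean_space"
  assumes "f \<in> L2" "g \<in> L2" "h \<in> L2"
  shows "L2_norm UNIV (\<lambda>x. f x - h x) \<le> L2_norm UNIV (\<lambda>x. f x - g x) + L2_norm UNIV (\<lambda>x. g x - h x)"
  using L2_norm_triangle[OF L2_diff[OF assms(1,2)] L2_diff[OF assms(2,3)]] by simp

lemma L2_norm_cong_AE:
  fixes f g :: "'a::euclidean_space \<Rightarrow> 'b::euclidean_space"
  assumes "f \<in> borel_measurable borel" "g \<in> borel_measurable borel" "AE x in lborel. f x = g x"
  shows "L2_norm UNIV f = L2_norm UNIV g"
proof -
  have "ip f f = ip g g"
    unfolding ip_self using assms by (intro integral_cong_AE) auto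
  then show ?thesis by (simp add: L2_norm_UNIV)
qed

lemma ip_cong_AE:
  fixes f g f' g' :: "'a::euclidean_space \<Rightarrow> 'b::euclidean_space"
  assumes "f \<in> borel_measurable borel" "g \<in> borel_measurable borel" "AE x in lborel. f x = g x"
    "f' \<in> borel_measurable borel" "g' \<in> borel_measurable borel" "AE x in lborel. f' x = g' x"
  shows "ip f f' = ip g g'"
  unfolding ip_def using assms by (intro integral_cong_AE) auto

lemma L2_norm_eq_0_AE:
  fixes f :: "'a::euclidean_space \<Rightarrow> 'b::euclidean_space"
  assumes "f \<in> L2" "L2_norm UNIV f = 0"
  shows "AE x in lborel. f x = 0"
proof -
  have "(LINT x|lborel. (norm (f x))\<^sup>2) = 0"
    using assms(2) by (simp add: L2_norm_UNIV ip_self)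
  then have "AE x in lborel. (norm (f x))\<^sup>2 = 0"
    using L2_integrable[OF assms(1)] by (subst (asm) integral_nonneg_eq_0_iff_AE) auto
  then show ?thesis by simp
qed

lemma L2_norm_le_AE:
  fixes f :: "'a::euclidean_space \<Rightarrow> 'b::euclidean_space" and g :: "'a \<Rightarrow> 'c::euclidean_space"
  assumes "f \<in> borel_measurable borel" "g \<in> L2" "AE x in lborel. norm (f x) \<le> norm (g x)"
  shows "L2_norm UNIV f \<le> L2_norm UNIV g"
proof -
  have "ip f f \<le> ip g g"
    unfolding ip_self using assms L2_bound[OF assms]
    by (intro integral_mono_AE L2_integrable) (auto elim!: eventually_mono intro!: power_mono)
  then show ?thesis by (simp add: L2_norm_UNIV)
qed

lemma nn_integral_norm_sq:
  fixes f :: "'a::euclidean_space \<Rightarrow> 'b::euclidean_space"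
  assumes "f \<in> L2"
  shows "(\<integral>\<^sup>+ x. ennreal ((norm (f x))\<^sup>2) \<partial>lborel) = ennreal ((L2_norm UNIV f)\<^sup>2)"
  using L2_integrable[OF assms] by (simp add: L2_norm_sq ip_self nn_integral_eq_integral)

lemma L2_I_nn_integral:
  fixes f :: "'a::euclidean_space \<Rightarrow> 'b::euclidean_space"
  assumes "f \<in> borel_measurable borel" "(\<integral>\<^sup>+ x. ennreal ((norm (f x))\<^sup>2) \<partial>lborel) \<le> ennreal (c\<^sup>2)" "c \<ge> 0"
  shows "f \<in> L2" "L2_norm UNIV f \<le> c"
proof -
  show L: "f \<in> L2"
    using assms by (intro L2_I integrableI_bounded) (auto simp: le_less_trans)
  have "ennreal ((L2_norm UNIV f)\<^sup>2) \<le> ennreal (c\<^sup>2)"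
    using nn_integral_norm_sq[OF L] assms(2) by simp
  then have "(L2_norm UNIV f)\<^sup>2 \<le> c\<^sup>2" by (subst (asm) ennreal_le_iff) auto
  then show "L2_norm UNIV f \<le> c" using assms(3) by (rule power2_le_imp_le)
qed

text \<open>Fatou's lemma yields membership of the limit together with the bound. It serves wherever
  square integrability of a pointwise limit is not known beforehand: for completeness, for
  transforms of integrable functions and for derivatives of test functions.\<close>

lemma L2_norm_Fatou:
  fixes f :: "nat \<Rightarrow> 'a::euclidean_space \<Rightarrow> 'b::euclidean_space"
  assumes "\<And>n. f n \<in> L2" "g \<in> borel_measurable borel" "AE x in lborel. (\<lambda>n. f n x) \<longlonglongrightarrow> g x"
    "\<And>n. n \<ge> k \<Longrightarrow> L2_norm UNIV (f n) \<le> c"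
  shows "g \<in> L2" "L2_norm UNIV g \<le> c"
proof -
  have c: "c \<ge> 0" using assms(4)[of k] L2_norm_nonneg[of UNIV "f k"] by linarith
  have "(\<integral>\<^sup>+ x. ennreal ((norm (g x))\<^sup>2) \<partial>lborel) = (\<integral>\<^sup>+ x. liminf (\<lambda>n. ennreal ((norm (f n x))\<^sup>2)) \<partial>lborel)"
  proof (rule nn_integral_cong_AE)
    show "AE x in lborel. ennreal ((norm (g x))\<^sup>2) = liminf (\<lambda>n. ennreal ((norm (f n x))\<^sup>2))"
      using assms(3)
    proof eventually_elim
      case (elim x)
      have "(\<lambda>n. ennreal ((norm (f n x))\<^sup>2)) \<longlonglongrightarrow> ennreal ((norm (g x))\<^sup>2)"
        by (intro tendsto_ennrealI tendsto_power tendsto_norm elim)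
      then show ?case using lim_imp_Liminf[OF sequentially_bot] by metis
    qed
  qed
  also have "\<dots> \<le> liminf (\<lambda>n. \<integral>\<^sup>+ x. ennreal ((norm (f n x))\<^sup>2) \<partial>lborel)"
    using assms(1)[THEN L2_measurable] by (intro nn_integral_liminf) auto
  also have "\<dots> = liminf (\<lambda>n. ennreal ((L2_norm UNIV (f n))\<^sup>2))"
    by (simp add: nn_integral_norm_sq assms(1))
  also have "\<dots> \<le> liminf (\<lambda>n::nat. ennreal (c\<^sup>2))"
    using assms(4) c
    by (intro Liminf_mono eventually_sequentiallyI[of k] ennreal_leI) (auto intro!: power_mono)
  also have "\<dots> = ennreal (c\<^sup>2)" by (simp add: Liminf_const)
  finally show "g \<in> L2" "L2_norm UNIV g \<le> c"
    using L2_I_nn_integral[OF assms(2)] c by auto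
qed

text \<open>
  Along a subsequence with increments of norm at most \<open>2\<^sup>-\<^sup>k\<close> the function
  \<open>\<Sum>k. 2 ^ k * (norm (f (Suc k) x - f k x))\<^sup>2\<close> is integrable, hence finite almost everywhere.
\<close>

lemma L2_fast_Cauchy_AE_convergent:
  fixes f :: "nat \<Rightarrow> 'a::euclidean_space \<Rightarrow> 'b::euclidean_space"
  assumes f: "\<And>n. f n \<in> L2" and d: "\<And>k. L2_norm UNIV (\<lambda>x. f (Suc k) x - f k x) \<le> (1/2) ^ k"
  shows "AE x in lborel. convergent (\<lambda>n. f n x)"
proof -
  define h where "h k x = f (Suc k) x - f k x" for k x
  have h: "h k \<in> L2" for k unfolding h_def using f by (intro L2_diff)
  have [measurable]: "h k \<in> borel_measurable borel" for k using h L2_measurable by auto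
  have "(\<integral>\<^sup>+ x. (\<Sum>k. ennreal (2 ^ k * (norm (h k x))\<^sup>2)) \<partial>lborel)
      = (\<Sum>k. \<integral>\<^sup>+ x. ennreal (2 ^ k * (norm (h k x))\<^sup>2) \<partial>lborel)"
    by (rule nn_integral_suminf) simp
  also have "\<dots> \<le> (\<Sum>k. ennreal ((1/2) ^ k))"
  proof (rule suminf_le)
    fix k
    have "(\<integral>\<^sup>+ x. ennreal (2 ^ k * (norm (h k x))\<^sup>2) \<partial>lborel) = ennreal (2 ^ k * (L2_norm UNIV (h k))\<^sup>2)"
      by (simp add: ennreal_mult nn_integral_cmult nn_integral_norm_sq[OF h])
    also have "\<dots> \<le> ennreal (2 ^ k * ((1/2) ^ k)\<^sup>2)"
      using d[of k] unfolding h_def[abs_def]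
      by (intro ennreal_leI mult_left_mono power_mono) auto
    also have "2 ^ k * ((1/2) ^ k)\<^sup>2 = ((1/2) ^ k :: real)"
      by (simp add: power2_eq_square power_one_over)
    finally show "(\<integral>\<^sup>+ x. ennreal (2 ^ k * (norm (h k x))\<^sup>2) \<partial>lborel) \<le> ennreal ((1/2) ^ k)" .
  qed auto
  also have "\<dots> < top"
    by (subst suminf_ennreal2) (auto intro!: summable_geometric)
  finally have "AE x in lborel. (\<Sum>k. ennreal (2 ^ k * (norm (h k x))\<^sup>2)) \<noteq> \<infinity>"
    by (intro nn_integral_PInf_AE) auto
  then show ?thesis
  proof eventually_elim
    case (elim x)
    have "(\<lambda>k. 2 ^ k * (norm (h k x))\<^sup>2) \<longlonglongrightarrow> 0"
      using summable_suminf_not_top[OF _ elim[unfolded infinity_ennreal_def]] by (intro summable_LIMSEQ_zero) auto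
    then obtain C where C: "\<And>k. 2 ^ k * (norm (h k x))\<^sup>2 \<le> C"
      by (metis (no_types, lifting) convergentI convergent_imp_Bseq Bseq_def abs_le_D1 real_norm_def)
    have C0: "0 \<le> C" using order_trans[OF zero_le_power2 C[of 0, simplified]] .
    \<comment> \<open>The bound on \<open>2 ^ k * (norm (h k x))\<^sup>2\<close> dominates the
      increments by a geometric series of ratio 1 / sqrt 2, so the telescoping series converges
      absolutely.\<close>
    have "norm (h k x) \<le> sqrt C * (1 / sqrt 2) ^ k" for k
    proof (rule power2_le_imp_le)
      have "((1 / sqrt 2) ^ k)\<^sup>2 = ((1 / sqrt 2)\<^sup>2) ^ k"
        by (simp only: power_mult[symmetric] mult.commute)
      also have "\<dots> = 1 / 2 ^ k" by (simp add: power_divide)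
      finally have "(sqrt C * (1 / sqrt 2) ^ k)\<^sup>2 = C / 2 ^ k"
        using C0 by (simp add: power_mult_distrib)
      moreover have "(norm (h k x))\<^sup>2 \<le> C / 2 ^ k"
        using C[of k] by (simp add: field_simps)
      ultimately show "(norm (h k x))\<^sup>2 \<le> (sqrt C * (1 / sqrt 2) ^ k)\<^sup>2" by simp
    qed (use C0 in auto)
    moreover have "summable (\<lambda>k. sqrt C * (1 / sqrt 2) ^ k)"
      by (intro summable_mult summable_geometric) simp
    ultimately have "summable (\<lambda>k. h k x)"
      using summable_comparison_test'[of "\<lambda>k. sqrt C * (1 / sqrt 2) ^ k" 0 "\<lambda>k. h k x"] by blast
    then have "(\<lambda>n. \<Sum>k<n. h k x) \<longlonglongrightarrow> (\<Sum>k. h k x)" by (rule summable_LIMSEQ)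
    moreover have "(\<Sum>k<n. h k x) = f n x - f 0 x" for n
      unfolding h_def by (rule sum_lessThan_telescope)
    ultimately have "(\<lambda>n. f n x - f 0 x + f 0 x) \<longlonglongrightarrow> (\<Sum>k. h k x) + f 0 x"
      by (intro tendsto_add tendsto_const) simp
    then show ?case by (auto simp: convergent_def)
  qed
qed

text \<open>A subsequence with increments below 2^-k converges almost everywhere. Fatou's lemma,
  applied to \<open>f n - f (r k)\<close> for growing \<open>k\<close>, then bounds the distance of
  every late \<open>f n\<close> to the limit, so the whole sequence is handled at once.\<close>

lemma L2_complete:
  fixes f :: "nat \<Rightarrow> 'a::euclidean_space \<Rightarrow> 'b::euclidean_space"
  assumes f: "\<And>n. f n \<in> L2"
    and C: "\<And>e. e > 0 \<Longrightarrow> \<exists>N. \<forall>m\<ge>N. \<forall>n\<ge>N. L2_norm UNIV (\<lambda>x. f m x - f n x) < e"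
  obtains g where "g \<in> L2" "(\<lambda>n. L2_norm UNIV (\<lambda>x. f n x - g x)) \<longlonglongrightarrow> 0"
proof -
  have "\<exists>N. \<forall>m\<ge>N. \<forall>n\<ge>N. L2_norm UNIV (\<lambda>x. f m x - f n x) < (1/2) ^ k" for k
    by (rule C) simp
  then obtain M where M: "\<And>k m n. m \<ge> M k \<Longrightarrow> n \<ge> M k \<Longrightarrow> L2_norm UNIV (\<lambda>x. f m x - f n x) < (1/2) ^ k"
    by metis
  define r where "r = rec_nat (M 0) (\<lambda>k p. max (Suc p) (M (Suc k)))"
  have r_Suc: "r (Suc k) = max (Suc (r k)) (M (Suc k))" for k by (simp add: r_def)
  have r_M: "r k \<ge> M k" for k by (cases k) (auto simp: r_def)
  have r_mono: "strict_mono r" by (intro strict_monoI_Suc) (simp add: r_Suc)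
  have r_le: "r k \<le> r (Suc k)" for k by (simp add: r_Suc)
  \<comment> \<open>On the null set where the subsequence diverges \<open>lim\<close> is
    unspecified; \<open>g\<close> is nevertheless Borel measurable.\<close>
  define g where "g x = lim (\<lambda>k. f (r k) x)" for x
  have fm[measurable]: "f n \<in> borel_measurable borel" for n using f L2_measurable by auto
  have gm[measurable]: "g \<in> borel_measurable borel" unfolding g_def[abs_def] by measurable
  have "AE x in lborel. convergent (\<lambda>k. f (r k) x)"
  proof (rule L2_fast_Cauchy_AE_convergent)
    fix k show "L2_norm UNIV (\<lambda>x. f (r (Suc k)) x - f (r k) x) \<le> (1/2) ^ k"
      using M[of k "r (Suc k)" "r k"] r_M[of k] r_le[of k] by simp
  qed (rule f)
  then have lim: "AE x in lborel. (\<lambda>k. f (r k) x) \<longlonglongrightarrow> g x"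
    by eventually_elim (simp add: g_def convergent_LIMSEQ_iff)
  have small: "(\<lambda>x. f n x - g x) \<in> L2 \<and> L2_norm UNIV (\<lambda>x. f n x - g x) \<le> e"
    if N: "\<And>m n. m \<ge> N \<Longrightarrow> n \<ge> N \<Longrightarrow> L2_norm UNIV (\<lambda>x. f m x - f n x) < e" and "n \<ge> N" for N n e
  proof -
    have "AE x in lborel. (\<lambda>k. f n x - f (r k) x) \<longlonglongrightarrow> f n x - g x"
      using lim by eventually_elim (intro tendsto_diff tendsto_const)
    moreover have "L2_norm UNIV (\<lambda>x. f n x - f (r k) x) \<le> e" if "k \<ge> N" for k
      using N[of n "r k"] \<open>n \<ge> N\<close> that seq_suble[OF r_mono, of k] by force
    ultimately show ?thesis
      using L2_norm_Fatou[of "\<lambda>k x. f n x - f (r k) x" "\<lambda>x. f n x - g x" N e] f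
      by (simp add: L2_diff)
  qed
  obtain N1 where "\<And>m n. m \<ge> N1 \<Longrightarrow> n \<ge> N1 \<Longrightarrow> L2_norm UNIV (\<lambda>x. f m x - f n x) < 1"
    using C[of 1] by auto
  then have "(\<lambda>x. f N1 x - g x) \<in> L2" using small[of N1 1 N1] by simp
  then have "(\<lambda>x. f N1 x - (f N1 x - g x)) \<in> L2" by (rule L2_diff[OF f])
  then have g: "g \<in> L2" by (simp only: diff_diff_eq2 add_diff_cancel_left')
  have "(\<lambda>n. L2_norm UNIV (\<lambda>x. f n x - g x)) \<longlonglongrightarrow> 0"
  proof (rule LIMSEQ_I)
    fix e :: real assume "e > 0"
    then obtain N where "\<And>m n. m \<ge> N \<Longrightarrow> n \<ge> N \<Longrightarrow> L2_norm UNIV (\<lambda>x. f m x - f n x) < e / 2"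
      using C[of "e/2"] by auto
    then have "L2_norm UNIV (\<lambda>x. f n x - g x) \<le> e / 2" if "n \<ge> N" for n using small that by blast
    then show "\<exists>N. \<forall>n\<ge>N. norm (L2_norm UNIV (\<lambda>x. f n x - g x) - 0) < e"
      using \<open>e > 0\<close> by (intro exI[of _ N]) force
  qed
  then show thesis using that g by blast
qed

lemma L2_limit_unique:
  fixes f :: "nat \<Rightarrow> 'a::euclidean_space \<Rightarrow> 'b::euclidean_space"
  assumes "\<And>n. f n \<in> L2" "g \<in> L2" "h \<in> L2"
    "(\<lambda>n. L2_norm UNIV (\<lambda>x. f n x - g x)) \<longlonglongrightarrow> 0" "(\<lambda>n. L2_norm UNIV (\<lambda>x. f n x - h x)) \<longlonglongrightarrow> 0"
  shows "AE x in lborel. g x = h x"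
proof -
  have "L2_norm UNIV (\<lambda>x. g x - h x) \<le> L2_norm UNIV (\<lambda>x. f n x - g x) + L2_norm UNIV (\<lambda>x. f n x - h x)" for n
    using L2_norm_triangle_diff[OF assms(2,1,3), of n] by (simp add: L2_norm_minus_commute[of g])
  then have "L2_norm UNIV (\<lambda>x. g x - h x) \<le> 0 + 0"
    by (intro LIMSEQ_le_const[OF tendsto_add[OF assms(4,5)]]) auto
  then have "AE x in lborel. g x - h x = 0"
    using L2_norm_nonneg[of UNIV "\<lambda>x. g x - h x"] assms(2,3)
    by (intro L2_norm_eq_0_AE L2_diff) auto
  then show ?thesis by simp
qed

lemma ip_tendsto:
  fixes f g :: "nat \<Rightarrow> 'a::euclidean_space \<Rightarrow> 'b::euclidean_space"
  assumes f: "\<And>n. f n \<in> L2" "f' \<in> L2" "(\<lambda>n. L2_norm UNIV (\<lambda>x. f n x - f' x)) \<longlonglongrightarrow> 0"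
    and g: "\<And>n. g n \<in> L2" "g' \<in> L2" "(\<lambda>n. L2_norm UNIV (\<lambda>x. g n x - g' x)) \<longlonglongrightarrow> 0"
  shows "(\<lambda>n. ip (f n) (g n)) \<longlonglongrightarrow> ip f' g'"
proof -
  let ?a = "\<lambda>n. L2_norm UNIV (\<lambda>x. f n x - f' x)" and ?b = "\<lambda>n. L2_norm UNIV (\<lambda>x. g n x - g' x)"
  have bnd: "norm (ip (f n) (g n) - ip f' g') \<le> ?a n * ?b n + ?a n * L2_norm UNIV g' + L2_norm UNIV f' * ?b n" for n
  proof -
    have "ip (f n) (g n) - ip f' g' = ip (\<lambda>x. f n x - f' x) (\<lambda>x. g n x - g' x)
        + ip (\<lambda>x. f n x - f' x) g' + ip f' (\<lambda>x. g n x - g' x)"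
      using f(1,2) g(1,2) by (simp add: ip_diff_left ip_diff_right L2_diff)
    then show ?thesis
      using ip_Cauchy_Schwarz[OF L2_diff[OF f(1)[of n] f(2)] L2_diff[OF g(1)[of n] g(2)]]
        ip_Cauchy_Schwarz[OF L2_diff[OF f(1)[of n] f(2)] g(2)]
        ip_Cauchy_Schwarz[OF f(2) L2_diff[OF g(1)[of n] g(2)]] by simp
  qed
  have "(\<lambda>n. ?a n * ?b n + ?a n * L2_norm UNIV g' + L2_norm UNIV f' * ?b n) \<longlonglongrightarrow> 0 * 0 + 0 * L2_norm UNIV g' + L2_norm UNIV f' * 0"
    by (intro tendsto_add tendsto_mult tendsto_const f(3) g(3))
  then have lim: "(\<lambda>n. ?a n * ?b n + ?a n * L2_norm UNIV g' + L2_norm UNIV f' * ?b n) \<longlonglongrightarrow> 0" by simp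
  have "(\<lambda>n. ip (f n) (g n) - ip f' g') \<longlonglongrightarrow> 0"
    by (rule Lim_null_comparison[OF _ lim]) (simp add: bnd del: real_norm_def)
  then show ?thesis by (rule LIM_zero_cancel)
qed

section \<open>Plancherel's theorem\<close>

lemma cis_measurable [measurable]: "cis \<in> borel_measurable borel"
  by (intro borel_measurable_continuous_onI continuous_intros)

lemma integrable_tensor:
  fixes f :: "'a::euclidean_space \<Rightarrow> complex" and g :: "'b::euclidean_space \<Rightarrow> complex"
  assumes f: "integrable lborel f" and g: "integrable lborel g"
    and [measurable]: "k \<in> borel_measurable (lborel \<Otimes>\<^sub>M lborel)"
    and k: "\<And>z. cmod (k z) \<le> 1"
  shows "integrable (lborel \<Otimes>\<^sub>M lborel) (\<lambda>(x, y). f x * g y * k (x, y))"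
proof (rule Bochner_Integration.integrable_bound)
  have [measurable]: "f \<in> borel_measurable borel" "g \<in> borel_measurable borel" using f g by auto
  show "integrable (lborel \<Otimes>\<^sub>M lborel) (\<lambda>z. f (fst z) * g (snd z))"
  proof (rule lborel_pair.Fubini_integrable)
    show "integrable lborel (\<lambda>x. \<integral>y. norm (f (fst (x, y)) * g (snd (x, y))) \<partial>lborel)"
      using f g by (simp add: norm_mult)
    show "AE x in lborel. integrable lborel (\<lambda>y. f (fst (x, y)) * g (snd (x, y)))"
      using g by simp
  qed simp
  show "AE z in lborel \<Otimes>\<^sub>M lborel. norm (case z of (x, y) \<Rightarrow> f x * g y * k (x, y)) \<le> norm (f (fst z) * g (snd z))"
    using k by (intro AE_I2) (auto simp: norm_mult split: prod.splits intro!: mult_left_le mult_nonneg_nonneg)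
qed (use f g in measurable)

text \<open>The multiplication formula of the Fourier transform without its normalisation. The
  factor \<sigma> lets it serve both the transform and its conjugate.\<close>

lemma integral_cis_swap:
  fixes h :: "'a::euclidean_space \<Rightarrow> complex" and u :: "'a \<Rightarrow> real"
  assumes h: "integrable lborel h" and u: "integrable lborel u"
  shows "(LINT \<xi>|lborel. h \<xi> * (LINT x|lborel. cis (\<sigma> * (x \<bullet> \<xi>)) * of_real (u x))) =
    (LINT x|lborel. of_real (u x) * (LINT \<xi>|lborel. h \<xi> * cis (\<sigma> * (x \<bullet> \<xi>))))"
proof -
  have [measurable]: "h \<in> borel_measurable borel" "u \<in> borel_measurable borel" using h u by auto
  let ?F = "\<lambda>x \<xi>. complex_of_real (u x) * h \<xi> * cis (\<sigma> * (x \<bullet> \<xi>))"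
  have "integrable (lborel \<Otimes>\<^sub>M lborel) (\<lambda>(x, \<xi>). complex_of_real (u x) * h \<xi> * (\<lambda>(x, \<xi>). cis (\<sigma> * (x \<bullet> \<xi>))) (x, \<xi>))"
    using h u by (intro integrable_tensor) auto
  then have "integrable (lborel \<Otimes>\<^sub>M lborel) (case_prod ?F)" by simp
  from lborel_pair.Fubini_integral[OF this]
  have "(LINT \<xi>|lborel. LINT x|lborel. ?F x \<xi>) = (LINT x|lborel. LINT \<xi>|lborel. ?F x \<xi>)" .
  moreover have "(LINT x|lborel. ?F x \<xi>) = h \<xi> * (LINT x|lborel. cis (\<sigma> * (x \<bullet> \<xi>)) * of_real (u x))" for \<xi>
    by (subst integral_mult_right_zero[symmetric]) (simp add: mult_ac)
  moreover have "(LINT \<xi>|lborel. ?F x \<xi>) = of_real (u x) * (LINT \<xi>|lborel. h \<xi> * cis (\<sigma> * (x \<bullet> \<xi>)))" for x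
    by (subst integral_mult_right_zero[symmetric]) (simp add: mult_ac)
  ultimately show ?thesis by simp
qed

subsection \<open>Gaussians\<close>

text \<open>Rescaling by \<open>sqrt (2 * a)\<close> turns the Gaussian into the standard normal
  density, whose characteristic function is known.\<close>

lemma gaussian_cis_real:
  fixes a z :: real
  assumes a: "a > 0"
  shows "integrable lborel (\<lambda>x. complex_of_real (exp (- x\<^sup>2 / (4 * a))) * cis (z * x))"
    and "(LINT x|lborel. complex_of_real (exp (- x\<^sup>2 / (4 * a))) * cis (z * x)) =
      of_real (sqrt (4 * pi * a) * exp (- a * z\<^sup>2))"
proof -
  let ?c = "sqrt (2 * a)"
  let ?f = "\<lambda>x. complex_of_real (std_normal_density x) * cis (?c * z * x)"
  have c: "?c \<noteq> 0" "?c > 0" using a by auto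
  have "integrable lborel std_normal_density" by simp
  then have int: "integrable lborel ?f"
    by (rule Bochner_Integration.integrable_bound) (auto simp: norm_mult)
  have "complex_of_real (exp (- (?c * z)\<^sup>2 / 2)) = char std_normal_distribution (?c * z)"
    by (simp add: char_std_normal_distribution)
  also have "\<dots> = (LINT x|lborel. ?f x)"
    unfolding char_def
    by (subst integral_density) (auto simp: cis_conv_exp scaleR_conv_of_real intro!: borel_measurable_continuous_onI continuous_intros)
  finally have eq: "(LINT x|lborel. ?f x) = of_real (exp (- a * z\<^sup>2))"
    using a by (simp add: power_mult_distrib)
  have *: "complex_of_real (exp (- x\<^sup>2 / (4 * a))) * cis (z * x) = of_real (sqrt (2 * pi)) * ?f (0 + (1 / ?c) * x)" for x
    using a by (simp add: normal_density_def power_divide mult_ac)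
  have "integrable lborel (\<lambda>x. ?f (0 + (1 / ?c) * x))"
    using int c by (intro lborel_integrable_real_affine) auto
  then show "integrable lborel (\<lambda>x. complex_of_real (exp (- x\<^sup>2 / (4 * a))) * cis (z * x))"
    unfolding * by (rule integrable_mult_right)
  have "(LINT x|lborel. ?f x) = \<bar>1 / ?c\<bar> *\<^sub>R (LINT x|lborel. ?f (0 + (1 / ?c) * x))"
    by (rule lborel_integral_real_affine) (use c in auto)
  then have "(LINT x|lborel. ?f (0 + (1 / ?c) * x)) = of_real ?c * of_real (exp (- a * z\<^sup>2))"
    using c a unfolding eq by (simp add: scaleR_conv_of_real field_simps)
  then show "(LINT x|lborel. complex_of_real (exp (- x\<^sup>2 / (4 * a))) * cis (z * x)) =
      of_real (sqrt (4 * pi * a) * exp (- a * z\<^sup>2))"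
    unfolding * integral_mult_right_zero
    by (simp add: real_sqrt_mult mult_ac power2_eq_square flip: of_real_mult)
qed

lemma norm_sq_Basis: "(norm (z::'a::euclidean_space))\<^sup>2 = (\<Sum>b\<in>Basis. (z \<bullet> b)\<^sup>2)"
  unfolding power2_norm_eq_inner[of z] by (subst euclidean_inner) (simp add: power2_eq_square)

lemma cis_sum: "finite B \<Longrightarrow> cis (\<Sum>b\<in>B. g b) = (\<Prod>b\<in>B. cis (g b))"
  by (induction rule: finite_induct) (auto simp: cis_mult[symmetric])

text \<open>\<open>lborel\<close> is the image of the product of one-dimensional Lebesgue measures,
  and the integrand is a product over the coordinates.\<close>

lemma gaussian_cis:
  fixes z :: "'a::euclidean_space"
  assumes a: "a > 0"
  shows "integrable lborel (\<lambda>x::'a. complex_of_real (exp (- (norm x)\<^sup>2 / (4 * a))) * cis (z \<bullet> x))" (is "integrable _ ?f")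
    and "(LINT x|lborel. complex_of_real (exp (- (norm (x::'a))\<^sup>2 / (4 * a))) * cis (z \<bullet> x)) =
      of_real (sqrt (4 * pi * a) ^ DIM('a) * exp (- a * (norm z)\<^sup>2))"
proof -
  interpret product_sigma_finite "\<lambda>_::'a. lborel :: real measure" ..
  let ?g = "\<lambda>b t. complex_of_real (exp (- t\<^sup>2 / (4 * a))) * cis ((z \<bullet> b) * t)"
  let ?T = "\<lambda>f::'a \<Rightarrow> real. \<Sum>b\<in>Basis. f b *\<^sub>R b"
  have fact: "?f (?T f) = (\<Prod>b\<in>Basis. ?g b (f b))" for f
  proof -
    have "(norm (?T f))\<^sup>2 = (\<Sum>b\<in>Basis. (f b)\<^sup>2)"
      unfolding norm_sq_Basis by (intro sum.cong refl) (simp only: inner_sum_left_Basis)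
    then have "exp (- (norm (?T f))\<^sup>2 / (4 * a)) = (\<Prod>b\<in>Basis. exp (- (f b)\<^sup>2 / (4 * a)))"
      by (simp only: sum_negf[symmetric] sum_divide_distrib exp_sum[OF finite_Basis])
    moreover have "z \<bullet> ?T f = (\<Sum>b\<in>Basis. (z \<bullet> b) * f b)"
      by (simp only: inner_sum_right inner_scaleR_right mult.commute)
    then have "cis (z \<bullet> ?T f) = (\<Prod>b\<in>Basis. cis ((z \<bullet> b) * f b))"
      by (simp only: cis_sum[OF finite_Basis])
    ultimately show ?thesis
      by (simp only: prod.distrib of_real_prod)
  qed
  have int: "integrable (\<Pi>\<^sub>M b\<in>Basis. lborel) (\<lambda>f. \<Prod>b\<in>Basis. ?g b (f b))"
    by (rule product_integrable_prod) (use gaussian_cis_real(1)[OF a] in auto)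
  have [measurable]: "?f \<in> borel_measurable borel" by measurable
  have [measurable]: "?T \<in> borel_measurable (\<Pi>\<^sub>M b\<in>Basis. lborel)" by measurable
  show "integrable lborel ?f"
    unfolding lborel_eq[where 'a = 'a] by (subst integrable_distr_eq) (simp_all only: fact int, measurable)
  have "(LINT x|lborel. ?f x) = (\<Prod>b\<in>Basis. LINT t|lborel. ?g b t)"
    unfolding lborel_eq[where 'a = 'a]
    by (subst integral_distr) (simp_all only: fact product_integral_prod[OF finite_Basis gaussian_cis_real(1)[OF a]], measurable)
  also have "\<dots> = of_real (\<Prod>b\<in>Basis. sqrt (4 * pi * a) * exp (- a * (z \<bullet> b)\<^sup>2))"
    by (simp only: gaussian_cis_real(2)[OF a] of_real_prod)
  also have "(\<Prod>b\<in>Basis. sqrt (4 * pi * a) * exp (- a * (z \<bullet> b)\<^sup>2)) = sqrt (4 * pi * a) ^ DIM('a) * exp (- a * (norm z)\<^sup>2)"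
    by (simp add: prod.distrib exp_sum[symmetric] sum_distrib_left norm_sq_Basis)
  finally show "(LINT x|lborel. ?f x) = of_real (sqrt (4 * pi * a) ^ DIM('a) * exp (- a * (norm z)\<^sup>2))" .
qed

text \<open>The heat kernel at time 1 / (4 a), normalised to mass one. The parameter is an inverse
  time: large \<open>a\<close> gives an approximate identity.\<close>

definition heat_kernel :: "real \<Rightarrow> 'a::euclidean_space \<Rightarrow> real" where
  "heat_kernel a z = sqrt (a / pi) ^ DIM('a) * exp (- a * (norm z)\<^sup>2)"

lemma heat_kernel_nonneg [simp]: "a > 0 \<Longrightarrow> 0 \<le> heat_kernel a z"
  by (simp add: heat_kernel_def)

lemma heat_kernel_measurable [measurable]: "heat_kernel a \<in> borel_measurable borel"
  unfolding heat_kernel_def[abs_def] by measurable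

lemma heat_kernel_minus: "heat_kernel a (x - y) = heat_kernel a (y - x)"
  by (simp add: heat_kernel_def norm_minus_commute)

lemma gaussian_integral:
  assumes a: "a > 0"
  shows "integrable lborel (\<lambda>x::'a::euclidean_space. exp (- a * (norm x)\<^sup>2))"
    and "(LINT x|lborel. exp (- a * (norm (x::'a))\<^sup>2)) = sqrt (pi / a) ^ DIM('a)"
proof -
  have *: "complex_of_real (exp (- (norm x)\<^sup>2 / (4 * (1 / (4 * a))))) * cis (0 \<bullet> x) = of_real (exp (- a * (norm x)\<^sup>2))" for x :: 'a
    using a by (simp add: field_simps)
  have a': "1 / (4 * a) > 0" using a by simp
  have "integrable lborel (\<lambda>x::'a. complex_of_real (exp (- a * (norm x)\<^sup>2)))"
    using gaussian_cis(1)[OF a', of "0::'a"] unfolding * .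
  then show int: "integrable lborel (\<lambda>x::'a. exp (- a * (norm x)\<^sup>2))"
    by (simp only: complex_of_real_integrable_eq)
  have "(LINT x|lborel. complex_of_real (exp (- a * (norm (x::'a))\<^sup>2))) = of_real (sqrt (pi / a) ^ DIM('a))"
    using gaussian_cis(2)[OF a', of "0::'a"] a unfolding * by simp
  then show "(LINT x|lborel. exp (- a * (norm (x::'a))\<^sup>2)) = sqrt (pi / a) ^ DIM('a)"
    unfolding integral_complex_of_real of_real_eq_iff .
qed

lemma heat_kernel_integral:
  assumes a: "a > 0"
  shows "integrable lborel (heat_kernel a :: 'a::euclidean_space \<Rightarrow> real)"
    and "(LINT x|lborel. heat_kernel a (x::'a)) = 1"
proof -
  show "integrable lborel (heat_kernel a :: 'a \<Rightarrow> real)"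
    unfolding heat_kernel_def[abs_def] by (intro integrable_mult_right gaussian_integral a)
  have "sqrt (a / pi) * sqrt (pi / a) = 1"
    using a by (simp add: real_sqrt_mult[symmetric])
  then show "(LINT x|lborel. heat_kernel a (x::'a)) = 1"
    using a unfolding heat_kernel_def integral_mult_right_zero gaussian_integral(2)[OF a] by (simp add: power_mult_distrib[symmetric])
qed

lemma lborel_distr_reflect: "distr lborel borel (\<lambda>y. t - y) = (lborel :: 'a::euclidean_space measure)"
  using lborel_affine[of "-1" t] by (simp add: density_1)

lemma integral_reflect:
  fixes f :: "'a::euclidean_space \<Rightarrow> 'b::{banach, second_countable_topology}"
  assumes [measurable]: "f \<in> borel_measurable borel"
  shows "(LINT y|lborel. f (t - y)) = (LINT y|lborel. f y)"
  by (subst (2) lborel_distr_reflect[symmetric, of t]) (simp add: integral_distr)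

lemma integrable_reflect:
  fixes f :: "'a::euclidean_space \<Rightarrow> 'b::{banach, second_countable_topology}"
  assumes "integrable lborel f"
  shows "integrable lborel (\<lambda>y. f (t - y))"
  using assms by (subst (asm) lborel_distr_reflect[symmetric, of t]) (auto dest: integrable_distr[rotated])

lemma AE_reflect:
  assumes "AE x in lborel. P (x::'a::euclidean_space)"
  shows "AE x in lborel. P (- x)"
proof -
  have "AE x in distr lborel borel (\<lambda>y. 0 - y). P (x::'a)"
    using assms by (subst lborel_distr_reflect)
  then have "AE x in lborel. P (0 - x)" by (rule AE_distrD[rotated]) simp
  then show ?thesis by simp
qed

subsection \<open>The Fourier transform on integrable functions\<close>

lemma integrable_cis_mult:
  fixes u :: "'a::euclidean_space \<Rightarrow> real"
  assumes "integrable lborel u"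
  shows "integrable lborel (\<lambda>x. cis (\<sigma> * (x \<bullet> \<xi>)) * of_real (u x))"
proof (rule Bochner_Integration.integrable_bound[OF assms])
  show "(\<lambda>x. cis (\<sigma> * (x \<bullet> \<xi>)) * of_real (u x)) \<in> borel_measurable lborel" using assms by auto
qed (simp add: norm_mult)

lemma integral_cis_bound:
  fixes u :: "'a::euclidean_space \<Rightarrow> real"
  shows "cmod (LINT x|lborel. cis (\<sigma> * (x \<bullet> \<xi>)) * of_real (u x)) \<le> (LINT x|lborel. \<bar>u x\<bar>)"
  by (rule order_trans[OF integral_norm_bound]) (simp add: norm_mult)

lemma integral_cis_measurable:
  fixes u :: "'a::euclidean_space \<Rightarrow> real"
  assumes "integrable lborel u"
  shows "(\<lambda>\<xi>. LINT x|lborel. cis (\<sigma> * (x \<bullet> \<xi>)) * of_real (u x)) \<in> borel_measurable borel"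
proof -
  have [measurable]: "u \<in> borel_measurable borel" using assms by auto
  have "(\<lambda>\<xi>. LINT x|lborel. cis (\<sigma> * (x \<bullet> \<xi>)) * of_real (u x)) \<in> borel_measurable lborel"
    by (rule lborel.borel_measurable_lebesgue_integral) measurable
  then show ?thesis by simp
qed

abbreviation fourier_const :: "'a::euclidean_space itself \<Rightarrow> real" where
  "fourier_const _ \<equiv> (2 * pi) powr (- real DIM('a) / 2)"

lemma fourier_const_sq: "fourier_const TYPE('a::euclidean_space) ^ 2 = 1 / (2 * pi) ^ DIM('a)"
proof -
  have "(2 * pi) powr (- real DIM('a) / 2) * (2 * pi) powr (- real DIM('a) / 2) = (2 * pi) powr (- real DIM('a))"
    by (simp add: powr_add[symmetric])
  also have "\<dots> = 1 / (2 * pi) ^ DIM('a)"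
    by (simp add: powr_minus powr_realpow divide_inverse)
  finally show ?thesis by (simp only: power2_eq_square)
qed

lemma fourier_L1_measurable [measurable (raw)]:
  "integrable lborel u \<Longrightarrow> fourier_L1 u \<in> borel_measurable borel"
  unfolding fourier_L1_def[abs_def] using integral_cis_measurable[of u "-1"] by simp

lemma fourier_L1_bound:
  fixes u :: "'a::euclidean_space \<Rightarrow> real"
  shows "cmod (fourier_L1 u \<xi>) \<le> fourier_const TYPE('a) * (LINT x|lborel. \<bar>u x\<bar>)"
  unfolding fourier_L1_def using integral_cis_bound[of "-1" \<xi> u]
  by (simp add: norm_mult mult_left_mono)

lemma fourier_L1_lin:
  assumes "integrable lborel u" "integrable lborel v"
  shows "fourier_L1 (\<lambda>x. a * u x + b * v x) \<xi> = a * fourier_L1 u \<xi> + b * fourier_L1 v \<xi>"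
proof -
  have "(LINT x|lborel. cis (- (x \<bullet> \<xi>)) * of_real (a * u x + b * v x)) =
     (LINT x|lborel. a * (cis (- (x \<bullet> \<xi>)) * of_real (u x)) + b * (cis (- (x \<bullet> \<xi>)) * of_real (v x)))"
    by (simp add: algebra_simps)
  also have "\<dots> = a * (LINT x|lborel. cis (- (x \<bullet> \<xi>)) * of_real (u x)) + b * (LINT x|lborel. cis (- (x \<bullet> \<xi>)) * of_real (v x))"
    using integrable_cis_mult[OF assms(1), of "-1" \<xi>] integrable_cis_mult[OF assms(2), of "-1" \<xi>]
    by (subst Bochner_Integration.integral_add) auto
  finally show ?thesis by (simp add: fourier_L1_def algebra_simps)
qed

lemma inner_complex_eq: "(z::complex) \<bullet> w = Re (z * cnj w)"
  by (simp add: inner_complex_def)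

lemma cnj_fourier_L1:
  fixes u :: "'a::euclidean_space \<Rightarrow> real"
  shows "cnj (fourier_L1 u \<xi>) = of_real (fourier_const TYPE('a)) * (LINT x|lborel. cis (1 * (x \<bullet> \<xi>)) * of_real (u x))"
  by (simp add: fourier_L1_def cis_cnj del: Bochner_Integration.integral_cnj flip: Bochner_Integration.integral_cnj)

lemma fourier_L1_minus: "fourier_L1 u (- \<xi>) = cnj (fourier_L1 u \<xi>)"
  by (simp add: cnj_fourier_L1) (simp add: fourier_L1_def)

text \<open>Damping the product of two transforms by a Gaussian amounts to smoothing one of the
  functions by the heat kernel. Plancherel's theorem follows by letting \<open>a\<close> grow, and
  the kernel of the fractional Laplacian by integrating over \<open>a\<close>.\<close>

lemma gaussian_fourier_inner:
  fixes u v :: "'a::euclidean_space \<Rightarrow> real"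
  assumes u: "integrable lborel u" and v: "integrable lborel v" and a: "a > 0"
  shows "integrable lborel (\<lambda>\<xi>. exp (- (norm \<xi>)\<^sup>2 / (4 * a)) * (fourier_L1 u \<xi> \<bullet> fourier_L1 v \<xi>))"
    and "(LINT \<xi>|lborel. exp (- (norm \<xi>)\<^sup>2 / (4 * a)) * (fourier_L1 u \<xi> \<bullet> fourier_L1 v \<xi>)) =
      (LINT x|lborel. u x * (LINT y|lborel. heat_kernel a (x - y) * v y))"
proof -
  let ?c = "fourier_const TYPE('a)"
  let ?I = "\<lambda>\<xi>. LINT x|lborel. cis ((-1) * (x \<bullet> \<xi>)) * complex_of_real (u x)"
  let ?J = "\<lambda>\<xi>. LINT x|lborel. cis (1 * (x \<bullet> \<xi>)) * complex_of_real (v x)"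
  let ?e = "\<lambda>\<xi>::'a. complex_of_real (exp (- (norm \<xi>)\<^sup>2 / (4 * a)))"
  have eI: "integrable lborel ?e"
    using gaussian_cis(1)[OF a, of "0::'a"] by simp
  have e_cis: "integrable lborel (\<lambda>\<xi>. ?e \<xi> * cis ((-1) * (x \<bullet> \<xi>)))" for x
    using gaussian_cis(1)[OF a, of "- x"] by simp
  note [measurable] = integral_cis_measurable[OF u] integral_cis_measurable[OF v]
  \<comment> \<open>The transforms are bounded but in general not integrable; the Gaussian supplies
    the integrability required by both exchanges of integrals.\<close>
  have eJ: "integrable lborel (\<lambda>\<xi>. ?e \<xi> * ?J \<xi>)"
  proof (rule Bochner_Integration.integrable_bound)
    show "integrable lborel (\<lambda>\<xi>. ?e \<xi> * of_real (LINT x|lborel. \<bar>v x\<bar>))"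
      by (rule integrable_mult_left[OF eI])
    show "AE \<xi> in lborel. cmod (?e \<xi> * ?J \<xi>) \<le> cmod (?e \<xi> * of_real (LINT x|lborel. \<bar>v x\<bar>))"
      unfolding norm_mult using integral_cis_bound[of 1 _ v]
      by (intro AE_I2 mult_left_mono) (simp_all only: norm_of_real abs_of_nonneg[OF integral_nonneg_AE] norm_ge_zero AE_I2 abs_ge_zero)
  qed measurable
  have eJI: "integrable lborel (\<lambda>\<xi>. ?e \<xi> * ?J \<xi> * ?I \<xi>)"
  proof (rule Bochner_Integration.integrable_bound)
    show "integrable lborel (\<lambda>\<xi>. ?e \<xi> * ?J \<xi> * of_real (LINT x|lborel. \<bar>u x\<bar>))"
      by (rule integrable_mult_left[OF eJ])
    show "AE \<xi> in lborel. cmod (?e \<xi> * ?J \<xi> * ?I \<xi>) \<le> cmod (?e \<xi> * ?J \<xi> * of_real (LINT x|lborel. \<bar>u x\<bar>))"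
      unfolding norm_mult[of _ "?I _"] norm_mult[of _ "of_real _"] using integral_cis_bound[of "-1" _ u]
      by (intro AE_I2 mult_left_mono) (simp_all only: norm_of_real abs_of_nonneg[OF integral_nonneg_AE] norm_ge_zero AE_I2 abs_ge_zero)
  qed measurable
  have F: "exp (- (norm \<xi>)\<^sup>2 / (4 * a)) * (fourier_L1 u \<xi> \<bullet> fourier_L1 v \<xi>) = ?c\<^sup>2 * Re (?e \<xi> * ?J \<xi> * ?I \<xi>)" for \<xi>
  proof -
    have "fourier_L1 u \<xi> \<bullet> fourier_L1 v \<xi> = Re (of_real (?c\<^sup>2) * (?J \<xi> * ?I \<xi>))"
      unfolding inner_complex_eq cnj_fourier_L1 unfolding fourier_L1_def by (simp add: power2_eq_square mult_ac)
    then show ?thesis by (simp add: mult.assoc)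
  qed
  show "integrable lborel (\<lambda>\<xi>. exp (- (norm \<xi>)\<^sup>2 / (4 * a)) * (fourier_L1 u \<xi> \<bullet> fourier_L1 v \<xi>))"
    unfolding F by (intro integrable_mult_right integrable_Re eJI)
  have "(LINT \<xi>|lborel. ?e \<xi> * ?J \<xi> * ?I \<xi>) = (LINT x|lborel. of_real (u x) * (LINT \<xi>|lborel. ?e \<xi> * ?J \<xi> * cis ((-1) * (x \<bullet> \<xi>))))"
    by (rule integral_cis_swap[OF eJ u])
  also have "\<dots> = (LINT x|lborel. of_real ((sqrt (4 * pi * a) ^ DIM('a)) * (u x * (LINT y|lborel. v y * exp (- a * (norm (x - y))\<^sup>2)))))"
  proof (rule Bochner_Integration.integral_cong[OF refl])
    fix x
    have "(LINT \<xi>|lborel. ?e \<xi> * ?J \<xi> * cis ((-1) * (x \<bullet> \<xi>))) = (LINT \<xi>|lborel. (?e \<xi> * cis ((-1) * (x \<bullet> \<xi>))) * ?J \<xi>)"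
      by (simp add: mult_ac)
    also have "\<dots> = (LINT y|lborel. of_real (v y) * (LINT \<xi>|lborel. ?e \<xi> * cis ((-1) * (x \<bullet> \<xi>)) * cis (1 * (y \<bullet> \<xi>))))"
      by (rule integral_cis_swap[OF e_cis v])
    also have "\<dots> = (LINT y|lborel. of_real (v y) * of_real (sqrt (4 * pi * a) ^ DIM('a) * exp (- a * (norm (y - x))\<^sup>2)))"
      using gaussian_cis(2)[OF a, of "_ - x"]
      by (simp add: mult.assoc cis_mult inner_diff_left)
    also have "\<dots> = of_real (sqrt (4 * pi * a) ^ DIM('a) * (LINT y|lborel. v y * exp (- a * (norm (x - y))\<^sup>2)))"
      unfolding of_real_mult[symmetric] integral_complex_of_real
      by (subst integral_mult_right_zero[symmetric]) (simp add: mult_ac norm_minus_commute)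
    finally show "of_real (u x) * (LINT \<xi>|lborel. ?e \<xi> * ?J \<xi> * cis ((-1) * (x \<bullet> \<xi>))) =
      of_real ((sqrt (4 * pi * a) ^ DIM('a)) * (u x * (LINT y|lborel. v y * exp (- a * (norm (x - y))\<^sup>2))))"
      by simp
  qed
  finally have 1: "(LINT \<xi>|lborel. ?e \<xi> * ?J \<xi> * ?I \<xi>) =
    of_real ((sqrt (4 * pi * a) ^ DIM('a)) * (LINT x|lborel. u x * (LINT y|lborel. v y * exp (- a * (norm (x - y))\<^sup>2))))"
    by (simp only: integral_complex_of_real integral_mult_right_zero)
  have "sqrt (4 * pi * a) = sqrt ((2 * pi)\<^sup>2 * (a / pi))" by (simp add: power2_eq_square)
  then have "sqrt (4 * pi * a) = (2 * pi) * sqrt (a / pi)"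
    unfolding real_sqrt_mult[of "(2 * pi)\<^sup>2"] real_sqrt_abs by simp
  \<comment> \<open>The squared normalisation of the transform times the Gaussian integral is
    exactly the constant that gives \<open>heat_kernel\<close> mass one.\<close>
  then have 2: "?c\<^sup>2 * sqrt (4 * pi * a) ^ DIM('a) = sqrt (a / pi) ^ DIM('a)"
    unfolding fourier_const_sq by (simp only: power_mult_distrib) simp
  have "(LINT \<xi>|lborel. exp (- (norm \<xi>)\<^sup>2 / (4 * a)) * (fourier_L1 u \<xi> \<bullet> fourier_L1 v \<xi>)) =
     ?c\<^sup>2 * Re (LINT \<xi>|lborel. ?e \<xi> * ?J \<xi> * ?I \<xi>)"
    unfolding F integral_mult_right_zero by (subst integral_Re[OF eJI]) simp
  also have "\<dots> = sqrt (a / pi) ^ DIM('a) * (LINT x|lborel. u x * (LINT y|lborel. v y * exp (- a * (norm (x - y))\<^sup>2)))"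
    unfolding 1 using 2 by simp
  also have "\<dots> = (LINT x|lborel. u x * (LINT y|lborel. heat_kernel a (x - y) * v y))"
    unfolding heat_kernel_def
    by (simp add: integral_mult_right_zero[symmetric] mult_ac del: integral_mult_right_zero integral_mult_left_zero)
  finally show "(LINT \<xi>|lborel. exp (- (norm \<xi>)\<^sup>2 / (4 * a)) * (fourier_L1 u \<xi> \<bullet> fourier_L1 v \<xi>)) =
      (LINT x|lborel. u x * (LINT y|lborel. heat_kernel a (x - y) * v y))" .
qed

lemma heat_kernel_pair:
  fixes w :: "'a::euclidean_space \<Rightarrow> real"
  assumes w: "integrable lborel w" and a: "a > 0"
  shows "integrable (lborel \<Otimes>\<^sub>M lborel) (\<lambda>(x, y). heat_kernel a (x - y) * w y)"
    and "(LINT x|lborel. LINT y|lborel. heat_kernel a (x - y) * w y) = (LINT y|lborel. w y)"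
proof -
  have [measurable]: "w \<in> borel_measurable borel" using w by auto
  have int: "integrable lborel (\<lambda>x. heat_kernel a (x - y))" for y :: 'a
    using integrable_reflect[OF heat_kernel_integral(1)[OF a], of y] by (simp add: heat_kernel_minus[of a y])
  have one: "(LINT x|lborel. heat_kernel a (x - y)) = 1" for y :: 'a
    using integral_reflect[of "heat_kernel a" y] heat_kernel_integral(2)[OF a, where 'a = 'a]
    by (simp add: heat_kernel_minus[of a y])
  have "integrable (lborel \<Otimes>\<^sub>M lborel) (\<lambda>(y, x). heat_kernel a (x - y) * w y)"
  proof (rule lborel_pair.Fubini_integrable)
    show "integrable lborel (\<lambda>y. LINT x|lborel. norm (case (y, x) of (y, x) \<Rightarrow> heat_kernel a (x - y) * w y))"
      using w a by (simp add: abs_mult one)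
    show "AE y in lborel. integrable lborel (\<lambda>x. case (y, x) of (y, x) \<Rightarrow> heat_kernel a (x - y) * w y)"
      using int by simp
  qed measurable
  from lborel_pair.integrable_product_swap[OF this]
  show *: "integrable (lborel \<Otimes>\<^sub>M lborel) (\<lambda>(x, y). heat_kernel a (x - y) * w y)" by simp
  from lborel_pair.Fubini_integral[OF *]
  show "(LINT x|lborel. LINT y|lborel. heat_kernel a (x - y) * w y) = (LINT y|lborel. w y)"
    by (simp add: one)
qed

lemma heat_kernel_bound: "a > 0 \<Longrightarrow> heat_kernel a (x::'a::euclidean_space) \<le> sqrt (a / pi) ^ DIM('a)"
  unfolding heat_kernel_def by (intro mult_left_le) auto

lemma heat_kernel_conv_integrable:
  fixes w :: "'a::euclidean_space \<Rightarrow> real"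
  assumes w: "integrable lborel w" and a: "a > 0"
  shows "integrable lborel (\<lambda>y. heat_kernel a (x - y) * w y)"
proof (rule Bochner_Integration.integrable_bound)
  show "integrable lborel (\<lambda>y. sqrt (a / pi) ^ DIM('a) * w y)" using w by simp
  show "AE y in lborel. norm (heat_kernel a (x - y) * w y) \<le> norm (sqrt (a / pi) ^ DIM('a) * w y)"
    using heat_kernel_bound[OF a] a by (intro AE_I2) (auto simp: abs_mult intro!: mult_right_mono)
qed (use w in measurable)

text \<open>The inequality \<open>2 * (u x * u y) \<le> (u x)\<^sup>2 + (u y)\<^sup>2\<close> is
  integrated against a kernel of mass one in each variable.\<close>

lemma heat_kernel_form_le:
  fixes u :: "'a::euclidean_space \<Rightarrow> real"
  assumes u: "integrable lborel u" "u \<in> L2" and a: "a > 0"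
  shows "(LINT x|lborel. u x * (LINT y|lborel. heat_kernel a (x - y) * u y)) \<le> ip u u"
proof -
  let ?K = "\<lambda>w x. LINT y|lborel. heat_kernel a (x - y) * w y"
  have u2: "integrable lborel (\<lambda>x. (u x)\<^sup>2)" using L2_integrable[OF u(2)] by simp
  have pw: "u x * ?K u x \<le> ((u x)\<^sup>2 + ?K (\<lambda>y. (u y)\<^sup>2) x) / 2" for x
  proof -
    have hx: "integrable lborel (\<lambda>y. heat_kernel a (x - y))"
      by (intro integrable_reflect heat_kernel_integral a)
    have one: "(LINT y|lborel. heat_kernel a (x - y)) = 1"
      by (simp add: integral_reflect heat_kernel_integral a)
    have "u x * ?K u x = (LINT y|lborel. u x * (heat_kernel a (x - y) * u y))" by simp
    also have "\<dots> \<le> (LINT y|lborel. ((u x)\<^sup>2 * heat_kernel a (x - y) + heat_kernel a (x - y) * (u y)\<^sup>2) / 2)"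
    proof (rule integral_mono)
      fix y
      have "2 * (u x * u y) \<le> (u x)\<^sup>2 + (u y)\<^sup>2" using sum_squares_bound[of "u x" "u y"] by simp
      then have "heat_kernel a (x - y) * (2 * (u x * u y)) \<le> heat_kernel a (x - y) * ((u x)\<^sup>2 + (u y)\<^sup>2)"
        using a by (intro mult_left_mono) auto
      then show "u x * (heat_kernel a (x - y) * u y) \<le> ((u x)\<^sup>2 * heat_kernel a (x - y) + heat_kernel a (x - y) * (u y)\<^sup>2) / 2"
        by (simp add: algebra_simps)
    qed (use hx heat_kernel_conv_integrable[OF u(1) a] heat_kernel_conv_integrable[OF u2 a] in auto)
    also have "\<dots> = ((u x)\<^sup>2 + ?K (\<lambda>y. (u y)\<^sup>2) x) / 2"
      using hx heat_kernel_conv_integrable[OF u2 a, of x] by (simp add: one)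
    finally show ?thesis .
  qed
  have K2: "integrable lborel (?K (\<lambda>y. (u y)\<^sup>2))"
    using lborel_pair.integrable_fst'[OF heat_kernel_pair(1)[OF u2 a]] by simp
  have uK: "integrable lborel (\<lambda>x. u x * ?K u x)"
  proof (rule Bochner_Integration.integrable_bound)
    let ?C = "sqrt (a / pi) ^ DIM('a) * (LINT y|lborel. \<bar>u y\<bar>)"
    show "integrable lborel (\<lambda>x. u x * ?C)" using u by simp
    have [measurable]: "u \<in> borel_measurable borel" using u by auto
    show "(\<lambda>x. u x * ?K u x) \<in> borel_measurable lborel" by measurable
    have bnd: "\<bar>?K u x\<bar> \<le> \<bar>?C\<bar>" for x
    proof -
      have "norm (?K u x) \<le> (LINT y|lborel. sqrt (a / pi) ^ DIM('a) * \<bar>u y\<bar>)"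
      proof (rule Bochner_Integration.integral_norm_bound_integral)
        fix y show "norm (heat_kernel a (x - y) * u y) \<le> sqrt (a / pi) ^ DIM('a) * \<bar>u y\<bar>"
          using a heat_kernel_bound[OF a, of "x - y"] by (simp add: abs_mult mult_right_mono)
      qed (use heat_kernel_conv_integrable[OF u(1) a] u in auto)
      then show ?thesis by simp
    qed
    show "AE x in lborel. norm (u x * ?K u x) \<le> norm (u x * ?C)"
    proof (rule AE_I2)
      fix x show "norm (u x * ?K u x) \<le> norm (u x * ?C)"
        using mult_left_mono[OF bnd[of x] abs_ge_zero[of "u x"]] by (simp only: real_norm_def abs_mult[of "u x"])
    qed
  qed
  have "(LINT x|lborel. u x * ?K u x) \<le> (LINT x|lborel. ((u x)\<^sup>2 + ?K (\<lambda>y. (u y)\<^sup>2) x) / 2)"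
    using uK u2 K2 pw by (intro integral_mono) auto
  also have "\<dots> = ip u u"
    using u2 K2 by (simp add: heat_kernel_pair(2)[OF u2 a] ip_self)
  finally show ?thesis .
qed

lemma gaussian_tendsto_1: "(\<lambda>n. exp (- c / (4 * real (Suc n)))) \<longlonglongrightarrow> 1"
proof -
  have "(\<lambda>n. exp ((- c / 4) * (1 / real (Suc n)))) \<longlonglongrightarrow> exp ((- c / 4) * 0)"
    using LIMSEQ_Suc[OF lim_1_over_n] by (intro tendsto_exp tendsto_mult tendsto_const) auto
  then show ?thesis by simp
qed

text \<open>The damped transforms have squared norm equal to the heat-smoothed form of
  \<open>u\<close>, hence at most \<open>ip u u\<close>. Fatou's lemma removes the damping;
  dominated convergence then identifies the limit of the forms. Equality with \<open>ip u u\<close>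
  relies on the heat kernel being an approximate identity.\<close>

lemma fourier_L1_in_L2:
  fixes u :: "'a::euclidean_space \<Rightarrow> real"
  assumes u: "integrable lborel u" "u \<in> L2"
  shows "fourier_L1 u \<in> L2" and "ip (fourier_L1 u) (fourier_L1 u) \<le> ip u u"
    and "(\<lambda>n. LINT x|lborel. u x * (LINT y|lborel. heat_kernel (real (Suc n)) (x - y) * u y)) \<longlonglongrightarrow>
      ip (fourier_L1 u) (fourier_L1 u)"
proof -
  \<comment> \<open>The exponent is halved because the square of this factor is to be the Gaussian
    weight.\<close>
  define e where "e n \<xi> = exp (- ((norm \<xi>)\<^sup>2 / 2) / (4 * real (Suc n)))" for n and \<xi> :: 'a
  define g where "g n \<xi> = e n \<xi> *\<^sub>R fourier_L1 u \<xi>" for n \<xi>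
  have ee: "(e n \<xi>)\<^sup>2 = exp (- (norm \<xi>)\<^sup>2 / (4 * real (Suc n)))" for n \<xi>
    unfolding e_def exp_double[symmetric] by (rule arg_cong[where f = exp]) (simp del: of_nat_Suc)
  have sq: "(norm (g n \<xi>))\<^sup>2 = exp (- (norm \<xi>)\<^sup>2 / (4 * real (Suc n))) * (fourier_L1 u \<xi> \<bullet> fourier_L1 u \<xi>)" for n \<xi>
    unfolding ee[symmetric] power2_norm_eq_inner[symmetric] by (simp add: g_def power_mult_distrib)
  have [measurable]: "fourier_L1 u \<in> borel_measurable borel" using u by (intro fourier_L1_measurable)
  have gL2: "g n \<in> L2" for n
    using gaussian_fourier_inner(1)[OF u(1) u(1), of "real (Suc n)"]
    by (intro L2_I) (auto simp only: sq of_nat_0_less_iff, auto simp: g_def[abs_def] e_def[abs_def])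
  have gip: "ip (g n) (g n) = (LINT x|lborel. u x * (LINT y|lborel. heat_kernel (real (Suc n)) (x - y) * u y))" for n
    unfolding ip_self sq by (rule gaussian_fourier_inner(2)[OF u(1) u(1)]) simp
  have gle: "L2_norm UNIV (g n) \<le> L2_norm UNIV u" for n
    unfolding L2_norm_UNIV gip using heat_kernel_form_le[OF u, of "real (Suc n)"] by simp
  have glim: "(\<lambda>n. g n \<xi>) \<longlonglongrightarrow> fourier_L1 u \<xi>" for \<xi>
  proof -
    have "(\<lambda>n. g n \<xi>) \<longlonglongrightarrow> 1 *\<^sub>R fourier_L1 u \<xi>"
      unfolding g_def e_def by (intro tendsto_scaleR tendsto_const gaussian_tendsto_1)
    then show ?thesis by simp
  qed
  show L: "fourier_L1 u \<in> L2" and "ip (fourier_L1 u) (fourier_L1 u) \<le> ip u u"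
    using L2_norm_Fatou[of g "fourier_L1 u" 0 "L2_norm UNIV u"] gL2 glim gle
    by (auto simp: L2_norm_UNIV)
  have "(\<lambda>n. ip (g n) (g n)) \<longlonglongrightarrow> ip (fourier_L1 u) (fourier_L1 u)"
    unfolding ip_self
  proof (rule integral_dominated_convergence)
    show "integrable lborel (\<lambda>x. (norm (fourier_L1 u x))\<^sup>2)" by (rule L2_integrable[OF L])
    show "AE x in lborel. (\<lambda>n. (norm (g n x))\<^sup>2) \<longlonglongrightarrow> (norm (fourier_L1 u x))\<^sup>2"
      by (intro AE_I2 tendsto_power tendsto_norm glim)
    have "e n \<xi> \<le> 1" "e n \<xi> \<ge> 0" for n \<xi> by (simp_all add: e_def)
    then have "norm (g n \<xi>) \<le> norm (fourier_L1 u \<xi>)" for n \<xi>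
      by (simp add: g_def mult_left_le_one_le)
    then show "AE x in lborel. norm ((norm (g n x))\<^sup>2) \<le> (norm (fourier_L1 u x))\<^sup>2" for n
      by (intro AE_I2) (auto intro!: power_mono)
  qed (use gL2[THEN L2_measurable] in auto)
  then show "(\<lambda>n. LINT x|lborel. u x * (LINT y|lborel. heat_kernel (real (Suc n)) (x - y) * u y)) \<longlonglongrightarrow>
      ip (fourier_L1 u) (fourier_L1 u)"
    unfolding gip .
qed

section \<open>Plancherel's identity for integrable functions\<close>

text \<open>One half of the exponent provides the decay; the other half, renormalised, is the kernel
  with parameter \<open>a / 2\<close>, whose mass is known.\<close>

lemma heat_kernel_tail:
  fixes z :: "'a::euclidean_space"
  assumes a: "a > 0" and d: "norm z \<ge> \<delta>" "\<delta> > 0"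
  shows "heat_kernel a z \<le> sqrt 2 ^ DIM('a) * exp (- a * \<delta>\<^sup>2 / 2) * heat_kernel (a / 2) z"
proof -
  have "sqrt (a / pi) = sqrt 2 * sqrt (a / 2 / pi)" by (simp add: real_sqrt_mult[symmetric])
  then have 1: "sqrt (a / pi) ^ DIM('a) = sqrt 2 ^ DIM('a) * sqrt (a / 2 / pi) ^ DIM('a)"
    by (simp only: power_mult_distrib)
  have "exp (- a * (norm z)\<^sup>2) = exp (- a * (norm z)\<^sup>2 / 2) * exp (- (a / 2) * (norm z)\<^sup>2)"
    by (simp add: exp_add[symmetric])
  also have "\<dots> \<le> exp (- a * \<delta>\<^sup>2 / 2) * exp (- (a / 2) * (norm z)\<^sup>2)"
    using a d by (intro mult_right_mono) (auto intro!: power_mono)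
  finally show ?thesis
    unfolding heat_kernel_def 1 using a by (simp add: mult_left_mono mult_ac)
qed

text \<open>Around a point of an open set the indicator is constant, so only the tail of the kernel
  matters and convergence holds at every point. This is why the identity is proved for open sets
  before general Borel sets.\<close>

lemma heat_conv_open_tendsto:
  fixes U :: "'a::euclidean_space set"
  assumes U: "open U" "x \<in> U"
  shows "(\<lambda>n. LINT y|lborel. heat_kernel (real (Suc n)) (x - y) * indicator U y) \<longlonglongrightarrow> 1"
proof -
  obtain \<delta> where \<delta>: "\<delta> > 0" "ball x \<delta> \<subseteq> U" using U by (meson openE)
  have [measurable]: "U \<in> sets borel" using U by auto
  let ?I = "\<lambda>n. LINT y|lborel. heat_kernel (real (Suc n)) (x - y) * indicator U y"
  let ?t = "\<lambda>n. sqrt 2 ^ DIM('a) * exp (- real (Suc n) * \<delta>\<^sup>2 / 2)"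
  have hk: "integrable lborel (\<lambda>y. heat_kernel a (x - y))" "(LINT y|lborel. heat_kernel a (x - y)) = 1" if "a > 0" for a
    by (use that in \<open>auto simp: integral_reflect heat_kernel_integral intro!: integrable_reflect\<close>)
  have bnd: "1 - ?t n \<le> ?I n \<and> ?I n \<le> 1" for n
  proof -
    let ?a = "real (Suc n)"
    have a: "?a > 0" "?a / 2 > 0" by auto
    have intU: "integrable lborel (\<lambda>y. heat_kernel ?a (x - y) * indicator U y)"
      using hk(1)[OF a(1)] integrable_real_mult_indicator[of U lborel "\<lambda>y. heat_kernel ?a (x - y)"] by simp
    have "?I n \<le> (LINT y|lborel. heat_kernel ?a (x - y))"
      using hk(1)[OF a(1)] intU by (intro integral_mono) (auto simp: indicator_def)
    moreover have "1 - ?I n = (LINT y|lborel. heat_kernel ?a (x - y) - heat_kernel ?a (x - y) * indicator U y)"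
      using hk[OF a(1)] intU by simp
    moreover have "\<dots> \<le> (LINT y|lborel. ?t n * heat_kernel (?a / 2) (x - y))"
    proof (rule integral_mono)
      fix y
      show "heat_kernel ?a (x - y) - heat_kernel ?a (x - y) * indicator U y \<le> ?t n * heat_kernel (?a / 2) (x - y)"
      proof (cases "y \<in> U")
        case False
        then have "norm (x - y) \<ge> \<delta>" using \<delta>(2) by (auto simp: dist_norm not_less subset_iff)
        then show ?thesis using heat_kernel_tail[OF a(1) _ \<delta>(1), of "x - y"] False by simp
      next
        case True then show ?thesis using heat_kernel_nonneg[OF a(2), of "x - y"] by simp
      qed
    qed (use hk(1)[OF a(1)] hk(1)[OF a(2)] intU in auto)
    moreover have "\<dots> = ?t n" using hk[OF a(2)] by simp
    ultimately show ?thesis using hk(2)[OF a(1)] by linarith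
  qed
  have "(\<lambda>n. exp (- (\<delta>\<^sup>2 / 2) * real (Suc n))) = (\<lambda>n. exp (- (\<delta>\<^sup>2 / 2)) ^ Suc n)"
    by (rule ext) (simp only: exp_of_nat2_mult)
  moreover have "(\<lambda>n. exp (- (\<delta>\<^sup>2 / 2)) ^ Suc n) \<longlonglongrightarrow> 0"
    using \<delta> by (intro LIMSEQ_Suc LIMSEQ_realpow_zero) auto
  ultimately have "(\<lambda>n. exp (- (\<delta>\<^sup>2 / 2) * real (Suc n))) \<longlonglongrightarrow> 0" by simp
  then have "(\<lambda>n. 1 - sqrt 2 ^ DIM('a) * exp (- (\<delta>\<^sup>2 / 2) * real (Suc n))) \<longlonglongrightarrow> 1 - sqrt 2 ^ DIM('a) * 0"
    by (intro tendsto_diff tendsto_mult tendsto_const)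
  moreover have "- (\<delta>\<^sup>2 / 2) * real (Suc n) = - real (Suc n) * \<delta>\<^sup>2 / 2" for n by (simp add: algebra_simps)
  ultimately have "(\<lambda>n. 1 - ?t n) \<longlonglongrightarrow> 1" by (simp only: mult_zero_right diff_zero)
  then show ?thesis
    by (rule tendsto_sandwich[OF _ _ _ tendsto_const, rotated 2]) (use bnd in auto)
qed

lemma indicator_L1_L2:
  assumes "A \<in> sets borel" "emeasure lborel A < \<infinity>"
  shows "integrable lborel (indicator A :: 'a::euclidean_space \<Rightarrow> real)" "(indicator A :: 'a \<Rightarrow> real) \<in> L2"
    "ip (indicator A) (indicator A :: 'a \<Rightarrow> real) = measure lborel A"
proof -
  show int: "integrable lborel (indicator A :: 'a \<Rightarrow> real)" using assms by simp
  have *: "(norm (indicator A x :: real))\<^sup>2 = indicator A x" for x :: 'a by (simp add: indicator_def)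
  show "(indicator A :: 'a \<Rightarrow> real) \<in> L2"
    using assms int by (intro L2_I) (auto simp only: *, auto)
  show "ip (indicator A) (indicator A :: 'a \<Rightarrow> real) = measure lborel A"
    unfolding ip_self * using assms by simp
qed

text \<open>A nonnegative quadratic form, continuous in the \<open>L2\<close> norm. Its zeros form a
  closed linear space, so it is enough to find zeros from which all functions can be
  approximated.\<close>

definition plancherel_defect :: "('a::euclidean_space \<Rightarrow> real) \<Rightarrow> real" where
  "plancherel_defect u = ip u u - ip (fourier_L1 u) (fourier_L1 u)"

lemma plancherel_defect_open:
  fixes U :: "'a::euclidean_space set"
  assumes U: "open U" "emeasure lborel U < \<infinity>"
  shows "plancherel_defect (indicator U) = 0"
proof -
  have UB[measurable]: "U \<in> sets borel" using U by auto
  note X = indicator_L1_L2[OF UB U(2)]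
  let ?K = "\<lambda>n x. LINT y|lborel. heat_kernel (real (Suc n)) (x - y) * indicator U y"
  have le: "0 \<le> ?K n x" "?K n x \<le> 1" for n x
  proof -
    have hk: "integrable lborel (\<lambda>y. heat_kernel (real (Suc n)) (x - y))" "(LINT y|lborel. heat_kernel (real (Suc n)) (x - y)) = 1"
      by (auto simp: integral_reflect heat_kernel_integral intro!: integrable_reflect)
    show "0 \<le> ?K n x" by (intro integral_nonneg_AE AE_I2) auto
    have "?K n x \<le> (LINT y|lborel. heat_kernel (real (Suc n)) (x - y))"
      by (intro integral_mono heat_kernel_conv_integrable X hk) (auto simp: indicator_def)
    then show "?K n x \<le> 1" using hk by simp
  qed
  have "(\<lambda>n. LINT x|lborel. indicator U x * ?K n x) \<longlonglongrightarrow> (LINT x|lborel. indicator U x)"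
  proof (rule integral_dominated_convergence[where w = "indicator U"])
    show "AE x in lborel. (\<lambda>n. indicator U x * ?K n x) \<longlonglongrightarrow> indicator U x"
    proof (rule AE_I2)
      fix x show "(\<lambda>n. indicator U x * ?K n x) \<longlonglongrightarrow> indicator U x"
        using heat_conv_open_tendsto[OF U(1), of x] by (cases "x \<in> U") auto
    qed
    show "AE x in lborel. norm (indicator U x * ?K n x) \<le> indicator U x" for n
      using le[of n] by (intro AE_I2) (auto simp: indicator_def)
  qed (use X in measurable)
  then have "ip (fourier_L1 (indicator U :: 'a \<Rightarrow> real)) (fourier_L1 (indicator U)) = measure lborel U"
    using LIMSEQ_unique[OF fourier_L1_in_L2(3)[OF X(1,2)]] U UB by simp
  then show ?thesis using X(3) by (simp add: plancherel_defect_def)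
qed

lemma plancherel_defect_nonneg:
  "integrable lborel u \<Longrightarrow> u \<in> L2 \<Longrightarrow> 0 \<le> plancherel_defect u"
  unfolding plancherel_defect_def using fourier_L1_in_L2(2)[of u] by simp

lemma plancherel_defect_le: "plancherel_defect u \<le> ip u u"
  by (simp add: plancherel_defect_def)

lemma ip_parallelogram:
  fixes f g :: "'a::euclidean_space \<Rightarrow> 'b::euclidean_space"
  assumes "f \<in> L2" "g \<in> L2"
  shows "ip (\<lambda>x. f x + g x) (\<lambda>x. f x + g x) + ip (\<lambda>x. f x - g x) (\<lambda>x. f x - g x) = 2 * ip f f + 2 * ip g g"
  using assms by (simp add: ip_add_left ip_add_right ip_diff_left ip_diff_right L2_add L2_diff)

text \<open>The parallelogram law is an equality once the defect of the difference is added on the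
  left, and that defect is nonnegative.\<close>

lemma plancherel_defect_add:
  fixes u v :: "'a::euclidean_space \<Rightarrow> real"
  assumes u: "integrable lborel u" "u \<in> L2" and v: "integrable lborel v" "v \<in> L2"
  shows "plancherel_defect (\<lambda>x. u x + v x) \<le> 2 * plancherel_defect u + 2 * plancherel_defect v"
proof -
  have "fourier_L1 (\<lambda>x. u x + v x) = (\<lambda>\<xi>. fourier_L1 u \<xi> + fourier_L1 v \<xi>)"
    "fourier_L1 (\<lambda>x. u x - v x) = (\<lambda>\<xi>. fourier_L1 u \<xi> - fourier_L1 v \<xi>)"
    using fourier_L1_lin[OF u(1) v(1), of 1 1] fourier_L1_lin[OF u(1) v(1), of 1 "-1"] by auto
  then have "plancherel_defect (\<lambda>x. u x + v x) + plancherel_defect (\<lambda>x. u x - v x) = 2 * plancherel_defect u + 2 * plancherel_defect v"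
    using ip_parallelogram[OF u(2) v(2)] ip_parallelogram[OF fourier_L1_in_L2(1)[OF u] fourier_L1_in_L2(1)[OF v]]
    by (simp add: plancherel_defect_def)
  moreover have "0 \<le> plancherel_defect (\<lambda>x. u x - v x)"
    using u v by (intro plancherel_defect_nonneg L2_diff) auto
  ultimately show ?thesis by simp
qed

lemma plancherel_defect_scale:
  fixes u :: "'a::euclidean_space \<Rightarrow> real"
  assumes u: "integrable lborel u"
  shows "plancherel_defect (\<lambda>x. c * u x) = c\<^sup>2 * plancherel_defect u"
proof -
  have 1: "fourier_L1 (\<lambda>x. c * u x) = (\<lambda>\<xi>. c *\<^sub>R fourier_L1 u \<xi>)"
    using fourier_L1_lin[OF u u, of c 0] by (auto simp: scaleR_conv_of_real)
  have 2: "ip (\<lambda>x. c * u x) (\<lambda>x. c * u x) = c\<^sup>2 * ip u u"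
    using ip_scale_left[of c u "\<lambda>x. c *\<^sub>R u x"] ip_scale_right[of u c u] by (simp add: power2_eq_square)
  show ?thesis
    unfolding plancherel_defect_def 1 2 ip_scale_left ip_scale_right by (simp add: power2_eq_square algebra_simps)
qed

text \<open>The defect of \<open>u\<close> is at most twice that of \<open>u - v\<close>, which is
  at most twice the squared distance, plus twice that of \<open>v\<close>, which is 0.\<close>

lemma plancherel_defect_approx:
  fixes u :: "'a::euclidean_space \<Rightarrow> real"
  assumes u: "integrable lborel u" "u \<in> L2"
    and approx: "\<And>e. e > 0 \<Longrightarrow> \<exists>v. integrable lborel v \<and> v \<in> L2 \<and> plancherel_defect v = 0 \<and> ip (\<lambda>x. u x - v x) (\<lambda>x. u x - v x) \<le> e"
  shows "plancherel_defect u = 0"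
proof -
  have "plancherel_defect u \<le> 0 + e" if "e > 0" for e
  proof -
    obtain v where v: "integrable lborel v" "v \<in> L2" "plancherel_defect v = 0" "ip (\<lambda>x. u x - v x) (\<lambda>x. u x - v x) \<le> e / 2"
      using approx[of "e / 2"] \<open>e > 0\<close> by auto
    have "plancherel_defect (\<lambda>x. (u x - v x) + v x) \<le> 2 * plancherel_defect (\<lambda>x. u x - v x) + 2 * plancherel_defect v"
      using u v by (intro plancherel_defect_add L2_diff) auto
    then show ?thesis using plancherel_defect_le[of "\<lambda>x. u x - v x"] v by simp
  qed
  then have "plancherel_defect u \<le> 0" by (rule field_le_epsilon)
  then show ?thesis using plancherel_defect_nonneg[OF u] by simp
qed

text \<open>Outer regularity approximates \<open>A\<close> from outside by open sets
  \<open>U\<close>; the squared distance of the indicators is the measure of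
  \<open>U - A\<close>.\<close>

lemma plancherel_defect_indicator:
  assumes A: "A \<in> sets borel" "emeasure lborel A < \<infinity>"
  shows "plancherel_defect (indicator A :: 'a::euclidean_space \<Rightarrow> real) = 0"
proof (rule plancherel_defect_approx)
  fix e :: real assume "e > 0"
  then obtain U where U: "open U" "A \<subseteq> U" "emeasure lborel (U - A) < e"
    using outer_regular_lborel[OF A(1)] by metis
  have [measurable]: "U \<in> sets borel" "A \<in> sets borel" using U A by auto
  have "emeasure lborel U \<le> emeasure lborel (A \<union> (U - A))" by (intro emeasure_mono) auto
  also have "\<dots> \<le> emeasure lborel A + emeasure lborel (U - A)" by (intro emeasure_subadditive) auto
  also have "\<dots> < \<infinity>" using A U by (auto simp: less_top[symmetric] top_unique)
  finally have fin: "emeasure lborel U < \<infinity>" .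
  have "emeasure lborel (U - A) < \<infinity>" using U(3) by (auto simp: less_top[symmetric] top_unique)
  then have eq: "ip (\<lambda>x. indicator A x - indicator U x) (\<lambda>x. indicator A x - indicator U x :: real) = measure lborel (U - A)"
  proof -
    have "(indicator A x - indicator U x) \<bullet> (indicator A x - indicator U x :: real) = indicator (U - A) x \<bullet> (indicator (U - A) x :: real)" for x
      using U(2) by (cases "x \<in> U"; cases "x \<in> A") auto
    then have "ip (\<lambda>x. indicator A x - indicator U x) (\<lambda>x. indicator A x - indicator U x :: real) = ip (indicator (U - A)) (indicator (U - A) :: 'a \<Rightarrow> real)"
      unfolding ip_def by (rule Bochner_Integration.integral_cong[OF refl])
    also have "\<dots> = measure lborel (U - A)"
      using \<open>emeasure lborel (U - A) < \<infinity>\<close> by (intro indicator_L1_L2(3)) auto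
    finally show ?thesis .
  qed
  show "\<exists>v. integrable lborel v \<and> v \<in> L2 \<and> plancherel_defect v = 0 \<and>
      ip (\<lambda>x. indicator A x - v x) (\<lambda>x. indicator A x - v x :: real) \<le> e"
    using plancherel_defect_open[OF U(1) fin] indicator_L1_L2(1,2)[of U] fin U(3) \<open>e > 0\<close>
    by (intro exI[of _ "indicator U"]) (auto simp: eq measure_def enn2real_leI)
qed (use indicator_L1_L2[OF A] in auto)

text \<open>The induction runs over all nonnegative Borel functions, so integrability stands as a
  premise inside the induction statement. It passes from a sum or an increasing limit to the parts
  by domination.\<close>

lemma plancherel_defect_nonneg_fun:
  fixes u :: "'a::euclidean_space \<Rightarrow> real"
  assumes "u \<in> borel_measurable lborel" "\<And>x. 0 \<le> u x"
  shows "integrable lborel u \<longrightarrow> u \<in> L2 \<longrightarrow> plancherel_defect u = 0"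
  using assms
proof (induction rule: borel_measurable_induct_real)
  case (set A)
  then show ?case by (auto simp: integrable_indicator_iff intro!: plancherel_defect_indicator)
next
  case (mult u c)
  show ?case
  proof (cases "c = 0")
    case True
    then have "plancherel_defect (\<lambda>x::'a. c * (0::real)) = 0" using plancherel_defect_scale[of "\<lambda>x. 0" c] by simp
    then show ?thesis using True by simp
  next
    case False
    show ?thesis
    proof (intro impI)
      assume *: "integrable lborel (\<lambda>x. c * u x)" "(\<lambda>x. c * u x) \<in> L2"
      have "integrable lborel u" "u \<in> L2"
        using integrable_mult_right[OF *(1), of "1/c"] L2_mult[OF *(2), of "1/c"] False by auto
      then show "plancherel_defect (\<lambda>x. c * u x) = 0" using mult by (simp add: plancherel_defect_scale)
    qed
  qed
next
  case (add u v)
  show ?case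
  proof (intro impI)
    assume *: "integrable lborel (\<lambda>x. v x + u x)" "(\<lambda>x. v x + u x) \<in> L2"
    have "integrable lborel u" "u \<in> L2" "integrable lborel v" "v \<in> L2"
      using add(1-4) by (auto intro!: Bochner_Integration.integrable_bound[OF *(1)] L2_bound[OF _ *(2)] AE_I2)
    then show "plancherel_defect (\<lambda>x. v x + u x) = 0"
      using plancherel_defect_add[of v u] add * plancherel_defect_nonneg[OF *] by auto
  qed
next
  case (seq U)
  show ?case
  proof (intro impI)
    assume *: "integrable lborel u" "u \<in> L2"
    have Ule: "U i x \<le> u x" for i x
      using seq(3,4) by (intro incseq_le) (auto simp: incseq_def le_fun_def)
    have U: "integrable lborel (U i)" "U i \<in> L2" for i
      using seq(1,2) Ule assms(2) by (auto intro!: Bochner_Integration.integrable_bound[OF *(1)] L2_bound[OF _ *(2)] AE_I2 order_trans[OF Ule])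
    have "(\<lambda>i. ip (\<lambda>x. u x - U i x) (\<lambda>x. u x - U i x)) \<longlonglongrightarrow> (LINT x::'a|lborel. 0)"
      unfolding ip_self
    proof (rule integral_dominated_convergence[where w = "\<lambda>x. (u x)\<^sup>2"])
      show "integrable lborel (\<lambda>x. (u x)\<^sup>2)" using L2_integrable[OF *(2)] by simp
      show "AE x in lborel. (\<lambda>i. (norm (u x - U i x))\<^sup>2) \<longlonglongrightarrow> 0"
      proof (rule AE_I2)
        fix x :: 'a
        have "(\<lambda>i. (norm (u x - U i x))\<^sup>2) \<longlonglongrightarrow> (norm (u x - u x))\<^sup>2"
          using seq(4)[of x] by (intro tendsto_power tendsto_norm tendsto_diff tendsto_const) auto
        then show "(\<lambda>i. (norm (u x - U i x))\<^sup>2) \<longlonglongrightarrow> 0" by simp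
      qed
      show "AE x in lborel. norm ((norm (u x - U i x))\<^sup>2) \<le> (u x)\<^sup>2" for i
        using Ule[of i] seq(2)[of i] by (intro AE_I2) (auto intro!: power_mono)
    qed (use seq(1) assms(1) * in \<open>auto\<close>)
    then have lim: "(\<lambda>i. ip (\<lambda>x. u x - U i x) (\<lambda>x. u x - U i x)) \<longlonglongrightarrow> 0" by simp
    show "plancherel_defect u = 0"
    proof (rule plancherel_defect_approx[OF *])
      fix e :: real assume "e > 0"
      then obtain i where "ip (\<lambda>x. u x - U i x) (\<lambda>x. u x - U i x) < e"
        using order_tendstoD(2)[OF lim] by (auto simp: eventually_sequentially)
      then show "\<exists>v. integrable lborel v \<and> v \<in> L2 \<and> plancherel_defect v = 0 \<and> ip (\<lambda>x. u x - v x) (\<lambda>x. u x - v x) \<le> e"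
        using U[of i] seq(5)[of i] by (intro exI[of _ "U i"]) auto
    qed
  qed
qed

lemma Plancherel_L1:
  fixes u :: "'a::euclidean_space \<Rightarrow> real"
  assumes u: "integrable lborel u" "u \<in> L2"
  shows "ip (fourier_L1 u) (fourier_L1 u) = ip u u"
proof -
  have [measurable]: "u \<in> borel_measurable borel" using u by auto
  have p: "integrable lborel (\<lambda>x. max (u x) 0)" "(\<lambda>x. max (u x) 0) \<in> L2"
    "integrable lborel (\<lambda>x. max (- u x) 0)" "(\<lambda>x. max (- u x) 0) \<in> L2"
    by (auto intro!: Bochner_Integration.integrable_bound[OF u(1)] L2_bound[OF _ u(2)] AE_I2)
  have 0: "plancherel_defect (\<lambda>x. max (u x) 0) = 0" "plancherel_defect (\<lambda>x. max (- u x) 0) = 0"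
    using plancherel_defect_nonneg_fun[of "\<lambda>x. max (u x) 0"] plancherel_defect_nonneg_fun[of "\<lambda>x. max (- u x) 0"] p by auto
  have "plancherel_defect (\<lambda>x. max (u x) 0 + (-1) * max (- u x) 0) \<le>
    2 * plancherel_defect (\<lambda>x. max (u x) 0) + 2 * plancherel_defect (\<lambda>x. (-1) * max (- u x) 0)"
    using p by (intro plancherel_defect_add L2_mult) auto
  also have "\<dots> = 0" using 0 plancherel_defect_scale[OF p(3), of "-1"] by simp
  also have "(\<lambda>x. max (u x) 0 + (-1) * max (- u x) 0) = u" by (auto simp: max_def)
  finally show ?thesis using plancherel_defect_nonneg[OF u] by (simp add: plancherel_defect_def)
qed

subsection \<open>The Fourier transform on square integrable functions\<close>

abbreviation trunc :: "real \<Rightarrow> ('a::euclidean_space \<Rightarrow> real) \<Rightarrow> 'a \<Rightarrow> real" where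
  "trunc R u \<equiv> (\<lambda>x. indicator (ball 0 R) x * u x)"

lemma trunc_measurable [measurable (raw)]:
  "u \<in> borel_measurable borel \<Longrightarrow> trunc R u \<in> borel_measurable borel"
  by (intro borel_measurable_times borel_measurable_indicator) auto

lemma trunc_in:
  fixes u :: "'a::euclidean_space \<Rightarrow> real"
  assumes u: "u \<in> L2"
  shows "integrable lborel (trunc R u)" "trunc R u \<in> L2"
proof -
  have [measurable]: "u \<in> borel_measurable borel" using u by auto
  show "trunc R u \<in> L2"
    by (rule L2_bound[OF trunc_measurable u]) (auto simp: indicator_def)
  show "integrable lborel (trunc R u)"
  proof (rule Bochner_Integration.integrable_bound)
    show "integrable lborel (\<lambda>x. indicator (ball 0 R) x + (norm (u x))\<^sup>2)"
      using L2_integrable[OF u] emeasure_lborel_ball_finite[of "0::'a" R]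
      by (intro Bochner_Integration.integrable_add) auto
    have "\<bar>u x\<bar> \<le> 1 + (u x)\<^sup>2" for x
      using sum_squares_bound[of 1 "\<bar>u x\<bar>"] abs_ge_zero[of "u x"] unfolding power2_abs by simp
    then show "AE x in lborel. norm (trunc R u x) \<le> norm (indicator (ball 0 R) x + (norm (u x))\<^sup>2)"
      by (intro AE_I2) (auto simp: indicator_def)
  qed (use trunc_measurable[of u R] in simp)
qed

lemma trunc_tendsto:
  fixes u :: "'a::euclidean_space \<Rightarrow> real"
  assumes u: "u \<in> L2"
  shows "((\<lambda>R. L2_norm UNIV (\<lambda>x. trunc R u x - u x)) \<longlongrightarrow> 0) at_top"
proof -
  have [measurable]: "u \<in> borel_measurable borel" using u by auto
  have "((\<lambda>R. LINT x|lborel. (norm (trunc R u x - u x))\<^sup>2) \<longlongrightarrow> (LINT x::'a|lborel. 0)) at_top"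
  proof (rule integral_dominated_convergence_at_top[where w = "\<lambda>x. (norm (u x))\<^sup>2"])
    show "AE x in lborel. ((\<lambda>R. (norm (trunc R u x - u x))\<^sup>2) \<longlongrightarrow> 0) at_top"
    proof (rule AE_I2)
      fix x :: 'a
      have "eventually (\<lambda>R. (norm (trunc R u x - u x))\<^sup>2 = 0) at_top"
        using eventually_gt_at_top[of "norm x"] by eventually_elim (simp add: indicator_def)
      then show "((\<lambda>R. (norm (trunc R u x - u x))\<^sup>2) \<longlongrightarrow> 0) at_top"
        by (rule tendsto_eventually)
    qed
    show "eventually (\<lambda>R. AE x in lborel. norm ((norm (trunc R u x - u x))\<^sup>2) \<le> (norm (u x))\<^sup>2) at_top"
      by (intro always_eventually allI AE_I2) (auto simp: indicator_def)
    show "(\<lambda>x. (norm (trunc R u x - u x))\<^sup>2) \<in> borel_measurable lborel" for R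
      using trunc_measurable[of u R] by simp
  qed (use L2_integrable[OF u] in auto)
  then have "((\<lambda>R. sqrt (ip (\<lambda>x. trunc R u x - u x) (\<lambda>x. trunc R u x - u x))) \<longlongrightarrow> sqrt 0) at_top"
    unfolding ip_self by (intro tendsto_real_sqrt) simp
  then show ?thesis by (simp add: L2_norm_UNIV)
qed

lemma fourier_L1_diff_norm:
  fixes u v :: "'a::euclidean_space \<Rightarrow> real"
  assumes u: "integrable lborel u" "u \<in> L2" and v: "integrable lborel v" "v \<in> L2"
  shows "L2_norm UNIV (\<lambda>\<xi>. fourier_L1 u \<xi> - fourier_L1 v \<xi>) = L2_norm UNIV (\<lambda>x. u x - v x)"
proof -
  have "fourier_L1 (\<lambda>x. u x - v x) = (\<lambda>\<xi>. fourier_L1 u \<xi> - fourier_L1 v \<xi>)"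
    using fourier_L1_lin[OF u(1) v(1), of 1 "-1"] by auto
  then show ?thesis
    using Plancherel_L1[of "\<lambda>x. u x - v x"] u v L2_diff[OF u(2) v(2)] by (simp add: L2_norm_UNIV)
qed

text \<open>Because the transform is isometric on integrable functions, the transforms of the
  truncations inherit the Cauchy property of the truncations themselves.\<close>

lemma fourier_exists:
  fixes u :: "'a::euclidean_space \<Rightarrow> real"
  assumes u: "u \<in> L2"
  obtains g where "g \<in> L2" "((\<lambda>R. L2_norm UNIV (\<lambda>\<xi>. fourier_L1 (trunc R u) \<xi> - g \<xi>)) \<longlongrightarrow> 0) at_top"
proof -
  let ?f = "\<lambda>n. fourier_L1 (trunc (real n) u)"
  let ?a = "\<lambda>R. L2_norm UNIV (\<lambda>x. trunc R u x - u x)"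
  note T = trunc_in[OF u]
  have f: "fourier_L1 (trunc R u) \<in> L2" for R using fourier_L1_in_L2(1)[OF T] .
  have le: "L2_norm UNIV (\<lambda>\<xi>. fourier_L1 (trunc R u) \<xi> - fourier_L1 (trunc S u) \<xi>) \<le> ?a R + ?a S" for R S
    unfolding fourier_L1_diff_norm[OF T T]
    using L2_norm_triangle_diff[OF T(2) u T(2), of R S] by (simp add: L2_norm_minus_commute[of u])
  have lim: "(\<lambda>n. ?a (real n)) \<longlonglongrightarrow> 0"
    using filterlim_compose[OF trunc_tendsto[OF u] filterlim_real_sequentially] .
  obtain g where g: "g \<in> L2" "(\<lambda>n. L2_norm UNIV (\<lambda>x. ?f n x - g x)) \<longlonglongrightarrow> 0"
  proof (rule L2_complete[of ?f])
    fix e :: real assume "e > 0"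
    then have "eventually (\<lambda>n. ?a (real n) < e / 2) sequentially"
      using order_tendstoD(2)[OF lim, of "e / 2"] by simp
    then obtain N where N: "\<And>n. n \<ge> N \<Longrightarrow> ?a (real n) < e / 2"
      unfolding eventually_sequentially by blast
    have "L2_norm UNIV (\<lambda>x. ?f m x - ?f n x) < e" if "m \<ge> N" "n \<ge> N" for m n
      using le[of "real m" "real n"] N[OF that(1)] N[OF that(2)] by linarith
    then show "\<exists>N. \<forall>m\<ge>N. \<forall>n\<ge>N. L2_norm UNIV (\<lambda>x. ?f m x - ?f n x) < e" by blast
  qed (use f in auto)
  \<comment> \<open>Letting \<open>n\<close> grow in the triangle inequality extends convergence
    from integer radii to all real radii.\<close>
  have "L2_norm UNIV (\<lambda>\<xi>. fourier_L1 (trunc R u) \<xi> - g \<xi>) \<le> ?a R" for R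
  proof (rule LIMSEQ_le_const)
    have "(\<lambda>n. ?a R + ?a (real n) + L2_norm UNIV (\<lambda>x. ?f n x - g x)) \<longlonglongrightarrow> ?a R + 0 + 0"
      by (intro tendsto_add tendsto_const lim g)
    then show "(\<lambda>n. ?a R + ?a (real n) + L2_norm UNIV (\<lambda>x. ?f n x - g x)) \<longlonglongrightarrow> ?a R" by simp
    show "\<exists>N. \<forall>n\<ge>N. L2_norm UNIV (\<lambda>\<xi>. fourier_L1 (trunc R u) \<xi> - g \<xi>) \<le> ?a R + ?a (real n) + L2_norm UNIV (\<lambda>x. ?f n x - g x)"
    proof (intro exI allI impI)
      fix n :: nat
      show "L2_norm UNIV (\<lambda>\<xi>. fourier_L1 (trunc R u) \<xi> - g \<xi>) \<le> ?a R + ?a (real n) + L2_norm UNIV (\<lambda>x. ?f n x - g x)"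
        using L2_norm_triangle_diff[OF f f g(1), of R "real n"] le[of R "real n"] by linarith
    qed
  qed
  then have "((\<lambda>R. L2_norm UNIV (\<lambda>\<xi>. fourier_L1 (trunc R u) \<xi> - g \<xi>)) \<longlongrightarrow> 0) at_top"
    by (intro tendsto_sandwich[OF _ _ tendsto_const trunc_tendsto[OF u]]) auto
  then show thesis using that g(1) by blast
qed

text \<open>The existence of a limit in the mean gives the choice in \<open>fourier\<close> a
  witness. Convergence is recorded for real norms along integer radii, the form in which it is
  applied.\<close>

lemma fourier_L2:
  fixes u :: "'a::euclidean_space \<Rightarrow> real"
  assumes u: "u \<in> L2"
  shows "fourier u \<in> L2"
    and "(\<lambda>n. L2_norm UNIV (\<lambda>\<xi>. fourier_L1 (trunc (real n) u) \<xi> - fourier u \<xi>)) \<longlonglongrightarrow> 0"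
proof -
  let ?P = "\<lambda>g::'a \<Rightarrow> complex. g \<in> L2 \<and> ((\<lambda>R. \<integral>\<^sup>+ \<xi>. ennreal ((cmod (fourier_L1 (trunc R u) \<xi> - g \<xi>))\<^sup>2) \<partial>lborel) \<longlongrightarrow> 0) at_top"
  have eq: "(\<integral>\<^sup>+ \<xi>. ennreal ((cmod (fourier_L1 (trunc R u) \<xi> - g \<xi>))\<^sup>2) \<partial>lborel) =
      ennreal ((L2_norm UNIV (\<lambda>\<xi>. fourier_L1 (trunc R u) \<xi> - g \<xi>))\<^sup>2)" if "g \<in> L2" for g R
    using that by (intro nn_integral_norm_sq L2_diff fourier_L1_in_L2 trunc_in u)
  obtain g where g: "g \<in> L2" "((\<lambda>R. L2_norm UNIV (\<lambda>\<xi>. fourier_L1 (trunc R u) \<xi> - g \<xi>)) \<longlongrightarrow> 0) at_top"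
    using fourier_exists[OF u] .
  have "((\<lambda>R. ennreal ((L2_norm UNIV (\<lambda>\<xi>. fourier_L1 (trunc R u) \<xi> - g \<xi>))\<^sup>2)) \<longlongrightarrow> ennreal (0\<^sup>2)) at_top"
    by (intro tendsto_ennrealI tendsto_power g)
  then have "?P g" using g(1) by (simp add: eq)
  then have "?P (SOME g. ?P g)" by (rule someI[of ?P])
  then have P: "?P (fourier u)" by (simp only: fourier_def)
  then show L: "fourier u \<in> L2" by simp
  have "((\<lambda>R. ennreal ((L2_norm UNIV (\<lambda>\<xi>. fourier_L1 (trunc R u) \<xi> - fourier u \<xi>))\<^sup>2)) \<longlongrightarrow> ennreal 0) at_top"
    using P by (simp add: eq[OF L])
  then have "((\<lambda>R. (L2_norm UNIV (\<lambda>\<xi>. fourier_L1 (trunc R u) \<xi> - fourier u \<xi>))\<^sup>2) \<longlongrightarrow> 0) at_top"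
    by (rule tendsto_ennrealD) auto
  then have "((\<lambda>R. sqrt ((L2_norm UNIV (\<lambda>\<xi>. fourier_L1 (trunc R u) \<xi> - fourier u \<xi>))\<^sup>2)) \<longlongrightarrow> sqrt 0) at_top"
    by (rule tendsto_real_sqrt)
  then have "((\<lambda>R. L2_norm UNIV (\<lambda>\<xi>. fourier_L1 (trunc R u) \<xi> - fourier u \<xi>)) \<longlongrightarrow> 0) at_top"
    by simp
  from filterlim_compose[OF this filterlim_real_sequentially]
  show "(\<lambda>n. L2_norm UNIV (\<lambda>\<xi>. fourier_L1 (trunc (real n) u) \<xi> - fourier u \<xi>)) \<longlonglongrightarrow> 0" .
qed

lemma trunc_LIMSEQ:
  fixes u :: "'a::euclidean_space \<Rightarrow> real"
  assumes u: "u \<in> L2"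
  shows "(\<lambda>n. L2_norm UNIV (\<lambda>x. trunc (real n) u x - u x)) \<longlonglongrightarrow> 0"
  using filterlim_compose[OF trunc_tendsto[OF u] filterlim_real_sequentially] .

lemma fourier_L1_trunc_L2:
  fixes u :: "'a::euclidean_space \<Rightarrow> real"
  shows "u \<in> L2 \<Longrightarrow> fourier_L1 (trunc R u) \<in> L2"
  by (intro fourier_L1_in_L2 trunc_in)

lemma fourier_unique:
  fixes u :: "'a::euclidean_space \<Rightarrow> real"
  assumes "u \<in> L2" "g \<in> L2" "(\<lambda>n. L2_norm UNIV (\<lambda>\<xi>. fourier_L1 (trunc (real n) u) \<xi> - g \<xi>)) \<longlonglongrightarrow> 0"
  shows "AE \<xi> in lborel. fourier u \<xi> = g \<xi>"
  using L2_limit_unique[OF fourier_L1_trunc_L2[OF assms(1)] fourier_L2(1)[OF assms(1)] assms(2) fourier_L2(2)[OF assms(1)] assms(3)] .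

lemma L2_tendsto_0_squeeze:
  assumes "\<And>n. L2_norm UNIV (f n) \<le> c n" "c \<longlonglongrightarrow> 0"
  shows "(\<lambda>n. L2_norm UNIV (f n)) \<longlonglongrightarrow> 0"
  by (rule tendsto_sandwich[OF _ _ tendsto_const assms(2)]) (auto intro!: always_eventually assms(1))

lemma fourier_lin:
  fixes u v :: "'a::euclidean_space \<Rightarrow> real"
  assumes u: "u \<in> L2" and v: "v \<in> L2"
  shows "AE \<xi> in lborel. fourier (\<lambda>x. a * u x + b * v x) \<xi> = a * fourier u \<xi> + b * fourier v \<xi>"
proof -
  let ?g = "\<lambda>\<xi>. a *\<^sub>R fourier u \<xi> + b *\<^sub>R fourier v \<xi>"
  let ?p = "\<lambda>n \<xi>. fourier_L1 (trunc (real n) u) \<xi> - fourier u \<xi>"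
  let ?q = "\<lambda>n \<xi>. fourier_L1 (trunc (real n) v) \<xi> - fourier v \<xi>"
  have L: "?p n \<in> L2" "?q n \<in> L2" for n
    by (intro L2_diff fourier_L1_trunc_L2 fourier_L2 u v)+
  have eq: "fourier_L1 (trunc (real n) (\<lambda>x. a * u x + b * v x)) \<xi> - ?g \<xi> = a *\<^sub>R ?p n \<xi> + b *\<^sub>R ?q n \<xi>" for n \<xi>
    using fourier_L1_lin[OF trunc_in(1)[OF u] trunc_in(1)[OF v], of a "real n" b "real n" \<xi>]
    by (simp add: scaleR_conv_of_real algebra_simps)
  have "L2_norm UNIV (\<lambda>\<xi>. a *\<^sub>R ?p n \<xi> + b *\<^sub>R ?q n \<xi>) \<le> \<bar>a\<bar> * L2_norm UNIV (?p n) + \<bar>b\<bar> * L2_norm UNIV (?q n)" for n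
    using L2_norm_triangle[OF L2_scale[OF L(1)] L2_scale[OF L(2)], of a n b n] by (simp only: L2_norm_scale)
  moreover have "(\<lambda>n. \<bar>a\<bar> * L2_norm UNIV (?p n) + \<bar>b\<bar> * L2_norm UNIV (?q n)) \<longlonglongrightarrow> \<bar>a\<bar> * 0 + \<bar>b\<bar> * 0"
    by (intro tendsto_add tendsto_mult tendsto_const fourier_L2 u v)
  ultimately have "(\<lambda>n. L2_norm UNIV (\<lambda>\<xi>. a *\<^sub>R ?p n \<xi> + b *\<^sub>R ?q n \<xi>)) \<longlonglongrightarrow> 0"
    by (intro L2_tendsto_0_squeeze) auto
  then have "AE \<xi> in lborel. fourier (\<lambda>x. a * u x + b * v x) \<xi> = ?g \<xi>"
    by (intro fourier_unique L2_add L2_mult L2_scale fourier_L2 u v) (simp only: eq)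
  then show ?thesis by (simp add: scaleR_conv_of_real)
qed

text \<open>Norm preservation on the truncations polarises to inner products, and both sides are
  continuous in the mean.\<close>

lemma fourier_isometry:
  fixes u v :: "'a::euclidean_space \<Rightarrow> real"
  assumes u: "u \<in> L2" and v: "v \<in> L2"
  shows "ip (fourier u) (fourier v) = ip u v"
proof -
  have pol: "ip f g = (ip (\<lambda>x. f x + g x) (\<lambda>x. f x + g x) - ip f f - ip g g) / 2" if "f \<in> L2" "g \<in> L2"
    for f g :: "'a \<Rightarrow> 'b::euclidean_space"
    using that by (simp add: ip_add_left ip_add_right L2_add ip_commute[of g f])
  have "ip (fourier_L1 (trunc (real n) u)) (fourier_L1 (trunc (real n) v)) = ip (trunc (real n) u) (trunc (real n) v)" for n
  proof -
    note T = trunc_in[OF u, of "real n"] trunc_in[OF v, of "real n"]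
    have s: "fourier_L1 (\<lambda>x. trunc (real n) u x + trunc (real n) v x) =
        (\<lambda>\<xi>. fourier_L1 (trunc (real n) u) \<xi> + fourier_L1 (trunc (real n) v) \<xi>)"
      using fourier_L1_lin[OF T(1,3), of 1 1] by auto
    have "integrable lborel (\<lambda>x. trunc (real n) u x + trunc (real n) v x)" using T by auto
    from Plancherel_L1[OF this L2_add[OF T(2,4)]] Plancherel_L1[OF T(1,2)] Plancherel_L1[OF T(3,4)]
    show ?thesis
      using pol[OF T(2,4)] pol[OF fourier_L1_in_L2(1)[OF T(1,2)] fourier_L1_in_L2(1)[OF T(3,4)]]
      unfolding s by simp
  qed
  then have "(\<lambda>n. ip (trunc (real n) u) (trunc (real n) v)) \<longlonglongrightarrow> ip (fourier u) (fourier v)"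
    using ip_tendsto[OF fourier_L1_trunc_L2[OF u] fourier_L2[OF u] fourier_L1_trunc_L2[OF v] fourier_L2[OF v]] by simp
  moreover have "(\<lambda>n. ip (trunc (real n) u) (trunc (real n) v)) \<longlonglongrightarrow> ip u v"
    by (intro ip_tendsto trunc_in trunc_LIMSEQ u v)
  ultimately show ?thesis by (rule LIMSEQ_unique)
qed

lemma fourier_norm:
  fixes u :: "'a::euclidean_space \<Rightarrow> real"
  shows "u \<in> L2 \<Longrightarrow> L2_norm UNIV (fourier u) = L2_norm UNIV u"
  by (simp add: L2_norm_UNIV fourier_isometry)

lemma fourier_diff_norm:
  fixes u v :: "'a::euclidean_space \<Rightarrow> real"
  assumes u: "u \<in> L2" and v: "v \<in> L2"
  shows "L2_norm UNIV (\<lambda>\<xi>. fourier u \<xi> - fourier v \<xi>) = L2_norm UNIV (\<lambda>x. u x - v x)"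
proof -
  have "AE \<xi> in lborel. fourier (\<lambda>x. u x - v x) \<xi> = fourier u \<xi> - fourier v \<xi>"
    using fourier_lin[OF u v, of 1 "-1"] by simp
  then have "L2_norm UNIV (fourier (\<lambda>x. u x - v x)) = L2_norm UNIV (\<lambda>\<xi>. fourier u \<xi> - fourier v \<xi>)"
    using u v by (intro L2_norm_cong_AE L2_measurable L2_diff fourier_L2)
  then show ?thesis using fourier_norm[OF L2_diff[OF u v]] by simp
qed

lemma fourier_cong_AE:
  fixes u v :: "'a::euclidean_space \<Rightarrow> real"
  assumes u: "u \<in> L2" and v: "v \<in> L2" and eq: "AE x in lborel. u x = v x"
  shows "AE \<xi> in lborel. fourier u \<xi> = fourier v \<xi>"
proof -
  have "L2_norm UNIV (\<lambda>x. u x - v x) = L2_norm UNIV (\<lambda>x::'a. 0::real)"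
    using eq u v by (intro L2_norm_cong_AE) auto
  then have "L2_norm UNIV (\<lambda>\<xi>. fourier u \<xi> - fourier v \<xi>) = 0"
    unfolding fourier_diff_norm[OF u v] by (simp add: L2_norm_UNIV ip_def)
  from L2_norm_eq_0_AE[OF L2_diff[OF fourier_L2(1)[OF u] fourier_L2(1)[OF v]] this] show ?thesis by simp
qed

lemma fourier_eq_fourier_L1:
  fixes u :: "'a::euclidean_space \<Rightarrow> real"
  assumes u: "integrable lborel u" "u \<in> L2"
  shows "AE \<xi> in lborel. fourier u \<xi> = fourier_L1 u \<xi>"
proof (rule fourier_unique[OF u(2) fourier_L1_in_L2(1)[OF u]])
  have "L2_norm UNIV (\<lambda>\<xi>. fourier_L1 (trunc (real n) u) \<xi> - fourier_L1 u \<xi>) = L2_norm UNIV (\<lambda>x. trunc (real n) u x - u x)" for n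
    by (rule fourier_L1_diff_norm[OF trunc_in[OF u(2)] u])
  then show "(\<lambda>n. L2_norm UNIV (\<lambda>\<xi>. fourier_L1 (trunc (real n) u) \<xi> - fourier_L1 u \<xi>)) \<longlonglongrightarrow> 0"
    using trunc_LIMSEQ[OF u(2)] by (simp only:)
qed

lemma L2_reflect:
  fixes f :: "'a::euclidean_space \<Rightarrow> complex"
  assumes "f \<in> L2"
  shows "(\<lambda>\<xi>. cnj (f (- \<xi>))) \<in> L2" "L2_norm UNIV (\<lambda>\<xi>. cnj (f (- \<xi>))) = L2_norm UNIV f"
proof -
  have [measurable]: "f \<in> borel_measurable borel" using assms by auto
  have [measurable]: "(\<lambda>\<xi>. cnj (f (- \<xi>))) \<in> borel_measurable borel"
    by (rule measurable_compose[OF _ borel_measurable_continuous_onI[OF continuous_on_cnj[OF continuous_on_id]]]) simp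
  show "(\<lambda>\<xi>. cnj (f (- \<xi>))) \<in> L2"
    using integrable_reflect[OF L2_integrable[OF assms], of 0] by (intro L2_I) auto
  have "(LINT \<xi>|lborel. (norm (f (0 - \<xi>)))\<^sup>2) = (LINT \<xi>|lborel. (norm (f \<xi>))\<^sup>2)"
    by (rule integral_reflect[of "\<lambda>\<xi>. (norm (f \<xi>))\<^sup>2"]) simp
  then show "L2_norm UNIV (\<lambda>\<xi>. cnj (f (- \<xi>))) = L2_norm UNIV f"
    by (simp add: L2_norm_UNIV ip_self)
qed

text \<open>Transforms of the integrable truncations have this symmetry at every point, and
  reflection followed by conjugation is isometric, so the limit has it almost everywhere.\<close>

lemma fourier_minus:
  fixes u :: "'a::euclidean_space \<Rightarrow> real"
  assumes u: "u \<in> L2"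
  shows "AE \<xi> in lborel. fourier u (- \<xi>) = cnj (fourier u \<xi>)"
proof -
  have "AE \<xi> in lborel. fourier u \<xi> = cnj (fourier u (- \<xi>))"
  proof (rule fourier_unique[OF u L2_reflect(1)[OF fourier_L2(1)[OF u]]])
    have "L2_norm UNIV (\<lambda>\<xi>. fourier_L1 (trunc (real n) u) \<xi> - cnj (fourier u (- \<xi>))) =
       L2_norm UNIV (\<lambda>\<xi>. fourier_L1 (trunc (real n) u) \<xi> - fourier u \<xi>)" for n
      using L2_reflect(2)[OF L2_diff[OF fourier_L1_trunc_L2[OF u] fourier_L2(1)[OF u]], of "real n"]
      by (simp add: fourier_L1_minus)
    then show "(\<lambda>n. L2_norm UNIV (\<lambda>\<xi>. fourier_L1 (trunc (real n) u) \<xi> - cnj (fourier u (- \<xi>)))) \<longlonglongrightarrow> 0"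
      using fourier_L2(2)[OF u] by simp
  qed
  then show ?thesis by (auto elim!: eventually_mono)
qed

subsection \<open>Surjectivity onto functions with Hermitian symmetry\<close>

text \<open>
  The Hartley transform is the real form of the Fourier transform. It has a symmetric kernel and is
  an isometry, hence an involution; this yields the inversion of the Fourier transform.
\<close>

definition hartley :: "('a \<Rightarrow> complex) \<Rightarrow> 'a \<Rightarrow> real" where
  "hartley g \<xi> = Re (g \<xi>) - Im (g \<xi>)"

lemma hartley_L2:
  fixes g :: "'a::euclidean_space \<Rightarrow> complex"
  assumes "g \<in> L2"
  shows "hartley g \<in> L2" "L2_norm UNIV (hartley g) \<le> 2 * L2_norm UNIV g"
proof -
  have m: "hartley g \<in> borel_measurable borel"
    unfolding hartley_def[abs_def] using assms by measurable
  have le: "AE x in lborel. norm (hartley g x) \<le> norm (2 *\<^sub>R g x)"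
    using abs_Re_le_cmod abs_Im_le_cmod
    by (intro AE_I2) (auto simp: hartley_def intro!: order_trans[OF abs_triangle_ineq4] add_mono[of _ "norm (g x)" _ "norm (g x)" for x, simplified mult_2[symmetric]])
  from L2_bound[OF m L2_scale[OF assms, of 2] le] show "hartley g \<in> L2" .
  have "L2_norm UNIV (hartley g) \<le> L2_norm UNIV (\<lambda>x. 2 *\<^sub>R g x)"
    by (rule L2_norm_le_AE[OF m L2_scale[OF assms] le])
  then show "L2_norm UNIV (hartley g) \<le> 2 * L2_norm UNIV g" by (simp only: L2_norm_scale)
qed

text \<open>For real \<open>u\<close> the difference of real and imaginary part integrates
  \<open>u\<close> against cos + sin of \<open>x \<bullet> \<xi>\<close>. This kernel is symmetric
  in the two variables, and Fubini's theorem moves it from one function to the other.\<close>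

lemma hartley_symmetric_L1:
  fixes u v :: "'a::euclidean_space \<Rightarrow> real"
  assumes u: "integrable lborel u" and v: "integrable lborel v"
  shows "ip (hartley (fourier_L1 u)) v = ip u (hartley (fourier_L1 v))"
proof -
  have int: "integrable lborel (\<lambda>\<xi>. complex_of_real (v \<xi>) * fourier_L1 u \<xi>)"
    if u: "integrable lborel u" and v: "integrable lborel v" for u v :: "'a \<Rightarrow> real"
  proof (rule Bochner_Integration.integrable_bound)
    let ?C = "fourier_const TYPE('a) * (LINT x|lborel. \<bar>u x\<bar>)"
    show "integrable lborel (\<lambda>\<xi>. v \<xi> * ?C)" using v by simp
    have "cmod (fourier_L1 u \<xi>) \<le> \<bar>?C\<bar>" for \<xi> using fourier_L1_bound[of u \<xi>] by simp
    then show "AE \<xi> in lborel. norm (complex_of_real (v \<xi>) * fourier_L1 u \<xi>) \<le> norm (v \<xi> * ?C)"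
      by (intro AE_I2) (simp only: norm_mult norm_of_real real_norm_def abs_mult[of "v _"] mult_left_mono abs_ge_zero)
    have "fourier_L1 u \<in> borel_measurable borel" using u by (rule fourier_L1_measurable)
    then show "(\<lambda>\<xi>. complex_of_real (v \<xi>) * fourier_L1 u \<xi>) \<in> borel_measurable lborel" using v by auto
  qed
  have "(LINT \<xi>|lborel. of_real (v \<xi>) * (LINT x|lborel. cis ((-1) * (x \<bullet> \<xi>)) * of_real (u x))) =
     (LINT x|lborel. of_real (u x) * (LINT \<xi>|lborel. of_real (v \<xi>) * cis ((-1) * (x \<bullet> \<xi>))))"
    using v by (intro integral_cis_swap u) simp
  moreover have "of_real (v \<xi>) * fourier_L1 u \<xi> = of_real (fourier_const TYPE('a)) * (of_real (v \<xi>) * (LINT x|lborel. cis ((-1) * (x \<bullet> \<xi>)) * of_real (u x)))" for \<xi>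
    by (simp add: fourier_L1_def mult_ac)
  moreover have "of_real (u x) * fourier_L1 v x = of_real (fourier_const TYPE('a)) * (of_real (u x) * (LINT \<xi>|lborel. of_real (v \<xi>) * cis ((-1) * (x \<bullet> \<xi>))))" for x
    by (simp add: fourier_L1_def mult_ac inner_commute)
  ultimately have eq: "(LINT \<xi>|lborel. of_real (v \<xi>) * fourier_L1 u \<xi>) = (LINT x|lborel. of_real (u x) * fourier_L1 v x)"
    by (simp only: integral_mult_right_zero)
  have "ip (hartley (fourier_L1 u)) v = Re (LINT \<xi>|lborel. of_real (v \<xi>) * fourier_L1 u \<xi>) - Im (LINT \<xi>|lborel. of_real (v \<xi>) * fourier_L1 u \<xi>)"
    if u: "integrable lborel u" and v: "integrable lborel v" for u v :: "'a \<Rightarrow> real"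
  proof -
    let ?F = "\<lambda>\<xi>. of_real (v \<xi>) * fourier_L1 u \<xi>"
    have "ip (hartley (fourier_L1 u)) v = (LINT \<xi>|lborel. Re (?F \<xi>) - Im (?F \<xi>))"
      by (simp add: ip_def hartley_def algebra_simps)
    also have "\<dots> = (LINT \<xi>|lborel. Re (?F \<xi>)) - (LINT \<xi>|lborel. Im (?F \<xi>))"
      by (rule Bochner_Integration.integral_diff[OF integrable_Re[OF int[OF u v]] integrable_Im[OF int[OF u v]]])
    finally show ?thesis by (simp only: integral_Re[OF int[OF u v]] integral_Im[OF int[OF u v]])
  qed
  from this[OF u v] this[OF v u] show ?thesis by (simp add: eq ip_commute[of u])
qed

lemma hartley_symmetric:
  fixes u v :: "'a::euclidean_space \<Rightarrow> real"
  assumes u: "u \<in> L2" and v: "v \<in> L2"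
  shows "ip (hartley (fourier u)) v = ip u (hartley (fourier v))"
proof -
  have lim: "(\<lambda>n. L2_norm UNIV (\<lambda>x. hartley (fourier_L1 (trunc (real n) u)) x - hartley (fourier u) x)) \<longlonglongrightarrow> 0"
    if u: "u \<in> L2" for u :: "'a \<Rightarrow> real"
  proof (rule L2_tendsto_0_squeeze)
    show "L2_norm UNIV (\<lambda>x. hartley (fourier_L1 (trunc (real n) u)) x - hartley (fourier u) x) \<le>
      2 * L2_norm UNIV (\<lambda>x. fourier_L1 (trunc (real n) u) x - fourier u x)" for n
      using hartley_L2(2)[OF L2_diff[OF fourier_L1_trunc_L2[OF u] fourier_L2(1)[OF u]], of "real n"]
      by (simp add: hartley_def[abs_def] algebra_simps)
    show "(\<lambda>n. 2 * L2_norm UNIV (\<lambda>x. fourier_L1 (trunc (real n) u) x - fourier u x)) \<longlonglongrightarrow> 0"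
      using tendsto_mult[OF tendsto_const fourier_L2(2)[OF u], of 2] by simp
  qed
  have "(\<lambda>n. ip (hartley (fourier_L1 (trunc (real n) u))) (trunc (real n) v)) \<longlonglongrightarrow> ip (hartley (fourier u)) v"
    by (intro ip_tendsto lim hartley_L2 fourier_L1_trunc_L2 trunc_in trunc_LIMSEQ fourier_L2 u v)
  moreover have "(\<lambda>n. ip (trunc (real n) u) (hartley (fourier_L1 (trunc (real n) v)))) \<longlonglongrightarrow> ip u (hartley (fourier v))"
    by (intro ip_tendsto lim hartley_L2 fourier_L1_trunc_L2 trunc_in trunc_LIMSEQ fourier_L2 u v)
  ultimately show ?thesis
    using hartley_symmetric_L1[OF trunc_in(1)[OF u] trunc_in(1)[OF v]] by (simp add: LIMSEQ_unique)
qed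

text \<open>The product of the two Hartley transforms differs from the inner product of the Fourier
  transforms by the cross term \<open>?k\<close>. Hermitian symmetry makes \<open>?k\<close> odd, so
  its integral is 0.\<close>

lemma hartley_isometry:
  fixes u v :: "'a::euclidean_space \<Rightarrow> real"
  assumes u: "u \<in> L2" and v: "v \<in> L2"
  shows "ip (hartley (fourier u)) (hartley (fourier v)) = ip u v"
proof -
  let ?k = "\<lambda>\<xi>. Re (fourier u \<xi>) * Im (fourier v \<xi>) + Im (fourier u \<xi>) * Re (fourier v \<xi>)"
  note [measurable] = fourier_L2(1)[OF u, THEN L2_measurable] fourier_L2(1)[OF v, THEN L2_measurable]
  have ReIm: "(\<lambda>\<xi>. Re (fourier u \<xi>)) \<in> L2" "(\<lambda>\<xi>. Im (fourier u \<xi>)) \<in> L2" if u: "u \<in> L2" for u :: "'a \<Rightarrow> real"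
  proof -
    note [measurable] = fourier_L2(1)[OF u, THEN L2_measurable]
    show "(\<lambda>\<xi>. Re (fourier u \<xi>)) \<in> L2"
      by (rule L2_bound[OF _ fourier_L2(1)[OF u]]) (auto simp: abs_Re_le_cmod)
    show "(\<lambda>\<xi>. Im (fourier u \<xi>)) \<in> L2"
      by (rule L2_bound[OF _ fourier_L2(1)[OF u]]) (auto simp: abs_Im_le_cmod)
  qed
  have int: "integrable lborel ?k"
    using L2_inner_integrable[OF ReIm(1)[OF u] ReIm(2)[OF v]] L2_inner_integrable[OF ReIm(2)[OF u] ReIm(1)[OF v]] by simp
  have "(LINT \<xi>|lborel. ?k \<xi>) = (LINT \<xi>|lborel. ?k (0 - \<xi>))"
    by (subst integral_reflect[of ?k]) auto
  also have "\<dots> = (LINT \<xi>|lborel. - ?k \<xi>)"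
    using fourier_minus[OF u] fourier_minus[OF v]
    by (intro integral_cong_AE) (auto elim!: eventually_elim2)
  also have "\<dots> = - (LINT \<xi>|lborel. ?k \<xi>)" by (rule Bochner_Integration.integral_minus)
  finally have 0: "(LINT \<xi>|lborel. ?k \<xi>) = 0" by linarith
  have "ip (hartley (fourier u)) (hartley (fourier v)) = (LINT \<xi>|lborel. fourier u \<xi> \<bullet> fourier v \<xi> - ?k \<xi>)"
    by (simp add: ip_def hartley_def inner_complex_def algebra_simps)
  also have "\<dots> = ip (fourier u) (fourier v)"
    using int u v 0 by (subst Bochner_Integration.integral_diff) (auto simp: ip_def intro!: L2_inner_integrable fourier_L2)
  finally show ?thesis by (simp add: fourier_isometry u v)
qed

text \<open>A Hermitian \<open>g\<close> has even real and odd imaginary part, so comparing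
  \<open>hartley g\<close> at \<xi> and at -\<xi> recovers it. It remains to invert the Hartley
  transform, and a symmetric isometry is its own inverse.\<close>

lemma fourier_surj:
  fixes g :: "'a::euclidean_space \<Rightarrow> complex"
  assumes g: "g \<in> L2" and herm: "AE \<xi> in lborel. g (- \<xi>) = cnj (g \<xi>)"
  obtains w where "w \<in> L2" "AE \<xi> in lborel. fourier w \<xi> = g \<xi>"
proof
  define h where "h = hartley g"
  define w where "w = hartley (fourier h)"
  have h: "h \<in> L2" unfolding h_def by (intro hartley_L2 g)
  show w: "w \<in> L2" unfolding w_def by (intro hartley_L2 fourier_L2 h)
  define d where "d \<xi> = hartley (fourier w) \<xi> - h \<xi>" for \<xi>
  have Hw: "hartley (fourier w) \<in> L2" by (intro hartley_L2 fourier_L2 w)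
  have d: "d \<in> L2" unfolding d_def[abs_def] by (intro L2_diff h Hw)
  \<comment> \<open>Symmetry moves one transform onto \<open>d\<close>, and the isometry cancels it
    against the other. The error \<open>d\<close> is thereby orthogonal to itself.\<close>
  have "ip (hartley (fourier w)) d = ip w (hartley (fourier d))" by (rule hartley_symmetric[OF w d])
  also have "\<dots> = ip h d" unfolding w_def by (rule hartley_isometry[OF h d])
  finally have "ip d d = 0"
    using ip_diff_left[OF Hw h d] by (simp add: d_def[abs_def])
  then have "AE \<xi> in lborel. d \<xi> = 0" using L2_norm_eq_0_AE[OF d] by (simp add: L2_norm_UNIV)
  then have eq: "AE \<xi> in lborel. hartley (fourier w) \<xi> = hartley g \<xi>" by (simp add: d_def h_def)
  show "AE \<xi> in lborel. fourier w \<xi> = g \<xi>"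
    using eq AE_reflect[OF eq] herm fourier_minus[OF w]
  proof eventually_elim
    case (elim \<xi>)
    then have "Re (fourier w \<xi>) - Im (fourier w \<xi>) = Re (g \<xi>) - Im (g \<xi>)"
      "Re (fourier w \<xi>) + Im (fourier w \<xi>) = Re (g \<xi>) + Im (g \<xi>)"
      by (simp_all add: hartley_def)
    then show ?case by (intro complex_eqI) linarith+
  qed
qed

section \<open>Sobolev spaces\<close>

text \<open>Bessel and Riesz weights are both of this shape, so bilinearity and norm estimates are
  proved once for a general multiplier.\<close>

definition weighted :: "('a::euclidean_space \<Rightarrow> real) \<Rightarrow> ('a \<Rightarrow> real) \<Rightarrow> 'a \<Rightarrow> complex" where
  "weighted m u \<xi> = m \<xi> *\<^sub>R fourier u \<xi>"

lemma weighted_measurable: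
  assumes "m \<in> borel_measurable borel" "u \<in> L2"
  shows "weighted m u \<in> borel_measurable borel"
  unfolding weighted_def[abs_def]
  by (rule borel_measurable_scaleR[OF assms(1) L2_measurable[OF fourier_L2(1)[OF assms(2)]]])

lemma weighted_lin_AE:
  fixes u v :: "'a::euclidean_space \<Rightarrow> real"
  assumes "u \<in> L2" "v \<in> L2"
  shows "AE \<xi> in lborel. weighted m (\<lambda>x. a * u x + b * v x) \<xi> = a *\<^sub>R weighted m u \<xi> + b *\<^sub>R weighted m v \<xi>"
  using fourier_lin[OF assms, of a b]
  by eventually_elim (simp add: weighted_def scaleR_conv_of_real algebra_simps)

lemma weighted_lin_L2:
  fixes u v :: "'a::euclidean_space \<Rightarrow> real"
  assumes m: "m \<in> borel_measurable borel" and u: "u \<in> L2" "weighted m u \<in> L2" and v: "v \<in> L2" "weighted m v \<in> L2"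
  shows "weighted m (\<lambda>x. a * u x + b * v x) \<in> L2"
proof (rule L2_bound)
  show "(\<lambda>\<xi>. a *\<^sub>R weighted m u \<xi> + b *\<^sub>R weighted m v \<xi>) \<in> L2" by (intro L2_add L2_scale u v)
  show "AE \<xi> in lborel. norm (weighted m (\<lambda>x. a * u x + b * v x) \<xi>) \<le> norm (a *\<^sub>R weighted m u \<xi> + b *\<^sub>R weighted m v \<xi>)"
    using weighted_lin_AE[OF u(1) v(1), of m a b] by eventually_elim simp
qed (intro weighted_measurable m L2_add L2_mult u v)

lemma weighted_ip_lin:
  fixes u v w :: "'a::euclidean_space \<Rightarrow> real"
  assumes m: "m \<in> borel_measurable borel" and u: "u \<in> L2" "weighted m u \<in> L2" and v: "v \<in> L2" "weighted m v \<in> L2"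
    and w: "w \<in> L2" "weighted m w \<in> L2"
  shows "ip (weighted m (\<lambda>x. a * u x + b * v x)) (weighted m w) = a * ip (weighted m u) (weighted m w) + b * ip (weighted m v) (weighted m w)"
proof -
  have "ip (weighted m (\<lambda>x. a * u x + b * v x)) (weighted m w) = ip (\<lambda>\<xi>. a *\<^sub>R weighted m u \<xi> + b *\<^sub>R weighted m v \<xi>) (weighted m w)"
    using weighted_lin_AE[OF u(1) v(1), of m a b]
    by (intro ip_cong_AE weighted_measurable m w L2_add L2_mult u v L2_measurable L2_scale) auto
  then show ?thesis using u v w by (simp add: ip_add_left L2_scale ip_scale_left)
qed

lemma weighted_norm_triangle:
  fixes u v :: "'a::euclidean_space \<Rightarrow> real"
  assumes m: "m \<in> borel_measurable borel" and u: "u \<in> L2" "weighted m u \<in> L2" and v: "v \<in> L2" "weighted m v \<in> L2"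
  shows "L2_norm UNIV (weighted m (\<lambda>x. a * u x + b * v x)) \<le> \<bar>a\<bar> * L2_norm UNIV (weighted m u) + \<bar>b\<bar> * L2_norm UNIV (weighted m v)"
proof -
  have "L2_norm UNIV (weighted m (\<lambda>x. a * u x + b * v x)) = L2_norm UNIV (\<lambda>\<xi>. a *\<^sub>R weighted m u \<xi> + b *\<^sub>R weighted m v \<xi>)"
    by (intro L2_norm_cong_AE weighted_lin_AE weighted_measurable m L2_add L2_mult u v L2_measurable L2_scale)
  then show ?thesis
    using L2_norm_triangle[OF L2_scale[OF u(2), of a] L2_scale[OF v(2), of b]] by (simp only: L2_norm_scale)
qed

abbreviation bessel :: "real \<Rightarrow> 'a::euclidean_space \<Rightarrow> real" where
  "bessel s \<equiv> (\<lambda>\<xi>. (1 + (norm \<xi>)\<^sup>2) powr (s / 2))"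

abbreviation riesz :: "real \<Rightarrow> 'a::euclidean_space \<Rightarrow> real" where
  "riesz s \<equiv> (\<lambda>\<xi>. norm \<xi> powr s)"

lemma bessel_measurable: "bessel s \<in> borel_measurable borel"
  by measurable

lemma riesz_measurable: "riesz s \<in> borel_measurable borel"
  by measurable

lemma bessel_weight_eq: "bessel_weight s u = weighted (bessel s) u"
  by (rule ext) (simp add: bessel_weight_def weighted_def scaleR_conv_of_real)

lemma Hs_iff: "u \<in> Hs s \<longleftrightarrow> u \<in> L2 \<and> weighted (bessel s) u \<in> L2"
  by (simp add: Hs_def bessel_weight_eq)

lemma Hs_norm_eq: "Hs_norm s u = L2_norm UNIV (weighted (bessel s) u)"
  by (simp add: Hs_norm_def bessel_weight_eq)

lemma Hs_norm_nonneg [simp]: "0 \<le> Hs_norm s u"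
  by (simp add: Hs_norm_def)

lemma Hs_L2: "u \<in> Hs s \<Longrightarrow> u \<in> L2"
  by (simp add: Hs_iff)

lemma Hs_lin: "u \<in> Hs s \<Longrightarrow> v \<in> Hs s \<Longrightarrow> (\<lambda>x. a * u x + b * v x) \<in> Hs s"
  unfolding Hs_iff by (auto intro!: weighted_lin_L2 bessel_measurable L2_add L2_mult)

lemma Hs_norm_lin:
  "u \<in> Hs s \<Longrightarrow> v \<in> Hs s \<Longrightarrow> Hs_norm s (\<lambda>x. a * u x + b * v x) \<le> \<bar>a\<bar> * Hs_norm s u + \<bar>b\<bar> * Hs_norm s v"
  unfolding Hs_iff Hs_norm_eq by (intro weighted_norm_triangle bessel_measurable) auto

lemma Hs_diff: "u \<in> Hs s \<Longrightarrow> v \<in> Hs s \<Longrightarrow> (\<lambda>x. u x - v x) \<in> Hs s"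
  using Hs_lin[of u s v 1 "-1"] by simp

lemma Hs_norm_triangle_diff:
  "u \<in> Hs s \<Longrightarrow> v \<in> Hs s \<Longrightarrow> w \<in> Hs s \<Longrightarrow>
    Hs_norm s (\<lambda>x. u x - w x) \<le> Hs_norm s (\<lambda>x. u x - v x) + Hs_norm s (\<lambda>x. v x - w x)"
  using Hs_norm_lin[of "\<lambda>x. u x - v x" s "\<lambda>x. v x - w x" 1 1] by (simp add: Hs_diff)

lemma bessel_ge_1: "0 \<le> s \<Longrightarrow> 1 \<le> bessel s \<xi>"
  by (simp add: ge_one_powr_ge_zero)

lemma riesz_le_bessel:
  assumes "0 \<le> s" shows "riesz s \<xi> \<le> bessel s \<xi>"
proof (cases "\<xi> = 0")
  case False
  then have "norm \<xi> powr s = ((norm \<xi>)\<^sup>2) powr (s / 2)"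
    by (simp add: powr_powr flip: powr_numeral)
  also have "\<dots> \<le> (1 + (norm \<xi>)\<^sup>2) powr (s / 2)" using assms by (intro powr_mono2) auto
  finally show ?thesis .
qed (use assms in auto)

text \<open>Replacing 1 + |\<xi>|^2 by twice its larger term costs a factor 2^s, which is at most 2.
  This leads from an energy bound back to the full Sobolev norm.\<close>

lemma bessel_sq_le:
  assumes "0 \<le> s" "s \<le> 1" shows "(bessel s \<xi>)\<^sup>2 \<le> 2 * (1 + (riesz s \<xi>)\<^sup>2)"
proof -
  have b: "(bessel s \<xi>)\<^sup>2 = (1 + (norm \<xi>)\<^sup>2) powr s"
    by (simp add: power2_eq_square powr_add[symmetric])
  show ?thesis
  proof (cases "norm \<xi> \<le> 1")
    case True
    then have "(norm \<xi>)\<^sup>2 \<le> 1" by (simp add: power_le_one)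
    then have "(1 + (norm \<xi>)\<^sup>2) powr s \<le> 2 powr s" using assms by (intro powr_mono2) auto
    also have "\<dots> \<le> 2 powr 1" using assms by (intro powr_mono) auto
    also have "2 powr 1 \<le> 2 * (1 + (norm \<xi> powr s)\<^sup>2)" by simp
    finally show ?thesis unfolding b .
  next
    case False
    then have "1 \<le> (norm \<xi>)\<^sup>2" by (simp add: one_le_power)
    then have "(1 + (norm \<xi>)\<^sup>2) powr s \<le> (2 * (norm \<xi>)\<^sup>2) powr s" using assms by (intro powr_mono2) auto
    also have "\<dots> = 2 powr s * (riesz s \<xi>)\<^sup>2"
      using False by (simp add: powr_mult power2_eq_square powr_add[symmetric])
    also have "\<dots> \<le> 2 powr 1 * (riesz s \<xi>)\<^sup>2" using assms by (intro mult_right_mono powr_mono) auto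
    finally show ?thesis unfolding b by simp
  qed
qed

lemma Hs_riesz:
  fixes u :: "'a::euclidean_space \<Rightarrow> real"
  assumes u: "u \<in> Hs s" and s: "0 \<le> s"
  shows "weighted (riesz s) u \<in> L2" "L2_norm UNIV (weighted (riesz s) u) \<le> Hs_norm s u"
    "L2_norm UNIV u \<le> Hs_norm s u"
proof -
  note L = u[unfolded Hs_iff]
  have 1: "AE \<xi> in lborel. norm (weighted (riesz s) u \<xi>) \<le> norm (weighted (bessel s) u \<xi>)"
    using riesz_le_bessel[OF s] by (intro AE_I2) (auto simp: weighted_def intro!: mult_right_mono)
  show "weighted (riesz s) u \<in> L2" "L2_norm UNIV (weighted (riesz s) u) \<le> Hs_norm s u"
    unfolding Hs_norm_eq using L 1 weighted_measurable[OF riesz_measurable, of u s]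
    by (auto intro: L2_bound L2_norm_le_AE)
  have 2: "AE \<xi> in lborel. norm (fourier u \<xi>) \<le> norm (weighted (bessel s) u \<xi>)"
  proof (rule AE_I2)
    fix \<xi>
    show "norm (fourier u \<xi>) \<le> norm (weighted (bessel s) u \<xi>)"
      using mult_right_mono[OF bessel_ge_1[OF s, of \<xi>] norm_ge_zero[of "fourier u \<xi>"]] by (simp add: weighted_def)
  qed
  show "L2_norm UNIV u \<le> Hs_norm s u"
    unfolding Hs_norm_eq fourier_norm[OF conjunct1[OF L], symmetric]
    using L 2 fourier_L2(1)[of u] by (intro L2_norm_le_AE) auto
qed

lemma riesz_Hs:
  fixes u :: "'a::euclidean_space \<Rightarrow> real"
  assumes u: "u \<in> L2" "weighted (riesz s) u \<in> L2" and s: "0 \<le> s" "s \<le> 1"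
  shows "u \<in> Hs s" "(Hs_norm s u)\<^sup>2 \<le> 2 * (ip u u + ip (weighted (riesz s) u) (weighted (riesz s) u))"
proof -
  have sq: "(norm (weighted (bessel s) u \<xi>))\<^sup>2 \<le> 2 * ((norm (fourier u \<xi>))\<^sup>2 + (norm (weighted (riesz s) u \<xi>))\<^sup>2)" for \<xi>
    using mult_right_mono[OF bessel_sq_le[OF s, of \<xi>] zero_le_power2[of "norm (fourier u \<xi>)"]]
    by (simp add: weighted_def power_mult_distrib algebra_simps)
  have int: "integrable lborel (\<lambda>\<xi>. 2 * ((norm (fourier u \<xi>))\<^sup>2 + (norm (weighted (riesz s) u \<xi>))\<^sup>2))"
    using u by (intro integrable_mult_right Bochner_Integration.integrable_add L2_integrable fourier_L2)
  have m: "weighted (bessel s) u \<in> borel_measurable borel" by (intro weighted_measurable bessel_measurable u)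
  have "integrable lborel (\<lambda>\<xi>. (norm (weighted (bessel s) u \<xi>))\<^sup>2)"
    by (rule Bochner_Integration.integrable_bound[OF int]) (use m sq in \<open>auto intro!: AE_I2\<close>)
  then have L: "weighted (bessel s) u \<in> L2" using m by (intro L2_I)
  then show "u \<in> Hs s" using u by (simp add: Hs_iff)
  have "ip (weighted (bessel s) u) (weighted (bessel s) u) \<le> (LINT \<xi>|lborel. 2 * ((norm (fourier u \<xi>))\<^sup>2 + (norm (weighted (riesz s) u \<xi>))\<^sup>2))"
    unfolding ip_self by (intro integral_mono int L2_integrable L sq)
  also have "\<dots> = 2 * (ip (fourier u) (fourier u) + ip (weighted (riesz s) u) (weighted (riesz s) u))"
    using L2_integrable[OF fourier_L2(1)[OF u(1)]] L2_integrable[OF u(2)] by (simp add: ip_self)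
  finally show "(Hs_norm s u)\<^sup>2 \<le> 2 * (ip u u + ip (weighted (riesz s) u) (weighted (riesz s) u))"
    unfolding Hs_norm_eq L2_norm_sq by (simp add: fourier_isometry u)
qed

text \<open>The energy form is set up on the Fourier side, which keeps the choice in
  \<open>frac_laplace\<close> out of all later estimates.\<close>

definition frac_form :: "real \<Rightarrow> ('a::euclidean_space \<Rightarrow> real) \<Rightarrow> ('a \<Rightarrow> real) \<Rightarrow> real" where
  "frac_form s u v = ip (weighted (riesz s) u) (weighted (riesz s) v)"

lemma frac_form_commute: "frac_form s u v = frac_form s v u"
  by (simp add: frac_form_def ip_commute)

lemma frac_form_nonneg [simp]: "0 \<le> frac_form s u u"
  by (simp add: frac_form_def)

lemma frac_form_lin_left:
  assumes "u \<in> Hs s" "v \<in> Hs s" "w \<in> Hs s" "0 \<le> s"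
  shows "frac_form s (\<lambda>x. a * u x + b * v x) w = a * frac_form s u w + b * frac_form s v w"
  unfolding frac_form_def using assms by (intro weighted_ip_lin riesz_measurable Hs_riesz Hs_L2)

lemma frac_form_lin_right:
  assumes "u \<in> Hs s" "v \<in> Hs s" "w \<in> Hs s" "0 \<le> s"
  shows "frac_form s w (\<lambda>x. a * u x + b * v x) = a * frac_form s w u + b * frac_form s w v"
  using frac_form_lin_left[OF assms] by (simp add: frac_form_commute)

lemma frac_form_bound:
  assumes "u \<in> Hs s" "v \<in> Hs s" "0 \<le> s"
  shows "\<bar>frac_form s u v\<bar> \<le> Hs_norm s u * Hs_norm s v"
proof -
  have "\<bar>frac_form s u v\<bar> \<le> L2_norm UNIV (weighted (riesz s) u) * L2_norm UNIV (weighted (riesz s) v)"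
    unfolding frac_form_def using assms by (intro ip_Cauchy_Schwarz Hs_riesz)
  also have "\<dots> \<le> Hs_norm s u * Hs_norm s v"
    using assms by (intro mult_mono Hs_riesz) auto
  finally show ?thesis .
qed

lemma frac_form_le_Hs: "u \<in> Hs s \<Longrightarrow> 0 \<le> s \<Longrightarrow> frac_form s u u \<le> (Hs_norm s u)\<^sup>2"
  using frac_form_bound[of u s u] by (simp add: power2_eq_square)

text \<open>The Riesz weight is real and even, so the weighted transform is still Hermitian and
  belongs to a real function. This gives the choice in \<open>frac_laplace\<close> a
  witness.\<close>

lemma frac_laplace_Hs:
  fixes u :: "'a::euclidean_space \<Rightarrow> real"
  assumes u: "u \<in> Hs s" and s: "0 \<le> s"
  shows "frac_laplace (s / 2) u \<in> L2" "AE \<xi> in lborel. fourier (frac_laplace (s / 2) u) \<xi> = weighted (riesz s) u \<xi>"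
proof -
  have "AE \<xi> in lborel. weighted (riesz s) u (- \<xi>) = cnj (weighted (riesz s) u \<xi>)"
    using fourier_minus[OF Hs_L2[OF u]] by eventually_elim (simp add: weighted_def)
  then obtain w where w: "w \<in> L2" "AE \<xi> in lborel. fourier w \<xi> = weighted (riesz s) u \<xi>"
    using fourier_surj[OF Hs_riesz(1)[OF u s]] by blast
  let ?P = "\<lambda>w. w \<in> L2 \<and> (AE \<xi> in lborel. fourier w \<xi> = of_real (norm \<xi> powr (2 * (s / 2))) * fourier u \<xi>)"
  have "?P w" using w by (simp add: weighted_def scaleR_conv_of_real)
  then have "?P (SOME w. ?P w)" by (rule someI[of ?P])
  then have "?P (frac_laplace (s / 2) u)" by (simp only: frac_laplace_def)
  then show "frac_laplace (s / 2) u \<in> L2" "AE \<xi> in lborel. fourier (frac_laplace (s / 2) u) \<xi> = weighted (riesz s) u \<xi>"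
    by (simp_all add: weighted_def scaleR_conv_of_real)
qed

lemma L2_inner_frac_laplace:
  fixes u v :: "'a::euclidean_space \<Rightarrow> real"
  assumes u: "u \<in> Hs s" and v: "v \<in> Hs s" and s: "0 \<le> s"
  shows "L2_inner UNIV (frac_laplace (s / 2) u) (frac_laplace (s / 2) v) = frac_form s u v"
proof -
  note U = frac_laplace_Hs[OF u s] and V = frac_laplace_Hs[OF v s]
  have "L2_inner UNIV (frac_laplace (s / 2) u) (frac_laplace (s / 2) v) = ip (frac_laplace (s / 2) u) (frac_laplace (s / 2) v)"
    by (simp add: L2_inner_def ip_def set_lebesgue_integral_def)
  also have "\<dots> = ip (fourier (frac_laplace (s / 2) u)) (fourier (frac_laplace (s / 2) v))"
    by (simp add: fourier_isometry U V)
  also have "\<dots> = frac_form s u v"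
    unfolding frac_form_def
    by (intro ip_cong_AE L2_measurable fourier_L2 U V Hs_riesz u v s)
  finally show ?thesis .
qed

lemma L2_norm_frac_laplace:
  "u \<in> Hs s \<Longrightarrow> 0 \<le> s \<Longrightarrow> (L2_norm UNIV (frac_laplace (s / 2) u))\<^sup>2 = frac_form s u u"
  using L2_inner_frac_laplace[of u s u]
  by (simp add: L2_norm_sq ip_def L2_inner_def set_lebesgue_integral_def)

subsection \<open>Test functions\<close>

lemma C_k_has_derivative:
  assumes "C_k (Suc k) f"
  shows "(f has_derivative frechet_derivative f (at x)) (at x)"
  using assms by (simp add: frechet_derivative_works)

lemma C_k_lin:
  fixes f g :: "'a::euclidean_space \<Rightarrow> real"
  shows "C_k k f \<Longrightarrow> C_k k g \<Longrightarrow> C_k k (\<lambda>x. a * f x + b * g x)"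
proof (induction k arbitrary: f g)
  case 0 then show ?case by (auto intro!: continuous_intros)
next
  case (Suc k)
  have d: "((\<lambda>x. a * f x + b * g x) has_derivative (\<lambda>h. a * frechet_derivative f (at x) h + b * frechet_derivative g (at x) h)) (at x)" for x
    by (intro derivative_intros C_k_has_derivative[OF Suc.prems(1)] C_k_has_derivative[OF Suc.prems(2)])
  have "frechet_derivative (\<lambda>x. a * f x + b * g x) (at x) = (\<lambda>h. a * frechet_derivative f (at x) h + b * frechet_derivative g (at x) h)" for x
    using frechet_derivative_at[OF d] by simp
  moreover have "(\<lambda>x. a * f x + b * g x) differentiable (at x)" for x
    using d by (rule differentiableI)
  ultimately show ?case using Suc by simp
qed

lemma test_functions_lin:
  fixes f g :: "'a::euclidean_space \<Rightarrow> real"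
  assumes "f \<in> test_functions V" "g \<in> test_functions V"
  shows "(\<lambda>x. a * f x + b * g x) \<in> test_functions V"
proof -
  have "{x. a * f x + b * g x \<noteq> 0} \<subseteq> {x. f x \<noteq> 0} \<union> {x. g x \<noteq> 0}" by auto
  then have sub: "closure {x. a * f x + b * g x \<noteq> 0} \<subseteq> closure {x. f x \<noteq> 0} \<union> closure {x. g x \<noteq> 0}"
    unfolding closure_Un[symmetric] by (rule closure_mono)
  have "compact (closure {x. f x \<noteq> 0} \<union> closure {x. g x \<noteq> 0})"
    using assms by (auto simp: test_functions_def intro: compact_Un)
  then have "compact ((closure {x. f x \<noteq> 0} \<union> closure {x. g x \<noteq> 0}) \<inter> closure {x. a * f x + b * g x \<noteq> 0})"
    by (rule compact_Int_closed) (rule closed_closure)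
  then have "compact (closure {x. a * f x + b * g x \<noteq> 0})"
    by (simp only: Int_absorb1[OF sub])
  then show ?thesis
    using assms sub by (auto simp: test_functions_def intro!: C_k_lin)
qed

text \<open>The partial derivatives are continuous and vanish off the compact support, hence are
  bounded; the mean value inequality then gives the Lipschitz constant.\<close>

lemma test_function_props:
  fixes \<phi> :: "'a::euclidean_space \<Rightarrow> real"
  assumes "\<phi> \<in> test_functions V"
  shows "\<exists>R>0. \<exists>L\<ge>0. \<exists>M. (\<forall>x. norm x > R \<longrightarrow> \<phi> x = 0) \<and> (\<forall>x y. \<bar>\<phi> x - \<phi> y\<bar> \<le> L * norm (x - y)) \<and>
    (\<forall>x. \<bar>\<phi> x\<bar> \<le> M)" and "continuous_on UNIV \<phi>"
proof -
  let ?S = "closure {x. \<phi> x \<noteq> 0}"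
  have C: "C_k k \<phi>" for k using assms by (auto simp: test_functions_def)
  have S: "compact ?S" using assms by (auto simp: test_functions_def)
  have cont: "continuous_on UNIV \<phi>" using C[of 0] by simp
  have out: "\<phi> x = 0" if "x \<notin> ?S" for x using that closure_subset[of "{x. \<phi> x \<noteq> 0}"] by auto
  have bnd: "\<exists>M. \<forall>x. \<bar>f x\<bar> \<le> M" if f: "continuous_on UNIV f" and out: "\<And>x. x \<notin> ?S \<Longrightarrow> f x = 0" for f :: "'a \<Rightarrow> real"
  proof -
    have "bounded (f ` ?S)"
      using S f by (intro compact_imp_bounded compact_continuous_image) (auto intro: continuous_on_subset)
    then obtain M where "\<And>x. x \<in> ?S \<Longrightarrow> \<bar>f x\<bar> \<le> M" by (auto simp: bounded_iff)
    then have "\<bar>f x\<bar> \<le> max M 0" for x using out[of x] by (cases "x \<in> ?S") (auto intro: max.coboundedI1)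
    then show ?thesis by blast
  qed
  obtain M where M: "\<And>x. \<bar>\<phi> x\<bar> \<le> M" using bnd[OF cont out] by blast
  obtain R0 where "\<And>x. x \<in> ?S \<Longrightarrow> norm x \<le> R0"
    using compact_imp_bounded[OF S] by (auto simp: bounded_iff)
  then have R: "\<phi> x = 0" if "norm x > max R0 1" for x using out[of x] that by force
  define D where "D x = frechet_derivative \<phi> (at x)" for x
  have D: "(\<phi> has_derivative D x) (at x)" for x
    unfolding D_def using C_k_has_derivative[OF C[of "Suc 0"]] by simp
  have "\<exists>M. \<forall>x. \<bar>D x e\<bar> \<le> M" if e: "e \<in> Basis" for e
  proof (rule bnd)
    show "continuous_on UNIV (\<lambda>x. D x e)" using C[of "Suc 0"] e by (simp add: D_def)
    fix x assume x: "x \<notin> ?S"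
    have "(\<phi> has_derivative (\<lambda>_. 0)) (at x)"
    proof (rule has_derivative_transform_within_open[of "\<lambda>_. 0"])
      show "open (- ?S)" by auto
      show "x \<in> - ?S" using x by simp
      show "0 = \<phi> y" if "y \<in> - ?S" for y by (rule out[symmetric]) (use that in blast)
    qed (rule has_derivative_const)
    from has_derivative_unique[OF D[of x] this] show "D x e = 0" by simp
  qed
  then obtain B where B: "\<And>e x. e \<in> Basis \<Longrightarrow> \<bar>D x e\<bar> \<le> B e" by metis
  define L where "L = (\<Sum>e\<in>Basis. \<bar>B e\<bar>)"
  have on: "onorm (D x) \<le> L" for x
  proof (rule onorm_bound)
    show "0 \<le> L" by (simp add: L_def sum_nonneg)
    fix h
    interpret linear "D x" using D[of x] has_derivative_linear by blast
    have "D x h = D x (\<Sum>e\<in>Basis. (h \<bullet> e) *\<^sub>R e)" by (simp only: euclidean_representation)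
    also have "\<dots> = (\<Sum>e\<in>Basis. (h \<bullet> e) * D x e)" by (simp add: sum scale)
    finally have "\<bar>D x h\<bar> \<le> (\<Sum>e\<in>Basis. \<bar>(h \<bullet> e) * D x e\<bar>)" by (simp only: sum_abs)
    also have "\<dots> \<le> (\<Sum>e\<in>Basis. norm h * \<bar>B e\<bar>)"
      using B by (intro sum_mono) (auto simp: abs_mult intro!: mult_mono Basis_le_norm order_trans[OF B])
    finally show "norm (D x h) \<le> L * norm h" by (simp add: L_def sum_distrib_left mult.commute)
  qed
  have Lip: "\<bar>\<phi> x - \<phi> y\<bar> \<le> L * norm (x - y)" for x y
    using differentiable_bound[of UNIV \<phi> D L x y] D on by auto
  have "0 \<le> L" by (simp add: L_def sum_nonneg)
  moreover have "max R0 1 > 0" by simp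
  ultimately show "\<exists>R>0. \<exists>L\<ge>0. \<exists>M. (\<forall>x. norm x > R \<longrightarrow> \<phi> x = 0) \<and> (\<forall>x y. \<bar>\<phi> x - \<phi> y\<bar> \<le> L * norm (x - y)) \<and>
    (\<forall>x. \<bar>\<phi> x\<bar> \<le> M)"
    using R Lip M by blast
  show "continuous_on UNIV \<phi>" by (rule cont)
qed

lemma L2_of_bounded_support:
  fixes \<phi> :: "'a::euclidean_space \<Rightarrow> real"
  assumes [measurable]: "\<phi> \<in> borel_measurable borel" and "\<And>x. norm x > R \<Longrightarrow> \<phi> x = 0" "\<And>x. \<bar>\<phi> x\<bar> \<le> M"
  shows "integrable lborel \<phi>" "\<phi> \<in> L2" "ip \<phi> \<phi> \<le> M\<^sup>2 * measure lborel (cball (0::'a) R)"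
proof -
  have i: "integrable lborel (indicator (cball (0::'a) R) :: 'a \<Rightarrow> real)"
    using emeasure_lborel_cball_finite[of "0::'a" R] by simp
  have M: "0 \<le> M" using assms(3)[of 0] by linarith
  have le: "\<bar>\<phi> x\<bar> \<le> M * indicator (cball 0 R) x" for x
    using assms(2)[of x] assms(3)[of x] M by (auto simp: indicator_def not_le)
  show "integrable lborel \<phi>"
    by (rule Bochner_Integration.integrable_bound[OF integrable_mult_right[OF i, of M]]) (use le M in \<open>auto intro!: AE_I2\<close>)
  have le2: "(norm (\<phi> x))\<^sup>2 \<le> M\<^sup>2 * indicator (cball 0 R) x" for x
    using power_mono[OF le[of x] abs_ge_zero, of 2] by (auto simp: power_mult_distrib indicator_def)
  have int: "integrable lborel (\<lambda>x. (norm (\<phi> x))\<^sup>2)"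
    by (rule Bochner_Integration.integrable_bound[OF integrable_mult_right[OF i, of "M\<^sup>2"]]) (use le2 in \<open>auto intro!: AE_I2\<close>)
  show "\<phi> \<in> L2" by (rule L2_I[OF _ int]) measurable
  have "ip \<phi> \<phi> \<le> (LINT x|lborel. M\<^sup>2 * indicator (cball (0::'a) R) x)"
    unfolding ip_self by (intro integral_mono int integrable_mult_right i le2)
  then show "ip \<phi> \<phi> \<le> M\<^sup>2 * measure lborel (cball (0::'a) R)"
    by simp
qed

section \<open>Translations, difference quotients and Sobolev regularity of test functions\<close>

lemma integral_translate:
  fixes f :: "'a::euclidean_space \<Rightarrow> 'b::{banach, second_countable_topology}"
  assumes [measurable]: "f \<in> borel_measurable borel"
  shows "(LINT y|lborel. f (y + t)) = (LINT y|lborel. f y)"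
proof -
  have "(LINT y|lborel. f (t - (0 - y))) = (LINT y|lborel. f (t - y))"
    by (rule integral_reflect[of "\<lambda>y. f (t - y)" 0]) simp
  then show ?thesis using integral_reflect[OF assms, of t] by (simp add: add.commute)
qed

lemma fourier_L1_translate:
  fixes u :: "'a::euclidean_space \<Rightarrow> real"
  assumes "u \<in> borel_measurable borel"
  shows "fourier_L1 (\<lambda>x. u (x + t)) \<xi> = cis (t \<bullet> \<xi>) * fourier_L1 u \<xi>"
proof -
  let ?f = "\<lambda>x. cis (t \<bullet> \<xi>) * (cis (- (x \<bullet> \<xi>)) * complex_of_real (u x))"
  have "(LINT x|lborel. ?f (x + t)) = (LINT x|lborel. ?f x)"
    using assms by (intro integral_translate) auto
  moreover have "?f (x + t) = cis (- (x \<bullet> \<xi>)) * complex_of_real (u (x + t))" for x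
    by (simp add: cis_mult inner_add_left flip: mult.assoc)
  ultimately have "(LINT x|lborel. cis (- (x \<bullet> \<xi>)) * complex_of_real (u (x + t))) = cis (t \<bullet> \<xi>) * (LINT x|lborel. cis (- (x \<bullet> \<xi>)) * complex_of_real (u x))"
    by (simp only: integral_mult_right_zero)
  then show ?thesis by (simp add: fourier_L1_def)
qed

lemma cis_difference_quotient: "(\<lambda>n. (cis (inverse (real (Suc n)) * c) - 1) * of_real (real (Suc n))) \<longlonglongrightarrow> \<i> * of_real c"
proof -
  show ?thesis
  proof (cases "c = 0")
    case False
    define z where "z n = \<i> * of_real (inverse (real (Suc n)) * c)" for n
    have "(\<lambda>n. inverse (real (Suc n)) * c) \<longlonglongrightarrow> 0 * c"
      by (intro tendsto_mult LIMSEQ_inverse_real_of_nat tendsto_const)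
    then have "z \<longlonglongrightarrow> \<i> * of_real 0"
      unfolding z_def[abs_def] by (intro tendsto_mult tendsto_of_real tendsto_const) simp
    moreover have "z n \<noteq> 0" for n using False by (simp add: z_def del: of_nat_Suc)
    ultimately have "filterlim z (at 0) sequentially"
      by (intro filterlim_atI) simp_all
    from filterlim_compose[OF lim_exp_minus_1 this]
    have "(\<lambda>n. (exp (z n) - 1) / z n * (\<i> * of_real c)) \<longlonglongrightarrow> 1 * (\<i> * of_real c)"
      by (intro tendsto_mult tendsto_const)
    moreover have "(exp (z n) - 1) / z n * (\<i> * of_real c) = (cis (inverse (real (Suc n)) * c) - 1) * of_real (real (Suc n))" for n
      using False by (simp add: z_def cis_conv_exp field_simps del: of_nat_Suc)
    ultimately show ?thesis by simp
  qed simp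
qed

text \<open>
  The difference quotients of a Lipschitz function of compact support are bounded in \<open>L2\<close>;
  on the Fourier side they converge pointwise to \<open>\<i> (\<xi> \<bullet> e) fourier \<phi>\<close>.
\<close>

lemma test_functions_Hs:
  fixes \<phi> :: "'a::euclidean_space \<Rightarrow> real"
  assumes \<phi>: "\<phi> \<in> test_functions V" and s: "0 \<le> s" "s \<le> 1"
  shows "\<phi> \<in> Hs s"
proof -
  obtain R L M where "R > 0" "L \<ge> 0" and R: "\<And>x. norm x > R \<Longrightarrow> \<phi> x = 0" and L: "\<And>x y. \<bar>\<phi> x - \<phi> y\<bar> \<le> L * norm (x - y)"
    and M: "\<And>x. \<bar>\<phi> x\<bar> \<le> M"
    using test_function_props(1)[OF \<phi>] by blast
  note cont = test_function_props(2)[OF \<phi>]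
  have \<phi>m[measurable]: "\<phi> \<in> borel_measurable borel" using cont by (rule borel_measurable_continuous_onI)
  have X: "integrable lborel \<phi>" "\<phi> \<in> L2"
    by (rule L2_of_bounded_support[of \<phi> R M, OF \<phi>m], erule R, rule M)+
  let ?F = "fourier_L1 \<phi>"
  have F: "?F \<in> L2" by (rule fourier_L1_in_L2(1)[OF X(1,2)])
  note [measurable] = L2_measurable[OF F]
  have D: "(\<lambda>\<xi>. (\<xi> \<bullet> e) *\<^sub>R ?F \<xi>) \<in> L2" if e: "e \<in> Basis" for e
  proof -
    define k where "k n = real (Suc n)" for n
    define q where "q n x = k n * \<phi> (x + inverse (k n) *\<^sub>R e) + (- k n) * \<phi> x" for n x
    have k: "k n \<ge> 1" for n by (simp add: k_def)
    have tr: "integrable lborel (\<lambda>x. \<phi> (x + t))" for t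
      using integrable_reflect[OF integrable_reflect[OF X(1), of t], of 0] by (simp add: add.commute)
    have q: "integrable lborel (q n)" "q n \<in> L2" "ip (q n) (q n) \<le> L\<^sup>2 * measure lborel (cball (0::'a) (R + 1))" for n
    proof -
      have m: "q n \<in> borel_measurable borel" unfolding q_def[abs_def] by measurable
      \<comment> \<open>Steps of length at most 1 keep the supports of all quotients in one ball of
        radius \<open>R + 1\<close>, which makes their norms uniformly bounded.\<close>
      have nb: "norm (inverse (k n) *\<^sub>R e) \<le> 1" using k[of n] e by (simp add: divide_simps)
      have o: "q n x = 0" if "norm x > R + 1" for x
      proof -
        have "norm x \<le> norm (x + inverse (k n) *\<^sub>R e) + norm (inverse (k n) *\<^sub>R e)"
          using norm_triangle_ineq4[of "x + inverse (k n) *\<^sub>R e" "inverse (k n) *\<^sub>R e"] by simp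
        then show ?thesis using that nb R by (simp add: q_def)
      qed
      have b: "\<bar>q n x\<bar> \<le> L" for x
      proof -
        have "\<bar>q n x\<bar> = k n * \<bar>\<phi> (x + inverse (k n) *\<^sub>R e) - \<phi> x\<bar>"
          using k[of n] by (simp add: q_def abs_mult flip: right_diff_distrib)
        also have "\<dots> \<le> k n * (L * norm (inverse (k n) *\<^sub>R e))"
          using L[of "x + inverse (k n) *\<^sub>R e" x] k[of n] by (intro mult_left_mono) auto
        also have "\<dots> = L" using k[of n] e by simp
        finally show ?thesis .
      qed
      show "integrable lborel (q n)" "q n \<in> L2" "ip (q n) (q n) \<le> L\<^sup>2 * measure lborel (cball (0::'a) (R + 1))"
        by (rule L2_of_bounded_support[of "q n" "R + 1" L, OF m], erule o, rule b)+
    qed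
    have Fq: "fourier_L1 (q n) \<xi> = (cis (inverse (k n) * (e \<bullet> \<xi>)) - 1) * of_real (k n) * ?F \<xi>" for n \<xi>
      unfolding q_def using fourier_L1_lin[OF tr X(1), of "k n" "inverse (k n) *\<^sub>R e" "- k n" \<xi>]
      by (simp add: fourier_L1_translate algebra_simps)
    have lim: "(\<lambda>n. fourier_L1 (q n) \<xi>) \<longlonglongrightarrow> \<i> * of_real (e \<bullet> \<xi>) * ?F \<xi>" for \<xi>
      unfolding Fq k_def by (intro tendsto_mult tendsto_const cis_difference_quotient)
    have "(\<lambda>\<xi>. \<i> * of_real (e \<bullet> \<xi>) * ?F \<xi>) \<in> L2"
    proof (rule L2_norm_Fatou(1))
      show "fourier_L1 (q n) \<in> L2" for n by (rule fourier_L1_in_L2(1)[OF q(1,2)])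
      show "L2_norm UNIV (fourier_L1 (q n)) \<le> sqrt (L\<^sup>2 * measure lborel (cball (0::'a) (R + 1)))" if "n \<ge> 0" for n
        unfolding L2_norm_UNIV Plancherel_L1[OF q(1,2)] using q(3) by simp
    qed (use lim in auto)
    then show ?thesis
      by (rule L2_bound[rotated]) (auto simp: norm_mult inner_commute)
  qed
  have "integrable lborel (\<lambda>\<xi>. \<Sum>e\<in>Basis. (norm ((\<xi> \<bullet> e) *\<^sub>R ?F \<xi>))\<^sup>2)"
    using D by (intro Bochner_Integration.integrable_sum L2_integrable)
  moreover have "(\<Sum>e\<in>Basis. (norm ((\<xi> \<bullet> e) *\<^sub>R ?F \<xi>))\<^sup>2) = (norm (norm \<xi> *\<^sub>R ?F \<xi>))\<^sup>2" for \<xi>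
    by (simp add: power_mult_distrib norm_sq_Basis[of \<xi>] sum_distrib_right)
  ultimately have N: "(\<lambda>\<xi>. norm \<xi> *\<^sub>R ?F \<xi>) \<in> L2" by (intro L2_I) auto
  \<comment> \<open>For exponents up to 1 the Riesz weight is controlled by the first-order weight
    just obtained.\<close>
  have r: "riesz s \<xi> \<le> 1 + norm \<xi>" for \<xi> :: 'a
  proof (cases "norm \<xi> \<le> 1")
    case True
    then have "norm \<xi> powr s \<le> 1" using s by (simp add: powr_le1)
    then show ?thesis using norm_ge_zero[of \<xi>] by linarith
  next
    case False
    then have "norm \<xi> powr s \<le> norm \<xi> powr 1" using s by (intro powr_mono) auto
    then show ?thesis using False by simp
  qed
  have "weighted (riesz s) \<phi> \<in> L2"
  proof (rule L2_bound)
    show "(\<lambda>\<xi>. ?F \<xi> + norm \<xi> *\<^sub>R ?F \<xi>) \<in> L2" by (intro L2_add F N)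
    show "AE \<xi> in lborel. norm (weighted (riesz s) \<phi> \<xi>) \<le> norm (?F \<xi> + norm \<xi> *\<^sub>R ?F \<xi>)"
      using fourier_eq_fourier_L1[OF X(1,2)]
    proof eventually_elim
      case (elim \<xi>)
      have "?F \<xi> + norm \<xi> *\<^sub>R ?F \<xi> = (1 + norm \<xi>) *\<^sub>R ?F \<xi>" by (simp add: scaleR_left_distrib)
      then show ?case using mult_right_mono[OF r[of \<xi>] norm_ge_zero[of "?F \<xi>"]] elim by (simp add: weighted_def)
    qed
  qed (intro weighted_measurable riesz_measurable X)
  then show ?thesis by (intro riesz_Hs X s)
qed

text \<open>\<open>smooth_step 0\<close> is the usual smooth function \<open>exp (- 1 / t)\<close>; derivatives stay in the family.\<close>

definition smooth_step :: "nat \<Rightarrow> real \<Rightarrow> real" where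
  "smooth_step j t = (if t > 0 then exp (- (1 / t)) / t ^ j else 0)"

lemma power_div_fact_le_exp:
  fixes x :: real
  assumes "0 \<le> x"
  shows "x ^ n / fact n \<le> exp x"
proof -
  have "(\<Sum>k\<in>{n}. x ^ k /\<^sub>R fact k) \<le> (\<Sum>k. x ^ k /\<^sub>R fact k)"
    using assms by (intro sum_le_suminf summable_exp_generic) auto
  then show ?thesis by (simp add: exp_def divide_inverse mult.commute)
qed

text \<open>Off the origin this is calculus. At 0 the exponential series bounds
  \<open>exp (- (1 / h))\<close> by \<open>fact (j + 2) * h ^ (j + 2)\<close>, so the difference
  quotient is at most a multiple of \<open>\<bar>h\<bar>\<close>.\<close>

lemma smooth_step_deriv:
  "(smooth_step j has_real_derivative (smooth_step (j + 2) t - j * smooth_step (j + 1) t)) (at t)"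
proof -
  consider "t > 0" | "t < 0" | "t = 0" by linarith
  then show ?thesis
  proof cases
    case 1
    have "real j * t ^ (j - Suc 0) = real j * t ^ j / t" using 1 by (cases j) auto
    then have p: "((\<lambda>t. t ^ j) has_real_derivative real j * t ^ j / t) (at t)"
      using DERIV_pow[of j t] by simp
    have e: "((\<lambda>t. exp (- (1 / t))) has_real_derivative exp (- (1 / t)) / t\<^sup>2) (at t)"
      using 1 by (auto intro!: derivative_eq_intros simp: power2_eq_square)
    have "((\<lambda>t. exp (- (1 / t)) / t ^ j) has_real_derivative (smooth_step (j + 2) t - j * smooth_step (j + 1) t)) (at t)"
      by (rule DERIV_cong[OF DERIV_divide[OF e p]])
        (use 1 in \<open>auto simp: smooth_step_def field_simps power2_eq_square\<close>)
    then show ?thesis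
      by (rule has_field_derivative_transform_within_open[where S = "{0<..}"]) (use 1 in \<open>auto simp: smooth_step_def\<close>)
  next
    case 2
    have "((\<lambda>t. 0) has_real_derivative (smooth_step (j + 2) t - j * smooth_step (j + 1) t)) (at t)"
      using 2 by (auto simp: smooth_step_def)
    then show ?thesis
      by (rule has_field_derivative_transform_within_open[where S = "{..<0}"]) (use 2 in \<open>auto simp: smooth_step_def\<close>)
  next
    case 3
    have bnd: "norm ((smooth_step j (0 + h) - smooth_step j 0) / h) \<le> fact (j + 2) * \<bar>h\<bar>" for h
    proof (cases "h > 0")
      case True
      have *: "exp (- (1 / h)) \<le> fact k * h ^ k" for k
      proof -
        have "(1 / h) ^ k / fact k \<le> exp (1 / h)" using True by (intro power_div_fact_le_exp) auto
        moreover have "(1 / h) ^ k / fact k > 0" using True by simp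
        ultimately have "inverse (exp (1 / h)) \<le> inverse ((1 / h) ^ k / fact k)" by (rule le_imp_inverse_le)
        moreover have "inverse ((1 / h) ^ k / fact k) = fact k * h ^ k" by (simp add: power_divide)
        ultimately show ?thesis by (simp only: exp_minus)
      qed
      have "exp (- (1 / h)) \<le> fact (j + 2) * h ^ (j + 2)" by (rule *)
      then have "exp (- (1 / h)) / h ^ j / h \<le> fact (j + 2) * h ^ (j + 2) / h ^ j / h"
        using True by (intro divide_right_mono) auto
      also have "\<dots> = fact (j + 2) * h" using True by (simp add: power_add power2_eq_square)
      finally show ?thesis using True by (simp add: smooth_step_def)
    next
      case False
      then have "(smooth_step j (0 + h) - smooth_step j 0) / h = 0" by (simp add: smooth_step_def)
      then show ?thesis by (simp only: norm_zero) (intro mult_nonneg_nonneg, auto)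
    qed
    have "((\<lambda>h::real. fact (j + 2) * \<bar>h\<bar>) \<longlongrightarrow> fact (j + 2) * \<bar>0\<bar>) (at 0)"
      by (intro tendsto_intros)
    then have lim: "((\<lambda>h::real. fact (j + 2) * \<bar>h\<bar>) \<longlongrightarrow> 0) (at 0)" by simp
    have "((\<lambda>h. (smooth_step j (0 + h) - smooth_step j 0) / h) \<longlongrightarrow> 0) (at 0)"
      by (rule Lim_null_comparison[OF always_eventually lim]) (intro allI bnd)
    then show ?thesis using 3 by (simp add: DERIV_def smooth_step_def)
  qed
qed

section \<open>Smoothness of the bump function\<close>

text \<open>A class closed under directional derivatives. Smoothness follows by induction on the
  order, and no formula for higher derivatives is ever written down.\<close>

inductive bump_class :: "('a::euclidean_space \<Rightarrow> real) \<Rightarrow> bool" where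
  base: "bump_class (\<lambda>x. smooth_step j (1 / 4 - x \<bullet> x))"
| lin: "bump_class f \<Longrightarrow> bump_class g \<Longrightarrow> bump_class (\<lambda>x. a * f x + b * g x)"
| mult: "bump_class f \<Longrightarrow> bump_class (\<lambda>x. (x \<bullet> e) * f x)"

lemma bump_class_deriv:
  fixes f :: "'a::euclidean_space \<Rightarrow> real"
  assumes "bump_class f"
  shows "\<exists>f'. (\<forall>x. (f has_derivative f' x) (at x)) \<and> (\<forall>e. bump_class (\<lambda>x. f' x e))"
  using assms
proof induction
  case (base j)
  let ?r = "\<lambda>x::'a. 1 / 4 - x \<bullet> x"
  let ?d = "\<lambda>x::'a. smooth_step (j + 2) (?r x) - j * smooth_step (j + 1) (?r x)"
  have "((\<lambda>x. smooth_step j (?r x)) has_derivative (\<lambda>h. ?d x * (- 2 * (x \<bullet> h)))) (at x)" for x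
  proof (rule has_derivative_compose[of ?r "\<lambda>h. - 2 * (x \<bullet> h)" x UNIV "smooth_step j" "\<lambda>y. ?d x * y"])
    show "(?r has_derivative (\<lambda>h. - 2 * (x \<bullet> h))) (at x)"
      by (auto intro!: derivative_eq_intros simp: inner_commute)
    show "(smooth_step j has_derivative (\<lambda>y. ?d x * y)) (at (?r x))"
      using smooth_step_deriv[of j "?r x"] by (simp add: has_field_derivative_def)
  qed
  moreover have "bump_class (\<lambda>x. ?d x * (- 2 * (x \<bullet> e)))" for e
  proof -
    have "bump_class (\<lambda>x::'a. (- 2) * ((x \<bullet> e) * smooth_step (j + 2) (?r x)) + (2 * j) * ((x \<bullet> e) * smooth_step (j + 1) (?r x)))"
      by (intro bump_class.intros)
    moreover have "(\<lambda>x::'a. (- 2) * ((x \<bullet> e) * smooth_step (j + 2) (?r x)) + (2 * j) * ((x \<bullet> e) * smooth_step (j + 1) (?r x)))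
      = (\<lambda>x. ?d x * (- 2 * (x \<bullet> e)))"
      by (rule ext) (simp add: algebra_simps)
    ultimately show ?thesis by simp
  qed
  ultimately show ?case by (intro exI[of _ "\<lambda>x h. ?d x * (- 2 * (x \<bullet> h))"]) blast
next
  case (lin f g a b)
  then obtain f' g' where d: "\<And>x. (f has_derivative f' x) (at x)" "\<And>x. (g has_derivative g' x) (at x)"
    and c: "\<And>e. bump_class (\<lambda>x. f' x e)" "\<And>e. bump_class (\<lambda>x. g' x e)" by blast
  have "((\<lambda>x. a * f x + b * g x) has_derivative (\<lambda>h. a * f' x h + b * g' x h)) (at x)" for x
    by (intro derivative_intros d)
  then show ?case using c by (intro exI[of _ "\<lambda>x h. a * f' x h + b * g' x h"]) (auto intro: bump_class.lin)
next
  case (mult f b)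
  then obtain f' where d: "\<And>x. (f has_derivative f' x) (at x)" and c: "\<And>e. bump_class (\<lambda>x. f' x e)" by blast
  have "((\<lambda>x. (x \<bullet> b) * f x) has_derivative (\<lambda>h. (h \<bullet> b) * f x + (x \<bullet> b) * f' x h)) (at x)" for x
    by (rule derivative_eq_intros d refl)+ (simp add: algebra_simps)
  moreover have "bump_class (\<lambda>x. (e \<bullet> b) * f x + 1 * ((x \<bullet> b) * f' x e))" for e
    by (intro bump_class.lin bump_class.mult mult.hyps c)
  ultimately show ?case by (intro exI[of _ "\<lambda>x h. (h \<bullet> b) * f x + (x \<bullet> b) * f' x h"]) auto
qed

lemma bump_class_C_k: "bump_class f \<Longrightarrow> C_k k f"
proof (induction k arbitrary: f)
  case 0
  then obtain f' where "\<And>x. (f has_derivative f' x) (at x)" using bump_class_deriv by blast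
  then show ?case by (auto intro!: continuous_at_imp_continuous_on has_derivative_continuous)
next
  case (Suc k)
  then obtain f' where d: "\<And>x. (f has_derivative f' x) (at x)" and c: "\<And>e. bump_class (\<lambda>x. f' x e)"
    using bump_class_deriv by blast
  have "frechet_derivative f (at x) = f' x" for x using frechet_derivative_at[OF d] by simp
  then show ?case using Suc.IH[OF c] d by (auto intro: differentiableI)
qed

definition bump :: "'a::euclidean_space \<Rightarrow> real" where
  "bump x = smooth_step 0 (1 / 4 - x \<bullet> x)"

lemma bump_pos_iff: "bump x \<noteq> 0 \<longleftrightarrow> norm x < 1 / 2"
proof -
  have "x \<bullet> x < 1 / 4 \<longleftrightarrow> (norm x)\<^sup>2 < (1 / 2)\<^sup>2" by (simp add: dot_square_norm power_divide)
  also have "\<dots> \<longleftrightarrow> norm x < 1 / 2"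
    using power2_less_imp_less[of "norm x" "1 / 2"] power_strict_mono[of "norm x" "1 / 2" 2] by auto
  finally show ?thesis by (auto simp: bump_def smooth_step_def)
qed

text \<open>Supplies an element of positive norm, so that the infimum in
  \<open>first_eigenvalue\<close> ranges over a nonempty set.\<close>

lemma bump_test_function: "(bump :: 'a::euclidean_space \<Rightarrow> real) \<in> test_functions (ball 0 1)"
proof -
  have "{x::'a. bump x \<noteq> 0} = ball 0 (1 / 2)" by (auto simp: bump_pos_iff)
  moreover have "cball (0::'a) (1 / 2) \<subseteq> ball 0 1" by (auto simp: dist_norm)
  moreover have "bump_class (bump :: 'a \<Rightarrow> real)" unfolding bump_def[abs_def] by (rule bump_class.base)
  ultimately show ?thesis by (auto simp: test_functions_def bump_class_C_k)
qed

subsection \<open>The spaces of functions supported in a set\<close>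

lemma Htilde_Hs: "u \<in> Htilde s V \<Longrightarrow> u \<in> Hs s"
  by (simp add: Htilde_def)

lemma Htilde_L2: "u \<in> Htilde s V \<Longrightarrow> u \<in> L2"
  by (rule Hs_L2[OF Htilde_Hs])

lemma Htilde_I:
  assumes "u \<in> Hs s" "\<And>\<epsilon>. \<epsilon> > 0 \<Longrightarrow> \<exists>\<phi>\<in>test_functions V. Hs_norm s (\<lambda>x. u x - \<phi> x) < \<epsilon>"
  shows "u \<in> Htilde s V"
  using assms by (simp add: Htilde_def)

lemma Htilde_approx:
  assumes "u \<in> Htilde s V" "\<epsilon> > 0"
  obtains \<phi> where "\<phi> \<in> test_functions V" "Hs_norm s (\<lambda>x. u x - \<phi> x) < \<epsilon>"
  using assms unfolding Htilde_def by blast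

text \<open>\<open>fourier\<close> is determined up to null sets only, even for the zero function.
  The value is therefore obtained from linearity with coefficients 0 and not by evaluation.\<close>

lemma Hs_norm_0 [simp]: "Hs_norm s (\<lambda>x::'a::euclidean_space. 0) = 0"
proof -
  let ?z = "\<lambda>x::'a. 0 * 0 + 0 * (0::real)"
  have "weighted (bessel s) ?z \<in> L2"
  proof (rule L2_bound[OF _ L2_zero])
    show "AE \<xi> in lborel. norm (weighted (bessel s) ?z \<xi>) \<le> norm (0::real)"
      using weighted_lin_AE[OF L2_zero L2_zero, of "bessel s" 0 0] by eventually_elim simp
    have "?z \<in> L2" using L2_zero by simp
    then show "weighted (bessel s) ?z \<in> borel_measurable borel"
      by (intro weighted_measurable bessel_measurable)
  qed
  then have "(\<lambda>x::'a. 0) \<in> Hs s" using L2_zero by (simp add: Hs_iff)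
  from Hs_norm_lin[OF this this, of 0 0] have "Hs_norm s (\<lambda>x::'a. 0) \<le> 0" by simp
  then show ?thesis by (rule antisym) (rule Hs_norm_nonneg)
qed

lemma test_functions_Htilde:
  assumes "\<phi> \<in> test_functions V" "0 \<le> s" "s \<le> 1"
  shows "\<phi> \<in> Htilde s V"
  by (rule Htilde_I) (use assms test_functions_Hs in \<open>auto intro!: bexI[of _ \<phi>]\<close>)

lemma Htilde_lin:
  assumes u: "u \<in> Htilde s V" and v: "v \<in> Htilde s V" and s: "0 \<le> s" "s \<le> 1"
  shows "(\<lambda>x. a * u x + b * v x) \<in> Htilde s V"
proof (rule Htilde_I)
  show "(\<lambda>x. a * u x + b * v x) \<in> Hs s" by (intro Hs_lin Htilde_Hs[OF u] Htilde_Hs[OF v])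
  fix \<epsilon> :: real assume "\<epsilon> > 0"
  define \<delta> where "\<delta> = \<epsilon> / (\<bar>a\<bar> + \<bar>b\<bar> + 1)"
  have \<delta>: "\<delta> > 0" using \<open>\<epsilon> > 0\<close> by (simp add: \<delta>_def)
  obtain \<phi> \<psi> where \<phi>: "\<phi> \<in> test_functions V" "Hs_norm s (\<lambda>x. u x - \<phi> x) < \<delta>"
    and \<psi>: "\<psi> \<in> test_functions V" "Hs_norm s (\<lambda>x. v x - \<psi> x) < \<delta>"
    using Htilde_approx[OF u \<delta>] Htilde_approx[OF v \<delta>] by metis
  have "Hs_norm s (\<lambda>x. a * (u x - \<phi> x) + b * (v x - \<psi> x)) \<le> \<bar>a\<bar> * Hs_norm s (\<lambda>x. u x - \<phi> x) + \<bar>b\<bar> * Hs_norm s (\<lambda>x. v x - \<psi> x)"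
    by (intro Hs_norm_lin Hs_diff Htilde_Hs[OF u] Htilde_Hs[OF v] test_functions_Hs[OF \<phi>(1) s] test_functions_Hs[OF \<psi>(1) s])
  also have "\<dots> \<le> \<bar>a\<bar> * \<delta> + \<bar>b\<bar> * \<delta>"
    using \<phi> \<psi> by (intro add_mono mult_left_mono) auto
  also have "\<dots> < (\<bar>a\<bar> + \<bar>b\<bar> + 1) * \<delta>" using \<delta> by (simp add: algebra_simps)
  also have "\<dots> = \<epsilon>" unfolding \<delta>_def by simp
  finally have "Hs_norm s (\<lambda>x. (a * u x + b * v x) - (a * \<phi> x + b * \<psi> x)) < \<epsilon>"
    by (simp add: algebra_simps)
  then show "\<exists>\<phi>\<in>test_functions V. Hs_norm s (\<lambda>x. a * u x + b * v x - \<phi> x) < \<epsilon>"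
    using test_functions_lin[OF \<phi>(1) \<psi>(1), of a b] by (intro bexI[of _ "\<lambda>x. a * \<phi> x + b * \<psi> x"])
qed

lemma zero_Htilde: "0 \<le> s \<Longrightarrow> s \<le> 1 \<Longrightarrow> (\<lambda>x. 0) \<in> Htilde s V"
proof -
  assume s: "0 \<le> s" "s \<le> 1"
  have "C_k k (\<lambda>x::'a. 0::real)" for k
    by (induction k) (auto simp: frechet_derivative_const)
  then have "(\<lambda>x. 0) \<in> test_functions V" by (simp add: test_functions_def)
  then show ?thesis using s by (rule test_functions_Htilde)
qed

text \<open>Test functions vanish off \<open>V\<close>, and the Sobolev norm dominates the
  \<open>L2\<close> norm of the part outside \<open>V\<close>, so that part has norm 0.\<close>

lemma Htilde_outside:
  fixes u :: "'a::euclidean_space \<Rightarrow> real"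
  assumes u: "u \<in> Htilde s V" and s: "0 \<le> s" "s \<le> 1" and V: "V \<in> sets borel"
  shows "AE x in lborel. x \<notin> V \<longrightarrow> u x = 0"
proof -
  let ?v = "\<lambda>x. indicator (- V) x * u x"
  have m: "?v \<in> borel_measurable borel"
    using V L2_measurable[OF Htilde_L2[OF u]] by (intro borel_measurable_times borel_measurable_indicator) auto
  have vL: "?v \<in> L2"
    by (rule L2_bound[OF m Htilde_L2[OF u]]) (auto simp: indicator_def)
  have "L2_norm UNIV ?v \<le> 0 + \<epsilon>" if "\<epsilon> > 0" for \<epsilon>
  proof -
    obtain \<phi> where \<phi>: "\<phi> \<in> test_functions V" "Hs_norm s (\<lambda>x. u x - \<phi> x) < \<epsilon>"
      using Htilde_approx[OF u \<open>\<epsilon> > 0\<close>] .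
    have d: "(\<lambda>x. u x - \<phi> x) \<in> Hs s" by (intro Hs_diff Htilde_Hs[OF u] test_functions_Hs[OF \<phi>(1) s])
    have "\<phi> x = 0" if "x \<notin> V" for x
    proof (rule ccontr)
      assume "\<phi> x \<noteq> 0"
      then have "x \<in> closure {x. \<phi> x \<noteq> 0}" using closure_subset[of "{x. \<phi> x \<noteq> 0}"] by auto
      then show False using \<phi>(1) that by (auto simp: test_functions_def)
    qed
    then have "L2_norm UNIV ?v \<le> L2_norm UNIV (\<lambda>x. u x - \<phi> x)"
      by (intro L2_norm_le_AE m Hs_L2[OF d] AE_I2) (auto simp: indicator_def)
    also have "\<dots> \<le> Hs_norm s (\<lambda>x. u x - \<phi> x)" by (rule Hs_riesz(3)[OF d s(1)])
    finally show ?thesis using \<phi>(2) by simp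
  qed
  then have "L2_norm UNIV ?v \<le> 0" by (rule field_le_epsilon)
  then have "L2_norm UNIV ?v = 0" using L2_norm_nonneg[of UNIV ?v] by linarith
  from L2_norm_eq_0_AE[OF vL this] show ?thesis by eventually_elim (auto simp: indicator_def)
qed

text \<open>The functions and their weighted transforms converge separately. Since the weight is at
  least 1 it can be divided out, which identifies the second limit as the weighted transform of the
  first.\<close>

lemma Hs_complete:
  fixes u :: "nat \<Rightarrow> 'a::euclidean_space \<Rightarrow> real"
  assumes u: "\<And>n. u n \<in> Hs s" and s: "0 \<le> s"
    and C: "\<And>e. e > 0 \<Longrightarrow> \<exists>N. \<forall>m\<ge>N. \<forall>n\<ge>N. Hs_norm s (\<lambda>x. u m x - u n x) < e"
  obtains w where "w \<in> Hs s" "(\<lambda>n. Hs_norm s (\<lambda>x. u n x - w x)) \<longlonglongrightarrow> 0"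
proof -
  note uL = Hs_L2[OF u]
  have W: "weighted (bessel s) (u n) \<in> L2" for n using u by (simp add: Hs_iff)
  have dW: "AE \<xi> in lborel. weighted (bessel s) (\<lambda>x. u m x - v x) \<xi> = weighted (bessel s) (u m) \<xi> - weighted (bessel s) v \<xi>"
    if "v \<in> L2" for m v
    using weighted_lin_AE[OF uL[of m] that, of "bessel s" 1 "-1"] by simp
  have nW: "Hs_norm s (\<lambda>x. u m x - u n x) = L2_norm UNIV (\<lambda>\<xi>. weighted (bessel s) (u m) \<xi> - weighted (bessel s) (u n) \<xi>)" for m n
    unfolding Hs_norm_eq
    by (intro L2_norm_cong_AE dW uL weighted_measurable bessel_measurable L2_diff L2_measurable W)
  obtain w where w: "w \<in> L2" "(\<lambda>n. L2_norm UNIV (\<lambda>x. u n x - w x)) \<longlonglongrightarrow> 0"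
  proof (rule L2_complete[OF uL])
    fix e :: real assume "e > 0"
    then obtain N where N: "\<And>m n. m \<ge> N \<Longrightarrow> n \<ge> N \<Longrightarrow> Hs_norm s (\<lambda>x. u m x - u n x) < e" using C by blast
    have "L2_norm UNIV (\<lambda>x. u m x - u n x) < e" if "m \<ge> N" "n \<ge> N" for m n
      using Hs_riesz(3)[OF Hs_diff[OF u[of m] u[of n]] s] N[OF that] by linarith
    then show "\<exists>N. \<forall>m\<ge>N. \<forall>n\<ge>N. L2_norm UNIV (\<lambda>x. u m x - u n x) < e" by blast
  qed
  obtain G where G: "G \<in> L2" "(\<lambda>n. L2_norm UNIV (\<lambda>\<xi>. weighted (bessel s) (u n) \<xi> - G \<xi>)) \<longlonglongrightarrow> 0"
  proof (rule L2_complete[of "\<lambda>n. weighted (bessel s) (u n)", OF W])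
    show "\<exists>N. \<forall>m\<ge>N. \<forall>n\<ge>N. L2_norm UNIV (\<lambda>\<xi>. weighted (bessel s) (u m) \<xi> - weighted (bessel s) (u n) \<xi>) < e" if "e > 0" for e
      using C[OF that] by (simp only: nW)
  qed
  define G' where "G' \<xi> = inverse (bessel s \<xi>) *\<^sub>R G \<xi>" for \<xi>
  have b0: "bessel s \<xi> > 0" for \<xi> :: 'a
    using bessel_ge_1[OF s, of \<xi>] by linarith
  have inv: "inverse (bessel s \<xi>) \<le> 1" for \<xi> :: 'a
    using bessel_ge_1[OF s, of \<xi>] by (rule inverse_le_1_iff[THEN iffD2, OF disjI2])
  have G'm: "G' \<in> borel_measurable borel"
    unfolding G'_def[abs_def]
    by (intro borel_measurable_scaleR borel_measurable_inverse bessel_measurable L2_measurable G)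
  have G'L: "G' \<in> L2"
    using inv b0 by (intro L2_bound[OF G'm G(1)] AE_I2) (simp add: G'_def mult_left_le_one_le less_imp_le)
  have "L2_norm UNIV (\<lambda>\<xi>. fourier (u n) \<xi> - G' \<xi>) \<le> L2_norm UNIV (\<lambda>\<xi>. weighted (bessel s) (u n) \<xi> - G \<xi>)" for n
  proof (rule L2_norm_le_AE)
    show "(\<lambda>\<xi>. fourier (u n) \<xi> - G' \<xi>) \<in> borel_measurable borel"
      by (intro borel_measurable_diff G'm L2_measurable fourier_L2 uL)
    show "(\<lambda>\<xi>. weighted (bessel s) (u n) \<xi> - G \<xi>) \<in> L2" by (intro L2_diff W G)
    show "AE \<xi> in lborel. norm (fourier (u n) \<xi> - G' \<xi>) \<le> norm (weighted (bessel s) (u n) \<xi> - G \<xi>)"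
    proof (rule AE_I2)
      fix \<xi> :: 'a
      have "fourier (u n) \<xi> - G' \<xi> = inverse (bessel s \<xi>) *\<^sub>R (weighted (bessel s) (u n) \<xi> - G \<xi>)"
        using b0[of \<xi>] by (simp add: G'_def weighted_def scaleR_diff_right)
      then show "norm (fourier (u n) \<xi> - G' \<xi>) \<le> norm (weighted (bessel s) (u n) \<xi> - G \<xi>)"
        using inv[of \<xi>] b0[of \<xi>] by (simp add: mult_left_le_one_le less_imp_le)
    qed
  qed
  then have l1: "(\<lambda>n. L2_norm UNIV (\<lambda>\<xi>. fourier (u n) \<xi> - G' \<xi>)) \<longlonglongrightarrow> 0"
    by (rule L2_tendsto_0_squeeze) (rule G(2))
  have l2: "(\<lambda>n. L2_norm UNIV (\<lambda>\<xi>. fourier (u n) \<xi> - fourier w \<xi>)) \<longlonglongrightarrow> 0"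
    using w(2) by (simp add: fourier_diff_norm uL w(1))
  have eq: "AE \<xi> in lborel. weighted (bessel s) w \<xi> = G \<xi>"
    using L2_limit_unique[OF fourier_L2(1)[OF uL] fourier_L2(1)[OF w(1)] G'L l2 l1]
    by eventually_elim (use b0 in \<open>simp add: weighted_def G'_def less_imp_neq[symmetric]\<close>)
  have wm: "weighted (bessel s) w \<in> borel_measurable borel" by (intro weighted_measurable bessel_measurable w)
  have "weighted (bessel s) w \<in> L2"
    by (rule L2_bound[OF wm G(1)]) (use eq in \<open>auto elim!: eventually_mono\<close>)
  then have wH: "w \<in> Hs s" using w(1) by (simp add: Hs_iff)
  have "Hs_norm s (\<lambda>x. u n x - w x) = L2_norm UNIV (\<lambda>\<xi>. weighted (bessel s) (u n) \<xi> - G \<xi>)" for n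
    unfolding Hs_norm_eq
  proof (rule L2_norm_cong_AE)
    show "AE \<xi> in lborel. weighted (bessel s) (\<lambda>x. u n x - w x) \<xi> = weighted (bessel s) (u n) \<xi> - G \<xi>"
      using dW[OF w(1), of n] eq by eventually_elim simp
  qed (intro weighted_measurable bessel_measurable L2_diff L2_measurable W G uL w)+
  then have "(\<lambda>n. Hs_norm s (\<lambda>x. u n x - w x)) \<longlonglongrightarrow> 0" using G(2) by simp
  then show thesis using that wH by blast
qed

lemma Htilde_closed:
  assumes u: "\<And>n::nat. u n \<in> Htilde s V" and w: "w \<in> Hs s" "(\<lambda>n. Hs_norm s (\<lambda>x. u n x - w x)) \<longlonglongrightarrow> 0"
    and s: "0 \<le> s" "s \<le> 1"
  shows "w \<in> Htilde s V"
proof (rule Htilde_I[OF w(1)])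
  fix \<epsilon> :: real assume "\<epsilon> > 0"
  then have "eventually (\<lambda>n. Hs_norm s (\<lambda>x. u n x - w x) < \<epsilon> / 2) sequentially"
    using order_tendstoD(2)[OF w(2), of "\<epsilon> / 2"] by simp
  then obtain n where n: "Hs_norm s (\<lambda>x. u n x - w x) < \<epsilon> / 2"
    using eventually_happens' sequentially_bot by blast
  have n': "Hs_norm s (\<lambda>x. w x - u n x) \<le> Hs_norm s (\<lambda>x. u n x - w x)"
    using Hs_norm_lin[OF Hs_diff[OF Htilde_Hs[OF u[of n]] w(1)] Hs_diff[OF Htilde_Hs[OF u[of n]] w(1)], of "-1" 0] by simp
  obtain \<phi> where \<phi>: "\<phi> \<in> test_functions V" "Hs_norm s (\<lambda>x. u n x - \<phi> x) < \<epsilon> / 2"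
    using Htilde_approx[OF u[of n], of "\<epsilon> / 2"] \<open>\<epsilon> > 0\<close> by auto
  have "Hs_norm s (\<lambda>x. w x - \<phi> x) \<le> Hs_norm s (\<lambda>x. w x - u n x) + Hs_norm s (\<lambda>x. u n x - \<phi> x)"
    by (intro Hs_norm_triangle_diff w Htilde_Hs[OF u] test_functions_Hs[OF \<phi>(1) s])
  then show "\<exists>\<phi>\<in>test_functions V. Hs_norm s (\<lambda>x. w x - \<phi> x) < \<epsilon>"
    using \<phi> n n' by (intro bexI[of _ \<phi>]) auto
qed

lemma L1_bound_of_support:
  fixes u :: "'a::euclidean_space \<Rightarrow> real"
  assumes u: "u \<in> L2" and supp: "AE x in lborel. x \<notin> ball 0 R \<longrightarrow> u x = 0"
  shows "integrable lborel u" "(LINT x|lborel. \<bar>u x\<bar>) \<le> sqrt (measure lborel (ball (0::'a) R)) * L2_norm UNIV u"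
proof -
  let ?i = "indicator (ball 0 R) :: 'a \<Rightarrow> real"
  have fin: "emeasure lborel (ball (0::'a) R) < \<infinity>" by (rule emeasure_lborel_ball_finite)
  note I = indicator_L1_L2[OF _ fin, simplified]
  have um[measurable]: "u \<in> borel_measurable borel" by (rule L2_measurable[OF u])
  have a: "(\<lambda>x. \<bar>u x\<bar>) \<in> L2" by (rule L2_bound[OF _ u]) auto
  have eq: "AE x in lborel. \<bar>u x\<bar> \<bullet> ?i x = \<bar>u x\<bar>"
    using supp by eventually_elim (auto simp: indicator_def)
  have im: "?i \<in> borel_measurable borel" by (rule borel_measurable_indicator) simp
  have m: "(\<lambda>x. \<bar>u x\<bar> \<bullet> ?i x) \<in> borel_measurable lborel" using im by simp
  have "integrable lborel (\<lambda>x. \<bar>u x\<bar>)"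
    using integrable_cong_AE[OF m _ eq] L2_inner_integrable[OF a I(2)] by simp
  then show "integrable lborel u"
    using integrable_abs_cancel[of lborel u] by simp
  have "(LINT x|lborel. \<bar>u x\<bar>) = ip (\<lambda>x. \<bar>u x\<bar>) ?i"
    unfolding ip_def using m eq by (intro integral_cong_AE) auto
  also have "\<dots> \<le> L2_norm UNIV (\<lambda>x. \<bar>u x\<bar>) * L2_norm UNIV ?i"
    using ip_Cauchy_Schwarz[OF a I(2)] by simp
  also have "\<dots> = sqrt (measure lborel (ball (0::'a) R)) * L2_norm UNIV u"
    unfolding L2_norm_UNIV I(3) by (simp add: ip_self)
  finally show "(LINT x|lborel. \<bar>u x\<bar>) \<le> sqrt (measure lborel (ball (0::'a) R)) * L2_norm UNIV u" .
qed

lemma L2_norm_Htilde: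
  fixes u :: "'a::euclidean_space \<Rightarrow> real"
  assumes u: "u \<in> Htilde s V" and s: "0 \<le> s" "s \<le> 1" and V: "V \<in> sets borel"
  shows "L2_norm V u = L2_norm UNIV u"
proof -
  have "(LINT x:V|lborel. (norm (u x))\<^sup>2) = (LINT x|lborel. (norm (u x))\<^sup>2)"
    unfolding set_lebesgue_integral_def
    using Htilde_outside[OF u s V] L2_measurable[OF Htilde_L2[OF u]] V
    by (intro integral_cong_AE) (auto elim!: eventually_mono simp: indicator_def)
  then show ?thesis by (simp add: L2_norm_def set_lebesgue_integral_def)
qed

text \<open>
  The transform of a function supported in the unit ball is bounded by its norm, so low frequencies
  carry at most half of the mass.
\<close>

lemma Poincare_Htilde:
  assumes s: "0 < s" "s \<le> 1"
  obtains c where "c > 0" "\<And>u. u \<in> Htilde s (ball (0::'a::euclidean_space) 1) \<Longrightarrow> c * ip u u \<le> frac_form s u u"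
proof -
  let ?c = "fourier_const TYPE('a)" and ?m = "measure lborel (ball (0::'a) 1)"
  define K where "K = ?c\<^sup>2 * ?m * ?m"
  have K0: "K \<ge> 0" by (simp add: K_def)
  \<comment> \<open>This \<delta> is at most 1, so its power in the volume of a ball is at most
    \<delta>, and it leaves at most half of the mass to frequencies below \<delta>.\<close>
  define \<delta> where "\<delta> = 1 / (2 * K + 1)"
  have \<delta>: "0 < \<delta>" "\<delta> \<le> 1" "K * \<delta> \<le> 1 / 2" using K0 by (auto simp: \<delta>_def field_simps)
  have ball\<delta>: "measure lborel (ball (0::'a) \<delta>) \<le> ?m * \<delta>"
  proof -
    have "measure lborel (ball (0::'a) \<delta>) = ?m * \<delta> ^ DIM('a)"
      using \<delta> content_ball[of \<delta> "0::'a"] content_ball[of 1 "0::'a"] by simp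
    also have "\<dots> \<le> ?m * \<delta> ^ 1" using \<delta> by (intro mult_left_mono power_decreasing) auto
    finally show ?thesis by simp
  qed
  have main: "ip u u \<le> 2 * \<delta> powr (- 2 * s) * frac_form s u u" if u: "u \<in> Htilde s (ball 0 1)" for u :: "'a \<Rightarrow> real"
  proof -
    have s': "0 \<le> s" using s by simp
    have H: "u \<in> Hs s" and L: "u \<in> L2" using u by (auto intro: Htilde_Hs Htilde_L2)
    note out = Htilde_outside[OF u s' s(2)]
    have int: "integrable lborel u" and L1: "(LINT x|lborel. \<bar>u x\<bar>) \<le> sqrt ?m * L2_norm UNIV u"
      using L1_bound_of_support[OF L, of 1] out by auto
    have b: "AE \<xi> in lborel. (cmod (fourier u \<xi>))\<^sup>2 \<le> ?c\<^sup>2 * ?m * ip u u"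
      using fourier_eq_fourier_L1[OF int L]
    proof eventually_elim
      case (elim \<xi>)
      have "cmod (fourier u \<xi>) \<le> ?c * (sqrt ?m * L2_norm UNIV u)"
        using order_trans[OF fourier_L1_bound[of u \<xi>] mult_left_mono[OF L1, of ?c]] elim by simp
      then have "(cmod (fourier u \<xi>))\<^sup>2 \<le> (?c * (sqrt ?m * L2_norm UNIV u))\<^sup>2" by (intro power_mono) auto
      then show ?case by (simp add: power_mult_distrib L2_norm_sq mult.assoc)
    qed
    let ?A = "?c\<^sup>2 * ?m * ip u u"
    let ?i = "indicator (ball 0 \<delta>) :: 'a \<Rightarrow> real"
    have ii: "integrable lborel ?i" using emeasure_lborel_ball_finite[of "0::'a" \<delta>] by simp
    note rz = Hs_riesz(1)[OF H s']
    have "AE \<xi> in lborel. (norm (fourier u \<xi>))\<^sup>2 \<le> ?A * ?i \<xi> + \<delta> powr (- 2 * s) * (norm (weighted (riesz s) u \<xi>))\<^sup>2"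
      using b
    proof eventually_elim
      case (elim \<xi>)
      show ?case
      proof (cases "norm \<xi> < \<delta>")
        case True then show ?thesis using elim by (simp add: add_increasing2)
      next
        case False
        then have "\<delta> powr s \<le> norm \<xi> powr s" using \<delta> s by (intro powr_mono2) auto
        then have "(\<delta> powr s)\<^sup>2 \<le> (norm \<xi> powr s)\<^sup>2" by (intro power_mono) auto
        then have "\<delta> powr (- 2 * s) * (\<delta> powr s)\<^sup>2 \<le> \<delta> powr (- 2 * s) * (norm \<xi> powr s)\<^sup>2"
          by (intro mult_left_mono) auto
        moreover have "\<delta> powr (- 2 * s) * (\<delta> powr s)\<^sup>2 = 1"
          using \<delta> by (simp add: power2_eq_square powr_add[symmetric])
        ultimately have "1 * (norm (fourier u \<xi>))\<^sup>2 \<le> \<delta> powr (- 2 * s) * (norm \<xi> powr s)\<^sup>2 * (norm (fourier u \<xi>))\<^sup>2"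
          by (intro mult_right_mono) auto
        then show ?thesis using False by (simp add: weighted_def power_mult_distrib mult.assoc)
      qed
    qed
    then have "ip (fourier u) (fourier u) \<le> (LINT \<xi>|lborel. ?A * ?i \<xi> + \<delta> powr (- 2 * s) * (norm (weighted (riesz s) u \<xi>))\<^sup>2)"
      unfolding ip_self using ii rz L
      by (intro integral_mono_AE L2_integrable fourier_L2 Bochner_Integration.integrable_add integrable_mult_right)
    also have "\<dots> = ?A * measure lborel (ball (0::'a) \<delta>) + \<delta> powr (- 2 * s) * frac_form s u u"
      using ii L2_integrable[OF rz] by (simp add: frac_form_def ip_self)
    also have "?A * measure lborel (ball (0::'a) \<delta>) \<le> ?A * (?m * \<delta>)"
      using ball\<delta> by (intro mult_left_mono) auto
    also have "?A * (?m * \<delta>) = (K * \<delta>) * ip u u" by (simp add: K_def)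
    also have "\<dots> \<le> 1 / 2 * ip u u" using \<delta> by (intro mult_right_mono) auto
    finally show ?thesis by (simp add: fourier_isometry L)
  qed
  show thesis
  proof (rule that[of "1 / (2 * \<delta> powr (- 2 * s))"])
    show "1 / (2 * \<delta> powr (- 2 * s)) > 0" using \<delta> by simp
    show "1 / (2 * \<delta> powr (- 2 * s)) * ip u u \<le> frac_form s u u" if "u \<in> Htilde s (ball 0 1)" for u :: "'a \<Rightarrow> real"
      using main[OF that] \<delta> by (simp add: divide_le_eq mult.commute)
  qed
qed

lemma ip_scale_real: "ip (\<lambda>x. c * u x) (\<lambda>x. c * u x) = c\<^sup>2 * ip u (u :: 'a::euclidean_space \<Rightarrow> real)"
  using ip_scale_left[of c u "\<lambda>x. c *\<^sub>R u x"] ip_scale_right[of u c u] by (simp add: power2_eq_square)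

lemma frac_form_scale:
  "u \<in> Hs s \<Longrightarrow> 0 \<le> s \<Longrightarrow> frac_form s (\<lambda>x. c * u x) (\<lambda>x. c * u x) = c\<^sup>2 * frac_form s u u"
  using frac_form_lin_left[of u s u "\<lambda>x. c * u x" c 0] frac_form_lin_right[of u s u u c 0] Hs_lin[of u s u c 0]
  by (simp add: power2_eq_square)

text \<open>The Poincare constant is a positive lower bound for the quotients over which the infimum
  is taken. Normalising \<open>u\<close> turns the infimum into an inequality on the whole
  space.\<close>

lemma first_eigenvalue_props:
  assumes s: "0 < s" "s \<le> 1"
  shows "first_eigenvalue s (ball (0::'a::euclidean_space) 1) > 0"
    and "\<And>u. u \<in> Htilde s (ball (0::'a) 1) \<Longrightarrow> first_eigenvalue s (ball (0::'a) 1) * ip u u \<le> frac_form s u u"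
proof -
  let ?H = "Htilde s (ball (0::'a) 1)"
  let ?S = "{(L2_norm UNIV (frac_laplace (s / 2) u))\<^sup>2 | u. u \<in> ?H \<and> L2_norm (ball (0::'a) 1) u = 1}"
  have s': "0 \<le> s" using s by simp
  obtain c where c: "c > 0" "\<And>u. u \<in> ?H \<Longrightarrow> c * ip u u \<le> frac_form s u u"
    using Poincare_Htilde[OF s] by blast
  have val: "(L2_norm UNIV (frac_laplace (s / 2) u))\<^sup>2 = frac_form s u u" if "u \<in> ?H" for u
    using L2_norm_frac_laplace[OF Htilde_Hs[OF that] s'] .
  have nrm: "L2_norm (ball (0::'a) 1) u = sqrt (ip u u)" if "u \<in> ?H" for u
    using L2_norm_Htilde[OF that s' s(2)] by (simp add: L2_norm_UNIV)
  have lb: "c \<le> x" if x: "x \<in> ?S" for x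
  proof -
    obtain u where u: "u \<in> ?H" "L2_norm (ball (0::'a) 1) u = 1" "x = (L2_norm UNIV (frac_laplace (s / 2) u))\<^sup>2"
      using x by blast
    then have "ip u u = 1" "x = frac_form s u u" using nrm[OF u(1)] val[OF u(1)] by simp_all
    then show ?thesis using c(2)[OF u(1)] by simp
  qed
  have bdd: "bdd_below ?S" using lb by (rule bdd_belowI)
  have scaled: "frac_form s u u / ip u u \<in> ?S" if u: "u \<in> ?H" and pos: "ip u u > 0" for u
  proof -
    let ?k = "1 / sqrt (ip u u)"
    have v: "(\<lambda>x. ?k * u x) \<in> ?H" using Htilde_lin[OF u u s' s(2), of ?k 0] by simp
    have "ip (\<lambda>x. ?k * u x) (\<lambda>x. ?k * u x) = 1"
      unfolding ip_scale_real using pos by (simp add: power_divide)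
    moreover have "frac_form s (\<lambda>x. ?k * u x) (\<lambda>x. ?k * u x) = frac_form s u u / ip u u"
      unfolding frac_form_scale[OF Htilde_Hs[OF u] s'] using pos by (simp add: power_divide)
    ultimately show ?thesis using val[OF v] nrm[OF v] v by (intro CollectI exI[of _ "\<lambda>x. ?k * u x"]) auto
  qed
  have bH: "bump \<in> ?H" by (rule test_functions_Htilde[OF bump_test_function s' s(2)])
  have "ip bump (bump :: 'a \<Rightarrow> real) \<noteq> 0"
  proof
    assume "ip bump (bump :: 'a \<Rightarrow> real) = 0"
    then have "AE x::'a in lborel. bump x = 0"
      using L2_norm_eq_0_AE[OF Htilde_L2[OF bH]] by (simp add: L2_norm_UNIV)
    then have "AE x::'a in lborel. x \<notin> ball 0 (1 / 2)"
      by eventually_elim (metis bump_pos_iff dist_0_norm mem_ball)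
    then have "emeasure lborel (ball (0::'a) (1 / 2)) = 0"
      by (subst (asm) AE_iff_measurable[of "ball 0 (1/2)"]) auto
    then have "measure lborel (ball (0::'a) (1 / 2)) = 0" by (simp add: measure_def)
    then show False using content_ball_pos[of "1 / 2" "0::'a"] by simp
  qed
  then have "ip bump (bump :: 'a \<Rightarrow> real) > 0" using ip_self_nonneg[of "bump :: 'a \<Rightarrow> real"] by linarith
  then have ne: "?S \<noteq> {}" using scaled[OF bH] by blast
  show "first_eigenvalue s (ball (0::'a) 1) > 0"
    using cInf_greatest[OF ne lb] c(1) by (simp add: first_eigenvalue_def)
  fix u assume u: "u \<in> ?H"
  show "first_eigenvalue s (ball (0::'a) 1) * ip u u \<le> frac_form s u u"
  proof (cases "ip u u = 0")
    case False
    then have pos: "ip u u > 0" using ip_self_nonneg[of u] by linarith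
    have "first_eigenvalue s (ball (0::'a) 1) \<le> frac_form s u u / ip u u"
      unfolding first_eigenvalue_def by (rule cInf_lower[OF scaled[OF u pos] bdd])
    then show ?thesis using pos by (simp add: le_divide_eq)
  qed simp
qed

subsection \<open>Riesz representation\<close>

text \<open>The direct method: the functional \<open>B u u - 2 * l u\<close> is minimised, and its
  minimiser satisfies the equation. Stating it for a general coercive symmetric form lets it cover
  every admissible potential.\<close>

lemma Riesz_Htilde:
  fixes B :: "('a::euclidean_space \<Rightarrow> real) \<Rightarrow> ('a \<Rightarrow> real) \<Rightarrow> real"
  assumes s: "0 \<le> s" "s \<le> 1"
    and lin: "\<And>a b u v w. u \<in> Htilde s V \<Longrightarrow> v \<in> Htilde s V \<Longrightarrow> w \<in> Htilde s V \<Longrightarrow> B (\<lambda>x. a * u x + b * v x) w = a * B u w + b * B v w"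
    and sym: "\<And>u v. u \<in> Htilde s V \<Longrightarrow> v \<in> Htilde s V \<Longrightarrow> B u v = B v u"
    and c: "c > 0" "\<And>u. u \<in> Htilde s V \<Longrightarrow> c * (Hs_norm s u)\<^sup>2 \<le> B u u"
    and C: "\<And>u. u \<in> Htilde s V \<Longrightarrow> B u u \<le> C * (Hs_norm s u)\<^sup>2"
    and l: "\<And>a b u v. u \<in> Htilde s V \<Longrightarrow> v \<in> Htilde s V \<Longrightarrow> l (\<lambda>x. a * u x + b * v x) = a * l u + b * l v"
    and K: "\<And>u. u \<in> Htilde s V \<Longrightarrow> \<bar>l u\<bar> \<le> K * Hs_norm s u"
  obtains w where "w \<in> Htilde s V" "\<And>v. v \<in> Htilde s V \<Longrightarrow> B w v = l v"
proof -
  let ?H = "Htilde s V" and ?h = "Hs_norm s"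
  note H_lin = Htilde_lin[OF _ _ s]
  have B0: "0 \<le> B u u" if "u \<in> ?H" for u
    by (rule order_trans[OF _ c(2)[OF that]]) (use c(1) in simp)
  have lin2: "B w (\<lambda>x. a * u x + b * v x) = a * B w u + b * B w v" if "u \<in> ?H" "v \<in> ?H" "w \<in> ?H" for a b u v w
    using lin[OF that] sym that H_lin[OF that(1,2)] by simp
  have expand: "B (\<lambda>x. a * u x + b * v x) (\<lambda>x. a * u x + b * v x) = a\<^sup>2 * B u u + 2 * a * b * B u v + b\<^sup>2 * B v v"
    if "u \<in> ?H" "v \<in> ?H" for a b u v
    using lin[OF that H_lin[OF that], of a b a b] lin2[OF that that(1), of a b] lin2[OF that that(2), of a b] sym[OF that]
    by (simp add: power2_eq_square algebra_simps)
  have CS: "(B u v)\<^sup>2 \<le> B u u * B v v" if "u \<in> ?H" "v \<in> ?H" for u v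
  proof (rule quadratic_nonneg_imp_discriminant[OF _ B0[OF that(2)]])
    fix t
    show "0 \<le> B u u + 2 * B u v * t + B v v * t\<^sup>2"
      using B0[OF H_lin[OF that, of 1 t]] expand[OF that, of 1 t] by (simp add: algebra_simps)
  qed
  define J where "J u = B u u - 2 * l u" for u
  have Jlow: "- (K\<^sup>2 / c) \<le> J u" if "u \<in> ?H" for u
  proof -
    \<comment> \<open>Completing the square bounds the functional from below.\<close>
    have "0 \<le> (c * ?h u - K)\<^sup>2 / c" using c(1) by simp
    also have "\<dots> = c * (?h u)\<^sup>2 - 2 * (K * ?h u) + K\<^sup>2 / c"
      using c(1) by (simp add: power2_eq_square field_simps)
    finally show ?thesis using c(2)[OF that] K[OF that] by (simp add: J_def)
  qed
  define I where "I = Inf (J ` ?H)"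
  have bdd: "bdd_below (J ` ?H)" using Jlow by (intro bdd_belowI[of _ "- (K\<^sup>2 / c)"]) auto
  have ne: "J ` ?H \<noteq> {}" using zero_Htilde[OF s] by blast
  have I: "I \<le> J u" if "u \<in> ?H" for u unfolding I_def using that by (intro cInf_lower bdd) auto
  have "\<exists>u\<in>?H. J u < I + 1 / real (Suc n)" for n
    using cInf_lessD[OF ne, of "I + 1 / real (Suc n)"] by (auto simp: I_def)
  then obtain u where u: "\<And>n. u n \<in> ?H" and Ju: "\<And>n. J (u n) < I + 1 / real (Suc n)" by metis
  have diff: "(\<lambda>x. v x - w x) \<in> ?H" if "v \<in> ?H" "w \<in> ?H" for v w
    using H_lin[OF that, of 1 "-1"] by simp
  have close: "c * (?h (\<lambda>x. u m x - u n x))\<^sup>2 \<le> 4 / real (Suc N)" if "m \<ge> N" "n \<ge> N" for m n N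
  proof -
    \<comment> \<open>The parallelogram law for the quadratic part: the value at the midpoint is at
      least \<open>I\<close>, which forces two near-minimisers to be close to each other.\<close>
    have "J (\<lambda>x. 1 / 2 * u m x + 1 / 2 * u n x) = 1 / 2 * J (u m) + 1 / 2 * J (u n) - 1 / 4 * B (\<lambda>x. u m x - u n x) (\<lambda>x. u m x - u n x)"
      using expand[OF u[of m] u[of n], of "1/2" "1/2"] expand[OF u[of m] u[of n], of 1 "-1"] l[OF u[of m] u[of n], of "1/2" "1/2"]
      by (simp add: J_def power2_eq_square field_simps)
    then have "B (\<lambda>x. u m x - u n x) (\<lambda>x. u m x - u n x) \<le> 2 * (J (u m) - I) + 2 * (J (u n) - I)"
      using I[OF H_lin[OF u[of m] u[of n], of "1/2" "1/2"]] by simp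
    also have "\<dots> \<le> 2 * (1 / real (Suc m)) + 2 * (1 / real (Suc n))"
    proof -
      have "J (u k) - I \<le> 1 / real (Suc k)" for k using Ju[of k] by simp
      then show ?thesis by (intro add_mono mult_left_mono) auto
    qed
    also have "\<dots> \<le> 2 * (1 / real (Suc N)) + 2 * (1 / real (Suc N))"
      using that by (intro add_mono mult_left_mono divide_left_mono) auto
    finally show ?thesis using c(2)[OF diff[OF u[of m] u[of n]]] by simp
  qed
  obtain w where w: "w \<in> Hs s" "(\<lambda>n. ?h (\<lambda>x. u n x - w x)) \<longlonglongrightarrow> 0"
  proof (rule Hs_complete[of u s])
    fix e :: real assume e: "e > 0"
    have "eventually (\<lambda>N. 1 / real (Suc N) < c * e\<^sup>2 / 4) sequentially"
      using order_tendstoD(2)[OF LIMSEQ_Suc[OF lim_1_over_n], of "c * e\<^sup>2 / 4"] c(1) e by simp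
    then obtain N where N: "1 / real (Suc N) < c * e\<^sup>2 / 4"
      using eventually_happens' sequentially_bot by blast
    have "?h (\<lambda>x. u m x - u n x) < e" if "m \<ge> N" "n \<ge> N" for m n
    proof -
      have "c * (?h (\<lambda>x. u m x - u n x))\<^sup>2 < c * e\<^sup>2" using close[OF that] N by simp
      then have "(?h (\<lambda>x. u m x - u n x))\<^sup>2 < e\<^sup>2" using c(1) by simp
      then show ?thesis by (rule power2_less_imp_less) (use e in simp)
    qed
    then show "\<exists>N. \<forall>m\<ge>N. \<forall>n\<ge>N. ?h (\<lambda>x. u m x - u n x) < e" by blast
  qed (use Htilde_Hs[OF u] s in auto)
  have wH: "w \<in> ?H" by (rule Htilde_closed[OF u w s])
  have "B w v = l v" if v: "v \<in> ?H" for v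
  proof -
    have "(\<lambda>n. B (u n) v - B w v) \<longlonglongrightarrow> 0"
    proof (rule Lim_null_comparison)
      show "eventually (\<lambda>n. norm (B (u n) v - B w v) \<le> sqrt (C * B v v) * ?h (\<lambda>x. u n x - w x)) sequentially"
      proof (intro always_eventually allI)
        fix n
        let ?d = "\<lambda>x. u n x - w x"
        have "B (u n) v - B w v = B ?d v" using lin[OF u[of n] wH v, of 1 "-1"] by simp
        then have "(B (u n) v - B w v)\<^sup>2 \<le> B ?d ?d * B v v" using CS[OF diff[OF u[of n] wH] v] by simp
        also have "\<dots> \<le> (C * (?h ?d)\<^sup>2) * B v v"
          by (intro mult_right_mono C diff u wH B0 v)
        finally have "sqrt ((B (u n) v - B w v)\<^sup>2) \<le> sqrt ((C * B v v) * (?h ?d)\<^sup>2)"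
          by (intro real_sqrt_le_mono) (simp add: mult_ac)
        then show "norm (B (u n) v - B w v) \<le> sqrt (C * B v v) * ?h ?d"
          unfolding real_sqrt_mult[of "C * B v v"] by simp
      qed
      show "(\<lambda>n. sqrt (C * B v v) * ?h (\<lambda>x. u n x - w x)) \<longlonglongrightarrow> 0"
        by (rule tendsto_mult_right_zero[OF w(2)])
    qed
    then have Bl: "(\<lambda>n. B (u n) v) \<longlonglongrightarrow> B w v" by (rule LIM_zero_cancel)
    \<comment> \<open>Near-minimality on the lines \<open>u n + t v\<close>. In the limit the
      constant term is 0, and a nonnegative quadratic without constant term has no linear term
      either.\<close>
    have "0 \<le> 0 + 2 * (B w v - l v) * t + B v v * t\<^sup>2" for t
    proof (rule LIMSEQ_le_const)
      show "(\<lambda>n. 1 / real (Suc n) + 2 * (B (u n) v - l v) * t + B v v * t\<^sup>2) \<longlonglongrightarrow> 0 + 2 * (B w v - l v) * t + B v v * t\<^sup>2"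
        by (intro tendsto_add tendsto_mult tendsto_diff tendsto_const Bl LIMSEQ_Suc[OF lim_1_over_n])
      show "\<exists>N. \<forall>n\<ge>N. 0 \<le> 1 / real (Suc n) + 2 * (B (u n) v - l v) * t + B v v * t\<^sup>2"
      proof (intro exI allI impI)
        fix n :: nat
        have "J (\<lambda>x. 1 * u n x + t * v x) = J (u n) + 2 * (B (u n) v - l v) * t + B v v * t\<^sup>2"
          unfolding J_def expand[OF u v] l[OF u v] by (simp add: algebra_simps)
        then show "0 \<le> 1 / real (Suc n) + 2 * (B (u n) v - l v) * t + B v v * t\<^sup>2"
          using I[OF H_lin[OF u[of n] v, of 1 t]] Ju[of n] by linarith
      qed
    qed
    then have "(B w v - l v)\<^sup>2 \<le> 0 * B v v"
      by (rule quadratic_nonneg_imp_discriminant) (rule B0[OF v])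
    then show ?thesis by simp
  qed
  then show thesis using that wH by blast
qed

subsection \<open>The Dirichlet problem\<close>

definition potential_form :: "'a::euclidean_space set \<Rightarrow> ('a \<Rightarrow> real) \<Rightarrow> ('a \<Rightarrow> real) \<Rightarrow> ('a \<Rightarrow> real) \<Rightarrow> real" where
  "potential_form \<Omega> q u v = L2_inner \<Omega> (\<lambda>x. q x * u x) v"

lemma potential_form_ip:
  "potential_form \<Omega> q u v = ip (\<lambda>x. indicator \<Omega> x * q x * u x) v"
  by (simp add: potential_form_def L2_inner_def set_lebesgue_integral_def ip_def mult.assoc)

lemma potential_mult_L2:
  fixes u :: "'a::euclidean_space \<Rightarrow> real"
  assumes "\<Omega> \<in> sets borel" and q: "q \<in> borel_measurable borel" "\<And>x. \<bar>q x\<bar> \<le> M" and u: "u \<in> L2"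
  shows "(\<lambda>x. indicator \<Omega> x * q x * u x) \<in> L2"
    and "L2_norm UNIV (\<lambda>x. indicator \<Omega> x * q x * u x) \<le> M * L2_norm UNIV u"
proof -
  have M: "0 \<le> M" using q(2)[of 0] by linarith
  have m: "(\<lambda>x. indicator \<Omega> x * q x * u x) \<in> borel_measurable borel"
    using assms(1) q(1) L2_measurable[OF u] by (intro borel_measurable_times borel_measurable_indicator) auto
  have le: "AE x in lborel. norm (indicator \<Omega> x * q x * u x) \<le> norm (M * u x)"
    using q(2) M by (intro AE_I2) (auto simp: indicator_def abs_mult intro!: mult_right_mono)
  show "(\<lambda>x. indicator \<Omega> x * q x * u x) \<in> L2" by (rule L2_bound[OF m L2_mult[OF u] le])
  show "L2_norm UNIV (\<lambda>x. indicator \<Omega> x * q x * u x) \<le> M * L2_norm UNIV u"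
    using L2_norm_le_AE[OF m L2_mult[OF u] le] L2_norm_scale[of M u] M by simp
qed

lemma potential_form_props:
  fixes u v w :: "'a::euclidean_space \<Rightarrow> real"
  assumes \<Omega>: "\<Omega> \<in> sets borel" and q: "q \<in> borel_measurable borel" "\<And>x. \<bar>q x\<bar> \<le> M"
    and u: "u \<in> L2" and v: "v \<in> L2" and w: "w \<in> L2"
  shows "potential_form \<Omega> q (\<lambda>x. a * u x + b * v x) w = a * potential_form \<Omega> q u w + b * potential_form \<Omega> q v w"
    and "potential_form \<Omega> q u v = potential_form \<Omega> q v u"
    and "\<bar>potential_form \<Omega> q u v\<bar> \<le> M * L2_norm UNIV u * L2_norm UNIV v"
proof -
  note P = potential_mult_L2[OF \<Omega> q]
  have "(\<lambda>x. indicator \<Omega> x * q x * (a * u x + b * v x)) = (\<lambda>x. a *\<^sub>R (indicator \<Omega> x * q x * u x) + b *\<^sub>R (indicator \<Omega> x * q x * v x))"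
    by (simp add: algebra_simps)
  then show "potential_form \<Omega> q (\<lambda>x. a * u x + b * v x) w = a * potential_form \<Omega> q u w + b * potential_form \<Omega> q v w"
    unfolding potential_form_ip
    by (simp only: ip_add_left[OF L2_scale[OF P(1)[OF u]] L2_scale[OF P(1)[OF v]] w] ip_scale_left)
  show "potential_form \<Omega> q u v = potential_form \<Omega> q v u"
    unfolding potential_form_ip ip_def by (simp add: mult_ac)
  have "\<bar>potential_form \<Omega> q u v\<bar> \<le> L2_norm UNIV (\<lambda>x. indicator \<Omega> x * q x * u x) * L2_norm UNIV v"
    unfolding potential_form_ip by (rule ip_Cauchy_Schwarz[OF P(1)[OF u] v])
  also have "\<dots> \<le> (M * L2_norm UNIV u) * L2_norm UNIV v"
    by (intro mult_right_mono P u) simp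
  finally show "\<bar>potential_form \<Omega> q u v\<bar> \<le> M * L2_norm UNIV u * L2_norm UNIV v" .
qed

lemma potential_form_vanish:
  assumes "AE x in lborel. x \<in> \<Omega> \<longrightarrow> v x = 0" and "\<Omega> \<in> sets borel" "q \<in> borel_measurable borel" "u \<in> L2" "v \<in> L2"
  shows "potential_form \<Omega> q u v = 0"
proof -
  have "potential_form \<Omega> q u v = (LINT x|lborel. indicator \<Omega> x * q x * u x * v x)"
    by (simp add: potential_form_ip ip_def)
  also have "\<dots> = (LINT x|lborel. 0 * q x)"
    using assms L2_measurable[OF assms(4)] L2_measurable[OF assms(5)]
    by (intro integral_cong_AE) (auto elim!: eventually_mono simp: indicator_def)
  finally show ?thesis by simp
qed

section \<open>The fractional Laplacian between disjoint sets\<close>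

subsection \<open>The symbol as a superposition of Gaussians\<close>

text \<open>The subordination formula writes a^s as a multiple of the integral of (1 - exp (- a t))
  t^(-1-s) over t > 0. In the inverse time \<tau> = 1 / (4 t) of \<open>heat_kernel\<close> the
  measure t^(-1-s) dt becomes a multiple of this density.\<close>

definition power_density :: "real \<Rightarrow> real \<Rightarrow> real" where
  "power_density s \<tau> = indicator {0<..} \<tau> * \<tau> powr (s - 1)"

definition gauss_defect :: "real \<Rightarrow> real \<Rightarrow> real \<Rightarrow> real" where
  "gauss_defect s a \<tau> = power_density s \<tau> * (1 - exp (- a / (4 * \<tau>)))"

lemma power_density_measurable [measurable]: "power_density s \<in> borel_measurable borel"
  unfolding power_density_def[abs_def] by measurable

lemma power_density_nonneg [simp]: "0 \<le> power_density s \<tau>"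
  by (simp add: power_density_def)

lemma gauss_defect_nonneg: "0 \<le> a \<Longrightarrow> 0 \<le> gauss_defect s a \<tau>"
  unfolding gauss_defect_def by (cases "\<tau> > 0") (auto simp: power_density_def)

lemma gauss_defect_measurable [measurable]: "gauss_defect s a \<in> borel_measurable borel"
  unfolding gauss_defect_def[abs_def] by measurable

lemma integrable_of_has_integral:
  fixes f :: "real \<Rightarrow> real"
  assumes "\<And>x. x \<in> A \<Longrightarrow> 0 \<le> f x" "(f has_integral I) A" "(\<lambda>x. indicator A x * f x) \<in> borel_measurable borel"
  shows "integrable lborel (\<lambda>x. indicator A x * f x)"
proof (rule integrableI_bounded)
  have "(\<integral>\<^sup>+ x. ennreal (norm (indicator A x * f x)) \<partial>lborel) = (\<integral>\<^sup>+ x. ennreal (indicator A x * f x) \<partial>lborel)"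
    by (intro nn_integral_cong) (auto simp: indicator_def assms(1))
  also have "\<dots> = ennreal I" by (rule nn_integral_has_integral_lebesgue[OF assms(1,2)])
  finally show "(\<integral>\<^sup>+ x. ennreal (norm (indicator A x * f x)) \<partial>lborel) < \<infinity>" by simp
qed (use assms(3) in simp)

text \<open>Near 0 the defect is at most \<tau>^(s-1), integrable since s > 0; from 1 on, the bound
  1 - exp (- x) \<le> x gives \<tau>^(s-2), integrable since s < 1.\<close>

lemma gauss_defect_integrable_1:
  assumes s: "0 < s" "s < 1"
  shows "integrable lborel (gauss_defect s 1)"
proof (rule Bochner_Integration.integrable_bound)
  let ?g = "\<lambda>\<tau>::real. indicator {0..1} \<tau> * \<tau> powr (s - 1) + indicator {1..} \<tau> * \<tau> powr (s - 2)"
  show "integrable lborel ?g"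
  proof (intro Bochner_Integration.integrable_add)
    show "integrable lborel (\<lambda>\<tau>::real. indicator {0..1} \<tau> * \<tau> powr (s - 1))"
      by (rule integrable_of_has_integral[OF _ has_integral_powr_from_0[of "s - 1" 1]]) (use s in auto)
    show "integrable lborel (\<lambda>\<tau>::real. indicator {1..} \<tau> * \<tau> powr (s - 2))"
      by (rule integrable_of_has_integral[OF _ has_integral_powr_to_inf[of "s - 2" 1]]) (use s in auto)
  qed
  have "gauss_defect s 1 \<tau> \<le> ?g \<tau>" for \<tau>
  proof -
    consider "\<tau> \<le> 0" | "0 < \<tau>" "\<tau> < 1" | "\<tau> \<ge> 1" by linarith
    then show ?thesis
    proof cases
      case 2
      have "\<tau> powr (s - 1) * (1 - exp (- 1 / (4 * \<tau>))) \<le> \<tau> powr (s - 1)" by (intro mult_left_le) auto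
      then show ?thesis using 2 by (simp add: gauss_defect_def power_density_def)
    next
      case 3
      have "1 - exp (- 1 / (4 * \<tau>)) \<le> 1 / (4 * \<tau>)" using exp_ge_add_one_self[of "- 1 / (4 * \<tau>)"] by simp
      also have "\<dots> \<le> 1 / \<tau>" using 3 by (simp add: field_simps)
      finally have "\<tau> powr (s - 1) * (1 - exp (- 1 / (4 * \<tau>))) \<le> \<tau> powr (s - 1) * (1 / \<tau>)"
        by (intro mult_left_mono) auto
      also have "\<tau> powr (s - 1) * (1 / \<tau>) = \<tau> powr (s - 2)"
        using 3 powr_add[of \<tau> "s - 1" "-1"] by (simp add: powr_minus divide_inverse)
      finally have "gauss_defect s 1 \<tau> \<le> indicator {1..} \<tau> * \<tau> powr (s - 2)"
        using 3 by (simp add: gauss_defect_def power_density_def)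
      moreover have "0 \<le> indicator {0..1} \<tau> * \<tau> powr (s - 1)" by simp
      ultimately show ?thesis by linarith
    qed (simp add: gauss_defect_def power_density_def)
  qed
  then have le: "gauss_defect s 1 \<tau> \<le> norm (?g \<tau>)" for \<tau>
    unfolding real_norm_def by (rule order_trans[OF _ abs_ge_self])
  have "norm (gauss_defect s 1 \<tau>) = gauss_defect s 1 \<tau>" for \<tau>
    unfolding real_norm_def by (rule abs_of_nonneg[OF gauss_defect_nonneg]) simp
  then show "AE \<tau> in lborel. norm (gauss_defect s 1 \<tau>) \<le> norm (?g \<tau>)"
    using le by (intro AE_I2) (simp only:)
qed measurable

definition gauss_const :: "real \<Rightarrow> real" where
  "gauss_const s = (LINT \<tau>|lborel. gauss_defect s 1 \<tau>)"

lemma gauss_const_pos: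
  assumes s: "0 < s" "s < 1"
  shows "0 < gauss_const s"
proof -
  \<comment> \<open>A lower bound of the integrand on [1, 2]: both factors decrease there, so their
    values at 2 are taken.\<close>
  let ?\<delta> = "2 powr (s - 1) * (1 - exp (- 1 / 8)) :: real"
  have d: "?\<delta> > 0" by simp
  have "?\<delta> * indicator {1..2} \<tau> \<le> gauss_defect s 1 \<tau>" for \<tau>
  proof (cases "\<tau> \<in> {1..2}")
    case True
    have "2 powr (s - 1) \<le> \<tau> powr (s - 1)" using s True by (intro powr_mono2') auto
    moreover have "1 - exp (- 1 / 8) \<le> 1 - exp (- 1 / (4 * \<tau>))" using True by (simp add: field_simps)
    ultimately have "?\<delta> \<le> \<tau> powr (s - 1) * (1 - exp (- 1 / (4 * \<tau>)))" by (intro mult_mono) auto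
    then show ?thesis using True by (simp add: gauss_defect_def power_density_def)
  qed (simp add: gauss_defect_nonneg)
  then have "(LINT \<tau>|lborel. ?\<delta> * indicator {1..2::real} \<tau>) \<le> gauss_const s"
    unfolding gauss_const_def by (intro integral_mono gauss_defect_integrable_1 s) auto
  then have "?\<delta> \<le> gauss_const s" by simp
  with d show ?thesis by linarith
qed

text \<open>Substituting \<open>a * \<tau>\<close> for \<tau> extracts the power of
  \<open>a\<close>. With the squared norm of \<xi> for \<open>a\<close> this represents the symbol
  of the fractional Laplacian.\<close>

lemma gauss_defect_integral:
  assumes s: "0 < s" "s < 1" and a: "0 \<le> a"
  shows "integrable lborel (gauss_defect s a)" "(LINT \<tau>|lborel. gauss_defect s a \<tau>) = gauss_const s * a powr s"
proof -
  have "integrable lborel (gauss_defect s a) \<and> (LINT \<tau>|lborel. gauss_defect s a \<tau>) = gauss_const s * a powr s"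
  proof (cases "a = 0")
    case True
    then have "gauss_defect s a = (\<lambda>\<tau>. 0)" by (auto simp: gauss_defect_def)
    then show ?thesis using True by simp
  next
    case False
    then have a: "a > 0" using assms by simp
    have eq: "gauss_defect s a (0 + a * \<tau>) = a powr (s - 1) * gauss_defect s 1 \<tau>" for \<tau>
      using a by (cases "\<tau> > 0") (auto simp: gauss_defect_def power_density_def powr_mult zero_less_mult_iff mult.assoc)
    have "integrable lborel (\<lambda>\<tau>. gauss_defect s a (0 + a * \<tau>))"
      unfolding eq by (intro integrable_mult_right gauss_defect_integrable_1 s)
    then have 1: "integrable lborel (gauss_defect s a)"
      using lborel_integrable_real_affine_iff[of a "gauss_defect s a" 0] a by simp
    have "(LINT \<tau>|lborel. gauss_defect s a \<tau>) = \<bar>a\<bar> *\<^sub>R (LINT \<tau>|lborel. gauss_defect s a (0 + a * \<tau>))"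
      by (rule lborel_integral_real_affine) (use a in simp)
    also have "\<dots> = a * (a powr (s - 1) * gauss_const s)"
      unfolding eq using a by (simp add: gauss_const_def)
    also have "\<dots> = gauss_const s * a powr s"
      using a powr_add[of a 1 "s - 1"] by simp
    finally show ?thesis using 1 by simp
  qed
  then show "integrable lborel (gauss_defect s a)" "(LINT \<tau>|lborel. gauss_defect s a \<tau>) = gauss_const s * a powr s"
    by auto
qed

definition heat_form :: "real \<Rightarrow> ('a::euclidean_space \<Rightarrow> real) \<Rightarrow> ('a \<Rightarrow> real) \<Rightarrow> real" where
  "heat_form \<tau> f g = (LINT x|lborel. f x * (LINT y|lborel. heat_kernel \<tau> (x - y) * g y))"

text \<open>The symbol is an integral of 1 minus a Gaussian. The constant 1 contributes
  \<open>ip f g\<close>, which vanishes as the functions live on disjoint sets, so only minus the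
  heat-smoothed forms remain. Fubini applies because the inner integral of the modulus is again a
  multiple of the integrable energy density.\<close>

lemma frac_form_heat:
  fixes f g :: "'a::euclidean_space \<Rightarrow> real"
  assumes s: "0 < s" "s < 1"
    and f: "f \<in> Hs s" "integrable lborel f" and g: "g \<in> Hs s" "integrable lborel g"
    and disj: "\<And>x. f x * g x = 0"
  shows "integrable lborel (\<lambda>\<tau>. power_density s \<tau> * heat_form \<tau> f g)"
    and "gauss_const s * frac_form s f g = - (LINT \<tau>|lborel. power_density s \<tau> * heat_form \<tau> f g)"
proof -
  let ?z = "\<lambda>\<xi>. fourier_L1 f \<xi> \<bullet> fourier_L1 g \<xi>"
  let ?G = "\<lambda>\<xi> \<tau>. gauss_defect s ((norm \<xi>)\<^sup>2) \<tau> * ?z \<xi>"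
  have fL: "f \<in> L2" and gL: "g \<in> L2" using f g by (auto intro: Hs_L2)
  have s0: "0 \<le> s" using s by simp
  note Ff = fourier_L1_in_L2(1)[OF f(2) fL] and Fg = fourier_L1_in_L2(1)[OF g(2) gL]
  have zm[measurable]: "?z \<in> borel_measurable borel"
    by (intro borel_measurable_inner L2_measurable Ff Fg)
  have zI: "integrable lborel ?z" by (rule L2_inner_integrable[OF Ff Fg])
  have sq: "((norm \<xi>)\<^sup>2) powr s = norm \<xi> powr s * norm \<xi> powr s" for \<xi> :: 'a
    by (simp add: power2_eq_square powr_mult)
  have AEe: "AE \<xi> in lborel. weighted (riesz s) f \<xi> \<bullet> weighted (riesz s) g \<xi> = ((norm \<xi>)\<^sup>2) powr s * ?z \<xi>"
    using fourier_eq_fourier_L1[OF f(2) fL] fourier_eq_fourier_L1[OF g(2) gL]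
    by eventually_elim (simp add: weighted_def sq)
  have ezm: "(\<lambda>\<xi>. ((norm \<xi>)\<^sup>2) powr s * ?z \<xi>) \<in> borel_measurable lborel" by measurable
  have wm: "(\<lambda>\<xi>. weighted (riesz s) f \<xi> \<bullet> weighted (riesz s) g \<xi>) \<in> borel_measurable lborel"
    using L2_measurable[OF Hs_riesz(1)[OF f(1) s0]] L2_measurable[OF Hs_riesz(1)[OF g(1) s0]] by simp
  have ezI: "integrable lborel (\<lambda>\<xi>. ((norm \<xi>)\<^sup>2) powr s * ?z \<xi>)"
    using L2_inner_integrable[OF Hs_riesz(1)[OF f(1) s0] Hs_riesz(1)[OF g(1) s0]]
    by (simp only: integrable_cong_AE[OF wm ezm AEe])
  have form: "frac_form s f g = (LINT \<xi>|lborel. ((norm \<xi>)\<^sup>2) powr s * ?z \<xi>)"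
    unfolding frac_form_def ip_def by (rule integral_cong_AE[OF wm ezm AEe])
  have "(\<lambda>(\<xi>::'a, \<tau>). power_density s \<tau> * (1 - exp (- (norm \<xi>)\<^sup>2 / (4 * \<tau>))) * ?z \<xi>) \<in> borel_measurable (lborel \<Otimes>\<^sub>M lborel)"
    by measurable
  then have Gm: "case_prod ?G \<in> borel_measurable (lborel \<Otimes>\<^sub>M lborel)" by (simp add: gauss_defect_def)
  have pair: "integrable (lborel \<Otimes>\<^sub>M lborel) (case_prod ?G)"
  proof (rule lborel_pair.Fubini_integrable[OF Gm])
    have "(LINT \<tau>|lborel. norm (case_prod ?G (\<xi>, \<tau>))) = norm (gauss_const s * (((norm \<xi>)\<^sup>2) powr s * ?z \<xi>))" for \<xi>
    proof -
      have "(LINT \<tau>|lborel. norm (case_prod ?G (\<xi>, \<tau>))) = (LINT \<tau>|lborel. gauss_defect s ((norm \<xi>)\<^sup>2) \<tau> * \<bar>?z \<xi>\<bar>)"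
        by (simp only: prod.case abs_mult real_norm_def abs_of_nonneg[OF gauss_defect_nonneg[OF zero_le_power2]])
      also have "\<dots> = gauss_const s * ((norm \<xi>)\<^sup>2) powr s * \<bar>?z \<xi>\<bar>"
        by (simp add: gauss_defect_integral(2)[OF s])
      finally show ?thesis using gauss_const_pos[OF s] by (simp add: abs_mult)
    qed
    then show "integrable lborel (\<lambda>\<xi>. LINT \<tau>|lborel. norm (case_prod ?G (\<xi>, \<tau>)))"
      using integrable_norm[OF integrable_mult_right[OF ezI, of "gauss_const s"]] by simp
    show "AE \<xi> in lborel. integrable lborel (\<lambda>\<tau>. case_prod ?G (\<xi>, \<tau>))"
      using gauss_defect_integral(1)[OF s] by simp
  qed
  have inner: "(LINT \<xi>|lborel. ?G \<xi> \<tau>) = - (power_density s \<tau> * heat_form \<tau> f g)" for \<tau>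
  proof (cases "\<tau> > 0")
    case True
    note gf = gaussian_fourier_inner[OF f(2) g(2) True]
    have "(\<lambda>x. f x \<bullet> g x) = (\<lambda>x. 0)" by (rule ext) (simp only: inner_real_def disj)
    then have "ip f g = 0" by (simp add: ip_def)
    moreover have "ip f g = ip (fourier_L1 f) (fourier_L1 g)"
      unfolding fourier_isometry[OF fL gL, symmetric]
      by (intro ip_cong_AE L2_measurable fourier_L2 fL gL Ff Fg fourier_eq_fourier_L1 f g)
    ultimately have z0: "(LINT \<xi>|lborel. ?z \<xi>) = 0" by (simp add: ip_def)
    have "(LINT \<xi>|lborel. ?G \<xi> \<tau>) = (LINT \<xi>|lborel. power_density s \<tau> * (?z \<xi> - exp (- (norm \<xi>)\<^sup>2 / (4 * \<tau>)) * ?z \<xi>))"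
      by (simp add: gauss_defect_def algebra_simps)
    also have "\<dots> = power_density s \<tau> * ((LINT \<xi>|lborel. ?z \<xi>) - (LINT \<xi>|lborel. exp (- (norm \<xi>)\<^sup>2 / (4 * \<tau>)) * ?z \<xi>))"
      unfolding integral_mult_right_zero by (subst Bochner_Integration.integral_diff[OF zI gf(1)]) simp
    finally show ?thesis unfolding z0 gf(2) by (simp add: heat_form_def)
  qed (simp add: gauss_defect_def power_density_def)
  from lborel_pair.integrable_fst'[OF lborel_pair.integrable_product_swap[OF pair]]
  have "integrable lborel (\<lambda>\<tau>. LINT \<xi>|lborel. ?G \<xi> \<tau>)" by simp
  then show "integrable lborel (\<lambda>\<tau>. power_density s \<tau> * heat_form \<tau> f g)"
    unfolding inner by simp
  have "(LINT \<tau>|lborel. LINT \<xi>|lborel. ?G \<xi> \<tau>) = (LINT \<xi>|lborel. LINT \<tau>|lborel. ?G \<xi> \<tau>)"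
    by (rule lborel_pair.Fubini_integral[OF pair])
  also have "\<dots> = (LINT \<xi>|lborel. gauss_const s * (((norm \<xi>)\<^sup>2) powr s * ?z \<xi>))"
    by (simp add: gauss_defect_integral(2)[OF s] mult.assoc)
  also have "\<dots> = gauss_const s * frac_form s f g" unfolding form by simp
  finally show "gauss_const s * frac_form s f g = - (LINT \<tau>|lborel. power_density s \<tau> * heat_form \<tau> f g)"
    unfolding inner by simp
qed

subsection \<open>Taylor expansion of the kernel\<close>

text \<open>Writing 8 as 16/17 times 17/2 gains the factor (16/17)^m in every term of the tail; what
  is left resums to an exponential with the slightly larger rate 17/2.\<close>

lemma exp_Taylor_remainder:
  fixes z :: real
  assumes z: "\<bar>z\<bar> \<le> 8 * \<tau>" and \<tau>: "0 \<le> \<tau>"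
  shows "\<bar>exp z - (\<Sum>k<m. z ^ k / fact k)\<bar> \<le> (16 / 17) ^ m * exp (17 / 2 * \<tau>)"
proof -
  have e: "(\<lambda>k. x ^ k / fact k) sums exp x" for x :: real
    using exp_converges[of x] by (simp add: divide_inverse mult.commute)
  have t: "(\<lambda>k. x ^ (k + m) / fact (k + m)) sums (exp x - (\<Sum>k<m. x ^ k / fact k))" for x :: real
    using sums_split_initial_segment[OF e, of x m] by simp
  have b: "\<bar>z ^ (k + m) / fact (k + m)\<bar> \<le> (16 / 17) ^ m * ((17 / 2 * \<tau>) ^ (k + m) / fact (k + m))" for k
  proof -
    have "\<bar>z\<bar> ^ (k + m) \<le> (16 / 17 * (17 / 2 * \<tau>)) ^ (k + m)" using z by (intro power_mono) auto
    also have "\<dots> = (16 / 17) ^ (k + m) * (17 / 2 * \<tau>) ^ (k + m)" by (rule power_mult_distrib)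
    also have "\<dots> \<le> (16 / 17) ^ m * (17 / 2 * \<tau>) ^ (k + m)"
      using \<tau> by (intro mult_right_mono power_decreasing) auto
    finally show ?thesis by (simp add: power_abs divide_right_mono)
  qed
  have S: "summable (\<lambda>k. (16 / 17) ^ m * ((17 / 2 * \<tau>) ^ (k + m) / fact (k + m)))"
    by (intro summable_mult sums_summable[OF t])
  have "\<bar>exp z - (\<Sum>k<m. z ^ k / fact k)\<bar> = norm (\<Sum>k. z ^ (k + m) / fact (k + m))"
    using sums_unique[OF t[of z]] by simp
  also have "\<dots> \<le> (\<Sum>k. (16 / 17) ^ m * ((17 / 2 * \<tau>) ^ (k + m) / fact (k + m)))"
    by (rule norm_suminf_le[OF _ S]) (use b in simp)
  also have "\<dots> = (16 / 17) ^ m * (exp (17 / 2 * \<tau>) - (\<Sum>k<m. (17 / 2 * \<tau>) ^ k / fact k))"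
    by (subst suminf_mult[OF sums_summable[OF t]]) (simp only: sums_unique[OF t, symmetric])
  also have "\<dots> \<le> (16 / 17) ^ m * exp (17 / 2 * \<tau>)"
    using \<tau> by (intro mult_left_mono) (auto intro!: sum_nonneg)
  finally show ?thesis .
qed

text \<open>Expansion about r = 9, from which r is at most 8 away. The prefactor exp (- 9 \<tau>)
  beats the growth exp (17/2 \<tau>) of the remainder, so one degree \<open>m\<close> is good for
  all \<tau> and the error stays integrable at infinity.\<close>

lemma gaussian_Taylor:
  fixes r :: real
  assumes r: "1 \<le> r" "r \<le> 16" and \<tau>: "0 \<le> \<tau>"
  shows "\<bar>exp (- \<tau> * r) - exp (- 9 * \<tau>) * (\<Sum>k<m. \<tau> ^ k / fact k * (9 - r) ^ k)\<bar> \<le> (16 / 17) ^ m * exp (- \<tau> / 2)"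
proof -
  have "\<bar>9 - r\<bar> \<le> 8" using r by (simp add: abs_le_iff)
  then have "\<bar>\<tau> * (9 - r)\<bar> \<le> 8 * \<tau>" using \<tau> by (simp add: abs_mult mult.commute mult_left_mono)
  note T = exp_Taylor_remainder[OF this \<tau>, of m]
  have "exp (- \<tau> * r) - exp (- 9 * \<tau>) * (\<Sum>k<m. \<tau> ^ k / fact k * (9 - r) ^ k) =
    exp (- 9 * \<tau>) * (exp (\<tau> * (9 - r)) - (\<Sum>k<m. (\<tau> * (9 - r)) ^ k / fact k))"
  proof -
    have p: "(\<Sum>k<m. (\<tau> * (9 - r)) ^ k / fact k) = (\<Sum>k<m. \<tau> ^ k / fact k * (9 - r) ^ k)"
      by (intro sum.cong refl) (simp add: power_mult_distrib)
    have e: "exp (- 9 * \<tau>) * exp (\<tau> * (9 - r)) = exp (- \<tau> * r)"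
      by (simp add: exp_add[symmetric] algebra_simps)
    show ?thesis unfolding p right_diff_distrib[of "exp (- 9 * \<tau>)"] e ..
  qed
  then have "\<bar>exp (- \<tau> * r) - exp (- 9 * \<tau>) * (\<Sum>k<m. \<tau> ^ k / fact k * (9 - r) ^ k)\<bar> =
    exp (- 9 * \<tau>) * \<bar>exp (\<tau> * (9 - r)) - (\<Sum>k<m. (\<tau> * (9 - r)) ^ k / fact k)\<bar>"
    by (simp only: abs_mult abs_exp_cancel)
  also have "\<dots> \<le> exp (- 9 * \<tau>) * ((16 / 17) ^ m * exp (17 / 2 * \<tau>))"
    using T by (rule mult_left_mono) simp
  also have "\<dots> = (16 / 17) ^ m * exp (- \<tau> / 2)"
    by (simp add: exp_add[symmetric] mult.left_commute)
  finally show ?thesis .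
qed

subsection \<open>Separation of variables\<close>

text \<open>
  Words over the index set are grouped by their letter counts, so that only polynomially many
  different factors in \<open>y\<close> remain.
\<close>

definition letter_count :: "'i set \<Rightarrow> nat \<Rightarrow> (nat \<Rightarrow> 'i) \<Rightarrow> 'i \<Rightarrow> nat" where
  "letter_count I k w = restrict (\<lambda>i. card {j. j < k \<and> w j = i}) I"

definition word_sum :: "'i set \<Rightarrow> nat \<Rightarrow> ('i \<Rightarrow> real) \<Rightarrow> ('i \<Rightarrow> nat) \<Rightarrow> real" where
  "word_sum I k b \<beta> = (\<Sum>w | w \<in> PiE {..<k} (\<lambda>_. I) \<and> letter_count I k w = \<beta>. \<Prod>j<k. b (w j))"

text \<open>The multinomial expansion. The product of the \<open>a\<close> depends on a word only
  through its letter counts, and multiplicities are left inside \<open>word_sum\<close>. As no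
  letter occurs more than \<open>k < m\<close> times, the index set depends on \<open>m\<close>
  alone and is shared by all degrees below \<open>m\<close>.\<close>

lemma power_sum_separate:
  fixes a b :: "'i \<Rightarrow> real"
  assumes I: "finite I" and k: "k < m"
  shows "(\<Sum>i\<in>I. a i * b i) ^ k = (\<Sum>\<beta>\<in>PiE I (\<lambda>_. {..<m}). (\<Prod>i\<in>I. a i ^ \<beta> i) * word_sum I k b \<beta>)"
proof -
  let ?S = "PiE {..<k} (\<lambda>_. I)" and ?T = "PiE I (\<lambda>_. {..<m})"
  have fS: "finite ?S" and fT: "finite ?T" using I by (auto intro: finite_PiE)
  have img: "letter_count I k ` ?S \<subseteq> ?T"
  proof (rule image_subsetI)
    fix w :: "nat \<Rightarrow> 'i"
    have "card {j. j < k \<and> w j = i} \<le> card {..<k}" for i by (intro card_mono) auto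
    then have c: "card {j. j < k \<and> w j = i} \<le> k" for i by simp
    have "card {j. j < k \<and> w j = i} < m" for i by (rule le_less_trans[OF c k])
    then show "letter_count I k w \<in> ?T" by (auto simp: letter_count_def)
  qed
  have pa: "(\<Prod>j<k. a (w j)) = (\<Prod>i\<in>I. a i ^ letter_count I k w i)" if "w \<in> ?S" for w
  proof -
    have "w ` {..<k} \<subseteq> I" using that by auto
    from prod.group[OF finite_lessThan I this, of "\<lambda>j. a (w j)"]
    have "(\<Prod>j<k. a (w j)) = (\<Prod>i\<in>I. \<Prod>j\<in>{j \<in> {..<k}. w j = i}. a (w j))" by simp
    also have "\<dots> = (\<Prod>i\<in>I. a i ^ letter_count I k w i)"
      by (intro prod.cong refl) (simp add: letter_count_def)
    finally show ?thesis .
  qed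
  have "(\<Sum>i\<in>I. a i * b i) ^ k = (\<Prod>j<k. \<Sum>i\<in>I. a i * b i)" by simp
  also have "\<dots> = (\<Sum>w\<in>?S. \<Prod>j<k. a (w j) * b (w j))"
    using I by (subst prod_sum_PiE) auto
  also have "\<dots> = (\<Sum>w\<in>?S. (\<Prod>i\<in>I. a i ^ letter_count I k w i) * (\<Prod>j<k. b (w j)))"
    by (intro sum.cong refl) (simp add: prod.distrib pa)
  also have "\<dots> = (\<Sum>\<beta>\<in>?T. \<Sum>w | w \<in> ?S \<and> letter_count I k w = \<beta>. (\<Prod>i\<in>I. a i ^ letter_count I k w i) * (\<Prod>j<k. b (w j)))"
    by (rule sum.group[OF fS fT img, symmetric])
  also have "\<dots> = (\<Sum>\<beta>\<in>?T. (\<Prod>i\<in>I. a i ^ \<beta> i) * word_sum I k b \<beta>)"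
    unfolding word_sum_def sum_distrib_left by (intro sum.cong refl) auto
  finally show ?thesis .
qed

lemma word_sum_bound:
  assumes I: "finite I" and b: "\<And>i. i \<in> I \<Longrightarrow> \<bar>b i\<bar> \<le> M"
  shows "\<bar>word_sum I k b \<beta>\<bar> \<le> (real (card I) * M) ^ k"
proof -
  let ?S = "PiE {..<k} (\<lambda>_. I)"
  have "\<bar>word_sum I k b \<beta>\<bar> \<le> (\<Sum>w | w \<in> ?S \<and> letter_count I k w = \<beta>. \<bar>\<Prod>j<k. b (w j)\<bar>)"
    unfolding word_sum_def by (rule sum_abs)
  also have "\<dots> \<le> (\<Sum>w\<in>?S. \<bar>\<Prod>j<k. b (w j)\<bar>)"
    using I by (intro sum_mono2) (auto intro: finite_PiE)
  also have "\<dots> \<le> (\<Sum>w\<in>?S. M ^ k)"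
  proof (rule sum_mono)
    fix w assume "w \<in> ?S"
    then have "(\<Prod>j<k. \<bar>b (w j)\<bar>) \<le> (\<Prod>j<k. M)" using b by (intro prod_mono) auto
    then show "\<bar>\<Prod>j<k. b (w j)\<bar> \<le> M ^ k" by (simp add: abs_prod)
  qed
  also have "\<dots> = (real (card I) * M) ^ k"
    using I by (simp add: card_PiE power_mult_distrib)
  finally show ?thesis .
qed

subsection \<open>Approximation by forms of low rank\<close>

abbreviation annulus :: "'a::euclidean_space set" where
  "annulus \<equiv> ball 0 3 - closure (ball 0 2)"

lemma annulus_iff: "(x::'a::euclidean_space) \<in> annulus \<longleftrightarrow> 2 < norm x \<and> norm x < 3"
  by (auto simp: closure_ball)

lemma annulus_borel: "(annulus :: 'a::euclidean_space set) \<in> sets borel"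
  by (intro sets.Diff) auto

text \<open>The distances lie between 2 - 1 and 3 + 1.\<close>

lemma dist_annulus_ball:
  fixes x y :: "'a::euclidean_space"
  assumes "x \<in> annulus" "y \<in> ball 0 1"
  shows "1 \<le> (norm (x - y))\<^sup>2" "(norm (x - y))\<^sup>2 \<le> 16"
proof -
  have xy: "2 < norm x" "norm x < 3" "norm y < 1" using assms by (auto simp: annulus_iff)
  have "1 \<le> norm (x - y)" using xy norm_triangle_ineq2[of x y] by linarith
  then show "1 \<le> (norm (x - y))\<^sup>2" by (rule one_le_power)
  have "norm (x - y) \<le> 4" using xy norm_triangle_ineq4[of x y] by linarith
  then have "(norm (x - y))\<^sup>2 \<le> 4\<^sup>2" by (intro power_mono) auto
  then show "(norm (x - y))\<^sup>2 \<le> 16" by simp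
qed

section \<open>Forms given by bounded kernels\<close>

definition kernel_form :: "('a::euclidean_space \<Rightarrow> real) \<Rightarrow> ('a \<Rightarrow> real) \<Rightarrow> ('a \<times> 'a \<Rightarrow> real) \<Rightarrow> real" where
  "kernel_form f g K = (LINT z|(lborel \<Otimes>\<^sub>M lborel). f (fst z) * K z * g (snd z))"

text \<open>The supports are prescribed at every point, so that a kernel has to be bounded only on
  the product of the annulus and the ball. Elements of \<open>Htilde\<close> satisfy this after a
  change on a null set.\<close>

definition admissible :: "('a::euclidean_space \<Rightarrow> real) \<Rightarrow> ('a \<Rightarrow> real) \<Rightarrow> bool" where
  "admissible f g \<longleftrightarrow> integrable lborel f \<and> integrable lborel g \<and>
    (\<forall>x. x \<notin> annulus \<longrightarrow> f x = 0) \<and> (\<forall>y. y \<notin> ball 0 1 \<longrightarrow> g y = 0)"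

definition bounded_kernel :: "real \<Rightarrow> ('a::euclidean_space \<times> 'a \<Rightarrow> real) \<Rightarrow> bool" where
  "bounded_kernel B K \<longleftrightarrow> K \<in> borel_measurable (borel \<Otimes>\<^sub>M borel) \<and>
    (\<forall>x\<in>annulus. \<forall>y\<in>ball 0 1. \<bar>K (x, y)\<bar> \<le> B)"

lemma kernel_form_props:
  fixes f g :: "'a::euclidean_space \<Rightarrow> real"
  assumes fg: "admissible f g" and K: "bounded_kernel B K"
  shows "integrable (lborel \<Otimes>\<^sub>M lborel) (\<lambda>z. f (fst z) * K z * g (snd z))"
    and "\<bar>kernel_form f g K\<bar> \<le> B * (LINT x|lborel. \<bar>f x\<bar>) * (LINT y|lborel. \<bar>g y\<bar>)"
    and "kernel_form f g K = (LINT x|lborel. f x * (LINT y|lborel. K (x, y) * g y))"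
proof -
  have f: "integrable lborel f" and g: "integrable lborel g"
    and f0: "\<And>x. x \<notin> annulus \<Longrightarrow> f x = 0" and g0: "\<And>y. y \<notin> ball 0 1 \<Longrightarrow> g y = 0"
    using fg unfolding admissible_def by blast+
  have Km[measurable]: "K \<in> borel_measurable (borel \<Otimes>\<^sub>M borel)"
    and KB: "\<And>x y. x \<in> annulus \<Longrightarrow> y \<in> ball 0 1 \<Longrightarrow> \<bar>K (x, y)\<bar> \<le> B"
    using K unfolding bounded_kernel_def by blast+
  have [measurable]: "f \<in> borel_measurable borel" "g \<in> borel_measurable borel" using f g by auto
  let ?F = "\<lambda>z. f (fst z) * K z * g (snd z)" and ?G = "\<lambda>z::'a \<times> 'a. B * (\<bar>f (fst z)\<bar> * \<bar>g (snd z)\<bar>)"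
  have m: "?F \<in> borel_measurable (lborel \<Otimes>\<^sub>M lborel)" by measurable
  have t: "integrable (lborel \<Otimes>\<^sub>M lborel) (\<lambda>z. \<bar>f (fst z)\<bar> * \<bar>g (snd z)\<bar>)"
  proof (rule lborel_pair.Fubini_integrable)
    show "integrable lborel (\<lambda>x. \<integral>y. norm (\<bar>f (fst (x, y))\<bar> * \<bar>g (snd (x, y))\<bar>) \<partial>lborel)"
      using f g by (simp add: abs_mult)
    show "AE x in lborel. integrable lborel (\<lambda>y. \<bar>f (fst (x, y))\<bar> * \<bar>g (snd (x, y))\<bar>)"
      using g by simp
  qed measurable
  have le: "\<bar>?F z\<bar> \<le> ?G z" for z
  proof (cases "fst z \<in> annulus \<and> snd z \<in> ball 0 1")
    case True
    then have "\<bar>K z\<bar> \<le> B" using KB[of "fst z" "snd z"] by simp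
    then have "\<bar>K z\<bar> * (\<bar>f (fst z)\<bar> * \<bar>g (snd z)\<bar>) \<le> B * (\<bar>f (fst z)\<bar> * \<bar>g (snd z)\<bar>)"
      by (intro mult_right_mono) auto
    then show ?thesis by (simp add: abs_mult mult_ac)
  next
    case False
    then have "f (fst z) = 0 \<or> g (snd z) = 0" using f0 g0 by blast
    then show ?thesis by auto
  qed
  have tB: "integrable (lborel \<Otimes>\<^sub>M lborel) ?G" using t by (rule integrable_mult_right)
  show int: "integrable (lborel \<Otimes>\<^sub>M lborel) ?F"
  proof (rule Bochner_Integration.integrable_bound[OF tB m])
    show "AE z in lborel \<Otimes>\<^sub>M lborel. norm (?F z) \<le> norm (?G z)"
      using le by (intro AE_I2) (auto intro: order_trans[OF _ abs_ge_self])
  qed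
  have tI: "(LINT z|(lborel \<Otimes>\<^sub>M lborel). \<bar>f (fst z)\<bar> * \<bar>g (snd z)\<bar>) = (LINT x|lborel. \<bar>f x\<bar>) * (LINT y|lborel. \<bar>g y\<bar>)"
    using lborel_pair.integral_fst'[OF t] by simp
  have "\<bar>kernel_form f g K\<bar> \<le> (LINT z|(lborel \<Otimes>\<^sub>M lborel). \<bar>?F z\<bar>)"
    unfolding kernel_form_def by (rule integral_abs_bound)
  also have "\<dots> \<le> (LINT z|(lborel \<Otimes>\<^sub>M lborel). ?G z)"
    by (intro integral_mono integrable_abs int tB le)
  also have "\<dots> = B * (LINT x|lborel. \<bar>f x\<bar>) * (LINT y|lborel. \<bar>g y\<bar>)"
    by (simp add: tI)
  finally show "\<bar>kernel_form f g K\<bar> \<le> B * (LINT x|lborel. \<bar>f x\<bar>) * (LINT y|lborel. \<bar>g y\<bar>)" .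
  show "kernel_form f g K = (LINT x|lborel. f x * (LINT y|lborel. K (x, y) * g y))"
    unfolding kernel_form_def using lborel_pair.integral_fst'[OF int] by (simp add: mult.assoc)
qed

lemma bounded_kernel_power:
  "bounded_kernel (8 ^ k) (\<lambda>z. (9 - (norm (fst z - snd z))\<^sup>2) ^ k :: real)"
proof -
  have "\<bar>(9 - (norm (x - y))\<^sup>2) ^ k\<bar> \<le> 8 ^ k" if "x \<in> annulus" "y \<in> ball 0 1" for x y :: 'a
    using dist_annulus_ball[OF that] unfolding power_abs by (intro power_mono) auto
  then show ?thesis by (simp add: bounded_kernel_def)
qed

lemma kernel_form_sum:
  assumes fg: "admissible f g" and K: "\<And>k. k \<in> S \<Longrightarrow> bounded_kernel (B k) (K k)"
  shows "kernel_form f g (\<lambda>z. \<Sum>k\<in>S. c k * K k z) = (\<Sum>k\<in>S. c k * kernel_form f g (K k))"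
proof -
  have "kernel_form f g (\<lambda>z. \<Sum>k\<in>S. c k * K k z) = (LINT z|(lborel \<Otimes>\<^sub>M lborel). (\<Sum>k\<in>S. c k * (f (fst z) * K k z * g (snd z))))"
    unfolding kernel_form_def sum_distrib_left sum_distrib_right by (simp add: mult_ac)
  also have "\<dots> = (\<Sum>k\<in>S. c k * kernel_form f g (K k))"
    unfolding kernel_form_def using kernel_form_props(1)[OF fg K]
    by (subst Bochner_Integration.integral_sum) auto
  finally show ?thesis .
qed

lemma heat_form_Taylor:
  fixes f g :: "'a::euclidean_space \<Rightarrow> real"
  assumes fg: "admissible f g" and \<tau>: "\<tau> > 0"
  shows "\<bar>heat_form \<tau> f g - sqrt (\<tau> / pi) ^ DIM('a) * exp (- 9 * \<tau>) *
      (\<Sum>k<m. \<tau> ^ k / fact k * kernel_form f g (\<lambda>z. (9 - (norm (fst z - snd z))\<^sup>2) ^ k))\<bar> \<le>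
    sqrt (\<tau> / pi) ^ DIM('a) * ((16 / 17) ^ m * exp (- \<tau> / 2)) * (LINT x|lborel. \<bar>f x\<bar>) * (LINT y|lborel. \<bar>g y\<bar>)"
proof -
  let ?S = "sqrt (\<tau> / pi) ^ DIM('a)"
  let ?P = "\<lambda>k (z::'a \<times> 'a). (9 - (norm (fst z - snd z))\<^sup>2) ^ k"
  let ?H = "\<lambda>z::'a \<times> 'a. heat_kernel \<tau> (fst z - snd z)"
  let ?T = "\<lambda>z::'a \<times> 'a. \<Sum>k<m. ?S * exp (- 9 * \<tau>) * (\<tau> ^ k / fact k) * ?P k z"
  have H: "bounded_kernel ?S ?H"
    using heat_kernel_bound[OF \<tau>, where 'a = 'a] heat_kernel_nonneg[OF \<tau>, where 'a = 'a] by (simp add: bounded_kernel_def)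
  have hf: "heat_form \<tau> f g = kernel_form f g ?H"
    unfolding kernel_form_props(3)[OF fg H] heat_form_def by simp
  have kT: "kernel_form f g ?T = (\<Sum>k<m. ?S * exp (- 9 * \<tau>) * (\<tau> ^ k / fact k) * kernel_form f g (?P k))"
    by (rule kernel_form_sum[OF fg bounded_kernel_power])
  have Tm: "?T \<in> borel_measurable (borel \<Otimes>\<^sub>M borel)" by measurable
  have dB: "bounded_kernel (?S * ((16 / 17) ^ m * exp (- \<tau> / 2))) (\<lambda>z. ?H z - ?T z)"
    unfolding bounded_kernel_def
  proof (intro conjI ballI)
    show "(\<lambda>z. ?H z - ?T z) \<in> borel_measurable (borel \<Otimes>\<^sub>M borel)" by measurable
    fix x y :: 'a assume xy: "x \<in> annulus" "y \<in> ball 0 1"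
    let ?r = "(norm (x - y))\<^sup>2"
    have "?H (x, y) - ?T (x, y) = ?S * (exp (- \<tau> * ?r) - exp (- 9 * \<tau>) * (\<Sum>k<m. \<tau> ^ k / fact k * (9 - ?r) ^ k))"
      by (simp add: heat_kernel_def right_diff_distrib sum_distrib_left mult.assoc)
    then have "\<bar>?H (x, y) - ?T (x, y)\<bar> = ?S * \<bar>exp (- \<tau> * ?r) - exp (- 9 * \<tau>) * (\<Sum>k<m. \<tau> ^ k / fact k * (9 - ?r) ^ k)\<bar>"
      using \<tau> by (simp only: abs_mult abs_of_nonneg[OF zero_le_power[OF real_sqrt_ge_zero[OF divide_nonneg_pos[OF less_imp_le[OF \<tau>] pi_gt_zero]]]])
    also have "\<dots> \<le> ?S * ((16 / 17) ^ m * exp (- \<tau> / 2))"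
      using \<tau> by (intro mult_left_mono gaussian_Taylor dist_annulus_ball xy) auto
    finally show "\<bar>?H (x, y) - ?T (x, y)\<bar> \<le> ?S * ((16 / 17) ^ m * exp (- \<tau> / 2))" .
  qed
  have TI: "integrable (lborel \<Otimes>\<^sub>M lborel) (\<lambda>z. f (fst z) * ?T z * g (snd z))"
  proof -
    have "integrable (lborel \<Otimes>\<^sub>M lborel) (\<lambda>z. \<Sum>k<m. ?S * exp (- 9 * \<tau>) * (\<tau> ^ k / fact k) * (f (fst z) * ?P k z * g (snd z)))"
      by (intro Bochner_Integration.integrable_sum integrable_mult_right kernel_form_props(1)[OF fg bounded_kernel_power])
    then show ?thesis unfolding sum_distrib_left sum_distrib_right by (simp add: mult_ac)
  qed
  have "kernel_form f g (\<lambda>z. ?H z - ?T z) = kernel_form f g ?H - kernel_form f g ?T"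
    unfolding kernel_form_def
    by (subst Bochner_Integration.integral_diff[OF kernel_form_props(1)[OF fg H] TI, symmetric]) (simp add: algebra_simps)
  then have "heat_form \<tau> f g - ?S * exp (- 9 * \<tau>) * (\<Sum>k<m. \<tau> ^ k / fact k * kernel_form f g (?P k)) = kernel_form f g (\<lambda>z. ?H z - ?T z)"
    unfolding hf kT by (simp add: sum_distrib_left mult.assoc)
  then show ?thesis using kernel_form_props(2)[OF fg dB] by simp
qed

section \<open>Integration over the Gaussian parameter\<close>

text \<open>Up to sign and the factor \<open>gauss_const s\<close>, the coefficient with which the
  k-th power of 9 - |x - y|^2 enters the kernel of the fractional Laplacian.\<close>

definition heat_moment :: "'a::euclidean_space itself \<Rightarrow> real \<Rightarrow> nat \<Rightarrow> real" where
  "heat_moment _ s k = (LINT \<tau>|lborel. power_density s \<tau> * (sqrt (\<tau> / pi) ^ DIM('a) * exp (- 9 * \<tau>) * (\<tau> ^ k / fact k)))"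

definition heat_mass :: "'a::euclidean_space itself \<Rightarrow> real \<Rightarrow> real" where
  "heat_mass _ s = (LINT \<tau>|lborel. power_density s \<tau> * (sqrt (\<tau> / pi) ^ DIM('a) * exp (- \<tau> / 2)))"

text \<open>The Gamma integral with parameter s + n / 2, after halving the variable.\<close>

lemma heat_mass_integrable:
  assumes s: "0 < s"
  shows "integrable lborel (\<lambda>\<tau>. power_density s \<tau> * (sqrt (\<tau> / pi) ^ DIM('a::euclidean_space) * exp (- \<tau> / 2)))"
proof -
  let ?x = "s + DIM('a) / 2"
  let ?f = "\<lambda>t::real. indicator {0..} t * (t powr (?x - 1) / exp t)"
  have x: "?x > 0" using s by simp
  have "integrable lborel ?f"
    by (rule integrable_of_has_integral[OF _ Gamma_integral_real[OF x]]) auto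
  then have "integrable lborel (\<lambda>\<tau>. ?f (0 + 1 / 2 * \<tau>))" by (rule lborel_integrable_real_affine) simp
  then have "integrable lborel (\<lambda>\<tau>. (2 powr (?x - 1) * pi powr (- (DIM('a) / 2))) * ?f (0 + 1 / 2 * \<tau>))"
    by (rule integrable_mult_right)
  moreover have "(2 powr (?x - 1) * pi powr (- (DIM('a) / 2))) * ?f (0 + 1 / 2 * \<tau>) =
      power_density s \<tau> * (sqrt (\<tau> / pi) ^ DIM('a) * exp (- \<tau> / 2))" for \<tau>
  proof (cases "\<tau> > 0")
    case True
    have "sqrt (\<tau> / pi) ^ DIM('a) = (\<tau> / pi) powr (DIM('a) / 2)"
    proof -
      have x0: "\<tau> / pi > 0" using True by simp
      have "sqrt (\<tau> / pi) ^ DIM('a) = ((\<tau> / pi) powr (1 / 2)) powr real DIM('a)"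
        by (simp only: powr_half_sqrt[OF less_imp_le[OF x0]] powr_realpow[OF real_sqrt_gt_zero[OF x0]])
      then show ?thesis by (simp add: powr_powr)
    qed
    also have "\<dots> = \<tau> powr (DIM('a) / 2) * pi powr (- (DIM('a) / 2))"
      using True by (simp add: powr_divide powr_minus_divide)
    finally have 1: "sqrt (\<tau> / pi) ^ DIM('a) = \<tau> powr (DIM('a) / 2) * pi powr (- (DIM('a) / 2))" .
    have 2: "\<tau> powr (?x - 1) = \<tau> powr (s - 1) * \<tau> powr (DIM('a) / 2)"
      by (simp add: powr_add[symmetric] algebra_simps)
    have 3: "\<tau> powr (?x - 1) = 2 powr (?x - 1) * (0 + 1 / 2 * \<tau>) powr (?x - 1)"
      using True by (subst powr_mult[symmetric]) auto
    have i: "indicator {0..} (0 + 1 / 2 * \<tau>) = (1 :: real)" using True by simp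
    have e: "1 / exp (0 + 1 / 2 * \<tau>) = exp (- \<tau> / 2)" by (simp add: exp_minus inverse_eq_divide)
    have pd: "power_density s \<tau> = \<tau> powr (s - 1)" using True by (simp add: power_density_def)
    have alg: "A * B * (1 * (C / X)) = (A * C) * B * (1 / X)" for A B C X :: real by simp
    show ?thesis unfolding i alg 3[symmetric] e 1 pd 2 by (simp only: mult_ac)
  qed (auto simp: power_density_def indicator_def)
  ultimately show ?thesis by simp
qed

text \<open>The Taylor term is at most exp \<tau>, which the factor exp (- 9 \<tau>) absorbs; hence
  the bound is uniform in \<open>k\<close>.\<close>

lemma heat_moment_bound:
  assumes s: "0 < s"
  shows "integrable lborel (\<lambda>\<tau>. power_density s \<tau> * (sqrt (\<tau> / pi) ^ DIM('a::euclidean_space) * exp (- 9 * \<tau>) * (\<tau> ^ k / fact k)))"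
    and "0 \<le> heat_moment TYPE('a) s k" "heat_moment TYPE('a) s k \<le> heat_mass TYPE('a) s"
proof -
  let ?f = "\<lambda>\<tau>. power_density s \<tau> * (sqrt (\<tau> / pi) ^ DIM('a) * exp (- 9 * \<tau>) * (\<tau> ^ k / fact k))"
  let ?g = "\<lambda>\<tau>. power_density s \<tau> * (sqrt (\<tau> / pi) ^ DIM('a) * exp (- \<tau> / 2))"
  have b: "0 \<le> ?f \<tau> \<and> ?f \<tau> \<le> ?g \<tau>" for \<tau>
  proof (cases "\<tau> > 0")
    case True
    have "exp (- 9 * \<tau>) * (\<tau> ^ k / fact k) \<le> exp (- 9 * \<tau>) * exp \<tau>"
      using True by (intro mult_left_mono power_div_fact_le_exp) auto
    also have "\<dots> = exp (- 8 * \<tau>)" by (simp add: exp_add[symmetric])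
    also have "\<dots> \<le> exp (- \<tau> / 2)" using True by simp
    finally have "sqrt (\<tau> / pi) ^ DIM('a) * (exp (- 9 * \<tau>) * (\<tau> ^ k / fact k)) \<le> sqrt (\<tau> / pi) ^ DIM('a) * exp (- \<tau> / 2)"
      using True by (intro mult_left_mono) auto
    then have "?f \<tau> \<le> ?g \<tau>" by (intro mult_left_mono) (auto simp: mult.assoc)
    moreover have "0 \<le> ?f \<tau>" using True by (intro mult_nonneg_nonneg) auto
    ultimately show ?thesis by simp
  qed (simp add: power_density_def)
  show int: "integrable lborel ?f"
  proof (rule Bochner_Integration.integrable_bound[OF heat_mass_integrable[OF s, where 'a = 'a]])
    show "AE \<tau> in lborel. norm (?f \<tau>) \<le> norm (?g \<tau>)"
    proof (rule AE_I2)
      fix \<tau> show "norm (?f \<tau>) \<le> norm (?g \<tau>)" unfolding real_norm_def using b[of \<tau>] by linarith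
    qed
  qed measurable
  show "0 \<le> heat_moment TYPE('a) s k" unfolding heat_moment_def using b by (intro integral_nonneg_AE AE_I2) blast
  show "heat_moment TYPE('a) s k \<le> heat_mass TYPE('a) s"
    unfolding heat_moment_def heat_mass_def using b by (intro integral_mono int heat_mass_integrable s) blast
qed

text \<open>The expansion of the Gaussian is integrated over \<tau>. The sum enters with a plus sign
  because the form is minus the superposition of heat forms.\<close>

lemma frac_form_Taylor:
  fixes f g :: "'a::euclidean_space \<Rightarrow> real"
  assumes s: "0 < s" "s < 1" and fg: "admissible f g" and H: "f \<in> Hs s" "g \<in> Hs s"
  shows "\<bar>gauss_const s * frac_form s f g + (\<Sum>k<m. heat_moment TYPE('a) s k * kernel_form f g (\<lambda>z. (9 - (norm (fst z - snd z))\<^sup>2) ^ k))\<bar>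
    \<le> (16 / 17) ^ m * heat_mass TYPE('a) s * (LINT x|lborel. \<bar>f x\<bar>) * (LINT y|lborel. \<bar>g y\<bar>)"
proof -
  let ?P = "\<lambda>k. kernel_form f g (\<lambda>z. (9 - (norm (fst z - snd z))\<^sup>2) ^ k)"
  let ?w = "\<lambda>k \<tau>. power_density s \<tau> * (sqrt (\<tau> / pi) ^ DIM('a) * exp (- 9 * \<tau>) * (\<tau> ^ k / fact k))"
  let ?v = "\<lambda>\<tau>. power_density s \<tau> * (sqrt (\<tau> / pi) ^ DIM('a) * exp (- \<tau> / 2))"
  let ?N = "(LINT x|lborel. \<bar>f x\<bar>) * (LINT y|lborel. \<bar>g y\<bar>)"
  have disj: "f x * g x = 0" for x
    using fg by (cases "x \<in> annulus") (auto simp: admissible_def annulus_iff)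
  have fi: "integrable lborel f" "integrable lborel g" using fg by (auto simp: admissible_def)
  note FH = frac_form_heat[OF s H(1) fi(1) H(2) fi(2) disj]
  have wk: "integrable lborel (\<lambda>\<tau>. ?w k \<tau> * ?P k)" for k
    by (rule integrable_mult_left[OF heat_moment_bound(1)[OF s(1)]])
  have wI: "integrable lborel (\<lambda>\<tau>. \<Sum>k<m. ?w k \<tau> * ?P k)"
    by (rule Bochner_Integration.integrable_sum[OF wk])
  have "(LINT \<tau>|lborel. (\<Sum>k<m. ?w k \<tau> * ?P k)) = (\<Sum>k<m. heat_moment TYPE('a) s k * ?P k)"
    unfolding heat_moment_def integral_mult_left_zero[symmetric] by (rule Bochner_Integration.integral_sum[OF wk])
  then have "gauss_const s * frac_form s f g + (\<Sum>k<m. heat_moment TYPE('a) s k * ?P k) =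
      - ((LINT \<tau>|lborel. power_density s \<tau> * heat_form \<tau> f g) - (LINT \<tau>|lborel. (\<Sum>k<m. ?w k \<tau> * ?P k)))"
    unfolding FH(2) by simp
  also have "\<dots> = - (LINT \<tau>|lborel. power_density s \<tau> * heat_form \<tau> f g - (\<Sum>k<m. ?w k \<tau> * ?P k))"
    by (simp only: Bochner_Integration.integral_diff[OF FH(1) wI])
  finally have "\<bar>gauss_const s * frac_form s f g + (\<Sum>k<m. heat_moment TYPE('a) s k * ?P k)\<bar> =
      norm (LINT \<tau>|lborel. power_density s \<tau> * heat_form \<tau> f g - (\<Sum>k<m. ?w k \<tau> * ?P k))" by simp
  also have "\<dots> \<le> (LINT \<tau>|lborel. ?v \<tau> * ((16 / 17) ^ m * ?N))"
  proof (rule Bochner_Integration.integral_norm_bound_integral)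
    show "integrable lborel (\<lambda>\<tau>. power_density s \<tau> * heat_form \<tau> f g - (\<Sum>k<m. ?w k \<tau> * ?P k))"
      by (rule Bochner_Integration.integrable_diff[OF FH(1) wI])
    show "integrable lborel (\<lambda>\<tau>. ?v \<tau> * ((16 / 17) ^ m * ?N))"
      by (rule integrable_mult_left[OF heat_mass_integrable[OF s(1)]])
    fix \<tau>
    show "norm (power_density s \<tau> * heat_form \<tau> f g - (\<Sum>k<m. ?w k \<tau> * ?P k)) \<le> ?v \<tau> * ((16 / 17) ^ m * ?N)"
    proof (cases "\<tau> > 0")
      case True
      have "power_density s \<tau> * heat_form \<tau> f g - (\<Sum>k<m. ?w k \<tau> * ?P k) =
        power_density s \<tau> * (heat_form \<tau> f g - sqrt (\<tau> / pi) ^ DIM('a) * exp (- 9 * \<tau>) * (\<Sum>k<m. \<tau> ^ k / fact k * ?P k))"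
        by (simp add: right_diff_distrib sum_distrib_left mult.assoc)
      then have "norm (power_density s \<tau> * heat_form \<tau> f g - (\<Sum>k<m. ?w k \<tau> * ?P k)) =
        power_density s \<tau> * \<bar>heat_form \<tau> f g - sqrt (\<tau> / pi) ^ DIM('a) * exp (- 9 * \<tau>) * (\<Sum>k<m. \<tau> ^ k / fact k * ?P k)\<bar>"
        by (simp only: real_norm_def abs_mult abs_of_nonneg[OF power_density_nonneg])
      also have "\<dots> \<le> power_density s \<tau> * (sqrt (\<tau> / pi) ^ DIM('a) * ((16 / 17) ^ m * exp (- \<tau> / 2)) * (LINT x|lborel. \<bar>f x\<bar>) * (LINT y|lborel. \<bar>g y\<bar>))"
        by (intro mult_left_mono heat_form_Taylor[OF fg True]) simp
      finally show ?thesis by (simp only: mult_ac)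
    qed (simp add: power_density_def)
  qed
  also have "\<dots> = (16 / 17) ^ m * heat_mass TYPE('a) s * (LINT x|lborel. \<bar>f x\<bar>) * (LINT y|lborel. \<bar>g y\<bar>)"
    unfolding integral_mult_left_zero heat_mass_def by (simp only: mult_ac)
  finally show ?thesis .
qed

section \<open>Factorisation of the Taylor terms\<close>

abbreviation letters :: "('a::euclidean_space + bool) set" where
  "letters \<equiv> Basis <+> UNIV"

text \<open>9 - |x - y|^2 splits as 2 x \<bullet> y, one product per coordinate, plus (9 - |x|^2)
  times 1, plus -1 times |y|^2. These n + 2 products are the origin of the exponent \<open>d\<close>
  in the rank.\<close>

definition left_letter :: "'a::euclidean_space \<Rightarrow> 'a + bool \<Rightarrow> real" where
  "left_letter x i = (case i of Inl e \<Rightarrow> 2 * (x \<bullet> e) | Inr b \<Rightarrow> if b then 9 - (norm x)\<^sup>2 else - 1)"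

definition right_letter :: "'a::euclidean_space \<Rightarrow> 'a + bool \<Rightarrow> real" where
  "right_letter y i = (case i of Inl e \<Rightarrow> y \<bullet> e | Inr b \<Rightarrow> if b then 1 else (norm y)\<^sup>2)"

lemma letters_sum:
  fixes x y :: "'a::euclidean_space"
  shows "9 - (norm (x - y))\<^sup>2 = (\<Sum>i\<in>letters. right_letter y i * left_letter x i)"
proof -
  have "(\<Sum>i\<in>letters. right_letter y i * left_letter x i) = (\<Sum>e\<in>Basis. (y \<bullet> e) * (2 * (x \<bullet> e))) + (9 - (norm x)\<^sup>2 - (norm y)\<^sup>2)"
    by (simp add: sum.Plus right_letter_def left_letter_def UNIV_bool)
  also have "(\<Sum>e\<in>Basis. (y \<bullet> e) * (2 * (x \<bullet> e))) = 2 * (x \<bullet> y)"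
    by (subst euclidean_inner[of x y]) (simp add: sum_distrib_left mult_ac)
  finally show ?thesis by (simp add: power2_norm_eq_inner inner_diff inner_commute)
qed

lemma left_letter_bound: "x \<in> annulus \<Longrightarrow> i \<in> letters \<Longrightarrow> \<bar>left_letter x i\<bar> \<le> 9"
proof -
  assume x: "x \<in> annulus" and i: "i \<in> letters"
  have n: "2 < norm x" "norm x < 3" using x by (auto simp: annulus_iff)
  have "(norm x)\<^sup>2 \<le> 3\<^sup>2" using n by (intro power_mono) auto
  then have sq: "\<bar>9 - (norm x)\<^sup>2\<bar> \<le> 9" by (simp add: abs_le_iff)
  show ?thesis
  proof (cases i)
    case (Inl e)
    then have "\<bar>x \<bullet> e\<bar> \<le> norm x" using i by (auto intro: Basis_le_norm)
    then show ?thesis using n Inl by (simp add: left_letter_def abs_mult)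
  next
    case (Inr b) then show ?thesis using sq by (simp add: left_letter_def)
  qed
qed

lemma right_letter_bound: "y \<in> ball 0 1 \<Longrightarrow> i \<in> letters \<Longrightarrow> \<bar>right_letter y i\<bar> \<le> 1"
proof -
  assume y: "y \<in> ball 0 1" and i: "i \<in> letters"
  have n: "norm y \<le> 1" using y by simp
  then have sq: "(norm y)\<^sup>2 \<le> 1" by (simp add: power_le_one)
  show ?thesis
  proof (cases i)
    case (Inl e)
    then have "\<bar>y \<bullet> e\<bar> \<le> norm y" using i by (auto intro: Basis_le_norm)
    then show ?thesis using n Inl by (simp add: right_letter_def)
  next
    case (Inr b) then show ?thesis using sq by (simp add: right_letter_def)
  qed
qed

lemma letter_measurable [measurable]:
  "(\<lambda>x. left_letter x i) \<in> borel_measurable borel" "(\<lambda>x. right_letter x i) \<in> borel_measurable borel"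
  unfolding left_letter_def right_letter_def by (cases i; simp)+

definition right_factor :: "('a::euclidean_space + bool \<Rightarrow> nat) \<Rightarrow> 'a \<Rightarrow> real" where
  "right_factor \<beta> y = indicator (ball 0 1) y * (\<Prod>i\<in>letters. right_letter y i ^ \<beta> i)"

text \<open>Only words whose length is the total of the counts \<beta> contribute, so at most one
  term of the sum is nonzero; summing over all \<open>k < m\<close> lets one index set serve every
  degree. The sign and the division by \<open>gauss_const s\<close> come from the subordination
  formula.\<close>

definition left_factor :: "real \<Rightarrow> nat \<Rightarrow> ('a::euclidean_space + bool \<Rightarrow> nat) \<Rightarrow> 'a \<Rightarrow> real" where
  "left_factor s m \<beta> x = indicator annulus x *
     (- (1 / gauss_const s) * (\<Sum>k<m. heat_moment TYPE('a) s k * word_sum letters k (left_letter x) \<beta>))"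

lemma finite_letters: "finite (letters :: ('a::euclidean_space + bool) set)"
  by simp

lemma card_letters: "card (letters :: ('a::euclidean_space + bool) set) = DIM('a) + 2"
  by (simp add: card_Plus)

lemma right_prod_bound:
  "y \<in> ball 0 1 \<Longrightarrow> \<bar>\<Prod>i\<in>letters. right_letter y i ^ \<beta> i\<bar> \<le> 1"
  unfolding abs_prod power_abs by (intro prod_le_1) (auto intro!: power_le_one right_letter_bound)

lemma word_sum_letters_bound:
  fixes x :: "'a::euclidean_space"
  assumes "x \<in> annulus"
  shows "\<bar>word_sum letters k (left_letter x) \<beta>\<bar> \<le> (9 * (real DIM('a) + 2)) ^ k"
proof -
  have "\<bar>word_sum letters k (left_letter x) \<beta>\<bar> \<le> (real (card (letters :: ('a + bool) set)) * 9) ^ k"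
    by (rule word_sum_bound[OF finite_letters]) (rule left_letter_bound[OF assms])
  then show ?thesis by (simp add: card_letters algebra_simps)
qed

lemma word_sum_measurable [measurable]:
  "(\<lambda>x. word_sum letters k (left_letter x) \<beta>) \<in> borel_measurable borel"
  unfolding word_sum_def by measurable

lemma right_prod_measurable [measurable]:
  "(\<lambda>y. \<Prod>i\<in>letters. right_letter y i ^ \<beta> i) \<in> borel_measurable borel"
  by measurable

lemma right_factor_measurable: "right_factor \<beta> \<in> borel_measurable borel"
  unfolding right_factor_def[abs_def]
  by (intro borel_measurable_times borel_measurable_indicator right_prod_measurable) auto

lemma left_factor_measurable: "left_factor s m \<beta> \<in> borel_measurable borel"
  unfolding left_factor_def[abs_def]
  by (intro borel_measurable_times borel_measurable_indicator borel_measurable_sum borel_measurable_const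
      word_sum_measurable annulus_borel)

lemma L2_norm_of_bounded_support:
  fixes \<phi> :: "'a::euclidean_space \<Rightarrow> real"
  assumes "\<phi> \<in> borel_measurable borel" "\<And>x. norm x > R \<Longrightarrow> \<phi> x = 0" "\<And>x. \<bar>\<phi> x\<bar> \<le> M"
  shows "\<phi> \<in> L2" "L2_norm UNIV \<phi> \<le> M * sqrt (measure lborel (cball (0::'a) R))"
proof -
  show "\<phi> \<in> L2" by (rule L2_of_bounded_support(2)[OF assms])
  have "0 \<le> M" using assms(3)[of 0] by linarith
  have "L2_norm UNIV \<phi> \<le> sqrt (M\<^sup>2 * measure lborel (cball (0::'a) R))"
    unfolding L2_norm_UNIV by (intro real_sqrt_le_mono L2_of_bounded_support(3)[OF assms])
  also have "\<dots> = M * sqrt (measure lborel (cball (0::'a) R))"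
    using \<open>0 \<le> M\<close> by (simp add: real_sqrt_mult)
  finally show "L2_norm UNIV \<phi> \<le> M * sqrt (measure lborel (cball (0::'a) R))" .
qed

lemma right_factor_L2:
  fixes \<beta> :: "'a::euclidean_space + bool \<Rightarrow> nat"
  shows "right_factor \<beta> \<in> L2" "L2_norm UNIV (right_factor \<beta>) \<le> sqrt (measure lborel (cball (0::'a) 3))"
proof -
  have 0: "right_factor \<beta> y = 0" if "3 < norm y" for y using that by (simp add: right_factor_def)
  have b: "\<bar>right_factor \<beta> y\<bar> \<le> 1" for y
    using right_prod_bound[of y \<beta>] by (cases "y \<in> ball 0 1") (auto simp: right_factor_def)
  show "right_factor \<beta> \<in> L2" "L2_norm UNIV (right_factor \<beta>) \<le> sqrt (measure lborel (cball (0::'a) 3))"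
    using L2_norm_of_bounded_support[OF right_factor_measurable 0 b] by auto
qed

lemma heat_mass_nonneg: "0 < s \<Longrightarrow> 0 \<le> heat_mass TYPE('a::euclidean_space) s"
  using heat_moment_bound(2,3)[of s 0, where 'a = 'a] by linarith

lemma left_factor_L2:
  fixes \<beta> :: "'a::euclidean_space + bool \<Rightarrow> nat"
  assumes s: "0 < s" "s < 1"
  shows "left_factor s m \<beta> \<in> L2"
    "L2_norm UNIV (left_factor s m \<beta>) \<le>
      (heat_mass TYPE('a) s / gauss_const s) * (18 * (real DIM('a) + 2)) ^ m * sqrt (measure lborel (cball (0::'a) 3))"
proof -
  let ?M = "heat_mass TYPE('a) s" and ?c = "9 * (real DIM('a) + 2)"
  have g: "gauss_const s > 0" by (rule gauss_const_pos[OF s])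
  have c1: "?c \<ge> 1" by simp
  have 0: "left_factor s m \<beta> x = 0" if "3 < norm x" for x
    using that by (simp add: left_factor_def)
  have b: "\<bar>left_factor s m \<beta> x\<bar> \<le> (?M / gauss_const s) * (18 * (real DIM('a) + 2)) ^ m" for x
  proof (cases "x \<in> annulus")
    case True
    have "\<bar>\<Sum>k<m. heat_moment TYPE('a) s k * word_sum letters k (left_letter x) \<beta>\<bar>
        \<le> (\<Sum>k<m. \<bar>heat_moment TYPE('a) s k * word_sum letters k (left_letter x) \<beta>\<bar>)" by (rule sum_abs)
    also have "\<dots> \<le> (\<Sum>k<m. ?M * ?c ^ m)"
    proof (rule sum_mono)
      fix k assume "k \<in> {..<m}"
      then have "?c ^ k \<le> ?c ^ m" using c1 by (intro power_increasing) auto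
      then have "\<bar>word_sum letters k (left_letter x) \<beta>\<bar> \<le> ?c ^ m"
        using word_sum_letters_bound[OF True, of k \<beta>] by linarith
      then have "\<bar>heat_moment TYPE('a) s k\<bar> * \<bar>word_sum letters k (left_letter x) \<beta>\<bar> \<le> ?M * ?c ^ m"
        using heat_moment_bound(2,3)[OF s(1), of k, where 'a = 'a] heat_mass_nonneg[OF s(1), where 'a = 'a]
        by (intro mult_mono) auto
      then show "\<bar>heat_moment TYPE('a) s k * word_sum letters k (left_letter x) \<beta>\<bar> \<le> ?M * ?c ^ m"
        by (simp only: abs_mult)
    qed
    also have "\<dots> = real m * (?M * ?c ^ m)" by simp
    \<comment> \<open>The number of terms is absorbed into the exponential, which doubles the base 9
      (n + 2) to 18 (n + 2).\<close>
    also have "\<dots> \<le> 2 ^ m * (?M * ?c ^ m)"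
      using of_nat_less_two_power[of m, where 'a = real] heat_mass_nonneg[OF s(1), where 'a = 'a]
      by (intro mult_right_mono) auto
    also have "\<dots> = ?M * (18 * (real DIM('a) + 2)) ^ m"
      by (simp add: power_mult_distrib[symmetric])
    finally have "1 / gauss_const s * \<bar>\<Sum>k<m. heat_moment TYPE('a) s k * word_sum letters k (left_letter x) \<beta>\<bar>
        \<le> 1 / gauss_const s * (?M * (18 * (real DIM('a) + 2)) ^ m)"
      using g by (intro mult_left_mono) auto
    then show ?thesis using True g by (simp add: left_factor_def abs_mult)
  next
    case False
    then show ?thesis using g heat_mass_nonneg[OF s(1), where 'a = 'a] by (simp add: left_factor_def)
  qed
  show "left_factor s m \<beta> \<in> L2" "L2_norm UNIV (left_factor s m \<beta>) \<le>
      (?M / gauss_const s) * (18 * (real DIM('a) + 2)) ^ m * sqrt (measure lborel (cball (0::'a) 3))"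
    using L2_norm_of_bounded_support[OF left_factor_measurable 0 b] by auto
qed

lemma bounded_kernel_separated:
  "bounded_kernel ((9 * (real DIM('a) + 2)) ^ k)
     (\<lambda>z::'a::euclidean_space \<times> 'a. (\<Prod>i\<in>letters. right_letter (snd z) i ^ \<beta> i) * word_sum letters k (left_letter (fst z)) \<beta>)"
  unfolding bounded_kernel_def
proof (intro conjI ballI)
  show "(\<lambda>z::'a \<times> 'a. (\<Prod>i\<in>letters. right_letter (snd z) i ^ \<beta> i) * word_sum letters k (left_letter (fst z)) \<beta>) \<in> borel_measurable (borel \<Otimes>\<^sub>M borel)"
    by measurable
  fix x y :: 'a assume xy: "x \<in> annulus" "y \<in> ball 0 1"
  show "\<bar>(\<Prod>i\<in>letters. right_letter (snd (x, y)) i ^ \<beta> i) * word_sum letters k (left_letter (fst (x, y))) \<beta>\<bar> \<le> (9 * (real DIM('a) + 2)) ^ k"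
    using mult_mono[OF right_prod_bound[OF xy(2), of \<beta>] word_sum_letters_bound[OF xy(1), of k \<beta>]]
    by (simp add: abs_mult)
qed

lemma kernel_form_power_separate:
  fixes f g :: "'a::euclidean_space \<Rightarrow> real"
  assumes fg: "admissible f g" and k: "k < m"
  shows "kernel_form f g (\<lambda>z. (9 - (norm (fst z - snd z))\<^sup>2) ^ k) =
    (\<Sum>\<beta>\<in>PiE letters (\<lambda>_. {..<m}). (LINT x|lborel. f x * word_sum letters k (left_letter x) \<beta>) * ip (right_factor \<beta>) g)"
proof -
  let ?A = "PiE (letters :: ('a + bool) set) (\<lambda>_. {..<m})"
  let ?K = "\<lambda>\<beta> (z::'a \<times> 'a). (\<Prod>i\<in>letters. right_letter (snd z) i ^ \<beta> i) * word_sum letters k (left_letter (fst z)) \<beta>"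
  have one: "kernel_form f g (?K \<beta>) = (LINT x|lborel. f x * word_sum letters k (left_letter x) \<beta>) * ip (right_factor \<beta>) g" for \<beta>
  proof -
    have r: "(\<Prod>i\<in>letters. right_letter y i ^ \<beta> i) * g y = right_factor \<beta> y \<bullet> g y" for y
      using fg by (cases "y \<in> ball 0 1") (auto simp: admissible_def right_factor_def)
    have "kernel_form f g (?K \<beta>) = (LINT x|lborel. f x * (LINT y|lborel. word_sum letters k (left_letter x) \<beta> * (right_factor \<beta> y \<bullet> g y)))"
      unfolding kernel_form_props(3)[OF fg bounded_kernel_separated] r[symmetric] by (simp add: mult_ac)
    also have "\<dots> = (LINT x|lborel. f x * word_sum letters k (left_letter x) \<beta> * ip (right_factor \<beta>) g)"
      unfolding integral_mult_right_zero ip_def by (simp only: mult.assoc)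
    finally show ?thesis by (simp only: integral_mult_left_zero)
  qed
  have "(9 - (norm (fst z - snd z))\<^sup>2) ^ k = (\<Sum>\<beta>\<in>?A. 1 * ?K \<beta> z)" for z :: "'a \<times> 'a"
    unfolding letters_sum power_sum_separate[OF finite_letters k] by simp
  then have "kernel_form f g (\<lambda>z. (9 - (norm (fst z - snd z))\<^sup>2) ^ k) = kernel_form f g (\<lambda>z. \<Sum>\<beta>\<in>?A. 1 * ?K \<beta> z)"
    by (simp only:)
  also have "\<dots> = (\<Sum>\<beta>\<in>?A. 1 * kernel_form f g (?K \<beta>))"
    by (rule kernel_form_sum[OF fg bounded_kernel_separated])
  finally show ?thesis by (simp add: one)
qed

text \<open>After exchanging the sums over \<beta> and \<open>k\<close>, the inner sum is the
  separated k-th Taylor term. The error is that of the Taylor expansion, divided by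
  \<open>gauss_const s\<close>.\<close>

lemma frac_form_low_rank_admissible:
  fixes f g :: "'a::euclidean_space \<Rightarrow> real"
  assumes s: "0 < s" "s < 1" and fg: "admissible f g" and H: "f \<in> Hs s" "g \<in> Hs s"
  shows "\<bar>frac_form s f g - (\<Sum>\<beta>\<in>PiE letters (\<lambda>_. {..<m}). ip (left_factor s m \<beta>) f * ip (right_factor \<beta>) g)\<bar>
    \<le> heat_mass TYPE('a) s / gauss_const s * (16 / 17) ^ m * (LINT x|lborel. \<bar>f x\<bar>) * (LINT y|lborel. \<bar>g y\<bar>)"
proof -
  let ?A = "PiE (letters :: ('a + bool) set) (\<lambda>_. {..<m})"
  let ?W = "\<lambda>k x \<beta>. word_sum letters k (left_letter x) \<beta>"
  have g0: "gauss_const s > 0" by (rule gauss_const_pos[OF s])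
  have fi: "integrable lborel f" using fg by (simp add: admissible_def)
  have fW: "integrable lborel (\<lambda>x. f x * ?W k x \<beta>)" for k \<beta>
  proof (rule Bochner_Integration.integrable_bound)
    show "integrable lborel (\<lambda>x. (9 * (real DIM('a) + 2)) ^ k * f x)" using fi by simp
    show "AE x in lborel. norm (f x * ?W k x \<beta>) \<le> norm ((9 * (real DIM('a) + 2)) ^ k * f x)"
    proof (rule AE_I2)
      fix x show "norm (f x * ?W k x \<beta>) \<le> norm ((9 * (real DIM('a) + 2)) ^ k * f x)"
      proof (cases "x \<in> annulus")
        case True
        show ?thesis using mult_right_mono[OF word_sum_letters_bound[OF True, of k \<beta>] abs_ge_zero[of "f x"]]
          by (simp add: abs_mult mult.commute)
      next
        case False
        then have "f x = 0" using fg unfolding admissible_def by blast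
        then show ?thesis by simp
      qed
    qed
  qed (use fi in measurable)
  have lf: "ip (left_factor s m \<beta>) f = - (1 / gauss_const s) * (\<Sum>k<m. heat_moment TYPE('a) s k * (LINT x|lborel. f x * ?W k x \<beta>))" for \<beta>
  proof -
    have "left_factor s m \<beta> x \<bullet> f x = - (1 / gauss_const s) * (\<Sum>k<m. heat_moment TYPE('a) s k * (f x * ?W k x \<beta>))" for x
    proof (cases "x \<in> annulus")
      case True then show ?thesis by (simp add: left_factor_def sum_distrib_left sum_distrib_right mult_ac)
    next
      case False
      then have "f x = 0" using fg unfolding admissible_def by blast
      then show ?thesis by simp
    qed
    then have "ip (left_factor s m \<beta>) f = (LINT x|lborel. - (1 / gauss_const s) * (\<Sum>k<m. heat_moment TYPE('a) s k * (f x * ?W k x \<beta>)))"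
      unfolding ip_def by (simp only:)
    also have "\<dots> = - (1 / gauss_const s) * (LINT x|lborel. (\<Sum>k<m. heat_moment TYPE('a) s k * (f x * ?W k x \<beta>)))"
      by (rule integral_mult_right_zero)
    also have "(LINT x|lborel. (\<Sum>k<m. heat_moment TYPE('a) s k * (f x * ?W k x \<beta>))) = (\<Sum>k<m. LINT x|lborel. heat_moment TYPE('a) s k * (f x * ?W k x \<beta>))"
      by (rule Bochner_Integration.integral_sum) (rule integrable_mult_right[OF fW])
    finally show ?thesis by (simp only: integral_mult_right_zero)
  qed
  have "(\<Sum>\<beta>\<in>?A. ip (left_factor s m \<beta>) f * ip (right_factor \<beta>) g) =
      - (1 / gauss_const s) * (\<Sum>\<beta>\<in>?A. \<Sum>k<m. heat_moment TYPE('a) s k * ((LINT x|lborel. f x * ?W k x \<beta>) * ip (right_factor \<beta>) g))"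
    unfolding lf sum_distrib_left sum_distrib_right by (simp only: mult.assoc)
  also have "\<dots> = - (1 / gauss_const s) * (\<Sum>k<m. heat_moment TYPE('a) s k * (\<Sum>\<beta>\<in>?A. (LINT x|lborel. f x * ?W k x \<beta>) * ip (right_factor \<beta>) g))"
    by (subst sum.swap) (simp only: sum_distrib_left)
  also have "\<dots> = - (1 / gauss_const s) * (\<Sum>k<m. heat_moment TYPE('a) s k * kernel_form f g (\<lambda>z. (9 - (norm (fst z - snd z))\<^sup>2) ^ k))"
    using kernel_form_power_separate[OF fg, of _ m] by simp
  finally have "frac_form s f g - (\<Sum>\<beta>\<in>?A. ip (left_factor s m \<beta>) f * ip (right_factor \<beta>) g) =
      (1 / gauss_const s) * (gauss_const s * frac_form s f g + (\<Sum>k<m. heat_moment TYPE('a) s k * kernel_form f g (\<lambda>z. (9 - (norm (fst z - snd z))\<^sup>2) ^ k)))"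
    using g0 by (simp add: distrib_left)
  then have "\<bar>frac_form s f g - (\<Sum>\<beta>\<in>?A. ip (left_factor s m \<beta>) f * ip (right_factor \<beta>) g)\<bar> =
      (1 / gauss_const s) * \<bar>gauss_const s * frac_form s f g + (\<Sum>k<m. heat_moment TYPE('a) s k * kernel_form f g (\<lambda>z. (9 - (norm (fst z - snd z))\<^sup>2) ^ k))\<bar>"
    using g0 by (simp only: abs_mult abs_of_nonneg[of "1 / gauss_const s"] zero_le_divide_1_iff less_imp_le)
  also have "\<dots> \<le> (1 / gauss_const s) * ((16 / 17) ^ m * heat_mass TYPE('a) s * (LINT x|lborel. \<bar>f x\<bar>) * (LINT y|lborel. \<bar>g y\<bar>))"
    using g0 by (intro mult_left_mono frac_form_Taylor[OF s fg H]) auto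
  finally show ?thesis by (simp add: mult_ac)
qed

lemma Hs_cong_AE:
  assumes u: "u \<in> Hs s" and v: "v \<in> L2" and eq: "AE x in lborel. u x = v x"
  shows "v \<in> Hs s" "AE \<xi> in lborel. weighted m u \<xi> = weighted m v \<xi>"
proof -
  have f: "AE \<xi> in lborel. fourier u \<xi> = fourier v \<xi>" by (rule fourier_cong_AE[OF Hs_L2[OF u] v eq])
  then show "AE \<xi> in lborel. weighted m u \<xi> = weighted m v \<xi>" by eventually_elim (simp add: weighted_def)
  have "AE \<xi> in lborel. norm (weighted (bessel s) v \<xi>) \<le> norm (weighted (bessel s) u \<xi>)"
    using f by eventually_elim (simp add: weighted_def)
  moreover have "weighted (bessel s) u \<in> L2" using u by (simp add: Hs_iff)
  ultimately have "weighted (bessel s) v \<in> L2"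
    by (rule L2_bound[OF weighted_measurable[OF bessel_measurable v], rotated])
  then show "v \<in> Hs s" using v by (simp add: Hs_iff)
qed

lemma frac_form_cong_AE:
  assumes u: "u \<in> Hs s" and u': "u' \<in> L2" "AE x in lborel. u x = u' x"
    and v: "v \<in> Hs s" and v': "v' \<in> L2" "AE x in lborel. v x = v' x"
  shows "frac_form s u v = frac_form s u' v'"
  unfolding frac_form_def
  by (intro ip_cong_AE weighted_measurable riesz_measurable Hs_L2[OF u] Hs_L2[OF v] u' v' Hs_cong_AE(2)[OF u] Hs_cong_AE(2)[OF v])

text \<open>The form in which the kernel enters the rest of the proof: all constants are merged into
  \<open>C\<close> and \<open>R\<close>, and integrals of moduli become \<open>L2\<close> norms
  because the supports are bounded. Right factors are bounded uniformly, whereas the bound on left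
  factors grows exponentially in \<open>m\<close>.\<close>

lemma frac_form_low_rank:
  assumes s: "0 < s" "s < 1"
  obtains C R where "C \<ge> 1" "R \<ge> 1"
    "\<And>m (\<beta> :: 'a::euclidean_space + bool \<Rightarrow> nat). L2_norm UNIV (right_factor \<beta>) \<le> C"
    "\<And>m (\<beta> :: 'a + bool \<Rightarrow> nat). L2_norm UNIV (left_factor s m \<beta>) \<le> C * R ^ m"
    "\<And>m f g. f \<in> Htilde s (annulus :: 'a set) \<Longrightarrow> g \<in> Htilde s (ball 0 1) \<Longrightarrow>
      \<bar>frac_form s f g - (\<Sum>\<beta>\<in>PiE letters (\<lambda>_. {..<m}). ip (left_factor s m \<beta>) f * ip (right_factor \<beta>) g)\<bar>
        \<le> C * (16 / 17) ^ m * L2_norm UNIV f * L2_norm UNIV g"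
proof -
  let ?q = "heat_mass TYPE('a) s / gauss_const s" and ?v = "sqrt (measure lborel (cball (0::'a) 3))"
  let ?v1 = "sqrt (measure lborel (ball (0::'a) 1))" and ?v3 = "sqrt (measure lborel (ball (0::'a) 3))"
  let ?R = "18 * (real DIM('a) + 2)"
  have s0: "0 \<le> s" "s \<le> 1" using s by auto
  have q0: "0 \<le> ?q" using heat_mass_nonneg[OF s(1), where 'a = 'a] gauss_const_pos[OF s] by simp
  define C where "C = 1 + ?v + ?q * ?v + ?q * (?v3 * ?v1)"
  have v0: "0 \<le> ?q * ?v" "0 \<le> ?q * (?v3 * ?v1)" "0 \<le> ?v"
    by (rule mult_nonneg_nonneg[OF q0], simp)+ simp
  have C: "1 \<le> C" "?v \<le> C" "?q * ?v \<le> C" "?q * (?v3 * ?v1) \<le> C" using v0 unfolding C_def by linarith+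
  show thesis
  proof (rule that[of C ?R])
    show "1 \<le> C" by (rule C)
    show "1 \<le> ?R" by simp
    show "L2_norm UNIV (right_factor \<beta>) \<le> C" for \<beta> :: "'a + bool \<Rightarrow> nat"
      using right_factor_L2(2)[of \<beta>] C(2) by linarith
    show "L2_norm UNIV (left_factor s m \<beta>) \<le> C * ?R ^ m" for m and \<beta> :: "'a + bool \<Rightarrow> nat"
    proof -
      have "L2_norm UNIV (left_factor s m \<beta>) \<le> (?q * ?v) * ?R ^ m"
        using left_factor_L2(2)[OF s, of m \<beta>] by (simp only: mult_ac)
      also have "\<dots> \<le> C * ?R ^ m" using C(3) by (rule mult_right_mono) simp
      finally show ?thesis .
    qed
    fix m and f g :: "'a \<Rightarrow> real"
    assume f: "f \<in> Htilde s annulus" and g: "g \<in> Htilde s (ball 0 1)"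
    \<comment> \<open>Representatives that vanish everywhere off the annulus and the ball; they
      differ from \<open>f\<close> and \<open>g\<close> on null sets only.\<close>
    define F where "F x = indicator annulus x * f x" for x
    define G where "G x = indicator (ball 0 1) x * g x" for x
    note fL = Htilde_L2[OF f] and gL = Htilde_L2[OF g] and fH = Htilde_Hs[OF f] and gH = Htilde_Hs[OF g]
    have Fm: "F \<in> borel_measurable borel" unfolding F_def[abs_def]
      by (intro borel_measurable_times borel_measurable_indicator annulus_borel L2_measurable fL)
    have Gm: "G \<in> borel_measurable borel" unfolding G_def[abs_def]
      by (intro borel_measurable_times borel_measurable_indicator borel_open open_ball L2_measurable gL)
    have F: "F \<in> L2" by (rule L2_bound[OF Fm fL]) (simp add: F_def indicator_def)
    have G: "G \<in> L2" by (rule L2_bound[OF Gm gL]) (simp add: G_def indicator_def)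
    have fF: "AE x in lborel. f x = F x"
      using Htilde_outside[OF f s0 annulus_borel]
    proof eventually_elim
      case (elim x)
      then show ?case by (cases "x \<in> annulus") (simp_all only: F_def indicator_simps simp_thms mult_1 mult_zero_left)
    qed
    have gG: "AE x in lborel. g x = G x"
      using Htilde_outside[OF g s0 borel_open[OF open_ball]]
    proof eventually_elim
      case (elim x)
      then show ?case by (cases "x \<in> ball 0 1") (simp_all only: G_def indicator_simps simp_thms mult_1 mult_zero_left)
    qed
    have "AE x in lborel. x \<notin> ball 0 3 \<longrightarrow> F x = 0" by (intro AE_I2) (simp add: F_def indicator_def)
    note F1 = L1_bound_of_support[OF F this]
    have "AE x in lborel. x \<notin> ball 0 1 \<longrightarrow> G x = 0" by (intro AE_I2) (simp add: G_def indicator_def)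
    note G1 = L1_bound_of_support[OF G this]
    have nF: "L2_norm UNIV f = L2_norm UNIV F" and nG: "L2_norm UNIV g = L2_norm UNIV G"
      by (intro L2_norm_cong_AE L2_measurable fL F fF gL G gG)+
    have "F x = 0" if "x \<notin> annulus" for x using that by (simp only: F_def indicator_simps mult_zero_left simp_thms)
    moreover have "G x = 0" if "x \<notin> ball 0 1" for x using that by (simp only: G_def indicator_simps mult_zero_left simp_thms)
    ultimately have adm: "admissible F G" unfolding admissible_def using F1(1) G1(1) by blast
    have ipF: "ip (left_factor s m \<beta>) f = ip (left_factor s m \<beta>) F" and ipG: "ip (right_factor \<beta>) g = ip (right_factor \<beta>) G" for \<beta>
      using fF gG by (auto intro!: ip_cong_AE L2_measurable left_factor_L2 right_factor_L2 s fL F gL G)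
    have ff: "frac_form s f g = frac_form s F G" by (rule frac_form_cong_AE[OF fH F fF gH G gG])
    have "\<bar>frac_form s f g - (\<Sum>\<beta>\<in>PiE letters (\<lambda>_. {..<m}). ip (left_factor s m \<beta>) f * ip (right_factor \<beta>) g)\<bar>
        \<le> ?q * (16 / 17) ^ m * (LINT x|lborel. \<bar>F x\<bar>) * (LINT y|lborel. \<bar>G y\<bar>)"
      unfolding ff ipF ipG
      by (rule frac_form_low_rank_admissible[OF s adm Hs_cong_AE(1)[OF fH F fF] Hs_cong_AE(1)[OF gH G gG]])
    also have "\<dots> \<le> ?q * (16 / 17) ^ m * (?v3 * L2_norm UNIV F) * (?v1 * L2_norm UNIV G)"
      using q0 by (intro mult_mono mult_left_mono F1 G1 mult_nonneg_nonneg) (auto intro!: integral_nonneg_AE)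
    also have "\<dots> = (?q * (?v3 * ?v1)) * ((16 / 17) ^ m * L2_norm UNIV f * L2_norm UNIV g)"
      unfolding nF nG by (simp only: mult_ac)
    also have "\<dots> \<le> C * ((16 / 17) ^ m * L2_norm UNIV f * L2_norm UNIV g)"
      using C(4) by (rule mult_right_mono) simp
    finally show "\<bar>frac_form s f g - (\<Sum>\<beta>\<in>PiE letters (\<lambda>_. {..<m}). ip (left_factor s m \<beta>) f * ip (right_factor \<beta>) g)\<bar>
        \<le> C * (16 / 17) ^ m * L2_norm UNIV f * L2_norm UNIV g" by (simp only: mult.assoc)
  qed
qed

section \<open>Partition into slabs\<close>

text \<open>
  Seen from a boundary point \<open>p\<close>, the direction \<open>e\<close> points to an interior ball; convexity gives
  a cone condition in a neighbourhood of \<open>p\<close>, and the boundary is the graph of the lower envelope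
  of these cones.
\<close>

lemma convex_lipschitz_set:
  fixes D :: "'a::euclidean_space set"
  assumes cvx: "convex D" and int: "interior D \<noteq> {}"
  shows "lipschitz_set D"
  unfolding lipschitz_set_def
proof (intro conjI ballI)
  show "D \<noteq> {}" using int interior_subset by blast
  fix p assume p: "p \<in> frontier D"
  obtain z where "z \<in> interior D" using int by blast
  then obtain \<rho> where \<rho>: "\<rho> > 0" "ball z \<rho> \<subseteq> D" by (auto simp: mem_interior)
  define d where "d = norm (z - p)"
  have "p \<notin> ball z \<rho>"
  proof
    assume "p \<in> ball z \<rho>"
    moreover have "ball z \<rho> \<subseteq> interior D" using \<rho> by (intro interior_maximal) auto
    ultimately show False using p by (auto simp: frontier_def)
  qed
  then have d\<rho>: "d \<ge> \<rho>" by (simp add: d_def dist_norm)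
  have d: "d > 0" using d\<rho> \<rho> by simp
  define e where "e = (1 / d) *\<^sub>R (z - p)"
  have e: "norm e = 1" using d by (simp add: e_def d_def)
  have de: "d *\<^sub>R e = z - p" using d by (simp add: e_def)
  \<comment> \<open>Any two points within \<open>r\<close> of \<open>p\<close> are less than
    \<open>d\<close> apart, and a cone of slope \<open>L\<close> has radius \<rho> / 2 at height
    \<open>d\<close>. A cone with apex near \<open>p\<close> therefore ends inside the ball around
    \<open>z\<close>.\<close>
  define r where "r = \<rho> / 4"
  define L where "L = 2 * d / \<rho>"
  have r: "r > 0" and L: "L > 0" using \<rho> d by (auto simp: r_def L_def)
  define \<pi> where "\<pi> x = x - (x \<bullet> e) *\<^sub>R e" for x
  have \<pi>_diff: "\<pi> x - \<pi> y = \<pi> (x - y)" for x y by (simp add: \<pi>_def inner_diff_left algebra_simps)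
  define S where "S = D \<inter> ball p r"
  define h where "h y x = x \<bullet> e + L * norm (y - \<pi> x)" for x y
  define \<phi> where "\<phi> y = (INF x\<in>S. h y x)" for y
  have "p \<in> closure D" using p by (simp add: frontier_def)
  then have S: "S \<noteq> {}" using r unfolding S_def closure_approachable by (force simp: dist_commute)
  have low: "p \<bullet> e - r \<le> h y x" if "x \<in> S" for x y
  proof -
    have "\<bar>(x - p) \<bullet> e\<bar> \<le> norm (x - p) * norm e" by (rule Cauchy_Schwarz_ineq2)
    also have "\<dots> < r" using that e by (simp add: S_def dist_norm norm_minus_commute)
    finally have "p \<bullet> e - r \<le> x \<bullet> e" by (simp add: inner_diff_left)
    moreover have "0 \<le> L * norm (y - \<pi> x)" using L by simp
    ultimately show ?thesis by (simp add: h_def)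
  qed
  have bdd: "bdd_below (h y ` S)" for y using low by (intro bdd_belowI[of _ "p \<bullet> e - r"]) auto
  have \<phi>_le: "\<phi> y \<le> h y x" if "x \<in> S" for x y unfolding \<phi>_def by (rule cINF_lower[OF bdd that])
  have \<phi>_Lip: "\<phi> y \<le> \<phi> y' + L * norm (y - y')" for y y'
  proof -
    have "\<phi> y - L * norm (y - y') \<le> \<phi> y'"
      unfolding \<phi>_def[of y']
    proof (rule cINF_greatest[OF S])
      fix x assume x: "x \<in> S"
      have "norm (y - \<pi> x) \<le> norm (y - y') + norm (y' - \<pi> x)" using norm_triangle_ineq[of "y - y'" "y' - \<pi> x"] by simp
      then have "L * norm (y - \<pi> x) \<le> L * (norm (y - y') + norm (y' - \<pi> x))" using L by (intro mult_left_mono) auto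
      then show "\<phi> y - L * norm (y - y') \<le> h y' x" using \<phi>_le[OF x, of y] by (simp add: h_def algebra_simps)
    qed
    then show ?thesis by simp
  qed
  have Lip: "L-lipschitz_on {y. y \<bullet> e = 0} \<phi>"
  proof (rule lipschitz_onI)
    fix y y'
    show "dist (\<phi> y) (\<phi> y') \<le> L * dist y y'"
      using \<phi>_Lip[of y y'] \<phi>_Lip[of y' y] by (simp add: dist_real_def dist_norm norm_minus_commute abs_le_iff)
  qed (use L in simp)
  have up: "x \<in> D" if x: "x \<in> ball p r" "x \<bullet> e > \<phi> (\<pi> x)" for x
  proof -
    obtain x0 where x0: "x0 \<in> S" "h (\<pi> x) x0 < x \<bullet> e"
      using x(2) unfolding \<phi>_def by (auto simp: cINF_less_iff[OF S bdd])
    define v where "v = x - x0"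
    define k where "k = v \<bullet> e"
    \<comment> \<open>The ray from \<open>x0\<close> through \<open>x\<close> is prolonged until its
      component along \<open>e\<close> has grown by \<open>d\<close>. It then ends in the ball
      around \<open>z\<close>, and convexity puts \<open>x\<close>, which lies before that end, into
      \<open>D\<close>.\<close>
    define w where "w = x0 + (d / k) *\<^sub>R v"
    have kL: "L * norm (\<pi> v) < k"
      using x0(2) unfolding h_def \<pi>_diff by (simp add: v_def k_def inner_diff_left)
    have k0: "k > 0" using kL L by (meson le_less_trans less_imp_le mult_nonneg_nonneg norm_ge_zero)
    have "k \<le> norm v" using norm_cauchy_schwarz[of v e] e by (simp add: k_def)
    also have "norm v \<le> norm (x - p) + norm (x0 - p)" using norm_triangle_ineq4[of "x - p" "x0 - p"] by (simp add: v_def)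
    also have "\<dots> < r + r" using x(1) x0(1) by (intro add_strict_mono) (auto simp: S_def dist_norm norm_minus_commute)
    also have "\<dots> \<le> d" using d\<rho> \<rho> by (simp add: r_def)
    finally have kd: "k < d" .
    have vdec: "v = \<pi> v + k *\<^sub>R e" by (simp add: \<pi>_def k_def)
    have "(d / k) *\<^sub>R v = (d / k) *\<^sub>R \<pi> v + d *\<^sub>R e"
      using k0 by (subst vdec) (simp add: scaleR_add_right)
    then have wz: "w - z = (x0 - p) + (d / k) *\<^sub>R \<pi> v" unfolding w_def de by simp
    have "norm (w - z) \<le> norm (x0 - p) + (d / k) * norm (\<pi> v)"
      unfolding wz using norm_triangle_ineq[of "x0 - p" "(d / k) *\<^sub>R \<pi> v"] d k0 by simp
    also have "(d / k) * norm (\<pi> v) \<le> \<rho> / 2"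
      using kL k0 d \<rho> by (simp add: L_def field_simps)
    also have "norm (x0 - p) + \<rho> / 2 < \<rho>"
      using x0(1) \<rho>(1) by (simp add: S_def r_def dist_norm norm_minus_commute)
    finally have "w \<in> D" using \<rho>(2) by (auto simp: dist_norm norm_minus_commute)
    moreover have "x = (1 - k / d) *\<^sub>R x0 + (k / d) *\<^sub>R w"
      using d k0 by (simp add: w_def v_def algebra_simps)
    moreover have "x0 \<in> D" using x0(1) by (simp add: S_def)
    ultimately show "x \<in> D"
      using cvx kd k0 d unfolding convex_alt by (metis divide_less_eq_1_pos divide_nonneg_nonneg less_imp_le)
  qed
  have down: "x \<notin> D" if x: "x \<in> ball p r" "x \<bullet> e < \<phi> (\<pi> x)" for x
  proof
    assume "x \<in> D"
    then have "x \<in> S" using x(1) by (simp add: S_def)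
    from \<phi>_le[OF this, of "\<pi> x"] show False using x(2) by (simp add: h_def)
  qed
  show "\<exists>e r L \<phi>. norm e = 1 \<and> r > 0 \<and> L-lipschitz_on {y. y \<bullet> e = 0} \<phi> \<and>
       (\<forall>x\<in>ball p r.
          (x \<bullet> e > \<phi> (x - (x \<bullet> e) *\<^sub>R e) \<longrightarrow> x \<in> D) \<and>
          (x \<bullet> e < \<phi> (x - (x \<bullet> e) *\<^sub>R e) \<longrightarrow> x \<notin> D))"
    using e r Lip up down unfolding \<pi>_def by blast
qed

text \<open>Half-open strips orthogonal to one fixed basis vector, so that they are disjoint and
  cover the ball exactly. Each is convex with nonempty interior, which makes it a Lipschitz
  set.\<close>

definition slab :: "nat \<Rightarrow> nat \<Rightarrow> 'a::euclidean_space set" where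
  "slab N j = (let e = SOME b. b \<in> Basis in
     {x \<in> ball 0 1. 2 * real (j - 1) / N - 1 \<le> x \<bullet> e \<and> x \<bullet> e < 2 * real j / N - 1})"

lemma slab_props:
  assumes j: "j \<in> {1..N}"
  shows "slab N j \<in> sets (borel :: 'a measure)" "convex (slab N j :: 'a set)" "interior (slab N j :: 'a set) \<noteq> {}"
    "emeasure lborel (slab N j :: 'a::euclidean_space set) \<noteq> 0" "slab N j \<subseteq> (ball 0 1 :: 'a set)"
proof -
  define e where "e = (SOME b::'a. b \<in> Basis)"
  have e: "e \<in> Basis" unfolding e_def using nonempty_Basis by (rule some_in_eq[THEN iffD2])
  let ?a = "2 * real (j - 1) / N - 1" and ?b = "2 * real j / N - 1"
  have N: "real N > 0" using j by simp
  have ab: "?a < ?b" "-1 \<le> ?a" "?b \<le> 1" using j N by (auto simp: divide_strict_right_mono field_simps)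
  have sl: "slab N j = {x \<in> ball 0 1. ?a \<le> x \<bullet> e \<and> x \<bullet> e < ?b}" by (simp add: slab_def e_def Let_def)
  have sl2: "slab N j = ball 0 1 \<inter> {x. x \<bullet> e \<ge> ?a} \<inter> {x. x \<bullet> e < ?b}" unfolding sl by auto
  show sb: "slab N j \<in> sets (borel :: 'a measure)" unfolding sl2 by (intro sets.Int) (auto intro!: borel_closed borel_open closed_Collect_le open_Collect_less continuous_intros)
  show "convex (slab N j :: 'a set)"
    unfolding sl2 by (intro convex_Int convex_ball) (use convex_halfspace_ge[of ?a e] convex_halfspace_lt[of e ?b] in \<open>simp_all add: inner_commute\<close>)
  let ?c = "(?a + ?b) / 2"
  define U where "U = ball 0 1 \<inter> {x::'a. ?a < x \<bullet> e} \<inter> {x. x \<bullet> e < ?b}"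
  have U: "open U" unfolding U_def by (intro open_Int open_ball open_Collect_less continuous_intros)
  have "?c *\<^sub>R e \<in> U"
  proof -
    have "\<bar>(a + b) / 2\<bar> < 1" if "a < b" "-1 \<le> a" "b \<le> 1" for a b :: real
      using that by (auto simp: abs_if)
    from this[OF ab] have "\<bar>?c\<bar> < 1" .
    moreover have "?a < ?c" "?c < ?b" using ab by simp_all
    ultimately show ?thesis using e by (simp add: U_def inner_Basis)
  qed
  moreover have US: "U \<subseteq> slab N j" unfolding U_def sl2 by auto
  ultimately show "interior (slab N j :: 'a set) \<noteq> {}" using interior_maximal[OF US U] by blast
  obtain r where r: "r > 0" "ball (?c *\<^sub>R e) r \<subseteq> U" using openE[OF U \<open>?c *\<^sub>R e \<in> U\<close>] by blast
  show "emeasure lborel (slab N j :: 'a set) \<noteq> 0"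
  proof
    assume "emeasure lborel (slab N j :: 'a set) = 0"
    moreover have "emeasure lborel (ball (?c *\<^sub>R e) r) \<le> emeasure lborel (slab N j :: 'a set)"
      using r US sb by (intro emeasure_mono) auto
    ultimately have "measure lborel (ball (?c *\<^sub>R e) r) = 0" by (simp add: measure_def)
    then show False using content_ball_pos[OF r(1), of "?c *\<^sub>R e"] by simp
  qed
  show "slab N j \<subseteq> (ball 0 1 :: 'a set)" unfolding sl by auto
qed

lemma slab_disjoint:
  assumes "x \<in> slab N i" "x \<in> slab N j" "i \<in> {1..N}" "j \<in> {1..N}"
  shows "i = j"
proof -
  have "\<not> i < j" if "x \<in> slab N i" "x \<in> slab N j" "i \<in> {1..N}" "j \<in> {1..N}" for i j
  proof
    assume "i < j"
    then have "real i \<le> real (j - 1)" by simp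
    then have "2 * real i / N \<le> 2 * real (j - 1) / N" by (intro divide_right_mono) auto
    then show False using that by (auto simp: slab_def Let_def)
  qed
  from this[OF assms] this[OF assms(2,1,4,3)] show ?thesis by simp
qed

lemma slab_cover:
  assumes N: "N \<ge> 1"
  shows "(\<Union>j\<in>{1..N}. slab N j) = (ball 0 1 :: 'a::euclidean_space set)"
proof
  show "(\<Union>j\<in>{1..N}. slab N j) \<subseteq> (ball 0 1 :: 'a set)" using slab_props(5) by blast
  show "(ball 0 1 :: 'a set) \<subseteq> (\<Union>j\<in>{1..N}. slab N j)"
  proof
    fix x :: 'a assume x: "x \<in> ball 0 1"
    define e where "e = (SOME b::'a. b \<in> Basis)"
    have e: "e \<in> Basis" unfolding e_def using nonempty_Basis by (rule some_in_eq[THEN iffD2])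
    have "\<bar>x \<bullet> e\<bar> < 1" using Basis_le_norm[OF e, of x] x by simp
    then have xe: "-1 < x \<bullet> e" "x \<bullet> e < 1" by auto
    \<comment> \<open>A rescaled coordinate with values in [0, N); in slab \<open>j\<close> its
      integer part is \<open>j - 1\<close>.\<close>
    define t where "t = (x \<bullet> e + 1) * N / 2"
    have N0: "real N > 0" using N by simp
    have t0: "0 \<le> t" unfolding t_def using xe by (intro divide_nonneg_pos mult_nonneg_nonneg) auto
    have "(x \<bullet> e + 1) * N < 2 * real N" using xe N0 by (intro mult_strict_right_mono) auto
    then have "t < N" unfolding t_def by linarith
    note t = t0 this
    define j where "j = Suc (nat \<lfloor>t\<rfloor>)"
    have f: "real (nat \<lfloor>t\<rfloor>) \<le> t" "t < real (nat \<lfloor>t\<rfloor>) + 1" using t(1) by linarith+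
    have "real (nat \<lfloor>t\<rfloor>) < real N" using f(1) t(2) by (rule le_less_trans)
    then have "nat \<lfloor>t\<rfloor> < N" by (simp only: of_nat_less_iff)
    then have "j \<in> {1..N}" by (simp add: j_def)
    moreover have "x \<in> slab N j"
    proof -
      have "x \<bullet> e = 2 * t / N - 1" using N by (simp add: t_def)
      moreover have "2 * real (j - 1) / N \<le> 2 * t / N" using f by (intro divide_right_mono) (auto simp: j_def)
      moreover have "real j = real (nat \<lfloor>t\<rfloor>) + 1" by (simp only: j_def of_nat_Suc)
      then have "2 * t < 2 * real j" using f(2) by linarith
      then have "2 * t / N < 2 * real j / N" using N0 by (rule divide_strict_right_mono)
      ultimately show ?thesis using x by (simp add: slab_def Let_def e_def[symmetric])
    qed
    ultimately show "x \<in> (\<Union>j\<in>{1..N}. slab N j)" by blast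
  qed
qed

lemma slab_partitioning:
  assumes "N \<ge> 1"
  shows "lipschitz_partitioning (ball (0::'a::euclidean_space) 1) N (slab N)"
  unfolding lipschitz_partitioning_def
proof (intro conjI ballI impI)
  fix i j assume "i \<in> {1..N}" "j \<in> {1..N}" "i \<noteq> j"
  then have "slab N i \<inter> slab N j = ({} :: 'a set)" using slab_disjoint by blast
  then show "slab N i \<inter> slab N j \<in> null_sets (lborel :: 'a measure)" by simp
next
  fix j assume j: "j \<in> {1..N}"
  show "lipschitz_set (slab N j :: 'a set)" by (rule convex_lipschitz_set[OF slab_props(2,3)[OF j]])
  show "slab N j \<in> sets (borel :: 'a measure)" by (rule slab_props(1)[OF j])
qed (rule slab_cover[OF assms])

section \<open>Piecewise constant potentials on the slabs\<close>

definition slab_potential :: "nat \<Rightarrow> real \<Rightarrow> nat set \<Rightarrow> 'a::euclidean_space \<Rightarrow> real" where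
  "slab_potential N \<kappa> P x = (\<Sum>j=1..N. (if j \<in> P then \<kappa> else 0) * indicator (slab N j) x)"

lemma slab_potential_span: "slab_potential N \<kappa> P \<in> span_indicators N (slab N)"
  unfolding span_indicators_def slab_potential_def[abs_def] by (intro CollectI exI) (rule refl)

lemma slab_potential_on:
  assumes "x \<in> slab N i" "i \<in> {1..N}"
  shows "slab_potential N \<kappa> P x = (if i \<in> P then \<kappa> else 0)"
proof -
  have "slab_potential N \<kappa> P x = (\<Sum>j\<in>{1..N}. if j = i then (if j \<in> P then \<kappa> else 0) else 0)"
    unfolding slab_potential_def
  proof (rule sum.cong[OF refl])
    fix j assume j: "j \<in> {1..N}"
    show "(if j \<in> P then \<kappa> else 0) * indicator (slab N j) x = (if j = i then (if j \<in> P then \<kappa> else 0) else 0)"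
    proof (cases "j = i")
      case True then show ?thesis using assms(1) by simp
    next
      case False
      then have "x \<notin> slab N j" using slab_disjoint[OF _ assms(1) j assms(2)] by blast
      then show ?thesis using False by simp
    qed
  qed
  then show ?thesis using assms(2) by simp
qed

lemma slab_potential_bound:
  assumes "0 \<le> \<kappa>"
  shows "\<bar>slab_potential N \<kappa> P x\<bar> \<le> \<kappa>"
proof (cases "x \<in> (\<Union>j\<in>{1..N}. slab N j)")
  case True
  then obtain i where "i \<in> {1..N}" "x \<in> slab N i" by blast
  then show ?thesis using assms slab_potential_on[of x N i \<kappa> P] by auto
next
  case False
  then have "slab_potential N \<kappa> P x = 0" unfolding slab_potential_def by (intro sum.neutral) auto
  then show ?thesis using assms by simp
qed

lemma slab_potential_measurable: "slab_potential N \<kappa> P \<in> borel_measurable borel"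
  unfolding slab_potential_def[abs_def]
  by (intro borel_measurable_sum borel_measurable_times borel_measurable_const borel_measurable_indicator slab_props)

lemma Linf_norm_slab_potential:
  assumes "0 \<le> \<kappa>"
  shows "Linf_norm (ball 0 1) (slab_potential N \<kappa> P) \<le> ereal \<kappa>"
  unfolding Linf_norm_def
proof (rule esssup_I)
  show "(\<lambda>x. ereal \<bar>slab_potential N \<kappa> P x\<bar>) \<in> borel_measurable (restrict_space lborel (ball 0 1))"
    using slab_potential_measurable[of N \<kappa> P]
    by (intro measurable_restrict_space1 borel_measurable_ereal borel_measurable_abs) simp
qed (use slab_potential_bound[OF assms] in auto)

text \<open>On a slab whose index belongs to exactly one of the two sets the difference has modulus
  \<kappa>, and the slab has positive measure.\<close>

lemma Linf_norm_slab_potential_diff: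
  assumes \<kappa>: "0 \<le> \<kappa>" and P: "P \<subseteq> {1..N}" "Q \<subseteq> {1..N}" "P \<noteq> Q"
  shows "ereal \<kappa> \<le> Linf_norm (ball (0::'a::euclidean_space) 1) (\<lambda>x. slab_potential N \<kappa> P x - slab_potential N \<kappa> Q x)"
proof (rule ccontr)
  let ?q = "\<lambda>x::'a. slab_potential N \<kappa> P x - slab_potential N \<kappa> Q x"
  assume "\<not> ereal \<kappa> \<le> Linf_norm (ball (0::'a) 1) ?q"
  then have lt: "esssup (restrict_space lborel (ball 0 1)) (\<lambda>x. ereal \<bar>?q x\<bar>) < ereal \<kappa>" by (simp add: Linf_norm_def)
  obtain i where i: "i \<in> {1..N}" "(i \<in> P) \<noteq> (i \<in> Q)" using P by blast
  have "AE x in restrict_space lborel (ball (0::'a) 1). ereal \<bar>?q x\<bar> < ereal \<kappa>"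
    using esssup_AE[of "\<lambda>x. ereal \<bar>?q x\<bar>" "restrict_space lborel (ball 0 1)"] by eventually_elim (rule le_less_trans[OF _ lt])
  then have "AE x in lborel. x \<in> ball (0::'a) 1 \<longrightarrow> ereal \<bar>?q x\<bar> < ereal \<kappa>"
    by (subst (asm) AE_restrict_space_iff) auto
  then have "AE x::'a in lborel. x \<notin> slab N i"
  proof eventually_elim
    case (elim x)
    show ?case
    proof
      assume x: "x \<in> slab N i"
      then have "\<bar>?q x\<bar> < \<kappa>" using elim slab_props(5)[OF i(1)] by auto
      then show False using i(2) \<kappa> by (auto simp: slab_potential_on[OF x i(1)])
    qed
  qed
  then have "emeasure lborel (slab N i :: 'a set) = 0"
    using slab_props(1)[OF i(1), where 'a = 'a] by (subst (asm) AE_iff_measurable[of "slab N i"]) auto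
  then show False using slab_props(4)[OF i(1)] by blast
qed

section \<open>Instability\<close>

text \<open>Membership and the value of \<open>L\<close> are proved in one induction, because
  linearity of \<open>L\<close> is available only on the space.\<close>

lemma Htilde_linear_sum:
  assumes s: "0 \<le> s" "s \<le> 1" and A: "finite A" and v: "\<And>\<beta>. \<beta> \<in> A \<Longrightarrow> v \<beta> \<in> Htilde s V"
  shows "(\<lambda>x. \<Sum>\<beta>\<in>A. c \<beta> * v \<beta> x) \<in> Htilde s V"
    and "(\<And>a b u w. u \<in> Htilde s V \<Longrightarrow> w \<in> Htilde s V \<Longrightarrow> L (\<lambda>x. a * u x + b * w x) = a * L u + b * L w) \<Longrightarrow>
      L (\<lambda>x. \<Sum>\<beta>\<in>A. c \<beta> * v \<beta> x) = (\<Sum>\<beta>\<in>A. c \<beta> * L (v \<beta>) :: real)"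
proof -
  have "(\<lambda>x. \<Sum>\<beta>\<in>A. c \<beta> * v \<beta> x) \<in> Htilde s V \<and>
    ((\<forall>a b u w. u \<in> Htilde s V \<longrightarrow> w \<in> Htilde s V \<longrightarrow> L (\<lambda>x. a * u x + b * w x) = a * L u + b * L w) \<longrightarrow>
      L (\<lambda>x. \<Sum>\<beta>\<in>A. c \<beta> * v \<beta> x) = (\<Sum>\<beta>\<in>A. c \<beta> * L (v \<beta>)))"
    using A v
  proof (induction A)
    case empty
    have z: "(\<lambda>x. 0) \<in> Htilde s V" by (rule zero_Htilde[OF s])
    moreover have "L (\<lambda>x. 0) = 0" if "\<forall>a b u w. u \<in> Htilde s V \<longrightarrow> w \<in> Htilde s V \<longrightarrow> L (\<lambda>x. a * u x + b * w x) = a * L u + b * L w"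
      using that[rule_format, OF z z, of 0 0] by simp
    ultimately show ?case by simp
  next
    case (insert i A)
    then have IH: "(\<lambda>x. \<Sum>\<beta>\<in>A. c \<beta> * v \<beta> x) \<in> Htilde s V" and vi: "v i \<in> Htilde s V" by auto
    have eq: "(\<lambda>x. \<Sum>\<beta>\<in>insert i A. c \<beta> * v \<beta> x) = (\<lambda>x. c i * v i x + 1 * (\<Sum>\<beta>\<in>A. c \<beta> * v \<beta> x))"
      using insert.hyps by simp
    show ?case
    proof (intro conjI impI)
      show "(\<lambda>x. \<Sum>\<beta>\<in>insert i A. c \<beta> * v \<beta> x) \<in> Htilde s V"
        unfolding eq by (rule Htilde_lin[OF vi IH s])
      assume L: "\<forall>a b u w. u \<in> Htilde s V \<longrightarrow> w \<in> Htilde s V \<longrightarrow> L (\<lambda>x. a * u x + b * w x) = a * L u + b * L w"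
      have "L (\<lambda>x. \<Sum>\<beta>\<in>A. c \<beta> * v \<beta> x) = (\<Sum>\<beta>\<in>A. c \<beta> * L (v \<beta>))" using insert L by blast
      then show "L (\<lambda>x. \<Sum>\<beta>\<in>insert i A. c \<beta> * v \<beta> x) = (\<Sum>\<beta>\<in>insert i A. c \<beta> * L (v \<beta>))"
        unfolding eq L[rule_format, OF vi IH, of "c i" 1] using insert.hyps by simp
    qed
  qed
  then show "(\<lambda>x. \<Sum>\<beta>\<in>A. c \<beta> * v \<beta> x) \<in> Htilde s V"
    "(\<And>a b u w. u \<in> Htilde s V \<Longrightarrow> w \<in> Htilde s V \<Longrightarrow> L (\<lambda>x. a * u x + b * w x) = a * L u + b * L w) \<Longrightarrow>
      L (\<lambda>x. \<Sum>\<beta>\<in>A. c \<beta> * v \<beta> x) = (\<Sum>\<beta>\<in>A. c \<beta> * L (v \<beta>))" by blast+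
qed

section \<open>The Dirichlet problem in the ball and its Dirichlet-to-Neumann map\<close>

locale ball_problem =
  fixes s :: real and dummy :: "'a::euclidean_space itself"
  assumes s: "0 < s" "s < 1"
begin

lemma s': "0 \<le> s" "s \<le> 1" using s by auto

abbreviation \<Omega> :: "'a set" where "\<Omega> \<equiv> ball 0 1"
abbreviation H :: "('a \<Rightarrow> real) set" where "H \<equiv> Htilde s \<Omega>"
abbreviation HW :: "('a \<Rightarrow> real) set" where "HW \<equiv> Htilde s annulus"

definition eig :: real where "eig = first_eigenvalue s \<Omega>"

definition potential :: "('a \<Rightarrow> real) \<Rightarrow> bool" where
  "potential q \<longleftrightarrow> q \<in> borel_measurable borel \<and> (\<forall>x. \<bar>q x\<bar> \<le> eig / 2)"

definition B :: "('a \<Rightarrow> real) \<Rightarrow> ('a \<Rightarrow> real) \<Rightarrow> ('a \<Rightarrow> real) \<Rightarrow> real" where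
  "B q u v = frac_form s u v + potential_form \<Omega> q u v"

text \<open>The potential leaves at least half of the energy, and the squared Sobolev norm is at
  most 2 (1 / \<open>eig\<close> + 1) times the energy.\<close>

definition coer :: real where "coer = 1 / (4 * (1 / eig + 1))"

lemma eig: "eig > 0" "\<And>u. u \<in> H \<Longrightarrow> eig * ip u u \<le> frac_form s u u"
  unfolding eig_def using first_eigenvalue_props[OF s(1) s'(2)] by auto

lemma coer: "coer > 0"
  using eig(1) by (simp add: coer_def add_pos_pos)

lemma potentialD: "potential q \<Longrightarrow> q \<in> borel_measurable borel" "potential q \<Longrightarrow> \<bar>q x\<bar> \<le> eig / 2"
  by (auto simp: potential_def)

lemma Omega_borel: "\<Omega> \<in> sets borel" by simp

lemma B_lin:
  assumes q: "potential q" and u: "u \<in> Hs s" and v: "v \<in> Hs s" and w: "w \<in> Hs s"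
  shows "B q (\<lambda>x. a * u x + b * v x) w = a * B q u w + b * B q v w"
  unfolding B_def frac_form_lin_left[OF u v w s'(1)]
    potential_form_props(1)[OF Omega_borel potentialD[OF q] Hs_L2[OF u] Hs_L2[OF v] Hs_L2[OF w]]
  by (simp add: algebra_simps)

lemma B_sym:
  assumes q: "potential q" and u: "u \<in> Hs s" and v: "v \<in> Hs s"
  shows "B q u v = B q v u"
  unfolding B_def frac_form_commute[of s u v]
    potential_form_props(2)[OF Omega_borel potentialD[OF q] Hs_L2[OF u] Hs_L2[OF v] Hs_L2[OF v]] ..

text \<open>A potential of size at most \<open>eig / 2\<close> can cancel at most half of the
  energy, whatever its sign.\<close>

lemma B_coercive:
  assumes q: "potential q" and u: "u \<in> H"
  shows "coer * (Hs_norm s u)\<^sup>2 \<le> B q u u"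
proof -
  note uH = Htilde_Hs[OF u] and uL = Htilde_L2[OF u]
  let ?E = "frac_form s u u"
  have "\<bar>potential_form \<Omega> q u u\<bar> \<le> eig / 2 * L2_norm UNIV u * L2_norm UNIV u"
    by (rule potential_form_props(3)[OF Omega_borel potentialD[OF q] uL uL uL])
  also have "\<dots> = eig * ip u u / 2" by (simp add: L2_norm_sq[symmetric] power2_eq_square)
  also have "\<dots> \<le> ?E / 2" using eig(2)[OF u] by simp
  finally have 1: "?E / 2 \<le> B q u u" by (simp add: B_def abs_le_iff)
  have "(Hs_norm s u)\<^sup>2 \<le> 2 * (ip u u + ?E)"
    unfolding frac_form_def by (rule riesz_Hs(2)[OF uL Hs_riesz(1)[OF uH s'(1)] s'])
  also have "\<dots> \<le> 2 * (1 / eig + 1) * ?E"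
    using eig(2)[OF u] eig(1) by (simp add: field_simps)
  finally have "coer * (Hs_norm s u)\<^sup>2 \<le> coer * (2 * (1 / eig + 1) * ?E)"
    using coer by (intro mult_left_mono) auto
  also have "\<dots> = ?E / 2"
  proof -
    have "1 / eig + 1 > 0" using eig(1) by (simp add: add_pos_pos)
    then have "coer * (1 / eig + 1) = 1 / 4" by (simp add: coer_def)
    then have "coer * (1 / eig + 1) * (2 * ?E) = 1 / 4 * (2 * ?E)" by (simp only:)
    then have "coer * (2 * (1 / eig + 1) * ?E) = 1 / 4 * (2 * ?E)" by (simp only: mult_ac)
    also have "1 / 4 * (2 * ?E) = ?E / 2" by simp
    finally show ?thesis .
  qed
  finally show ?thesis using 1 by simp
qed

lemma B_upper:
  assumes q: "potential q" and u: "u \<in> H"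
  shows "B q u u \<le> (1 + eig / 2) * (Hs_norm s u)\<^sup>2"
proof -
  note uH = Htilde_Hs[OF u] and uL = Htilde_L2[OF u]
  have "potential_form \<Omega> q u u \<le> eig / 2 * L2_norm UNIV u * L2_norm UNIV u"
    using potential_form_props(3)[OF Omega_borel potentialD[OF q] uL uL uL] by linarith
  also have "\<dots> \<le> eig / 2 * (Hs_norm s u * Hs_norm s u)"
    unfolding mult.assoc using eig(1) Hs_riesz(3)[OF uH s'(1)] by (intro mult_left_mono mult_mono) auto
  finally show ?thesis
    using frac_form_le_Hs[OF uH s'(1)] by (simp add: B_def power2_eq_square algebra_simps)
qed

lemma Dirichlet_solve:
  assumes q: "potential q"
    and l: "\<And>a b u v. u \<in> H \<Longrightarrow> v \<in> H \<Longrightarrow> l (\<lambda>x. a * u x + b * v x) = a * l u + b * l v"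
    and K: "\<And>u. u \<in> H \<Longrightarrow> \<bar>l u\<bar> \<le> K * Hs_norm s u"
  obtains w where "w \<in> H" "\<And>v. v \<in> H \<Longrightarrow> B q w v = l v"
  by (rule Riesz_Htilde[OF s', of \<Omega> "B q" coer "1 + eig / 2" l K])
    (auto intro: B_lin[OF q] B_sym[OF q] Htilde_Hs coer B_coercive[OF q] B_upper[OF q] l K that)

lemma Dirichlet_bound:
  assumes q: "potential q" and w: "w \<in> H" and K: "\<bar>B q w w\<bar> \<le> K * Hs_norm s w" "0 \<le> K"
  shows "Hs_norm s w \<le> K / coer"
proof (cases "Hs_norm s w = 0")
  case True
  then show ?thesis using coer K(2) by simp
next
  case False
  then have pos: "Hs_norm s w > 0" using Hs_norm_nonneg[of s w] by linarith
  have "(coer * Hs_norm s w) * Hs_norm s w \<le> K * Hs_norm s w"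
    using B_coercive[OF q w] K(1) by (simp add: power2_eq_square mult.assoc)
  then have "coer * Hs_norm s w \<le> K" using pos by simp
  then show ?thesis using coer by (simp add: le_divide_eq mult.commute)
qed

lemma outside_annulus: "f \<in> HW \<Longrightarrow> AE x in lborel. x \<in> \<Omega> \<longrightarrow> f x = 0"
  using Htilde_outside[OF _ s' annulus_borel, of f] by (auto elim!: eventually_mono)

lemma potential_form_annulus:
  assumes "potential q" "f \<in> HW" "u \<in> L2"
  shows "potential_form \<Omega> q u f = 0"
  by (rule potential_form_vanish[OF outside_annulus[OF assms(2)] Omega_borel potentialD(1)[OF assms(1)] assms(3) Htilde_L2[OF assms(2)]])

lemma bilinear_form_B:
  assumes "u \<in> Hs s" "v \<in> Hs s"
  shows "bilinear_form s \<Omega> q u v = B q u v"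
  unfolding bilinear_form_def B_def potential_form_def L2_inner_frac_laplace[OF assms s'(1)] ..

text \<open>Whatever function the choice in \<open>solution\<close> picks, its defining properties
  make w = u - f solve a problem in the ball with source minus the energy form of \<open>f\<close>;
  the potential does not meet \<open>f\<close>, which lives in the annulus. The first term of the
  map is independent of the potential and cancels in differences.\<close>

lemma solution_correct:
  assumes q: "potential q" and f: "f \<in> HW"
  obtains w where "w \<in> H" "\<And>v. v \<in> H \<Longrightarrow> B q w v = - frac_form s f v"
    "\<And>g. g \<in> HW \<Longrightarrow> DN_map s \<Omega> q f g = frac_form s f g + frac_form s w g"
proof -
  note fH = Htilde_Hs[OF f]
  obtain w0 where w0: "w0 \<in> H" "\<And>v. v \<in> H \<Longrightarrow> B q w0 v = - frac_form s f v"
  proof (rule Dirichlet_solve[OF q, of "\<lambda>v. - frac_form s f v" "Hs_norm s f"])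
    show "- frac_form s f (\<lambda>x. a * u x + b * v x) = a * - frac_form s f u + b * - frac_form s f v" if "u \<in> H" "v \<in> H" for a b u v
      unfolding frac_form_lin_right[OF Htilde_Hs[OF that(1)] Htilde_Hs[OF that(2)] fH s'(1)] by simp
    show "\<bar>- frac_form s f u\<bar> \<le> Hs_norm s f * Hs_norm s u" if "u \<in> H" for u
      using frac_form_bound[OF fH Htilde_Hs[OF that] s'(1)] by simp
  qed (blast intro: that)
  have Bf: "B q (\<lambda>x. 1 * f x + 1 * w x) v = frac_form s f v + B q w v" if "w \<in> H" "v \<in> Hs s" for w v
  proof -
    have "potential_form \<Omega> q f v = potential_form \<Omega> q v f"
      by (rule potential_form_props(2)[OF Omega_borel potentialD[OF q] Hs_L2[OF fH] Hs_L2[OF that(2)] Hs_L2[OF fH]])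
    also have "\<dots> = 0" by (rule potential_form_annulus[OF q f Hs_L2[OF that(2)]])
    finally have "B q f v = frac_form s f v" by (simp add: B_def)
    then show ?thesis using B_lin[OF q fH Htilde_Hs[OF that(1)] that(2), of 1 1] by simp
  qed
  let ?P = "\<lambda>u. u \<in> Hs s \<and> (\<lambda>x. u x - f x) \<in> H \<and> (\<forall>w\<in>H. bilinear_form s \<Omega> q u w = 0)"
  have "?P (\<lambda>x. 1 * f x + 1 * w0 x)"
  proof (intro conjI ballI)
    show u: "(\<lambda>x. 1 * f x + 1 * w0 x) \<in> Hs s" by (rule Hs_lin[OF fH Htilde_Hs[OF w0(1)]])
    show "(\<lambda>x. 1 * f x + 1 * w0 x - f x) \<in> H" using w0(1) by simp
    show "bilinear_form s \<Omega> q (\<lambda>x. 1 * f x + 1 * w0 x) v = 0" if "v \<in> H" for v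
      unfolding bilinear_form_B[OF u Htilde_Hs[OF that]] Bf[OF w0(1) Htilde_Hs[OF that]] w0(2)[OF that] by simp
  qed
  then have "?P (SOME u. ?P u)" by (rule someI[of ?P])
  then have P: "?P (solution s \<Omega> q f)" unfolding solution_def .
  define u where "u = solution s \<Omega> q f"
  define w where "w = (\<lambda>x. u x - f x)"
  have u: "u \<in> Hs s" and w: "w \<in> H" and eq: "\<And>v. v \<in> H \<Longrightarrow> bilinear_form s \<Omega> q u v = 0"
    using P unfolding u_def[symmetric] w_def[symmetric] by blast+
  have uw: "u = (\<lambda>x. 1 * f x + 1 * w x)" by (simp add: w_def)
  have 1: "B q w v = - frac_form s f v" if "v \<in> H" for v
    using eq[OF that] unfolding bilinear_form_B[OF u Htilde_Hs[OF that]]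
    by (subst (asm) uw) (simp only: Bf[OF w Htilde_Hs[OF that]])
  have 2: "DN_map s \<Omega> q f g = frac_form s f g + frac_form s w g" if "g \<in> HW" for g
  proof -
    have "DN_map s \<Omega> q f g = B q u g"
      unfolding DN_map_def u_def[symmetric] by (rule bilinear_form_B[OF u Htilde_Hs[OF that]])
    also have "\<dots> = frac_form s f g + B q w g" by (subst uw) (rule Bf[OF w Htilde_Hs[OF that]])
    also have "B q w g = frac_form s w g" unfolding B_def potential_form_annulus[OF q that Htilde_L2[OF w]] by simp
    finally show ?thesis .
  qed
  show thesis by (rule that[OF w 1 2])
qed

lemma unit_L2: "f \<in> HW \<Longrightarrow> Hs_norm s f \<le> 1 \<Longrightarrow> L2_norm UNIV f \<le> 1"
  using Hs_riesz(3)[OF Htilde_Hs s'(1), of f] by fastforce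

text \<open>\<open>r\<close> is the solution \<open>w\<close> plus the combination of the
  \<open>V \<beta>\<close> that cancels the low-rank part of the source. Its own source is the
  approximation error alone, so coercivity makes \<open>r\<close> as small as that error.\<close>

lemma approximate_solution:
  fixes A :: "('a + bool \<Rightarrow> nat) set" and rf lf :: "('a + bool \<Rightarrow> nat) \<Rightarrow> 'a \<Rightarrow> real"
  assumes A: "finite A" and e: "0 \<le> e" and rf: "\<And>\<beta>. rf \<beta> \<in> L2"
    and lr: "\<And>v. v \<in> H \<Longrightarrow> \<bar>frac_form s f v - (\<Sum>\<beta>\<in>A. l \<beta> * ip (rf \<beta>) v)\<bar> \<le> e * L2_norm UNIV v"
    and q: "potential q" and f: "f \<in> HW" "Hs_norm s f \<le> 1"
    and V: "\<And>\<beta>. V \<beta> \<in> H" "\<And>\<beta> v. v \<in> H \<Longrightarrow> B q (V \<beta>) v = ip (rf \<beta>) v"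
    and w: "w \<in> H" "\<And>v. v \<in> H \<Longrightarrow> B q w v = - frac_form s f v"
  obtains r where "r \<in> H" "Hs_norm s w \<le> 1 / coer" "Hs_norm s r \<le> e / coer"
    "\<And>\<gamma>. ip (rf \<gamma>) r = ip (rf \<gamma>) w + (\<Sum>\<beta>\<in>A. l \<beta> * ip (rf \<gamma>) (V \<beta>))"
proof -
  define S where "S = (\<lambda>x. \<Sum>\<beta>\<in>A. l \<beta> * V \<beta> x)"
  define r where "r = (\<lambda>x. 1 * w x + 1 * S x)"
  have S: "S \<in> H" unfolding S_def by (rule Htilde_linear_sum(1)[OF s' A V(1)])
  have r: "r \<in> H" unfolding r_def by (rule Htilde_lin[OF w(1) S s'])
  have BS: "B q S v = (\<Sum>\<beta>\<in>A. l \<beta> * ip (rf \<beta>) v)" if "v \<in> H" for v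
  proof -
    have "B q S v = (\<Sum>\<beta>\<in>A. l \<beta> * B q (V \<beta>) v)" unfolding S_def
      by (rule Htilde_linear_sum(2)[OF s' A V(1), of "\<lambda>u. B q u v"]) (rule B_lin[OF q Htilde_Hs Htilde_Hs Htilde_Hs[OF that]])
    then show ?thesis by (simp add: V(2)[OF that])
  qed
  have ipS: "ip (rf \<gamma>) S = (\<Sum>\<beta>\<in>A. l \<beta> * ip (rf \<gamma>) (V \<beta>))" for \<gamma>
    unfolding S_def
  proof (rule Htilde_linear_sum(2)[OF s' A V(1), of "ip (rf \<gamma>)"])
    fix a b and u v :: "'a \<Rightarrow> real" assume u: "u \<in> H" and v: "v \<in> H"
    have L: "(\<lambda>x. a * u x) \<in> L2" "(\<lambda>x. b * v x) \<in> L2"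
      using Htilde_L2[OF Htilde_lin[OF u u s', of a 0]] Htilde_L2[OF Htilde_lin[OF v v s', of b 0]] by simp_all
    show "ip (rf \<gamma>) (\<lambda>x. a * u x + b * v x) = a * ip (rf \<gamma>) u + b * ip (rf \<gamma>) v"
      using ip_add_right[OF L rf] ip_scale_right[of "rf \<gamma>" a u] ip_scale_right[of "rf \<gamma>" b v] by simp
  qed
  have bnd: "\<bar>B q r v\<bar> \<le> e * Hs_norm s v" if "v \<in> H" for v
  proof -
    have "B q r v = - (frac_form s f v - (\<Sum>\<beta>\<in>A. l \<beta> * ip (rf \<beta>) v))"
      unfolding r_def B_lin[OF q Htilde_Hs[OF w(1)] Htilde_Hs[OF S] Htilde_Hs[OF that]] BS[OF that] w(2)[OF that] by simp
    then have "\<bar>B q r v\<bar> \<le> e * L2_norm UNIV v" using lr[OF that] by (simp only: abs_minus_cancel)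
    also have "\<dots> \<le> e * Hs_norm s v" using e by (intro mult_left_mono Hs_riesz(3) Htilde_Hs[OF that] s'(1))
    finally show ?thesis .
  qed
  have 1: "Hs_norm s r \<le> e / coer" by (rule Dirichlet_bound[OF q r bnd[OF r] e])
  have "\<bar>B q w w\<bar> \<le> 1 * Hs_norm s w"
  proof -
    have "\<bar>B q w w\<bar> \<le> Hs_norm s f * Hs_norm s w"
      using w(2)[OF w(1)] frac_form_bound[OF Htilde_Hs[OF f(1)] Htilde_Hs[OF w(1)] s'(1)] by simp
    also have "\<dots> \<le> 1 * Hs_norm s w" using f(2) by (intro mult_right_mono) auto
    finally show ?thesis .
  qed
  then have 2: "Hs_norm s w \<le> 1 / coer" by (rule Dirichlet_bound[OF q w(1)]) simp
  have 3: "ip (rf \<gamma>) r = ip (rf \<gamma>) w + (\<Sum>\<beta>\<in>A. l \<beta> * ip (rf \<gamma>) (V \<beta>))" for \<gamma>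
    unfolding r_def ipS[symmetric] using ip_add_right[OF Htilde_L2[OF w(1)] Htilde_L2[OF S] rf] by simp
  show thesis by (rule that[OF r 2 1 3])
qed

text \<open>The low-rank approximation is used twice: for the data \<open>f\<close>, which reduces
  the solutions to the \<open>V \<beta>\<close>, and for the test function \<open>g\<close>, which
  reduces pairings to moments. Only moment differences and terms of order \<open>e\<close>
  survive.\<close>

lemma DN_difference_bound:
  fixes A :: "('a + bool \<Rightarrow> nat) set" and rf lf :: "('a + bool \<Rightarrow> nat) \<Rightarrow> 'a \<Rightarrow> real"
  assumes A: "finite A" and e: "0 \<le> e" "e \<le> C" and rf: "\<And>\<beta>. rf \<beta> \<in> L2"
    and lf: "\<And>\<beta>. lf \<beta> \<in> L2" "\<And>\<beta>. L2_norm UNIV (lf \<beta>) \<le> M"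
    and lr: "\<And>f v. f \<in> HW \<Longrightarrow> v \<in> H \<Longrightarrow>
      \<bar>frac_form s f v - (\<Sum>\<beta>\<in>A. ip (lf \<beta>) f * ip (rf \<beta>) v)\<bar> \<le> e * L2_norm UNIV f * L2_norm UNIV v"
    and q: "potential q1" "potential q2"
    and V1: "\<And>\<beta>. V1 \<beta> \<in> H" "\<And>\<beta> v. v \<in> H \<Longrightarrow> B q1 (V1 \<beta>) v = ip (rf \<beta>) v"
    and V2: "\<And>\<beta>. V2 \<beta> \<in> H" "\<And>\<beta> v. v \<in> H \<Longrightarrow> B q2 (V2 \<beta>) v = ip (rf \<beta>) v"
    and close: "\<And>\<beta> \<gamma>. \<beta> \<in> A \<Longrightarrow> \<gamma> \<in> A \<Longrightarrow> \<bar>ip (rf \<gamma>) (V1 \<beta>) - ip (rf \<gamma>) (V2 \<beta>)\<bar> \<le> \<delta>"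
    and f: "f \<in> HW" "Hs_norm s f \<le> 1" and g: "g \<in> HW" "Hs_norm s g \<le> 1"
  shows "\<bar>DN_map s \<Omega> q1 f g - DN_map s \<Omega> q2 f g\<bar> \<le> real (card A) * real (card A) * (M * M * \<delta>) + 2 * e * (2 + C) / coer"
proof -
  have lr1: "\<bar>frac_form s f v - (\<Sum>\<beta>\<in>A. ip (lf \<beta>) f * ip (rf \<beta>) v)\<bar> \<le> e * L2_norm UNIV v"
    if f: "f \<in> HW" "Hs_norm s f \<le> 1" and v: "v \<in> H" for f v
  proof -
    have "e * L2_norm UNIV f * L2_norm UNIV v \<le> e * 1 * L2_norm UNIV v"
      using e(1) unit_L2[OF f] by (intro mult_right_mono mult_left_mono) auto
    then show ?thesis using lr[OF f(1) v] by linarith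
  qed
  have lb: "\<bar>ip (lf \<beta>) f\<bar> \<le> M" if f: "f \<in> HW" "Hs_norm s f \<le> 1" for f \<beta>
  proof -
    have "\<bar>ip (lf \<beta>) f\<bar> \<le> L2_norm UNIV (lf \<beta>) * L2_norm UNIV f" by (rule ip_Cauchy_Schwarz[OF lf(1) Htilde_L2[OF f(1)]])
    also have "\<dots> \<le> M * 1"
      using order_trans[OF L2_norm_nonneg lf(2)] by (intro mult_mono lf(2) unit_L2[OF f]) auto
    finally show ?thesis by simp
  qed
  let ?l = "\<lambda>\<beta>. ip (lf \<beta>) f" and ?k = "\<lambda>\<gamma>. ip (lf \<gamma>) g"
  obtain w1 where w1: "w1 \<in> H" "\<And>v. v \<in> H \<Longrightarrow> B q1 w1 v = - frac_form s f v"
    and DN1: "\<And>g. g \<in> HW \<Longrightarrow> DN_map s \<Omega> q1 f g = frac_form s f g + frac_form s w1 g"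
    using solution_correct[OF q(1) f(1)] by blast
  obtain w2 where w2: "w2 \<in> H" "\<And>v. v \<in> H \<Longrightarrow> B q2 w2 v = - frac_form s f v"
    and DN2: "\<And>g. g \<in> HW \<Longrightarrow> DN_map s \<Omega> q2 f g = frac_form s f g + frac_form s w2 g"
    using solution_correct[OF q(2) f(1)] by blast
  obtain r1 where r1: "r1 \<in> H" "Hs_norm s w1 \<le> 1 / coer" "Hs_norm s r1 \<le> e / coer"
    "\<And>\<gamma>. ip (rf \<gamma>) r1 = ip (rf \<gamma>) w1 + (\<Sum>\<beta>\<in>A. ?l \<beta> * ip (rf \<gamma>) (V1 \<beta>))"
    using approximate_solution[where rf = rf, OF A e(1) rf lr1[OF f] q(1) f V1 w1] by blast
  obtain r2 where r2: "r2 \<in> H" "Hs_norm s w2 \<le> 1 / coer" "Hs_norm s r2 \<le> e / coer"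
    "\<And>\<gamma>. ip (rf \<gamma>) r2 = ip (rf \<gamma>) w2 + (\<Sum>\<beta>\<in>A. ?l \<beta> * ip (rf \<gamma>) (V2 \<beta>))"
    using approximate_solution[where rf = rf, OF A e(1) rf lr1[OF f] q(2) f V2 w2] by blast
  define W where "W = (\<lambda>x. 1 * w1 x + (-1) * w2 x)"
  define \<rho> where "\<rho> = (\<lambda>x. 1 * r1 x + (-1) * r2 x)"
  have W: "W \<in> H" unfolding W_def by (rule Htilde_lin[OF w1(1) w2(1) s'])
  have \<rho>: "\<rho> \<in> H" unfolding \<rho>_def by (rule Htilde_lin[OF r1(1) r2(1) s'])
  have nW: "Hs_norm s W \<le> 2 / coer" and n\<rho>: "Hs_norm s \<rho> \<le> 2 * e / coer"
    using Hs_norm_lin[OF Htilde_Hs[OF w1(1)] Htilde_Hs[OF w2(1)], of 1 "-1"] r1(2) r2(2)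
      Hs_norm_lin[OF Htilde_Hs[OF r1(1)] Htilde_Hs[OF r2(1)], of 1 "-1"] r1(3) r2(3)
    unfolding W_def \<rho>_def by simp_all
  have ipd: "ip (rf \<gamma>) (\<lambda>x. 1 * a x + (-1) * b x) = ip (rf \<gamma>) a - ip (rf \<gamma>) b" if "a \<in> H" "b \<in> H" for \<gamma> a b
    using ip_diff_right[OF Htilde_L2[OF that(1)] Htilde_L2[OF that(2)] rf, of \<gamma>] by simp
  let ?M = "\<lambda>\<beta> \<gamma>. ip (rf \<gamma>) (V1 \<beta>) - ip (rf \<gamma>) (V2 \<beta>)"
  \<comment> \<open>The moments of the difference of two solutions are those of a small function,
    minus combinations of the moment differences that are assumed small.\<close>
  have ipW: "ip (rf \<gamma>) W = ip (rf \<gamma>) \<rho> - (\<Sum>\<beta>\<in>A. ?l \<beta> * ?M \<beta> \<gamma>)" for \<gamma>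
    unfolding W_def \<rho>_def ipd[OF w1(1) w2(1)] ipd[OF r1(1) r2(1)] r1(4) r2(4)
    by (simp add: right_diff_distrib sum_subtractf)
  let ?EW = "frac_form s g W - (\<Sum>\<gamma>\<in>A. ?k \<gamma> * ip (rf \<gamma>) W)"
  let ?E\<rho> = "frac_form s g \<rho> - (\<Sum>\<gamma>\<in>A. ?k \<gamma> * ip (rf \<gamma>) \<rho>)"
  let ?X = "\<Sum>\<gamma>\<in>A. \<Sum>\<beta>\<in>A. ?k \<gamma> * (?l \<beta> * ?M \<beta> \<gamma>)"
  have "(\<Sum>\<gamma>\<in>A. ?k \<gamma> * ip (rf \<gamma>) W) = (\<Sum>\<gamma>\<in>A. ?k \<gamma> * ip (rf \<gamma>) \<rho>) - ?X"
    unfolding ipW by (simp add: right_diff_distrib sum_subtractf sum_distrib_left)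
  \<comment> \<open>The low-rank form of \<open>g\<close> is substituted at \<open>W\<close> and
    undone at \<rho>. Since \<rho> is small already, its energy pairing with \<open>g\<close> is
    bounded directly, without the large left factors.\<close>
  then have split: "frac_form s g W = ?EW + frac_form s g \<rho> - ?E\<rho> - ?X" by simp
  have bEW: "\<bar>?EW\<bar> \<le> e * (2 / coer)"
  proof -
    have "\<bar>?EW\<bar> \<le> e * L2_norm UNIV W" by (rule lr1[OF g W])
    also have "\<dots> \<le> e * (2 / coer)" using Hs_riesz(3)[OF Htilde_Hs[OF W] s'(1)] nW e(1) by (intro mult_left_mono) auto
    finally show ?thesis .
  qed
  have bE\<rho>: "\<bar>?E\<rho>\<bar> \<le> C * (2 * e / coer)"
  proof -
    have "\<bar>?E\<rho>\<bar> \<le> e * L2_norm UNIV \<rho>" by (rule lr1[OF g \<rho>])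
    also have "\<dots> \<le> C * (2 * e / coer)"
      using Hs_riesz(3)[OF Htilde_Hs[OF \<rho>] s'(1)] n\<rho> e by (intro mult_mono) auto
    finally show ?thesis .
  qed
  have b\<rho>: "\<bar>frac_form s g \<rho>\<bar> \<le> 2 * e / coer"
  proof -
    have "\<bar>frac_form s g \<rho>\<bar> \<le> Hs_norm s g * Hs_norm s \<rho>" by (rule frac_form_bound[OF Htilde_Hs[OF g(1)] Htilde_Hs[OF \<rho>] s'(1)])
    also have "\<dots> \<le> 1 * (2 * e / coer)" using g(2) n\<rho> by (intro mult_mono) auto
    finally show ?thesis by simp
  qed
  have bX: "\<bar>?X\<bar> \<le> real (card A) * real (card A) * (M * M * \<delta>)"
  proof -
    have "\<bar>?X\<bar> \<le> (\<Sum>\<gamma>\<in>A. \<bar>\<Sum>\<beta>\<in>A. ?k \<gamma> * (?l \<beta> * ?M \<beta> \<gamma>)\<bar>)" by (rule sum_abs)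
    also have "\<dots> \<le> (\<Sum>\<gamma>\<in>A. \<Sum>\<beta>\<in>A. \<bar>?k \<gamma> * (?l \<beta> * ?M \<beta> \<gamma>)\<bar>)" by (intro sum_mono sum_abs)
    also have "\<dots> \<le> (\<Sum>\<gamma>\<in>A. \<Sum>\<beta>\<in>A. M * (M * \<delta>))"
    proof (intro sum_mono)
      fix \<gamma> \<beta> assume "\<gamma> \<in> A" "\<beta> \<in> A"
      then show "\<bar>?k \<gamma> * (?l \<beta> * ?M \<beta> \<gamma>)\<bar> \<le> M * (M * \<delta>)"
        unfolding abs_mult using lb[OF f, of \<beta>] lb[OF g, of \<gamma>] close[of \<beta> \<gamma>] by (intro mult_mono) (auto intro: order_trans[OF abs_ge_zero])
    qed
    finally show ?thesis by (simp add: mult.assoc)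
  qed
  have tri: "\<bar>p\<bar> \<le> \<bar>a\<bar> + \<bar>b\<bar> + \<bar>c\<bar> + \<bar>d\<bar>" if "p = a + b - c - d" for p a b c d :: real
    using that by linarith
  have "DN_map s \<Omega> q1 f g - DN_map s \<Omega> q2 f g = frac_form s g W"
    unfolding DN1[OF g(1)] DN2[OF g(1)] W_def
      frac_form_lin_right[OF Htilde_Hs[OF w1(1)] Htilde_Hs[OF w2(1)] Htilde_Hs[OF g(1)] s'(1)]
    by (simp add: frac_form_commute[of s g])
  moreover have "\<bar>frac_form s g W\<bar> \<le> \<bar>?EW\<bar> + \<bar>frac_form s g \<rho>\<bar> + \<bar>?E\<rho>\<bar> + \<bar>?X\<bar>"
    by (rule tri[OF split])
  moreover have "e * (2 / coer) + 2 * e / coer + C * (2 * e / coer) = 2 * e * (2 + C) / coer"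
    using coer by (simp add: field_simps)
  ultimately show ?thesis using bEW b\<rho> bE\<rho> bX by linarith
qed

end

section \<open>Counting and choice of the rank\<close>

text \<open>Each vector is encoded by the integer parts of its entries divided by \<delta>. There
  are fewer codes than subsets, and equal integer parts mean entries at most \<delta> apart.\<close>

lemma pigeonhole_real_vectors:
  fixes F :: "nat set \<Rightarrow> 'i \<Rightarrow> real"
  assumes I: "finite I" and b: "\<And>P i. P \<subseteq> {1..N} \<Longrightarrow> i \<in> I \<Longrightarrow> \<bar>F P i\<bar> \<le> b" and \<delta>: "\<delta> > 0"
    and K: "b / \<delta> \<le> real K" and count: "(2 * K + 2) ^ card I < 2 ^ N"
  obtains P Q where "P \<subseteq> {1..N}" "Q \<subseteq> {1..N}" "P \<noteq> Q" "\<And>i. i \<in> I \<Longrightarrow> \<bar>F P i - F Q i\<bar> \<le> \<delta>"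
proof -
  define code where "code P = restrict (\<lambda>i. \<lfloor>F P i / \<delta>\<rfloor>) I" for P
  let ?T = "PiE I (\<lambda>_. {- int K - 1..int K})"
  have img: "code ` Pow {1..N} \<subseteq> ?T"
  proof (rule image_subsetI)
    fix P assume P: "P \<in> Pow {1..N}"
    have "\<lfloor>F P i / \<delta>\<rfloor> \<in> {- int K - 1..int K}" if "i \<in> I" for i
    proof -
      have "\<bar>F P i / \<delta>\<bar> \<le> b / \<delta>" using b[of P i] P that \<delta> by (simp add: divide_right_mono)
      then have "\<bar>F P i / \<delta>\<bar> \<le> real K" using K by linarith
      then have "- real K \<le> F P i / \<delta>" "F P i / \<delta> \<le> real K" by linarith+
      then have "- int K - 1 \<le> \<lfloor>F P i / \<delta>\<rfloor>" "\<lfloor>F P i / \<delta>\<rfloor> \<le> int K" by linarith+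
      then show ?thesis by simp
    qed
    then show "code P \<in> ?T" by (auto simp: code_def)
  qed
  have "card (code ` Pow {1..N}) \<le> card ?T" by (intro card_mono img finite_PiE I) auto
  also have "card ?T = (2 * K + 2) ^ card I"
  proof -
    have "card {- int K - 1..int K} = 2 * K + 2" by simp
    then show ?thesis using I by (simp only: card_PiE prod_constant)
  qed
  also have "\<dots> < card (Pow {1..N})" using count by (simp add: card_Pow)
  finally have "\<not> inj_on code (Pow {1..N})" by (rule pigeonhole)
  then obtain P Q where PQ: "P \<subseteq> {1..N}" "Q \<subseteq> {1..N}" "P \<noteq> Q" "code P = code Q" by (auto simp: inj_on_def)
  have "\<bar>F P i - F Q i\<bar> \<le> \<delta>" if "i \<in> I" for i
  proof -
    have "\<lfloor>F P i / \<delta>\<rfloor> = \<lfloor>F Q i / \<delta>\<rfloor>" using fun_cong[OF PQ(4), of i] that by (simp add: code_def)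
    then have "\<bar>F P i / \<delta> - F Q i / \<delta>\<bar> \<le> 1" by linarith
    then have "\<bar>F P i - F Q i\<bar> / \<delta> \<le> 1" using \<delta> by (simp add: diff_divide_distrib[symmetric])
    then show ?thesis using \<delta> by simp
  qed
  with PQ show thesis using that by blast
qed

text \<open>One entry needs at most \<open>k * m\<close> bits, all m^(2d) entries together
  \<open>k\<close> m^(2d+1). For \<open>k < m\<close> this is below m^(2d+2), hence below
  \<open>N\<close>.\<close>

lemma entropy_count:
  fixes b R :: real and d :: nat
  assumes b: "0 \<le> b" and R: "1 \<le> R"
  obtains k :: nat where "\<And>m N. k < m \<Longrightarrow> m ^ (2 * d + 2) \<le> N \<Longrightarrow>
    \<exists>K. b / ((16 / 17) ^ m / (real m ^ (2 * d) * R ^ (2 * m))) \<le> real K \<and> (2 * K + 2) ^ (m ^ (2 * d)) < 2 ^ N"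
proof -
  obtain a where a: "2 * b + 4 \<le> 2 ^ a" using real_arch_pow[of 2 "2 * b + 4"] by (auto intro: less_imp_le)
  obtain c where c: "17 / 16 * R\<^sup>2 \<le> 2 ^ c" using real_arch_pow[of 2 "17 / 16 * R\<^sup>2"] by (auto intro: less_imp_le)
  \<comment> \<open>\<open>a\<close> accounts for the constant factor, \<open>2 * d\<close> for the
    power of \<open>m\<close> through m \<le> 2^m, and \<open>c\<close> for the exponential
    factors.\<close>
  define k where "k = a + 2 * d + c"
  show thesis
  proof (rule that[of k])
    fix m N :: nat assume m: "k < m" and N: "m ^ (2 * d + 2) \<le> N"
    then have m1: "1 \<le> m" by simp
    define X where "X = real m ^ (2 * d) * R ^ (2 * m) * (17 / 16) ^ m"
    have X: "b / ((16 / 17) ^ m / (real m ^ (2 * d) * R ^ (2 * m))) = b * X"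
      by (simp add: X_def power_divide)
    have X1: "1 \<le> X"
    proof -
      have "1 * 1 * 1 \<le> X" unfolding X_def
        using m1 R by (intro mult_mono one_le_power mult_nonneg_nonneg zero_le_power) auto
      then show ?thesis by simp
    qed
    define K where "K = nat \<lceil>b * X\<rceil>"
    have bX: "0 \<le> b * X" using b X1 by simp
    then have K: "b * X \<le> real K" "real K \<le> b * X + 1" unfolding K_def by linarith+
    have "real (2 * K + 2) \<le> (2 * b + 4) * X" using K(2) X1 by (simp add: algebra_simps)
    also have "\<dots> \<le> (2 ^ a) ^ m * ((2 ^ m) ^ (2 * d) * (2 ^ c) ^ m)"
    proof (rule mult_mono)
      have "(2::real) ^ a \<le> (2 ^ a) ^ m" using power_increasing[of 1 m "(2::real) ^ a"] m1 by simp
      then show "2 * b + 4 \<le> (2 ^ a) ^ m" using a by linarith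
      have "real m \<le> 2 ^ m" using less_exp[of m] by (metis of_nat_le_iff of_nat_numeral of_nat_power less_imp_le)
      then have "real m ^ (2 * d) \<le> (2 ^ m) ^ (2 * d)" by (intro power_mono) auto
      moreover have "R ^ (2 * m) * (17 / 16) ^ m \<le> (2 ^ c) ^ m"
      proof -
        have "R ^ (2 * m) * (17 / 16) ^ m = (17 / 16 * R\<^sup>2) ^ m"
          unfolding power_mult power_mult_distrib by (rule mult.commute)
        then show ?thesis using c R power_mono[of "17 / 16 * R\<^sup>2" "2 ^ c" m] by simp
      qed
      ultimately show "X \<le> (2 ^ m) ^ (2 * d) * (2 ^ c) ^ m"
        unfolding X_def mult.assoc using R by (intro mult_mono) auto
    qed (use X1 in auto)
    also have "\<dots> = 2 ^ (k * m)" by (simp add: k_def power_mult[symmetric] power_add[symmetric] algebra_simps)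
    finally have "real (2 * K + 2) \<le> real (2 ^ (k * m))" by simp
    then have "2 * K + 2 \<le> 2 ^ (k * m)" by (simp only: of_nat_le_iff)
    then have "(2 * K + 2) ^ (m ^ (2 * d)) \<le> (2 ^ (k * m)) ^ (m ^ (2 * d))" by (rule power_mono) simp
    also have "\<dots> = 2 ^ (k * (m * m ^ (2 * d)))" by (simp only: power_mult[symmetric] mult.assoc)
    also have "\<dots> < 2 ^ N"
    proof (rule power_strict_increasing)
      have "k * (m * m ^ (2 * d)) < m * (m * m ^ (2 * d))" using m m1 by (intro mult_strict_right_mono) auto
      also have "\<dots> = m ^ (2 * d + 2)" by (simp add: power2_eq_square)
      finally show "k * (m * m ^ (2 * d)) < N" using N by linarith
    qed simp
    finally show "\<exists>K. b / ((16 / 17) ^ m / (real m ^ (2 * d) * R ^ (2 * m))) \<le> real K \<and> (2 * K + 2) ^ (m ^ (2 * d)) < 2 ^ N"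
      using K(1) unfolding X by blast
  qed
qed

text \<open>The largest \<open>m\<close> with \<open>m ^ p \<le> N\<close> satisfies
  \<open>N \<le> (m + 1) ^ p\<close>, so N^(1/(2p)) is at most the square root of m + 1. Halving the
  natural exponent 1/p makes the left side subexponential in \<open>m\<close>, and every constant is
  absorbed.\<close>

lemma stretched_exponential_rate:
  fixes c :: real and p M :: nat
  assumes c: "0 < c" and p: "1 \<le> p"
  obtains N0 where "1 \<le> N0" "\<And>N. N0 \<le> N \<Longrightarrow>
    \<exists>m\<ge>M. m ^ p \<le> N \<and> exp (real N powr (1 / (2 * real p))) \<le> c * (17 / 16) ^ m"
proof -
  have "(\<lambda>m. exp (sqrt (real m + 1)) / (17 / 16) ^ m) \<longlonglongrightarrow> 0" by real_asymp
  then have "\<forall>\<^sub>F m in sequentially. exp (sqrt (real m + 1)) / (17 / 16) ^ m < c" by (rule order_tendstoD(2)) (rule c)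
  then obtain M1 where M1: "\<And>m. M1 \<le> m \<Longrightarrow> exp (sqrt (real m + 1)) / (17 / 16) ^ m < c"
    unfolding eventually_sequentially by blast
  define M0 where "M0 = max 1 (max M M1)"
  show thesis
  proof (rule that[of "M0 ^ p"])
    show "1 \<le> M0 ^ p" by (simp add: M0_def)
    fix N assume N: "M0 ^ p \<le> N"
    define m where "m = Max {m. m ^ p \<le> N}"
    have "{m. m ^ p \<le> N} \<subseteq> {..N}"
    proof
      fix m assume "m \<in> {m. m ^ p \<le> N}"
      moreover have "m \<le> m ^ p" using p by (cases "m = 0") (auto intro: self_le_power)
      ultimately show "m \<in> {..N}" by simp
    qed
    then have fin: "finite {m. m ^ p \<le> N}" by (rule finite_subset) simp
    have "m \<in> {m. m ^ p \<le> N}" unfolding m_def by (rule Max_in[OF fin]) (use N in auto)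
    then have mN: "m ^ p \<le> N" by simp
    have "M0 \<le> m" unfolding m_def by (rule Max_ge[OF fin]) (use N in simp)
    then have mM: "M \<le> m" "M1 \<le> m" by (auto simp: M0_def)
    have "\<not> Suc m ^ p \<le> N" using Max_ge[OF fin, of "Suc m"] unfolding m_def[symmetric] by auto
    then have "N \<le> Suc m ^ p" by simp
    then have "real N \<le> (real m + 1) powr real p"
      using of_nat_le_iff[of N "Suc m ^ p", where 'a = real] by (simp add: powr_realpow add.commute)
    then have "real N powr (1 / (2 * real p)) \<le> ((real m + 1) powr real p) powr (1 / (2 * real p))"
      by (intro powr_mono2) auto
    also have "\<dots> = sqrt (real m + 1)" using p by (simp add: powr_powr powr_half_sqrt)
    finally have "exp (real N powr (1 / (2 * real p))) \<le> exp (sqrt (real m + 1))" by simp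
    also have "\<dots> \<le> c * (17 / 16) ^ m" using M1[OF mM(2)] by (simp add: divide_less_eq)
    finally show "\<exists>m\<ge>M. m ^ p \<le> N \<and> exp (real N powr (1 / (2 * real p))) \<le> c * (17 / 16) ^ m"
      using mM(1) mN by blast
  qed
qed

context ball_problem
begin

text \<open>The pigeonhole principle compares moments that involve the potentials only. The two sets
  are thus found before \<open>f\<close> and \<open>g\<close>, and the estimate is uniform in the
  data.\<close>

lemma close_DN_maps:
  obtains D :: real and p k :: nat where "0 < D" "1 \<le> p"
    "\<And>m N. k < m \<Longrightarrow> m ^ p \<le> N \<Longrightarrow> \<exists>P Q. P \<subseteq> {1..N} \<and> Q \<subseteq> {1..N} \<and> P \<noteq> Q \<and>
      (\<forall>f\<in>HW. \<forall>g\<in>HW. Hs_norm s f \<le> 1 \<longrightarrow> Hs_norm s g \<le> 1 \<longrightarrow>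
        \<bar>DN_map s \<Omega> (slab_potential N (eig / 2) P) f g - DN_map s \<Omega> (slab_potential N (eig / 2) Q) f g\<bar> \<le> D * (16 / 17) ^ m)"
proof -
  obtain C R where C: "C \<ge> 1" and R: "R \<ge> 1"
    and rf: "\<And>m (\<beta> :: 'a + bool \<Rightarrow> nat). L2_norm UNIV (right_factor \<beta>) \<le> C"
    and lf: "\<And>m (\<beta> :: 'a + bool \<Rightarrow> nat). L2_norm UNIV (left_factor s m \<beta>) \<le> C * R ^ m"
    and lr: "\<And>m f g. f \<in> HW \<Longrightarrow> g \<in> H \<Longrightarrow>
      \<bar>frac_form s f g - (\<Sum>\<beta>\<in>PiE letters (\<lambda>_. {..<m}). ip (left_factor s m \<beta>) f * ip (right_factor \<beta>) g)\<bar>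
        \<le> C * (16 / 17) ^ m * L2_norm UNIV f * L2_norm UNIV g"
    using frac_form_low_rank[OF s, where 'a = 'a] by blast
  note rfL = right_factor_L2(1)[where 'a = 'a]
  define d where "d = DIM('a) + 2"
  \<comment> \<open>A right factor has norm at most \<open>C\<close>, and the solution with it as
    source at most \<open>C / coer\<close>; hence \<open>b\<close> bounds every moment.\<close>
  define b where "b = C * (C / coer)"
  have b0: "0 \<le> b" unfolding b_def using C coer by simp
  obtain k where k: "\<And>m N. k < m \<Longrightarrow> m ^ (2 * d + 2) \<le> N \<Longrightarrow>
    \<exists>K. b / ((16 / 17) ^ m / (real m ^ (2 * d) * R ^ (2 * m))) \<le> real K \<and> (2 * K + 2) ^ (m ^ (2 * d)) < 2 ^ N"
    using entropy_count[OF b0 R, of d] by blast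
  define D where "D = C * C + 2 * C * (2 + C) / coer"
  have D0: "0 < D" unfolding D_def using C coer by (intro add_pos_nonneg) auto
  have main: "\<exists>P Q. P \<subseteq> {1..N} \<and> Q \<subseteq> {1..N} \<and> P \<noteq> Q \<and>
      (\<forall>f\<in>HW. \<forall>g\<in>HW. Hs_norm s f \<le> 1 \<longrightarrow> Hs_norm s g \<le> 1 \<longrightarrow>
        \<bar>DN_map s \<Omega> (slab_potential N (eig / 2) P) f g - DN_map s \<Omega> (slab_potential N (eig / 2) Q) f g\<bar> \<le> D * (16 / 17) ^ m)"
    if m: "k < m" and N: "m ^ (2 * d + 2) \<le> N" for m N
  proof -
    define q :: "nat set \<Rightarrow> 'a \<Rightarrow> real" where "q P = slab_potential N (eig / 2) P" for P
    have q: "potential (q P)" for P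
      unfolding potential_def q_def
      by (intro conjI allI slab_potential_measurable slab_potential_bound) (use eig(1) in simp)
    define V where "V P \<beta> = (SOME w. w \<in> H \<and> (\<forall>v\<in>H. B (q P) w v = ip (right_factor \<beta>) v))" for P \<beta>
    have rfb: "\<bar>ip (right_factor \<beta>) u\<bar> \<le> C * Hs_norm s u" if "u \<in> H" for \<beta> and u :: "'a \<Rightarrow> real"
    proof -
      have "\<bar>ip (right_factor \<beta>) u\<bar> \<le> L2_norm UNIV (right_factor \<beta>) * L2_norm UNIV u"
        by (rule ip_Cauchy_Schwarz[OF rfL Htilde_L2[OF that]])
      also have "\<dots> \<le> C * Hs_norm s u"
        using C by (intro mult_mono rf Hs_riesz(3) Htilde_Hs[OF that] s'(1)) auto
      finally show ?thesis .
    qed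
    have "\<exists>w. w \<in> H \<and> (\<forall>v\<in>H. B (q P) w v = ip (right_factor \<beta>) v)" for P \<beta>
    proof -
      have lin: "ip (right_factor \<beta>) (\<lambda>x. a * u x + c * v x) = a * ip (right_factor \<beta>) u + c * ip (right_factor \<beta>) v"
        if u: "u \<in> H" and v: "v \<in> H" for a c and u v :: "'a \<Rightarrow> real"
      proof -
        have L: "(\<lambda>x. a * u x) \<in> L2" "(\<lambda>x. c * v x) \<in> L2"
          using Htilde_L2[OF Htilde_lin[OF u u s', of a 0]] Htilde_L2[OF Htilde_lin[OF v v s', of c 0]] by simp_all
        show ?thesis
          using ip_add_right[OF L rfL] ip_scale_right[of "right_factor \<beta>" a u] ip_scale_right[of "right_factor \<beta>" c v] by simp
      qed
      show ?thesis by (rule Dirichlet_solve[OF q[of P] lin rfb]) blast+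
    qed
    then have V: "V P \<beta> \<in> H \<and> (\<forall>v\<in>H. B (q P) (V P \<beta>) v = ip (right_factor \<beta>) v)" for P \<beta>
      unfolding V_def by (rule someI_ex)
    have V1: "V P \<beta> \<in> H" for P \<beta> using V by blast
    have V2: "B (q P) (V P \<beta>) v = ip (right_factor \<beta>) v" if "v \<in> H" for P \<beta> v using V that by blast
    define A where "A = PiE (letters :: ('a + bool) set) (\<lambda>_. {..<m})"
    have A: "finite A" unfolding A_def by (intro finite_PiE finite_letters) simp
    have cA: "card A = m ^ d"
      unfolding A_def d_def by (simp only: card_PiE[OF finite_letters] prod_constant card_letters card_lessThan)
    \<comment> \<open>Chosen so that m^(2d) moment differences, each multiplied by two coefficients
      of size at most C R^m, add up to the order (16/17)^m of the truncation error.\<close>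
    define \<delta> where "\<delta> = (16 / 17) ^ m / (real m ^ (2 * d) * R ^ (2 * m))"
    have m0: "0 < real m" using m by simp
    have \<delta>: "0 < \<delta>" unfolding \<delta>_def using m0 R by simp
    obtain K where K: "b / \<delta> \<le> real K" "(2 * K + 2) ^ (m ^ (2 * d)) < 2 ^ N" using k[OF m N] unfolding \<delta>_def by blast
    define F where "F P z = ip (right_factor (snd z)) (V P (fst z))" for P z
    have Fb: "\<bar>F P z\<bar> \<le> b" for P z
    proof -
      have "\<bar>F P z\<bar> \<le> C * Hs_norm s (V P (fst z))" unfolding F_def by (rule rfb[OF V1])
      also have "\<dots> \<le> C * (C / coer)"
      proof (rule mult_left_mono)
        show "Hs_norm s (V P (fst z)) \<le> C / coer"
          by (rule Dirichlet_bound[OF q[of P] V1]) (use V2[OF V1] rfb[OF V1] C in auto)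
      qed (use C in simp)
      finally show ?thesis unfolding b_def .
    qed
    have cI: "card (A \<times> A) = m ^ (2 * d)" by (simp add: card_cartesian_product cA power_add[symmetric] mult_2)
    obtain P Q where PQ: "P \<subseteq> {1..N}" "Q \<subseteq> {1..N}" "P \<noteq> Q" "\<And>z. z \<in> A \<times> A \<Longrightarrow> \<bar>F P z - F Q z\<bar> \<le> \<delta>"
      using pigeonhole_real_vectors[of "A \<times> A" N F b \<delta> K] A Fb \<delta> K unfolding cI by blast
    have close: "\<bar>ip (right_factor \<gamma>) (V P \<beta>) - ip (right_factor \<gamma>) (V Q \<beta>)\<bar> \<le> \<delta>" if "\<beta> \<in> A" "\<gamma> \<in> A" for \<beta> \<gamma>
      using PQ(4)[of "(\<beta>, \<gamma>)"] that by (simp add: F_def)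
    define e where "e = C * (16 / 17 :: real) ^ m"
    have e: "0 \<le> e" "e \<le> C"
      using C mult_left_mono[of "(16 / 17 :: real) ^ m" 1 C] power_le_one[of "16 / 17 :: real" m] by (auto simp: e_def)
    have lrm: "\<bar>frac_form s f g - (\<Sum>\<beta>\<in>A. ip (left_factor s m \<beta>) f * ip (right_factor \<beta>) g)\<bar>
        \<le> e * L2_norm UNIV f * L2_norm UNIV g" if "f \<in> HW" "g \<in> H" for f g
      unfolding A_def e_def by (rule lr[OF that])
    have "\<bar>DN_map s \<Omega> (q P) f g - DN_map s \<Omega> (q Q) f g\<bar> \<le> D * (16 / 17) ^ m"
      if f: "f \<in> HW" "Hs_norm s f \<le> 1" and g: "g \<in> HW" "Hs_norm s g \<le> 1" for f g
    proof -
      have "\<bar>DN_map s \<Omega> (q P) f g - DN_map s \<Omega> (q Q) f g\<bar>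
        \<le> real (card A) * real (card A) * ((C * R ^ m) * (C * R ^ m) * \<delta>) + 2 * e * (2 + C) / coer"
        by (rule DN_difference_bound[where rf = right_factor and lf = "left_factor s m",
            OF A e rfL left_factor_L2(1)[OF s] lf lrm q q V1 V2 V1 V2 close f g])
      also have "real (card A) * real (card A) * ((C * R ^ m) * (C * R ^ m) * \<delta>) = C * C * (16 / 17) ^ m"
      proof -
        have cancel: "t * t * ((C * r) * (C * r) * (E / ((t * t) * (r * r)))) = C * C * E" if "r \<noteq> 0" "t \<noteq> 0" for t r E :: real
          using that by (simp add: field_simps)
        have eqs: "R ^ (2 * m) = R ^ m * R ^ m" "real m ^ (2 * d) = real m ^ d * real m ^ d"
          by (simp_all add: mult_2 power_add)
        show ?thesis unfolding \<delta>_def cA eqs of_nat_power by (rule cancel) (use R m0 in auto)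
      qed
      also have "C * C * (16 / 17) ^ m + 2 * e * (2 + C) / coer = D * (16 / 17) ^ m"
        unfolding D_def e_def using coer by (simp add: field_simps)
      finally show ?thesis .
    qed
    then show ?thesis using PQ(1,2,3) unfolding q_def by blast
  qed
  show thesis by (rule that[of D "2 * d + 2" k, OF D0 _ main]) simp_all
qed

lemma dual_norm_bound:
  assumes "\<And>g. g \<in> HW \<Longrightarrow> Hs_norm s g \<le> 1 \<Longrightarrow> \<bar>T g\<bar> \<le> K"
  shows "dual_norm s annulus T \<le> K"
  unfolding dual_norm_def
proof (rule cSUP_least)
  \<comment> \<open>An upper bound for a real supremum requires a nonempty index set, which the zero
    function provides.\<close>
  have z: "(\<lambda>x. 0) \<in> HW" by (rule zero_Htilde[OF s'])
  have "Hs_norm s (\<lambda>x::'a. 0) \<le> 1" by simp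
  with z show "{g \<in> HW. Hs_norm s g \<le> 1} \<noteq> {}" by blast
qed (use assms in auto)

text \<open>The infimum of a pair is at most its first entry, so the second entry may be any number
  \<open>h\<close>. The potentials precede \<open>C1\<close> and the data in the quantifiers, as the
  closeness of the maps is uniform in the data.\<close>

lemma instability:
  obtains N0 :: nat and \<mu> :: real where "1 \<le> N0" "0 < \<mu>"
    "\<And>N. N0 \<le> N \<Longrightarrow> \<exists>q1\<in>span_indicators N (slab N). \<exists>q2\<in>span_indicators N (slab N).
      Linf_norm \<Omega> q1 \<le> ereal (eig / 2) \<and> Linf_norm \<Omega> q2 \<le> ereal (eig / 2) \<and>
      (\<forall>C1>0. \<forall>f h. (\<forall>j\<in>{1..N}. f j \<in> HW \<and> Hs_norm s (f j) = 1) \<longrightarrow>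
        Linf_norm \<Omega> (\<lambda>x. q1 x - q2 x) \<le>
          ereal (C1 * Inf {DN_diff_norm s \<Omega> annulus N q1 q2 f, h}) \<longrightarrow>
        exp (real N powr \<mu>) \<le> C1)"
proof -
  obtain D :: real and p k :: nat where D: "0 < D" and p: "1 \<le> p"
    and close: "\<And>m N. k < m \<Longrightarrow> m ^ p \<le> N \<Longrightarrow> \<exists>P Q. P \<subseteq> {1..N} \<and> Q \<subseteq> {1..N} \<and> P \<noteq> Q \<and>
      (\<forall>f\<in>HW. \<forall>g\<in>HW. Hs_norm s f \<le> 1 \<longrightarrow> Hs_norm s g \<le> 1 \<longrightarrow>
        \<bar>DN_map s \<Omega> (slab_potential N (eig / 2) P) f g - DN_map s \<Omega> (slab_potential N (eig / 2) Q) f g\<bar> \<le> D * (16 / 17) ^ m)"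
    using close_DN_maps by blast
  have c: "0 < eig / (2 * D)" using eig(1) D by simp
  obtain N0 where N0: "1 \<le> N0" "\<And>N. N0 \<le> N \<Longrightarrow>
    \<exists>m\<ge>Suc k. m ^ p \<le> N \<and> exp (real N powr (1 / (2 * real p))) \<le> eig / (2 * D) * (17 / 16) ^ m"
    using stretched_exponential_rate[OF c p, of "Suc k"] by blast
  have "\<exists>q1\<in>span_indicators N (slab N). \<exists>q2\<in>span_indicators N (slab N).
      Linf_norm \<Omega> q1 \<le> ereal (eig / 2) \<and> Linf_norm \<Omega> q2 \<le> ereal (eig / 2) \<and>
      (\<forall>C1>0. \<forall>f h. (\<forall>j\<in>{1..N}. f j \<in> HW \<and> Hs_norm s (f j) = 1) \<longrightarrow>
        Linf_norm \<Omega> (\<lambda>x. q1 x - q2 x) \<le>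
          ereal (C1 * Inf {DN_diff_norm s \<Omega> annulus N q1 q2 f, h}) \<longrightarrow>
        exp (real N powr (1 / (2 * real p))) \<le> C1)" if N: "N0 \<le> N" for N
  proof -
    obtain m where m: "k < m" "m ^ p \<le> N" "exp (real N powr (1 / (2 * real p))) \<le> eig / (2 * D) * (17 / 16) ^ m"
      using N0(2)[OF N] unfolding Suc_le_eq by blast
    obtain P Q where PQ: "P \<subseteq> {1..N}" "Q \<subseteq> {1..N}" "P \<noteq> Q"
      and DN: "\<And>f g. f \<in> HW \<Longrightarrow> g \<in> HW \<Longrightarrow> Hs_norm s f \<le> 1 \<Longrightarrow> Hs_norm s g \<le> 1 \<Longrightarrow>
        \<bar>DN_map s \<Omega> (slab_potential N (eig / 2) P) f g - DN_map s \<Omega> (slab_potential N (eig / 2) Q) f g\<bar> \<le> D * (16 / 17) ^ m"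
      using close[OF m(1,2)] by blast
    define q1 :: "'a \<Rightarrow> real" where "q1 = slab_potential N (eig / 2) P"
    define q2 :: "'a \<Rightarrow> real" where "q2 = slab_potential N (eig / 2) Q"
    have \<kappa>: "0 \<le> eig / 2" using eig(1) by simp
    have "exp (real N powr (1 / (2 * real p))) \<le> C1"
      if C1: "0 < C1" and f: "\<forall>j\<in>{1..N}. f j \<in> HW \<and> Hs_norm s (f j) = 1"
        and L: "Linf_norm \<Omega> (\<lambda>x. q1 x - q2 x) \<le> ereal (C1 * Inf {DN_diff_norm s \<Omega> annulus N q1 q2 f, h})"
      for C1 h and f :: "nat \<Rightarrow> 'a \<Rightarrow> real"
    proof -
      have "ereal (eig / 2) \<le> Linf_norm \<Omega> (\<lambda>x. q1 x - q2 x)"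
        unfolding q1_def q2_def by (rule Linf_norm_slab_potential_diff[OF \<kappa> PQ])
      then have "eig / 2 \<le> C1 * Inf {DN_diff_norm s \<Omega> annulus N q1 q2 f, h}" using L by (metis ereal_less_eq(3) order_trans)
      also have "\<dots> \<le> C1 * DN_diff_norm s \<Omega> annulus N q1 q2 f"
        using C1 by (intro mult_left_mono cInf_lower bdd_below_finite) auto
      also have "\<dots> \<le> C1 * (D * (16 / 17) ^ m)"
      proof (rule mult_left_mono)
        have "dual_norm s annulus (\<lambda>g. DN_map s \<Omega> q1 (f j) g - DN_map s \<Omega> q2 (f j) g) \<le> D * (16 / 17) ^ m"
          if "j \<in> {1..N}" for j
          by (rule dual_norm_bound) (use f that DN[of "f j"] in \<open>auto simp: q1_def q2_def\<close>)
        moreover have "{1..N} \<noteq> {}" using N N0(1) by auto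
        ultimately show "DN_diff_norm s \<Omega> annulus N q1 q2 f \<le> D * (16 / 17) ^ m"
          unfolding DN_diff_norm_def by (subst Max_le_iff) auto
      qed (use C1 in simp)
      finally have "eig / 2 \<le> C1 * (D * (16 / 17) ^ m)" .
      \<comment> \<open>Multiplication by (17/16)^m / D.\<close>
      then have "eig / (2 * D) * (17 / 16) ^ m \<le> C1 * ((16 / 17) ^ m * (17 / 16) ^ m)"
        using D mult_right_mono[of "eig / 2" "C1 * (D * (16 / 17) ^ m)" "(17 / 16) ^ m / D"] by simp
      also have "(16 / 17 :: real) ^ m * (17 / 16) ^ m = 1" by (simp add: power_mult_distrib[symmetric])
      finally show ?thesis using m(3) by simp
    qed
    moreover have "q1 \<in> span_indicators N (slab N)" "q2 \<in> span_indicators N (slab N)"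
      unfolding q1_def q2_def by (rule slab_potential_span)+
    moreover have "Linf_norm \<Omega> q1 \<le> ereal (eig / 2)" "Linf_norm \<Omega> q2 \<le> ereal (eig / 2)"
      unfolding q1_def q2_def by (rule Linf_norm_slab_potential[OF \<kappa>])+
    ultimately show ?thesis by blast
  qed
  then show thesis using that[OF N0(1), of "1 / (2 * real p)"] p by simp
qed

end

theorem theorem5:
  fixes s :: real and \<Omega> W :: "'a::euclidean_space set"
  assumes "0 < s" and "s < 1"
    and "\<Omega> = ball 0 1" and "W = ball 0 3 - closure (ball 0 2)"
  shows "\<exists>(N0::nat) (\<mu>::real) (C::real). \<mu> > 0 \<and> C \<ge> 1 \<and>
    (\<forall>N\<ge>N0. \<exists>D. lipschitz_partitioning \<Omega> N D \<and>
      (\<forall>C1>0.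
        (\<forall>q1\<in>span_indicators N D. \<forall>q2\<in>span_indicators N D.
           Linf_norm \<Omega> q1 \<le> ereal (first_eigenvalue s \<Omega> / 2) \<and>
           Linf_norm \<Omega> q2 \<le> ereal (first_eigenvalue s \<Omega> / 2) \<longrightarrow>
           (\<exists>f :: nat \<Rightarrow> nat \<Rightarrow> 'a \<Rightarrow> real.
              (\<forall>k\<in>{1,2}. \<forall>j\<in>{1..N}. f k j \<in> Htilde s W \<and> Hs_norm s (f k j) = 1) \<and>
              Linf_norm \<Omega> (\<lambda>x. q1 x - q2 x) \<le>
                ereal (C1 * Inf {DN_diff_norm s \<Omega> W N q1 q2 (f 1), DN_diff_norm s \<Omega> W N q1 q2 (f 2)})))
        \<longrightarrow> C1 \<ge> exp (C * real N powr \<mu>)))"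
proof -
  interpret ball_problem s "TYPE('a)" by unfold_locales fact+
  have conv: "first_eigenvalue s \<Omega> = eig" "\<Omega> = ball 0 1" "W = annulus" using assms(3,4) by (simp_all add: eig_def)
  obtain N0 :: nat and \<mu> :: real where N0: "1 \<le> N0" and \<mu>: "0 < \<mu>"
    and unstable: "\<And>N. N0 \<le> N \<Longrightarrow> \<exists>q1\<in>span_indicators N (slab N). \<exists>q2\<in>span_indicators N (slab N).
      Linf_norm (ball (0::'a) 1) q1 \<le> ereal (eig / 2) \<and> Linf_norm (ball 0 1) q2 \<le> ereal (eig / 2) \<and>
      (\<forall>C1>0. \<forall>f h. (\<forall>j\<in>{1..N}. f j \<in> Htilde s annulus \<and> Hs_norm s (f j) = 1) \<longrightarrow>
        Linf_norm (ball 0 1) (\<lambda>x. q1 x - q2 x) \<le>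
          ereal (C1 * Inf {DN_diff_norm s (ball 0 1) annulus N q1 q2 f, h}) \<longrightarrow>
        exp (real N powr \<mu>) \<le> C1)"
    using instability by blast
  show ?thesis
    unfolding conv(1) unfolding conv(2,3)
  \<comment> \<open>The constant in the exponent can be 1, since the halved power of
    \<open>N\<close> has already absorbed all other constants.\<close>
  proof (rule exI[of _ N0], rule exI[of _ \<mu>], rule exI[of _ 1], intro conjI allI impI)
    fix N assume N: "N0 \<le> N"
    obtain q1 q2 :: "'a \<Rightarrow> real" where q: "q1 \<in> span_indicators N (slab N)" "q2 \<in> span_indicators N (slab N)"
      "Linf_norm (ball 0 1) q1 \<le> ereal (eig / 2)" "Linf_norm (ball 0 1) q2 \<le> ereal (eig / 2)"
      and bad: "\<And>C1 f h. 0 < C1 \<Longrightarrow> \<forall>j\<in>{1..N}. f j \<in> Htilde s annulus \<and> Hs_norm s (f j) = 1 \<Longrightarrow>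
        Linf_norm (ball 0 1) (\<lambda>x. q1 x - q2 x) \<le>
          ereal (C1 * Inf {DN_diff_norm s (ball 0 1) annulus N q1 q2 f, h}) \<Longrightarrow> exp (real N powr \<mu>) \<le> C1"
      using unstable[OF N] by blast
    show "\<exists>D. lipschitz_partitioning (ball (0::'a) 1) N D \<and>
      (\<forall>C1>0.
        (\<forall>q1\<in>span_indicators N D. \<forall>q2\<in>span_indicators N D.
           Linf_norm (ball 0 1) q1 \<le> ereal (eig / 2) \<and> Linf_norm (ball 0 1) q2 \<le> ereal (eig / 2) \<longrightarrow>
           (\<exists>f :: nat \<Rightarrow> nat \<Rightarrow> 'a \<Rightarrow> real.
              (\<forall>k\<in>{1,2}. \<forall>j\<in>{1..N}. f k j \<in> Htilde s annulus \<and> Hs_norm s (f k j) = 1) \<and>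
              Linf_norm (ball 0 1) (\<lambda>x. q1 x - q2 x) \<le>
                ereal (C1 * Inf {DN_diff_norm s (ball 0 1) annulus N q1 q2 (f 1), DN_diff_norm s (ball 0 1) annulus N q1 q2 (f 2)})))
        \<longrightarrow> C1 \<ge> exp (1 * real N powr \<mu>))"
    proof (rule exI[of _ "slab N"], intro conjI allI impI)
      show "lipschitz_partitioning (ball (0::'a) 1) N (slab N)" using N N0 by (intro slab_partitioning) simp
      fix C1 :: real assume C1: "0 < C1"
      assume stable: "\<forall>q1\<in>span_indicators N (slab N). \<forall>q2\<in>span_indicators N (slab N).
           Linf_norm (ball 0 1) q1 \<le> ereal (eig / 2) \<and> Linf_norm (ball 0 1) q2 \<le> ereal (eig / 2) \<longrightarrow>
           (\<exists>f :: nat \<Rightarrow> nat \<Rightarrow> 'a \<Rightarrow> real.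
              (\<forall>k\<in>{1,2}. \<forall>j\<in>{1..N}. f k j \<in> Htilde s annulus \<and> Hs_norm s (f k j) = 1) \<and>
              Linf_norm (ball 0 1) (\<lambda>x. q1 x - q2 x) \<le>
                ereal (C1 * Inf {DN_diff_norm s (ball 0 1) annulus N q1 q2 (f 1), DN_diff_norm s (ball 0 1) annulus N q1 q2 (f 2)}))"
      obtain f :: "nat \<Rightarrow> nat \<Rightarrow> 'a \<Rightarrow> real" where
        f: "\<forall>k\<in>{1,2}. \<forall>j\<in>{1..N}. f k j \<in> Htilde s annulus \<and> Hs_norm s (f k j) = 1"
        "Linf_norm (ball 0 1) (\<lambda>x. q1 x - q2 x) \<le>
          ereal (C1 * Inf {DN_diff_norm s (ball 0 1) annulus N q1 q2 (f 1), DN_diff_norm s (ball 0 1) annulus N q1 q2 (f 2)})"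
        using stable[rule_format, OF q(1,2) conjI[OF q(3,4)]] by blast
      have "\<forall>j\<in>{1..N}. f 1 j \<in> Htilde s annulus \<and> Hs_norm s (f 1 j) = 1" using f(1) by blast
      from bad[OF C1 this f(2)] show "exp (1 * real N powr \<mu>) \<le> C1" by simp
    qed
  qed (use \<mu> in auto)
qed

end
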